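(* Let $X\in\{B_n^{(1)},C_n^{(1)},A_{2n-1}^{(2)},A_{2n}^{(2)},A_{2n}^{(2)\dagger},D_{n+1}^{(2)}\}$ and let $B$ be a tensor product of Kirillov–Reshetikhin crystals $B^{1,s}$ of type $X$. Let $\Psi:B\to\hat V$ be the virtual crystal embedding into the crystal $\hat V$ of simply-laced type $Y$, and let $L$ and $\hat L$ be the multiplicity arrays of $B$ and $\hat V$. Then the simply-laced bijection $\bar\phi_{\hat L}:P(\hat V)\to\mathrm{RC}(\hat L)$ restricts to a bijection $P^v(B)\to\mathrm{RC}^v(L)$.
   Context: **Crystals.** Affine types have nodes $\{0\}\cup\bar I$; $\bar{\mathfrak g}$ is the simple Lie algebra with nodes $\bar I$. $A_{2n}^{(2)}$, $A_{2n}^{(2)\dagger}$ are the labelings of the same diagram with $\alpha_0$ the extra short, resp. extra long, root. Tensor products: $e_i(b_2\otimes b_1)=e_i(b_2)\otimes b_1$ if $\varepsilon_i(b_2)>\varphi_i(b_1)$, else $b_2\otimes e_i(b_1)$; $f_i(b_2\otimes b_1)=f_i(b_2)\otimes b_1$ if $\varepsilon_i(b_2)\ge\varphi_i(b_1)$, else $b_2\otimes f_i(b_1)$. $P(B)$ (resp. $P(B,\lambda)$) is the set of classical highest weight vectors, $\varepsilon_i(b)=0$ for $i\in\bar I$ (resp. those of weight $\lambda\in\bar P^+$). $B^s=B^{1,s}$ is the KR crystal (Kang–Kashiwara–Misra), $u(B^s)$ its unique vector of weight $s\bar\Lambda_1$. In type $A_N^{(1)}$, $B^{r,s}$ consists of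 semistandard tableaux of $r\times s$ rectangular shape in $\{1,\dots,N+1\}$; in type $D_N^{(1)}$, $B^s\cong B(s\bar\Lambda_1)$ consists of words of length $s$ in the crystal $B^1=\{1<\dots<N,\bar N<\dots<\bar1\}$ (via $B(s\bar\Lambda_1)\hookrightarrow B(\bar\Lambda_1)^{\otimes s}$). **Virtual crystals.** $Y=A_{2n-1}^{(1)}$ for $X=C_n^{(1)},A_{2n}^{(2)},A_{2n}^{(2)\dagger},D_{n+1}^{(2)}$; $Y=D_{n+1}^{(1)}$ for $X=B_n^{(1)},A_{2n-1}^{(2)}$. If $Y=A_{2n-1}^{(1)}$: $\iota(0)=\{0\}$, $\iota(i)=\{i,2n-i\}$ ($0<i<n$), $\iota(n)=\{n\}$. If $Y=D_{n+1}^{(1)}$: $\iota(i)=\{i\}$ ($i<n$), $\iota(n)=\{n,n+1\}$. $\gamma_i$: $C_n^{(1)}$: $\gamma_0=\gamma_n=2$, others $1$; $A_{2n}^{(2)}$: $\gamma_n=2$, others $1$; $A_{2n}^{(2)\dagger}$: $\gamma_0=2$, others $1$; $D_{n+1}^{(2)},A_{2n-1}^{(2)}$: all $1$; $B_n^{(1)}$: $\gamma_i=2$ for $i<n$, $\gamma_n=1$. On weights $\Psi(\Lambda_i^X)=\gamma_i\sum_{j\in\iota(i)}\Lambda_j^Y$. $\hat V^s=B_Y^{s\vee}\otimes B_Y^s$ if $Y=A_{2n-1}^{(1)}$, where the contragredient dual $B_Y^{s\vee}$ is identified with $B_Y^{2n-1,s}$; $\hat V^s=B_Y^s$ for $X=A_{2n-1}^{(2)}$;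 $\hat V^s=B_Y^{2s}$ for $X=B_n^{(1)}$. There is a unique injection $\Psi:B^s\to\hat V^s$ with $\Psi(u(B^s))=u(\hat V^s)$ ($u(\hat V^s)$ the tensor product of the vectors of extremal dominant weight $s\bar\Lambda_r$ in the factors $B^{r,s}$), intertwining $e_i$ with $\prod_{j\in\iota(i)}e_j^{\gamma_i}$ and $f_i$ with $\prod_{j\in\iota(i)}f_j^{\gamma_i}$, and with $\varphi_j(\Psi(b))=\gamma_i\varphi_i(b)$, $\varepsilon_j(\Psi(b))=\gamma_i\varepsilon_i(b)$ for $j\in\iota(i)$. For $B=B^{s_k}\otimes\cdots\otimes B^{s_1}$, $\hat V=\hat V^{s_k}\otimes\cdots\otimes\hat V^{s_1}$, $\Psi=\Psi\otimes\cdots\otimes\Psi$. $P^v(B)=\Psi(P(B))$. Multiplicity arrays: $L_i^{(a)}$ is the number of factors $B^{a,i}$. **Rigged configurations (simply-laced type).** $(\alpha_a|\alpha_b)$ is the Cartan matrix of $\bar{\mathfrak g}$. $\mathrm{RC}(L,\lambda)$ is the set of $(\nu,J)$: $\nu=(\nu^{(a)})_{a\in\bar I}$ partitions with $m_i^{(a)}$ parts of size $i$ in $\nu^{(a)}$, $\sum i m_i^{(a)}\alpha_a=\sum iL_i^{(a)}\bar\Lambda_a-\lambda$, vacancy numbers $p_i^{(a)}=\sum_j\min(i,j)L_j^{(a)}-\sum_b(\alpha_a|\alpha_b)\sum_j\min(i,j)m_j^{(b)}\ge0$ for all $a,i$, and $J^{(a,i)}$ a multiset of $m_i^{(a)}$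 integers in $[0,p_i^{(a)}]$, attached as riggings to the parts ("strings") of length $i$ of $\nu^{(a)}$. A string $(i,x)$ is singular if $x=p_i^{(a)}$; $J^{(a,i)}$ is singular if it has a part $p_i^{(a)}$. $\mathrm{RC}(L)=\bigsqcup_\lambda\mathrm{RC}(L,\lambda)$. **Maps.** For $B=B^1\otimes B'$, $\mathrm{lh}:P(B)\to P(B')$ drops the left factor. For $B=B^{r,s}\otimes B'$, $s\ge2$ ($r=1$ in type $D$), $\mathrm{ls}$ replaces the left factor by its leftmost column (letter) in $B^{r,1}$ tensored with the rest in $B^{r,s-1}$. In type $A$, for $B=B^{r,1}\otimes B'$, $r\ge2$, $\mathrm{lb}$ replaces the left factor by its bottom entry in $B^{1,1}$ tensored with the rest in $B^{r-1,1}$. On rigged configurations (with $L$ changed correspondingly): $\bar j(\nu,J)=(\nu,J)$; $\bar i$ adds a singular string of length $1$ to $(\nu,J)^{(a)}$ for each $1\le a<r$; and $\bar\delta$ is the following algorithm. *Type $A_N^{(1)}$*: $\ell^{(0)}=1$; for $a=1,\dots,N$ let $\ell^{(a)}$ be the least $i\ge\ell^{(a-1)}$ with $J^{(a,i)}$ singular; if none exists stop. *Type $D_N^{(1)}$*: do the same for $a=1,\dots,N-2$; if not stopped, find minimal $i,j\ge\ell^{(N-2)}$ with $J^{(N-1,i)}$, $J^{(N,j)}$ singular; if neither exists stop; if only $i$ (only $j$) exists, set $\ell^{(N-1)}=i$ ($\ell^{(N)}=j$) and stop; if both exist set $\ell^{(N-1)}=i,\ell^{(N)}=j$, $\bar\ell^{(N-1)}=\max(i,j)$,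 and for $a=N-2,\dots,1$ let $\bar\ell^{(a)}$ be the least $i\ge\bar\ell^{(a+1)}$ with $J^{(a,i)}$ singular (having two parts $p_i^{(a)}$ if $i=\ell^{(a)}$), stopping if none exists. Undefined $\ell^{(a)},\bar\ell^{(a)}$ are $\infty$. $\bar\delta(\nu,J)$ is obtained by removing one box from each selected string (a singular string of length $\ell^{(a)}$ in $(\nu,J)^{(a)}$ for each finite $\ell^{(a)}$ and one of length $\bar\ell^{(a)}$ for each finite $\bar\ell^{(a)}$, $a\le N-2$), making the shortened strings singular for the new vacancy numbers, and leaving all other riggings unchanged. **The bijection.** $\bar\phi$ is the unique family of bijections $P(B,\lambda)\to\mathrm{RC}(L,\lambda)$ (for $B$ a tensor product of $B^{r,s}$'s in type $A_N^{(1)}$, of $B^{1,s}$'s in type $D_N^{(1)}$) sending the empty path to the empty rigged configuration with $\bar\phi\circ\mathrm{lh}=\bar\delta\circ\bar\phi$, $\bar\phi\circ\mathrm{ls}=\bar j\circ\bar\phi$, and in type $A$ $\bar\phi\circ\mathrm{lb}=\bar i\circ\bar\phi$, whenever these maps are defined. $\bar\phi_{\hat L}$ is this bijection for $\hat V$ in type $Y$. **Virtual rigged configurations.** $\mathrm{RC}^v(L)=\bigsqcup_\lambda\mathrm{RC}^v(L,\lambda)$, where $\mathrm{RC}^v(L,\lambda)$ is the set of $(\hat\nu,\hat J)\in\mathrm{RC}(\hat L,\Psi(\lambda))$ (part multiplicities $\hat m_i^{(a)}$) such that: (1) $\hat m_i^{(b)}=\hat m_i^{(b')}$ and $\hat J^{(b,i)}=\hat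 J^{(b',i)}$ whenever $b,b'$ lie in the same set $\iota(a)$; (2) for each $a\in\bar I^X$ and $b\in\iota(a)$, $\hat m_j^{(b)}=0$ if $\gamma_a\nmid j$ and the parts of $\hat J^{(b,i)}$ are multiples of $\gamma_a$; except that for $X=A_{2n}^{(2)},A_{2n}^{(2)\dagger}$, $\hat m_j^{(n)}$ may be positive for any $j\ge1$, and for $X=A_{2n}^{(2)\dagger}$ additionally the parts of $\hat J^{(n,i)}$ must have the same parity as $i$. *)

theory Defs
  imports "HOL-Library.Multiset"
begin

section \<open>Crystals and their tensor products\<close>

text \<open>The value \<^term>\<open>None\<close> plays the role of the zero added to a crystal.  The operators are only
  meaningful on \<open>elems\<close>.\<close>

record 'b crystal =
  elems :: "'b set"
  e_op :: "nat \<Rightarrow> 'b \<Rightarrow> 'b option"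
  f_op :: "nat \<Rightarrow> 'b \<Rightarrow> 'b option"

fun opt_pow :: "nat \<Rightarrow> ('b \<Rightarrow> 'b option) \<Rightarrow> 'b \<Rightarrow> 'b option" where
  "opt_pow 0 g b = Some b"
| "opt_pow (Suc k) g b = Option.bind (g b) (opt_pow k g)"

definition eps :: "'b crystal \<Rightarrow> nat \<Rightarrow> 'b \<Rightarrow> nat" where
  "eps C i b = (GREATEST k. opt_pow k (e_op C i) b \<noteq> None)"

definition phi :: "'b crystal \<Rightarrow> nat \<Rightarrow> 'b \<Rightarrow> nat" where
  "phi C i b = (GREATEST k. opt_pow k (f_op C i) b \<noteq> None)"

text \<open>The list \<open>[b\<^sub>k, \<dots>, b\<^sub>1]\<close> stands for \<open>b\<^sub>k \<otimes> \<dots> \<otimes> b\<^sub>1\<close>: the head of a list is the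
  leftmost tensor factor.\<close>

fun tensor :: "'b crystal list \<Rightarrow> 'b list crystal" where
  "tensor [] = \<lparr> elems = {[]}, e_op = (\<lambda>_ _. None), f_op = (\<lambda>_ _. None) \<rparr>"
| "tensor (C # Cs) = (let D = tensor Cs in
    \<lparr> elems = {b # bs | b bs. b \<in> elems C \<and> bs \<in> elems D},
      e_op = (\<lambda>i w. if eps C i (hd w) > phi D i (tl w)
                    then map_option (\<lambda>b. b # tl w) (e_op C i (hd w))
                    else map_option (\<lambda>bs. hd w # bs) (e_op D i (tl w))),
      f_op = (\<lambda>i w. if eps C i (hd w) \<ge> phi D i (tl w)
                    then map_option (\<lambda>b. b # tl w) (f_op C i (hd w))
                    else map_option (\<lambda>bs. hd w # bs) (f_op D i (tl w))) \<rparr>)"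

text \<open>A classical weight is given by its coefficients in the basis of classical fundamental weights,
  indexed by the set \<open>I\<close> of classical nodes (and is \<open>0\<close> off \<open>I\<close>).\<close>

type_synonym weight = "nat \<Rightarrow> int"

definition wt :: "nat set \<Rightarrow> 'b crystal \<Rightarrow> 'b \<Rightarrow> weight" where
  "wt I C b = (\<lambda>i. if i \<in> I then int (phi C i b) - int (eps C i b) else 0)"

definition dominant :: "nat set \<Rightarrow> weight set" where
  "dominant I = {lam. (\<forall>i\<in>I. 0 \<le> lam i) \<and> (\<forall>i. i \<notin> I \<longrightarrow> lam i = 0)}"

definition hw_vectors :: "nat set \<Rightarrow> 'b crystal \<Rightarrow> 'b set" where
  "hw_vectors I C = {b \<in> elems C. \<forall>i\<in>I. eps C i b = 0}"

definition hw_vectors_wt :: "nat set \<Rightarrow> 'b crystal \<Rightarrow> weight \<Rightarrow> 'b set" where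
  "hw_vectors_wt I C lam = {b \<in> hw_vectors I C. wt I C b = lam}"


section \<open>Coordinates\<close>

text \<open>Letters are integers, \<open>-a\<close> standing for \<open>a\<close> with a bar.  A function \<open>x\<close> from letters to integers
  collects the Kang-Kashiwara-Misra coordinates \<open>x a\<close> (\<open>= x\<^sub>a\<close>) and \<open>x (-a)\<close> (\<open>x\<^sub>a\<close> with a bar).
  The functions below give the coordinates of the image under a crystal operator; the image is zero
  when these coordinates do not lie in the crystal.\<close>

type_synonym coords = "int \<Rightarrow> int"

text \<open>Node \<open>0\<close> of \<open>B\<^sub>n\<^sup>(\<^sup>1\<^sup>)\<close>, \<open>D\<^sub>n\<^sup>(\<^sup>1\<^sup>)\<close> and \<open>A\<^sub>2\<^sub>n\<^sub>-\<^sub>1\<^sup>(\<^sup>2\<^sup>)\<close>.\<close>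

definition fork_e0 :: "coords \<Rightarrow> coords" where
  "fork_e0 x = (if x 2 > x (-2) then x(2 := x 2 - 1, -1 := x (-1) + 1)
                else x(1 := x 1 - 1, -2 := x (-2) + 1))"

definition fork_f0 :: "coords \<Rightarrow> coords" where
  "fork_f0 x = (if x 2 \<ge> x (-2) then x(2 := x 2 + 1, -1 := x (-1) - 1)
                else x(1 := x 1 + 1, -2 := x (-2) - 1))"

text \<open>Node \<open>0\<close> when it is a short root (\<open>A\<^sub>2\<^sub>n\<^sup>(\<^sup>2\<^sup>)\<close> and \<open>D\<^sub>n\<^sub>+\<^sub>1\<^sup>(\<^sup>2\<^sup>)\<close>).\<close>

definition short_e0 :: "coords \<Rightarrow> coords" where
  "short_e0 x = (if x 1 > x (-1) then x(1 := x 1 - 1) else x(-1 := x (-1) + 1))"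

definition short_f0 :: "coords \<Rightarrow> coords" where
  "short_f0 x = (if x 1 \<ge> x (-1) then x(1 := x 1 + 1) else x(-1 := x (-1) - 1))"

text \<open>Node \<open>0\<close> when it is a long root (\<open>C\<^sub>n\<^sup>(\<^sup>1\<^sup>)\<close> and the dagger labeling of \<open>A\<^sub>2\<^sub>n\<^sup>(\<^sup>2\<^sup>)\<close>).\<close>

definition long_e0 :: "coords \<Rightarrow> coords" where
  "long_e0 x = (if x 1 \<ge> x (-1) + 2 then x(1 := x 1 - 2)
                else if x 1 = x (-1) + 1 then x(1 := x 1 - 1, -1 := x (-1) + 1)
                else x(-1 := x (-1) + 2))"

definition long_f0 :: "coords \<Rightarrow> coords" where
  "long_f0 x = (if x 1 \<ge> x (-1) then x(1 := x 1 + 2)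
                else if x 1 = x (-1) - 1 then x(1 := x 1 + 1, -1 := x (-1) - 1)
                else x(-1 := x (-1) - 2))"

text \<open>Nodes \<open>0 < i < n\<close>.\<close>

definition mid_e :: "int \<Rightarrow> coords \<Rightarrow> coords" where
  "mid_e i x = (if x (i+1) > x (-(i+1)) then x(i := x i + 1, i+1 := x (i+1) - 1)
                else x(-(i+1) := x (-(i+1)) + 1, -i := x (-i) - 1))"

definition mid_f :: "int \<Rightarrow> coords \<Rightarrow> coords" where
  "mid_f i x = (if x (i+1) \<ge> x (-(i+1)) then x(i := x i - 1, i+1 := x (i+1) + 1)
                else x(-(i+1) := x (-(i+1)) - 1, -i := x (-i) + 1))"

text \<open>Node \<open>n\<close> when it is a long root, respectively a short root.\<close>

definition long_en :: "int \<Rightarrow> coords \<Rightarrow> coords" where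
  "long_en n x = x(n := x n + 1, -n := x (-n) - 1)"

definition long_fn :: "int \<Rightarrow> coords \<Rightarrow> coords" where
  "long_fn n x = x(n := x n - 1, -n := x (-n) + 1)"

definition short_en :: "int \<Rightarrow> coords \<Rightarrow> coords" where
  "short_en n x = (if x 0 = 0 then x(0 := 1, -n := x (-n) - 1) else x(n := x n + 1, 0 := 0))"

definition short_fn :: "int \<Rightarrow> coords \<Rightarrow> coords" where
  "short_fn n x = (if x 0 = 0 then x(n := x n - 1, 0 := 1) else x(0 := 0, -n := x (-n) + 1))"


section \<open>Simply-laced types\<close>

datatype ytype = TypeA nat  \<comment> \<open>\<open>A\<^sub>N\<^sup>(\<^sup>1\<^sup>)\<close>\<close>
  | TypeD nat  \<comment> \<open>\<open>D\<^sub>N\<^sup>(\<^sup>1\<^sup>)\<close>\<close>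

fun nodes :: "ytype \<Rightarrow> nat set" where
  "nodes (TypeA N) = {1..N}"
| "nodes (TypeD N) = {1..N}"

text \<open>\<^term>\<open>cartan Y a b\<close> is meant for \<open>a, b \<in> nodes Y\<close>.\<close>

fun cartan :: "ytype \<Rightarrow> nat \<Rightarrow> nat \<Rightarrow> int" where
  "cartan (TypeA N) a b = (if a = b then 2 else if a = b + 1 \<or> b = a + 1 then -1 else 0)"
| "cartan (TypeD N) a b =
    (if a = b then 2
     else if (a < N \<and> b < N \<and> (a = b + 1 \<or> b = a + 1)) \<or> {a, b} = {N - 2, N} then -1 else 0)"

text \<open>A tableau is the list of its columns from left to right, a column the list of its entries
  from top to bottom.  A word is a tableau with columns of height one.\<close>

type_synonym column = "int list"
type_synonym tableau = "column list"
type_synonym path = "tableau list"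

fun columns :: "ytype \<Rightarrow> nat \<Rightarrow> column set" where
  "columns (TypeA N) r = {c. length c = r \<and> sorted_wrt (<) c \<and> set c \<subseteq> {1..int N + 1}}"
| "columns (TypeD N) r = {[x] | x. 1 \<le> \<bar>x\<bar> \<and> \<bar>x\<bar> \<le> int N}"

text \<open>In type \<open>D\<close> the letters \<open>N\<close> and \<open>-N\<close> have the same rank and are incomparable.\<close>

definition D_rank :: "nat \<Rightarrow> int \<Rightarrow> int" where
  "D_rank N x = (if x > 0 then x else 2 * int N + x)"

fun col_le :: "ytype \<Rightarrow> column \<Rightarrow> column \<Rightarrow> bool" where
  "col_le (TypeA N) c d = list_all2 (\<le>) c d"
| "col_le (TypeD N) c d = (c = d \<or> D_rank N (hd c) < D_rank N (hd d))"

definition D_letter_e :: "nat \<Rightarrow> nat \<Rightarrow> int \<Rightarrow> int option" where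
  "D_letter_e N i x =
    (if 1 \<le> i \<and> i < N \<and> x = int i + 1 then Some (int i)
     else if 1 \<le> i \<and> i < N \<and> x = - int i then Some (- (int i + 1))
     else if i = N \<and> x = - int N then Some (int N - 1)
     else if i = N \<and> x = - (int N - 1) then Some (int N)
     else None)"

definition D_letter_f :: "nat \<Rightarrow> nat \<Rightarrow> int \<Rightarrow> int option" where
  "D_letter_f N i x =
    (if 1 \<le> i \<and> i < N \<and> x = int i then Some (int i + 1)
     else if 1 \<le> i \<and> i < N \<and> x = - (int i + 1) then Some (- int i)
     else if i = N \<and> x = int N - 1 then Some (- int N)
     else if i = N \<and> x = int N then Some (- (int N - 1))
     else None)"

text \<open>The classical operators on a column \<open>c\<close> are those of the tensor product of its letters read
  from bottom to top.\<close>

fun col_e :: "ytype \<Rightarrow> nat \<Rightarrow> column \<Rightarrow> column option" where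
  "col_e (TypeA N) i c =
    (if 1 \<le> i \<and> i \<le> N \<and> int i + 1 \<in> set c \<and> int i \<notin> set c
     then Some (map (\<lambda>x. if x = int i + 1 then int i else x) c) else None)"
| "col_e (TypeD N) i c = map_option (\<lambda>x. [x]) (D_letter_e N i (hd c))"

fun col_f :: "ytype \<Rightarrow> nat \<Rightarrow> column \<Rightarrow> column option" where
  "col_f (TypeA N) i c =
    (if 1 \<le> i \<and> i \<le> N \<and> int i \<in> set c \<and> int i + 1 \<notin> set c
     then Some (map (\<lambda>x. if x = int i then int i + 1 else x) c) else None)"
| "col_f (TypeD N) i c = map_option (\<lambda>x. [x]) (D_letter_f N i (hd c))"

definition col_crystal :: "ytype \<Rightarrow> nat \<Rightarrow> column crystal" where
  "col_crystal Y r = \<lparr> elems = columns Y r, e_op = col_e Y, f_op = col_f Y \<rparr>"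

definition tableaux :: "ytype \<Rightarrow> nat \<Rightarrow> nat \<Rightarrow> tableau set" where
  "tableaux Y r s = {T. length T = s \<and> set T \<subseteq> columns Y r \<and> successively (col_le Y) T}"

definition content :: "tableau \<Rightarrow> coords" where
  "content T a = int (count_list (concat T) a)"

definition D_word :: "nat \<Rightarrow> coords \<Rightarrow> tableau" where
  "D_word N x = concat (map (\<lambda>a. replicate (nat (x a)) [a]) ([1..int N] @ [- int N..-1]))"

text \<open>The \<open>0\<close>-operators.  In type \<open>A\<close> they are written down only for \<open>r = 1\<close> and for \<open>r = N\<close>; for other
  \<open>r\<close> only the classical structure is used.  For \<open>r = 1\<close>, \<open>f\<^sub>0\<close> turns a letter \<open>N + 1\<close>
  into \<open>1\<close>.  For \<open>r = N\<close>, in the identification of \<open>B\<^sup>N\<^sup>,\<^sup>s\<close> with the contragredient dual of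
  \<open>B\<^sup>1\<^sup>,\<^sup>s\<close> a column missing the letter \<open>x\<close> stands for the dual of \<open>x\<close> (and the order of the columns
  is reversed), and \<open>f\<^sub>0\<close> on the dual is \<open>e\<^sub>0\<close> on \<open>B\<^sup>1\<^sup>,\<^sup>s\<close>: it turns a column missing \<open>1\<close> into one missing
  \<open>N + 1\<close>.  Both cases are covered by the same formula.\<close>

fun zero_e :: "ytype \<Rightarrow> nat \<Rightarrow> tableau \<Rightarrow> tableau option" where
  "zero_e (TypeA N) r T =
    (if r = 1 \<or> r = N then
       (if hd T = [1..int r] then Some (tl T @ [[int N + 2 - int r..int N + 1]]) else None)
     else undefined)"
| "zero_e (TypeD N) r T = (let y = fork_e0 (content T)
    in if \<forall>a. 0 \<le> y a then Some (D_word N y) else None)"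

fun zero_f :: "ytype \<Rightarrow> nat \<Rightarrow> tableau \<Rightarrow> tableau option" where
  "zero_f (TypeA N) r T =
    (if r = 1 \<or> r = N then
       (if last T = [int N + 2 - int r..int N + 1] then Some ([1..int r] # butlast T) else None)
     else undefined)"
| "zero_f (TypeD N) r T = (let y = fork_f0 (content T)
    in if \<forall>a. 0 \<le> y a then Some (D_word N y) else None)"

text \<open>\<open>B\<^sup>r\<^sup>,\<^sup>s\<close> of type \<open>Y\<close>, for \<open>s \<ge> 1\<close>, and \<open>r = 1\<close> in type \<open>D\<close>.  The classical operators are those of
  the tensor product of the columns, that is, of the column reading word.\<close>

definition KR :: "ytype \<Rightarrow> nat \<Rightarrow> nat \<Rightarrow> tableau crystal" where
  "KR Y r s =
    \<lparr> elems = tableaux Y r s,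
      e_op = (\<lambda>i T. if i = 0 then zero_e Y r T
                    else e_op (tensor (replicate s (col_crystal Y r))) i T),
      f_op = (\<lambda>i T. if i = 0 then zero_f Y r T
                    else f_op (tensor (replicate s (col_crystal Y r))) i T) \<rparr>"

text \<open>A list \<open>B\<close> of pairs \<open>(r, s)\<close> encodes the tensor product of the crystals \<open>B\<^sup>r\<^sup>,\<^sup>s\<close>.\<close>

type_synonym factors = "(nat \<times> nat) list"

definition path_crystal :: "ytype \<Rightarrow> factors \<Rightarrow> path crystal" where
  "path_crystal Y B = tensor (map (\<lambda>(r, s). KR Y r s) B)"

fun admissible_factor :: "ytype \<Rightarrow> nat \<times> nat \<Rightarrow> bool" where
  "admissible_factor (TypeA N) (r, s) = (1 \<le> r \<and> r \<le> N \<and> 1 \<le> s)"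
| "admissible_factor (TypeD N) (r, s) = (r = 1 \<and> 1 \<le> s)"

definition admissible :: "ytype \<Rightarrow> factors \<Rightarrow> bool" where
  "admissible Y B = list_all (admissible_factor Y) B"

definition lh :: "path \<Rightarrow> path" where
  "lh = tl"

fun ls :: "path \<Rightarrow> path" where
  "ls ((c # cs) # p) = [c] # cs # p"

fun lb :: "path \<Rightarrow> path" where
  "lb ([c] # p) = [[last c]] # [butlast c] # p"


section \<open>Rigged configurations\<close>

text \<open>The multiset \<^term>\<open>R a\<close> consists of the strings \<open>(i, x)\<close> of \<open>(\<nu>, J)\<^sup>(\<^sup>a\<^sup>)\<close>: a part of length \<open>i\<close> with rigging
  \<open>x\<close>.  The array \<open>L\<close> is encoded by multisets: \<open>L\<^sub>i\<^sup>(\<^sup>a\<^sup>)\<close> is \<^term>\<open>count (L a) i\<close>.\<close>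

type_synonym rigged = "nat \<Rightarrow> (nat \<times> int) multiset"
type_synonym arr = "nat \<Rightarrow> nat multiset"

definition mult_array :: "factors \<Rightarrow> arr" where
  "mult_array B a = image_mset snd (filter_mset (\<lambda>(r, s). r = a) (mset B))"

definition shape :: "rigged \<Rightarrow> arr" where
  "shape R a = image_mset fst (R a)"

definition riggings :: "rigged \<Rightarrow> nat \<Rightarrow> nat \<Rightarrow> int multiset" where
  "riggings R a i = image_mset snd (filter_mset (\<lambda>(j, x). j = i) (R a))"

definition vacancy :: "ytype \<Rightarrow> arr \<Rightarrow> arr \<Rightarrow> nat \<Rightarrow> nat \<Rightarrow> int" where
  "vacancy Y L nu a i =
    int (\<Sum>j\<in>#L a. min i j) - (\<Sum>b\<in>nodes Y. cartan Y a b * int (\<Sum>j\<in>#nu b. min i j))"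

text \<open>The last condition is the weight condition, written in the coordinates given by the fundamental
  weights (the Cartan matrix is symmetric).\<close>

definition RC_wt :: "ytype \<Rightarrow> arr \<Rightarrow> weight \<Rightarrow> rigged set" where
  "RC_wt Y L lam = {R.
     (\<forall>a. a \<notin> nodes Y \<longrightarrow> R a = {#}) \<and>
     (\<forall>a\<in>nodes Y. \<forall>i\<ge>1. 0 \<le> vacancy Y L (shape R) a i) \<and>
     (\<forall>a\<in>nodes Y. \<forall>(i, x)\<in>#R a. 1 \<le> i \<and> 0 \<le> x \<and> x \<le> vacancy Y L (shape R) a i) \<and>
     (\<forall>a\<in>nodes Y. (\<Sum>b\<in>nodes Y. cartan Y a b * int (\<Sum>\<^sub># (shape R b))) = int (\<Sum>\<^sub># (L a)) - lam a)}"

definition RC :: "ytype \<Rightarrow> arr \<Rightarrow> rigged set" where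
  "RC Y L = (\<Union>lam\<in>dominant (nodes Y). RC_wt Y L lam)"

text \<open>The algorithm for \<open>\<delta>\<close>; \<^term>\<open>None\<close> stands for \<open>\<infinity>\<close>.\<close>

definition first_from :: "(nat \<Rightarrow> bool) \<Rightarrow> nat \<Rightarrow> nat option" where
  "first_from Q k = (if \<exists>i\<ge>k. Q i then Some (LEAST i. k \<le> i \<and> Q i) else None)"

definition num_singular :: "ytype \<Rightarrow> arr \<Rightarrow> rigged \<Rightarrow> nat \<Rightarrow> nat \<Rightarrow> nat" where
  "num_singular Y L R a i = count (R a) (i, vacancy Y L (shape R) a i)"

fun ell_chain :: "ytype \<Rightarrow> arr \<Rightarrow> rigged \<Rightarrow> nat \<Rightarrow> nat option" where
  "ell_chain Y L R 0 = Some 1"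
| "ell_chain Y L R (Suc a) =
    Option.bind (ell_chain Y L R a) (first_from (\<lambda>i. num_singular Y L R (Suc a) i \<ge> 1))"

text \<open>In type \<open>D\<close> the searches at the two spin nodes \<open>N - 1\<close> and \<open>N\<close> both start from node \<open>N - 2\<close>.\<close>

fun ell :: "ytype \<Rightarrow> arr \<Rightarrow> rigged \<Rightarrow> nat \<Rightarrow> nat option" where
  "ell (TypeA N) L R a = ell_chain (TypeA N) L R a"
| "ell (TypeD N) L R a =
    (if a = N
     then Option.bind (ell_chain (TypeD N) L R (N - 2))
            (first_from (\<lambda>i. num_singular (TypeD N) L R N i \<ge> 1))
     else ell_chain (TypeD N) L R a)"

text \<open>\<^term>\<open>ell_bar N L R k\<close> is the selection with a bar at node \<open>N - 1 - k\<close>, in type \<open>D\<close>.\<close>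

fun ell_bar :: "nat \<Rightarrow> arr \<Rightarrow> rigged \<Rightarrow> nat \<Rightarrow> nat option" where
  "ell_bar N L R 0 =
    (case (ell (TypeD N) L R (N - 1), ell (TypeD N) L R N) of
       (Some i, Some j) \<Rightarrow> Some (max i j) | _ \<Rightarrow> None)"
| "ell_bar N L R (Suc k) = (let a = N - 1 - Suc k in
    Option.bind (ell_bar N L R k)
      (first_from (\<lambda>i. num_singular (TypeD N) L R a i
                       \<ge> (if ell (TypeD N) L R a = Some i then 2 else 1))))"

definition opt_mset :: "'b option \<Rightarrow> 'b multiset" where
  "opt_mset z = (case z of None \<Rightarrow> {#} | Some i \<Rightarrow> {#i#})"

text \<open>The lengths of the strings selected in \<open>(\<nu>, J)\<^sup>(\<^sup>a\<^sup>)\<close>.\<close>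

fun selected :: "ytype \<Rightarrow> arr \<Rightarrow> rigged \<Rightarrow> arr" where
  "selected (TypeA N) L R a = (if a \<in> nodes (TypeA N) then opt_mset (ell (TypeA N) L R a) else {#})"
| "selected (TypeD N) L R a =
    (if a \<in> nodes (TypeD N)
     then opt_mset (ell (TypeD N) L R a) +
          (if a \<le> N - 2 then opt_mset (ell_bar N L R (N - 1 - a)) else {#})
     else {#})"

text \<open>\<open>L\<close> is the array of the domain, which has a factor \<open>B\<^sup>1\<^sup>,\<^sup>1\<close> on the left; this factor is dropped.\<close>

definition delta :: "ytype \<Rightarrow> arr \<Rightarrow> rigged \<Rightarrow> rigged" where
  "delta Y L R =
    (let L' = L(1 := L 1 - {#1#});
         sel = selected Y L R;
         nu' = (\<lambda>a. shape R a - sel a + {# i - 1. i \<in># filter_mset (\<lambda>i. i > 1) (sel a) #})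
     in (\<lambda>a. R a - {# (i, vacancy Y L (shape R) a i). i \<in># sel a #}
             + {# (i - 1, vacancy Y L' nu' a (i - 1)). i \<in># filter_mset (\<lambda>i. i > 1) (sel a) #}))"

text \<open>The map adding singular strings of length one for \<open>1 \<le> a < r\<close>; \<open>L'\<close> is the array of the
  codomain.\<close>

definition i_bar :: "ytype \<Rightarrow> arr \<Rightarrow> nat \<Rightarrow> rigged \<Rightarrow> rigged" where
  "i_bar Y L' r R =
    (let nu' = (\<lambda>a. shape R a + (if 1 \<le> a \<and> a < r then {#1#} else {#}))
     in (\<lambda>a. R a + (if 1 \<le> a \<and> a < r then {#(1, vacancy Y L' nu' a 1)#} else {#})))"

text \<open>\<^term>\<open>Phi\<close> is the whole family of bijections, indexed by the tensor product \<open>B\<close>.\<close>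

definition rc_bijection :: "ytype \<Rightarrow> (factors \<Rightarrow> path \<Rightarrow> rigged) \<Rightarrow> bool" where
  "rc_bijection Y Phi \<longleftrightarrow>
    (\<forall>B lam. admissible Y B \<and> lam \<in> dominant (nodes Y) \<longrightarrow>
       bij_betw (Phi B) (hw_vectors_wt (nodes Y) (path_crystal Y B) lam)
                (RC_wt Y (mult_array B) lam)) \<and>
    Phi [] [] = (\<lambda>a. {#}) \<and>
    (\<forall>B b. admissible Y ((1, 1) # B) \<and> b \<in> hw_vectors (nodes Y) (path_crystal Y ((1, 1) # B)) \<longrightarrow>
       Phi B (lh b) = delta Y (mult_array ((1, 1) # B)) (Phi ((1, 1) # B) b)) \<and>
    (\<forall>r s B b. 2 \<le> s \<and> admissible Y ((r, s) # B)
         \<and> b \<in> hw_vectors (nodes Y) (path_crystal Y ((r, s) # B)) \<longrightarrow>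
       Phi ((r, 1) # (r, s - 1) # B) (ls b) = Phi ((r, s) # B) b) \<and>
    (\<forall>r B b. 2 \<le> r \<and> admissible Y ((r, 1) # B)
         \<and> b \<in> hw_vectors (nodes Y) (path_crystal Y ((r, 1) # B)) \<longrightarrow>
       Phi ((1, 1) # (r - 1, 1) # B) (lb b)
         = i_bar Y (mult_array ((1, 1) # (r - 1, 1) # B)) r (Phi ((r, 1) # B) b))"


section \<open>Non-simply-laced types and virtual crystals\<close>

datatype xtype =
    XB  \<comment> \<open>\<open>B\<^sub>n\<^sup>(\<^sup>1\<^sup>)\<close>\<close>
  | XC  \<comment> \<open>\<open>C\<^sub>n\<^sup>(\<^sup>1\<^sup>)\<close>\<close>
  | XAodd  \<comment> \<open>\<open>A\<^sub>2\<^sub>n\<^sub>-\<^sub>1\<^sup>(\<^sup>2\<^sup>)\<close>\<close>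
  | XAeven  \<comment> \<open>\<open>A\<^sub>2\<^sub>n\<^sup>(\<^sup>2\<^sup>)\<close>, with \<open>\<alpha>\<^sub>0\<close> the extra short root\<close>
  | XAdag  \<comment> \<open>\<open>A\<^sub>2\<^sub>n\<^sup>(\<^sup>2\<^sup>)\<close> dagger, with \<open>\<alpha>\<^sub>0\<close> the extra long root\<close>
  | XD  \<comment> \<open>\<open>D\<^sub>n\<^sub>+\<^sub>1\<^sup>(\<^sup>2\<^sup>)\<close>\<close>

text \<open>The ranges of the tables of Kac; \<open>A\<^sub>2\<^sup>(\<^sup>2\<^sup>)\<close> is included.\<close>

fun valid_rank :: "xtype \<Rightarrow> nat \<Rightarrow> bool" where
  "valid_rank XB n = (3 \<le> n)"
| "valid_rank XC n = (2 \<le> n)"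
| "valid_rank XAodd n = (3 \<le> n)"
| "valid_rank XAeven n = (1 \<le> n)"
| "valid_rank XAdag n = (1 \<le> n)"
| "valid_rank XD n = (2 \<le> n)"

text \<open>The sets of Kang, Kashiwara and Misra.  \<open>A\<^sub>2\<^sub>n\<^sup>(\<^sup>2\<^sup>)\<close> dagger has the node \<open>0\<close> of \<open>C\<^sub>n\<^sup>(\<^sup>1\<^sup>)\<close> and the
  node \<open>n\<close> of \<open>B\<^sub>n\<^sup>(\<^sup>1\<^sup>)\<close>; its crystals are those of \<open>A\<^sub>2\<^sub>n\<^sup>(\<^sup>2\<^sup>)\<close> with the nodes \<open>i\<close> and \<open>n - i\<close>
  interchanged.\<close>

definition KRX_elems :: "xtype \<Rightarrow> nat \<Rightarrow> nat \<Rightarrow> coords set" where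
  "KRX_elems X n s = {x.
     (\<forall>a. 0 \<le> x a) \<and> (\<forall>a. int n < \<bar>a\<bar> \<longrightarrow> x a = 0) \<and>
     (if X \<in> {XB, XAdag, XD} then x 0 \<le> 1 else x 0 = 0) \<and>
     (let t = (\<Sum>a = - int n..int n. x a) in
        if X \<in> {XB, XAodd} then t = int s
        else if X \<in> {XAeven, XD} then t \<le> int s
        else t \<le> int s \<and> even (int s - t))}"

definition KRX_e :: "xtype \<Rightarrow> nat \<Rightarrow> nat \<Rightarrow> coords \<Rightarrow> coords" where
  "KRX_e X n i =
    (if i = 0 then (if X \<in> {XB, XAodd} then fork_e0 else if X \<in> {XAeven, XD} then short_e0 else long_e0)
     else if i < n then mid_e (int i)
     else if X \<in> {XB, XAdag, XD} then short_en (int n) else long_en (int n))"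

definition KRX_f :: "xtype \<Rightarrow> nat \<Rightarrow> nat \<Rightarrow> coords \<Rightarrow> coords" where
  "KRX_f X n i =
    (if i = 0 then (if X \<in> {XB, XAodd} then fork_f0 else if X \<in> {XAeven, XD} then short_f0 else long_f0)
     else if i < n then mid_f (int i)
     else if X \<in> {XB, XAdag, XD} then short_fn (int n) else long_fn (int n))"

definition KRX :: "xtype \<Rightarrow> nat \<Rightarrow> nat \<Rightarrow> coords crystal" where
  "KRX X n s =
    \<lparr> elems = KRX_elems X n s,
      e_op = (\<lambda>i x. if i \<le> n \<and> KRX_e X n i x \<in> KRX_elems X n s then Some (KRX_e X n i x) else None),
      f_op = (\<lambda>i x. if i \<le> n \<and> KRX_f X n i x \<in> KRX_elems X n s then Some (KRX_f X n i x) else None) \<rparr>"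

text \<open>The vector of weight \<open>s\<close> times the first fundamental weight.\<close>

definition u_KRX :: "nat \<Rightarrow> coords" where
  "u_KRX s = (\<lambda>a. if a = 1 then int s else 0)"

definition Y_of :: "xtype \<Rightarrow> nat \<Rightarrow> ytype" where
  "Y_of X n = (if X \<in> {XB, XAodd} then TypeD (n + 1) else TypeA (2 * n - 1))"

text \<open>The set \<open>\<iota>(i)\<close> is given as a list, to have an order of composition for the commuting operators
  attached to its elements.\<close>

definition iota :: "xtype \<Rightarrow> nat \<Rightarrow> nat \<Rightarrow> nat list" where
  "iota X n i =
    (if X \<in> {XB, XAodd} then (if i < n then [i] else [n, n + 1])
     else if i = 0 \<or> i = n then [i] else [i, 2 * n - i])"

fun gamma :: "xtype \<Rightarrow> nat \<Rightarrow> nat \<Rightarrow> nat" where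
  "gamma XB n i = (if i < n then 2 else 1)"
| "gamma XC n i = (if i = 0 \<or> i = n then 2 else 1)"
| "gamma XAodd n i = 1"
| "gamma XAeven n i = (if i = n then 2 else 1)"
| "gamma XAdag n i = (if i = 0 then 2 else 1)"
| "gamma XD n i = 1"

definition Psi_wt :: "xtype \<Rightarrow> nat \<Rightarrow> weight \<Rightarrow> weight" where
  "Psi_wt X n lam = (\<lambda>j. \<Sum>i = 1..n. if j \<in> set (iota X n i) then int (gamma X n i) * lam i else 0)"

definition hat_factors :: "xtype \<Rightarrow> nat \<Rightarrow> nat \<Rightarrow> factors" where
  "hat_factors X n s =
    (if X = XB then [(1, 2 * s)] else if X = XAodd then [(1, s)] else [(2 * n - 1, s), (1, s)])"

definition u_path :: "factors \<Rightarrow> path" where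
  "u_path B = map (\<lambda>(r, s). replicate s [1..int r]) B"

definition virtual_op ::
  "xtype \<Rightarrow> nat \<Rightarrow> nat \<Rightarrow> (nat \<Rightarrow> 'b \<Rightarrow> 'b option) \<Rightarrow> 'b \<Rightarrow> 'b option" where
  "virtual_op X n i g v =
    fold (\<lambda>j w. Option.bind w (opt_pow (gamma X n i) (g j))) (iota X n i) (Some v)"

definition virtual_embedding :: "xtype \<Rightarrow> nat \<Rightarrow> nat \<Rightarrow> (coords \<Rightarrow> path) \<Rightarrow> bool" where
  "virtual_embedding X n s psi \<longleftrightarrow>
    (let B = KRX X n s; V = path_crystal (Y_of X n) (hat_factors X n s) in
      inj_on psi (elems B) \<and> psi ` elems B \<subseteq> elems V \<and>
      psi (u_KRX s) = u_path (hat_factors X n s) \<and>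
      (\<forall>b\<in>elems B. \<forall>i\<le>n.
         map_option psi (e_op B i b) = virtual_op X n i (e_op V) (psi b) \<and>
         map_option psi (f_op B i b) = virtual_op X n i (f_op V) (psi b) \<and>
         (\<forall>j\<in>set (iota X n i). phi V j (psi b) = gamma X n i * phi B i b \<and>
                               eps V j (psi b) = gamma X n i * eps B i b)))"

text \<open>In the following, \<open>B = B\<^sup>s\<^sup>_\<^sup>k \<otimes> \<dots> \<otimes> B\<^sup>s\<^sup>_\<^sup>1\<close> is given by the list \<open>ss = [s\<^sub>k, \<dots>, s\<^sub>1]\<close>.\<close>

definition hat_factors_list :: "xtype \<Rightarrow> nat \<Rightarrow> nat list \<Rightarrow> factors" where
  "hat_factors_list X n ss = concat (map (hat_factors X n) ss)"

definition Psi_path :: "(nat \<Rightarrow> coords \<Rightarrow> path) \<Rightarrow> nat list \<Rightarrow> coords list \<Rightarrow> path" where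
  "Psi_path psi ss b = concat (map2 psi ss b)"

definition P_X :: "xtype \<Rightarrow> nat \<Rightarrow> nat list \<Rightarrow> coords list set" where
  "P_X X n ss = hw_vectors {1..n} (tensor (map (KRX X n) ss))"

definition P_virtual :: "xtype \<Rightarrow> nat \<Rightarrow> (nat \<Rightarrow> coords \<Rightarrow> path) \<Rightarrow> nat list \<Rightarrow> path set" where
  "P_virtual X n psi ss = Psi_path psi ss ` P_X X n ss"

definition P_hat :: "xtype \<Rightarrow> nat \<Rightarrow> nat list \<Rightarrow> path set" where
  "P_hat X n ss = hw_vectors (nodes (Y_of X n)) (path_crystal (Y_of X n) (hat_factors_list X n ss))"

definition RC_hat :: "xtype \<Rightarrow> nat \<Rightarrow> nat list \<Rightarrow> rigged set" where
  "RC_hat X n ss = RC (Y_of X n) (mult_array (hat_factors_list X n ss))"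

definition RC_virtual_wt :: "xtype \<Rightarrow> nat \<Rightarrow> nat list \<Rightarrow> weight \<Rightarrow> rigged set" where
  "RC_virtual_wt X n ss lam =
    {R \<in> RC_wt (Y_of X n) (mult_array (hat_factors_list X n ss)) (Psi_wt X n lam).
      (\<forall>a\<in>{1..n}. \<forall>b\<in>set (iota X n a). \<forall>b'\<in>set (iota X n a). \<forall>i\<ge>1.
         count (shape R b) i = count (shape R b') i \<and> riggings R b i = riggings R b' i) \<and>
      (\<forall>a\<in>{1..n}. \<forall>b\<in>set (iota X n a).
         (\<forall>j\<ge>1. \<not> gamma X n a dvd j \<and> \<not> (X \<in> {XAeven, XAdag} \<and> b = n)
                 \<longrightarrow> count (shape R b) j = 0) \<and>
         (\<forall>i\<ge>1. \<forall>x\<in>#riggings R b i. int (gamma X n a) dvd x)) \<and>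
      (X = XAdag \<longrightarrow> (\<forall>i\<ge>1. \<forall>x\<in>#riggings R n i. even x \<longleftrightarrow> even i))}"

definition RC_virtual :: "xtype \<Rightarrow> nat \<Rightarrow> nat list \<Rightarrow> rigged set" where
  "RC_virtual X n ss = (\<Union>lam\<in>dominant {1..n}. RC_virtual_wt X n ss lam)"

end

theory Submission imports Defs "HOL-Library.Extended_Nat"
begin

text \<open>A letter of a path is the number of nodes at which \<open>\<delta>\<close> finds singular strings, so a row of
  length \<open>s\<close> is read off a rigged configuration by \<open>s\<close> chains of decreasing starting lengths.

  In type \<open>A\<close> the flip of the diagram turns a chain for a row into a chain for a dual row.  A chain for
  a row and a chain for a dual row commute up to a local rule on the two letters, hence a flip-invariant
  configuration stays flip-invariant when a dual row and a row of the same length are removed from it, and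
  the letter multiplicities of the removed pair are those of the virtual crystal.  The remaining
  conditions concern the middle node: there the parities of riggings and lengths change with the
  multiplicities of the extreme and middle pairs of letters.

  In type \<open>D\<close> the exchange of the spin nodes commutes with \<open>\<delta>\<close>, and by weights a configuration is
  invariant under it exactly if no letter \<open>N\<close> or \<open>- N\<close> occurs.  For \<open>X = B\<^sub>n\<close> the strings
  selected by two consecutive steps coincide up to one box, which preserves evenness exactly for the
  doubled words.  In all cases the class of virtual configurations and the image of the embedding are
  characterised by the same conditions on the letter multiplicities.\<close>

text \<open>Why chains have starting lengths: in type A, \<open>ls\<close> keeps the configuration
  but raises the vacancy numbers at node 1 by one for lengths up to k. No rigging exceeds its old
  vacancy number, so no string of such a length stays singular, and taking the first letter off a
  row of length k + 1 is a search started at k + 1. A column of height N needs N rounds of \<delta>,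
  with \<open>lb\<close> in between; together they are one search from node N down to node 1, the
  mirror image of the search for a row letter.

  The virtual crystal pairs rows of equal length, but the exchange is proved by induction over
  squares with unequal lengths. There the two chains may fail to cross, and a hexagon with one more
  dual letter replaces the square.

  No inverse of \<delta> is constructed. To see that a configuration is invariant under a diagram
  symmetry, its image is pulled back to a path by surjectivity; letters and remainder agree with
  those of the original path, so the two paths are equal. The image of the embedding is computed
  from string lengths, which together with the row lengths determine all letter
  multiplicities.\<close>

section \<open>Searches, vacancy updates and the flip in type A\<close>

definition first :: "(nat => bool) => enat => enat" where
 "first P x = Inf {enat i | i. x <= enat i & P i}"

lemma first_ge: "x <= first P x" unfolding first_def by (rule Inf_greatest) auto

lemma first_le: "x <= enat i ==> P i ==> first P x <= enat i" unfolding first_def by (rule Inf_lower) auto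

lemma first_sat: "first P x = enat i ==> P i"
proof -
 assume h: "first P x = enat i"
 let ?A = "{enat i | i. x <= enat i & P i}"
 have "?A ~= {}" using h unfolding first_def by (metis Inf_enat_def enat.distinct(1))
 hence "Inf ?A : ?A" unfolding Inf_enat_def by (auto intro: LeastI)
 thus "P i" using h unfolding first_def by auto
qed

lemma first_eqI:
 assumes "x <= y" "!!i. y = enat i ==> P i" "!!i. x <= enat i ==> P i ==> y <= enat i"
 shows "first P x = y"
proof (rule antisym)
 show "y <= first P x" by (cases "first P x") (use assms(3) first_ge[of x P] first_sat[of P x] in auto)
 show "first P x <= y" by (cases y) (use assms first_le[of x] in auto)
qed

lemma first_infty [simp]: "first P \<infinity> = \<infinity>" using first_ge[of \<infinity> P] by simp

lemma first_False [simp]: "first (%_. False) x = \<infinity>" by (rule first_eqI) auto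

type_synonym vacancies = "nat => nat => int"

definition sing :: "vacancies => rigged => nat => nat => bool" where
 "sing p R a i \<longleftrightarrow> (i, p a i) \<in># R a"

definition chi :: "enat => nat => int" where
 "chi s i = of_bool (s <= enat i)"

lemma chi_1 [simp]: "s <= enat i ==> chi s i = 1" by (simp add: chi_def)
lemma chi_0 [simp]: "enat i < s ==> chi s i = 0" by (simp add: chi_def)
lemma chi_infty [simp]: "chi \<infinity> i = 0" by simp

text \<open>Taking a box off a string of length \<open>s b\<close> at each node b changes the
  vacancy numbers by the Cartan matrix applied to \<open>chi (s b)\<close>. The values
  \<open>s 0\<close> and \<open>s (N + 1)\<close> lie outside the diagram and record the shortened
  tensor factor: a finite value k there lowers the contribution of L at the adjacent node by one for
  exactly the lengths i >= k.\<close>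

definition upd :: "nat => vacancies => (nat => enat) => vacancies" where
 "upd N p s a i = (if 1 <= a & a <= N
   then p a i + 2 * chi (s a) i - chi (s (a - 1)) i - chi (s (a + 1)) i else p a i)"

text \<open>\<open>p\<close> finds the singular string before the step, \<open>p'\<close> gives the
  rigging of the shortened string after it.\<close>

definition rm :: "nat => rigged => (nat => enat) => vacancies => vacancies => rigged" where
 "rm N R s p p' a = (if 1 <= a & a <= N
   then (case s a of \<infinity> => R a
    | enat i => R a - {#(i, p a i)#} + (if 1 < i then {#(i - 1, p' a (i - 1))#} else {#}))
   else R a)"

definition valid :: "nat => vacancies => rigged => bool" where
 "valid N p R \<longleftrightarrow> (\<forall>a. ~ (1 <= a & a <= N) --> R a = {#} & p a = (%_. 0)) &
   (\<forall>a i x. (i, x) \<in># R a --> 1 <= i & x <= p a i)"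

definition flip :: "nat => (nat => 'b) => nat => 'b" where
 "flip N f a = f (N + 1 - a)"

lemma flip_flip: "a <= N + 1 ==> flip N (flip N f) a = f a" by (simp add: flip_def)

lemma flip_flip_R: "valid N p R ==> flip N (flip N R) = R"
proof
 fix a assume v: "valid N p R"
 show "flip N (flip N R) a = R a"
 proof (cases "a <= N + 1")
  case False
  thus ?thesis using v by (auto simp: flip_def valid_def)
 qed (simp add: flip_flip)
qed

lemma flip_flip_p: "valid N p R ==> flip N (flip N p) = p"
proof
 fix a assume v: "valid N p R"
 show "flip N (flip N p) a = p a"
 proof (cases "a <= N + 1")
  case False
  thus ?thesis using v by (auto simp: flip_def valid_def)
 qed (simp add: flip_flip)
qed

lemma valid_flip: "valid N p R ==> valid N (flip N p) (flip N R)"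
proof -
 assume v: "valid N p R"
 { fix a assume "~ (1 <= a & a <= N)"
  hence "~ (1 <= N + 1 - a & N + 1 - a <= N)" by auto
  hence "R (N + 1 - a) = {#} & p (N + 1 - a) = (%_. 0)" using v unfolding valid_def by blast }
 thus ?thesis using v unfolding valid_def flip_def by blast
qed

lemma valid_le: "valid N p R ==> (i, x) \<in># R a ==> x <= p a i" by (auto simp: valid_def)

lemma valid_pos: "valid N p R ==> (i, x) \<in># R a ==> 1 <= i" by (auto simp: valid_def)

lemma flip_sing: "sing (flip N p) (flip N R) a = sing p R (N + 1 - a)" by (auto simp: sing_def flip_def)

lemma flip_upd: "flip N (upd N p s) a = upd N (flip N p) (flip N s) a"
proof (cases "1 <= a & a <= N")
 case True
 hence "Suc N - a - 1 = Suc N - (a + 1)" "Suc N - a + 1 = Suc N - (a - 1)" by auto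
 thus ?thesis by (auto simp: flip_def upd_def fun_eq_iff)
qed (auto simp: flip_def upd_def fun_eq_iff)

lemma flip_upd': "flip N (upd N p s) = upd N (flip N p) (flip N s)" using flip_upd by blast

lemma flip_rm: "flip N (rm N R s p p') = rm N (flip N R) (flip N s) (flip N p) (flip N p')"
proof
 fix a
 show "flip N (rm N R s p p') a = rm N (flip N R) (flip N s) (flip N p) (flip N p') a"
  by (cases "1 <= a & a <= N") (auto simp: flip_def rm_def split: enat.split)
qed

subsection \<open>Chains of singular strings\<close>

lemma sing_rm_cases:
 assumes "valid N p R" "sing p' (rm N R s p p') a i"
 shows "1 <= i & (s a = enat (Suc i) \<or> (i, p' a i) \<in># R a)" using assms valid_pos[OF assms(1)] unfolding sing_def rm_def
 by (auto split: if_splits enat.splits dest: in_diffD)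

lemma sing_rm_new:
 assumes "s a = enat (Suc i)" "1 <= i" "1 <= a" "a <= N"
 shows "sing p' (rm N R s p p') a i" using assms unfolding sing_def rm_def by auto

lemma sing_rm_old:
 assumes "(i, p' a i) \<in># R a" "s a ~= enat i"
 shows "sing p' (rm N R s p p') a i" using assms unfolding sing_def rm_def by (auto split: enat.splits simp: in_diff_count)

text \<open>Along the diagram \<open>l\<close> increases and \<open>m\<close> decreases, and both
  are computed from the same configuration. Their graphs meet on a plateau of height
  \<open>q\<close> over the nodes b to c. \<open>H1\<close> keeps \<open>l\<close> below the next
  value of \<open>m\<close> on the left of it, and \<open>H2\<close> keeps \<open>m\<close> below
  the previous value of \<open>l\<close> on the right.\<close>

locale crossing =
 fixes N b c :: nat and p :: vacancies and R :: rigged and l m :: "nat => enat" and q :: enat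
 assumes valid: "valid N p R"
  and bc: "1 <= b" "b <= c" "c <= N"
  and l0: "1 <= l 0" and mN: "1 <= m (Suc N)"
  and l: "!!a. a <= N ==> l (Suc a) = first (sing p R (Suc a)) (l a)"
  and m: "!!a. a <= N ==> m a = first (sing p R a) (m (Suc a))"
  and H1: "!!a. a < b ==> l a < m (Suc a)"
  and H2: "!!a. c <= a ==> a <= N ==> m (Suc a) < l a"
  and lq: "!!a. b <= a ==> a <= c ==> l a = q"
  and mq: "!!a. b <= a ==> a <= c ==> m a = q"
begin

lemma flipped: "crossing N (N + 1 - c) (N + 1 - b) (flip N p) (flip N R) (flip N m) (flip N l) q"
proof (unfold_locales, goal_cases)
 case 1 show ?case by (rule valid_flip[OF valid])
next case 2 thus ?case using bc by auto
next case 3 thus ?case using bc by auto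
next case 4 thus ?case using bc by auto
next case 5 thus ?case using mN by (simp add: flip_def)
next case 6 thus ?case using l0 by (simp add: flip_def)
next case (7 a) thus ?case using m[of "N - a"] by (simp add: flip_sing) (simp add: flip_def Suc_diff_le)
next case (8 a) 
 show ?case
 proof (cases a)
  case 0 
  thus ?thesis using l[of N] valid by (simp add: flip_sing) (simp add: flip_def)
 next
  case (Suc a')
  hence "Suc (N - a) = N - a'" using 8 by auto
  thus ?thesis using l[of "N - a"] 8 Suc by (simp add: flip_sing) (simp add: flip_def)
 qed
next case (9 a) thus ?case using H2[of "N - a"] by (simp add: flip_def Suc_diff_le)
next case (10 a) thus ?case using H1[of "N - a"] by (simp add: flip_def Suc_diff_le)
next case (11 a) thus ?case using mq[of "N + 1 - a"] bc by (simp add: flip_def)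
next case (12 a) thus ?case using lq[of "N + 1 - a"] bc by (simp add: flip_def)
qed

lemma l_mono: "a <= a' ==> a' <= Suc N ==> l a <= l a'"
proof (induction a' rule: dec_induct)
 case (step n) thus ?case using l[of n] first_ge[of "l n"] by (auto intro: order_trans)
qed simp

lemma m_mono: "a <= a' ==> a' <= Suc N ==> m a' <= m a"
proof (induction a' rule: dec_induct)
 case (step n) thus ?case using m[of n] first_ge[of "m (Suc n)"] by (auto intro: order_trans)
qed simp

lemma m_pos: "a <= Suc N ==> 1 <= m a" using m_mono[of a "Suc N"] mN by auto

lemma l_sing: "1 <= a ==> a <= Suc N ==> l a = enat i ==> sing p R a i" using l[of "a - 1"] first_sat[of "sing p R a"] by (cases a) auto

lemma m_sing: "a <= N ==> m a = enat i ==> sing p R a i" using m[of a] first_sat[of "sing p R a"] by auto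

text \<open>The height of the plateau for the second chain, whichever chain is removed first. Over
  several nodes the strings shortened to q - 1 are singular and get selected again. Over a single
  node the vacancy number drops by one between the incoming chains and q, so a string whose rigging
  was one below singular may be hit before q - 1.\<close>

definition r :: enat where
 "r = (if b < c then q - 1
    else first (%i. (i, p b i - 1) \<in># R b \<or> enat (Suc i) = q) (max (l (b - 1)) (m (b + 1))))"

lemma lb_q: "l (b - 1) < q" using H1[of "b - 1"] bc mq[of b] by simp
lemma mc_q: "m (Suc c) < q" using H2[of c] bc lq[of c] by simp

lemma q_Suc: "q = enat j ==> \<exists>i. j = Suc i" using lb_q by (cases j) (auto simp: zero_enat_def[symmetric])

lemma r_lt: "b < c ==> r = q - 1" and
 r_nlt: "~ b < c ==> r = first (%i. (i, p b i - 1) \<in># R b \<or> enat (Suc i) = q) (max (l (b - 1)) (m (b + 1)))"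
 by (simp_all only: r_def if_True if_False)

lemma r_ge: "l (b - 1) <= r" "m (Suc c) <= r"
proof -
 have "l (b - 1) <= r & m (Suc c) <= r"
 proof (cases "b < c")
  case True
  show ?thesis
  proof (cases q)
   case (enat j)
   then obtain i where i: "j = Suc i" using q_Suc by blast
   hence "r = enat i" using r_lt[OF True] enat by (simp add: one_enat_def)
   thus ?thesis using lb_q mc_q enat i by (cases "l (b-1)"; cases "m (Suc c)") auto
  next
   case infinity thus ?thesis using r_lt[OF True] by simp
  qed
 next
  case False
  hence "b = c" using bc by simp
  moreover have "max (l (b - 1)) (m (b + 1)) <= r" unfolding r_nlt[OF False] by (rule first_ge)
  ultimately show ?thesis by simp
 qed
 thus "l (b - 1) <= r" "m (Suc c) <= r" by auto
qed

lemma r_le: "q = enat (Suc j) ==> r <= enat j"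
proof -
 assume q: "q = enat (Suc j)"
 show ?thesis
 proof (cases "b < c")
  case True thus ?thesis using r_lt q by (simp add: one_enat_def)
 next
  case False
  hence bc': "b = c" using bc by simp
  have "max (l (b - 1)) (m (b + 1)) <= enat j" using lb_q mc_q q bc' by (cases "l (b-1)"; cases "m (Suc c)") auto
  thus ?thesis unfolding r_nlt[OF False] by (rule first_le) (simp add: q)
 qed
qed

lemma r_q: "r <= q" using r_le q_Suc by (cases q) (force intro: order_trans)+

lemma r_less: "r = enat i ==> enat i < q" using r_le q_Suc by (cases q) (fastforce)+

definition p1 where "p1 = upd N p l"
definition R1 where "R1 = rm N R l p p1"

lemma p1_eq: "1 <= a ==> a <= N ==> p1 a i = p a i + 2 * chi (l a) i - chi (l (a - 1)) i - chi (l (Suc a)) i" by (simp add: p1_def upd_def)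

lemma p1_below: "1 <= a ==> a <= N ==> enat i < l (a - 1) ==> p1 a i = p a i" using l_mono[of "a-1" a] l_mono[of a "Suc a"] by (auto simp: p1_eq)

lemma p1_above: "1 <= a ==> a <= N ==> l (Suc a) <= enat i ==> p1 a i = p a i" using l_mono[of "a-1" a] l_mono[of a "Suc a"] by (auto simp: p1_eq)

context
 fixes m' :: "nat => enat"
 assumes m'N: "m' (Suc N) = m (Suc N)"
  and m': "!!a. a <= N ==> m' a = first (sing p1 R1 a) (m' (Suc a))"
begin

text \<open>Right of the plateau \<open>m\<close> stays below \<open>l\<close> at the previous node,
  and the removal of \<open>l\<close> leaves the vacancy numbers at such lengths unchanged.\<close>

lemma m'_above: "c < a ==> a <= Suc N ==> m' a = m a"
proof (rule inc_induct[of a "Suc N" "%a. m' a = m a"])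
 fix n assume n: "c < a" "a <= n" "n < Suc N" "m' (Suc n) = m (Suc n)"
 have ln: "m n < l (n - 1)" using H2[of "n - 1"] n by auto
 have ln': "l (n - 1) <= l n" using l_mono[of "n-1" n] n by auto
 have "first (sing p1 R1 n) (m (Suc n)) = m n"
 proof (rule first_eqI)
  show "m (Suc n) <= m n" using m_mono[of n "Suc n"] n by auto
  fix i
  { assume i: "m n = enat i"
   have "p1 n i = p n i" using p1_below[of n i] n ln i by auto
   moreover have "sing p R n i" using m_sing[of n i] i n by auto
   ultimately show "sing p1 R1 n i" unfolding R1_def by (intro sing_rm_old) (use ln ln' i in \<open>auto simp: sing_def\<close>) }
  assume i: "m (Suc n) <= enat i" "sing p1 R1 n i"
  show "m n <= enat i"
  proof (rule ccontr)
   assume c: "~ m n <= enat i"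
   hence "enat i < l (n - 1)" using ln by auto
   hence pp: "p1 n i = p n i" using p1_below[of n i] n by auto
   have "l n = enat (Suc i) \<or> (i, p1 n i) \<in># R n" using sing_rm_cases[OF valid i(2)[unfolded R1_def]] by auto
   thus False
   proof
    assume "l n = enat (Suc i)"
    hence "l (n - 1) <= enat (Suc i)" using ln' by simp
    moreover have "enat (Suc i) <= m n" using c by (cases "m n") auto
    ultimately show False using ln by simp
   next
    assume "(i, p1 n i) \<in># R n"
    hence "sing p R n i" using pp by (simp add: sing_def)
    thus False using c first_le[OF i(1)] m[of n] n by auto
   qed
  qed
 qed
 thus "m' n = m n" using m'[of n] n by auto
qed (use m'N in auto)

text \<open>At c no string shorter than q was singular for \<open>p\<close> within reach of
  \<open>m\<close>. A hit below q therefore comes from the shortened string or from a vacancy number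
  that dropped, and a drop needs \<open>l (c - 1)\<close> below q, that is b = c. In a longer
  plateau each further node has its own shortened string at q - 1.\<close>

lemma m'_mid: "b <= a ==> a <= c ==> m' a = r"
proof (rule inc_induct[of a c "%a. m' a = r"])
 assume a: "b <= a" "a <= c"
 have mc: "m' (Suc c) = m (Suc c)" using m'_above[of "Suc c"] bc by auto
 have lc: "l c = q" "m c = q" using lq mq bc by auto
 have "first (sing p1 R1 c) (m (Suc c)) = r"
 proof (rule first_eqI)
  show "m (Suc c) <= r" by (rule r_ge)
  fix i
  have ge1: "1 <= i" if "m (Suc c) <= enat i" using order_trans[OF m_pos[of "Suc c"] that] bc by (simp add: one_enat_def)
  { assume i: "r = enat i"
   show "sing p1 R1 c i"
   proof (cases "q = enat (Suc i)")
    case True thus ?thesis unfolding R1_def by (intro sing_rm_new) (use lc bc ge1 r_ge i in auto)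
   next
    case False
    have "b = c"
    proof (rule ccontr)
     assume "b ~= c"
     hence "b < c" using bc by simp
     hence "q - 1 = enat i" using i by (simp add: r_def)
     hence "q = enat (Suc i)" using q_Suc by (cases q) (fastforce simp: one_enat_def)+
     thus False using False by simp
    qed
    hence rd: "r = first (%i. (i, p b i - 1) \<in># R b \<or> enat (Suc i) = q) (max (l (b - 1)) (m (b + 1)))" using r_nlt by simp
    have mem: "(i, p b i - 1) \<in># R b" using first_sat[OF rd[symmetric, unfolded i]] False by auto
    have iq: "enat i < q" using r_less[OF i] .
    have "l (Suc c) \<ge> q" using l_mono[of c "Suc c"] lc bc by auto
    hence "p1 c i = p c i - 1" using r_ge(1) i lc iq \<open>b = c\<close> bc by (auto simp: p1_eq)
    thus ?thesis unfolding R1_def by (intro sing_rm_old) (use mem \<open>b = c\<close> lc iq in auto)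
   qed }
  assume i: "m (Suc c) <= enat i" "sing p1 R1 c i"
  show "r <= enat i"
  proof (cases "enat i < q")
   case False thus ?thesis using r_q by auto
  next
   case True
   have "l c = enat (Suc i) \<or> (i, p1 c i) \<in># R c" using sing_rm_cases[OF valid i(2)[unfolded R1_def]] by auto
   thus ?thesis
   proof
    assume "l c = enat (Suc i)" thus ?thesis using r_le lc by auto
   next
    assume mem: "(i, p1 c i) \<in># R c"
    have nS: "~ sing p R c i" using True first_le[OF i(1), of "sing p R c"] m[of c] lc bc by auto
    have lcS: "enat i < l c" "enat i < l (Suc c)" using True lc l_mono[of c "Suc c"] bc by auto
    show ?thesis
    proof (cases "l (c - 1) <= enat i")
     case False
     hence "p1 c i = p c i" using p1_below[of c i] bc by auto
     thus ?thesis using mem nS by (auto simp: sing_def)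
    next
     case le: True
     have "b = c"
     proof (rule ccontr)
      assume "b ~= c" hence "l (c - 1) = q" using lq[of "c-1"] bc by auto
      thus False using le True by auto
     qed
     have "p1 c i = p c i - 1" using le lcS bc by (simp add: p1_eq)
     moreover have "~ b < c" "c - 1 = b - 1" "c + 1 = b + 1" using \<open>b = c\<close> by auto
     ultimately show ?thesis unfolding r_nlt[OF \<open>~ b < c\<close>] using mem \<open>b = c\<close> i le by (intro first_le) auto
    qed
   qed
  qed
 qed
 thus "m' c = r" using m'[of c] mc bc by auto
next
 fix n assume n: "b <= a" "a <= c" "a <= n" "n < c" "m' (Suc n) = r"
 have ln: "l n = q" using lq n by auto
 have "first (sing p1 R1 n) r = r"
 proof (rule first_eqI)
  fix i assume i: "r = enat i"
  have "1 <= i" using order_trans[OF m_pos[of "Suc c"] r_ge(2)] i bc by (simp add: one_enat_def)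
  moreover have "q = enat (Suc i)"
  proof -
   have "q - 1 = enat i" using r_lt i n by auto
   thus ?thesis using q_Suc by (cases q) (fastforce simp: one_enat_def)+
  qed
  ultimately show "sing p1 R1 n i" unfolding R1_def by (intro sing_rm_new) (use ln n bc in auto)
 qed auto
 thus "m' n = r" using m'[of n] n bc by auto
qed

text \<open>At the first node left of the plateau the search now starts from r, possibly lower than
  the former start q. Nothing is found in between: there \<open>p1\<close> exceeds \<open>p\<close>
  by one, while riggings are bounded by \<open>p\<close>.\<close>

lemma m'_below: "a < b ==> m' a = m a"
proof (rule inc_induct[of a "b - 1" "%a. m' a = m a"])
 have *: "m' n = m n" if n: "n < b" and st: "m' (Suc n) = m (Suc n) \<or> (Suc n = b & m' (Suc n) = r)" for n
 proof -
  have ln: "l n < m (Suc n)" using H1 n by auto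
  have nN: "n <= N" using n bc by auto
  have le: "m' (Suc n) <= m (Suc n)" "l n <= m' (Suc n)" using st r_q mq[of b] bc ln r_ge(1) by auto
  have eq: "p1 n i = p n i" if "1 <= n" "m (Suc n) <= enat i" for i
  proof -
   have "l (Suc n) <= m (Suc n)"
   proof (cases "Suc n = b")
    case True thus ?thesis using lq[of b] mq[of b] bc by auto
   next
    case False
    hence "l (Suc n) < m (Suc (Suc n))" using H1[of "Suc n"] n by auto
    also have "\<dots> <= m (Suc n)" using m_mono[of "Suc n" "Suc (Suc n)"] n bc by auto
    finally show ?thesis by simp
   qed
   thus ?thesis using p1_above[of n i] that nN by auto
  qed
  have "first (sing p1 R1 n) (m' (Suc n)) = m n"
  proof (rule first_eqI)
   show "m' (Suc n) <= m n" using m_mono[of n "Suc n"] le nN by auto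
   fix i
   { assume i: "m n = enat i"
    have S: "sing p R n i" using m_sing[of n i] i nN by auto
    hence n1: "1 <= n" using valid by (auto simp: sing_def valid_def)
    have mi: "m (Suc n) <= enat i" using i m_mono[of n "Suc n"] nN by auto
    hence "p1 n i = p n i" using eq n1 by auto
    thus "sing p1 R1 n i" unfolding R1_def by (intro sing_rm_old) (use S ln mi in \<open>auto simp: sing_def\<close>) }
   assume i: "m' (Suc n) <= enat i" "sing p1 R1 n i"
   have n1: "1 <= n" using i(2) valid unfolding sing_def R1_def rm_def by (auto simp: valid_def split: if_splits)
   have "l n = enat (Suc i) \<or> (i, p1 n i) \<in># R n" using sing_rm_cases[OF valid i(2)[unfolded R1_def]] by auto
   moreover have "l n ~= enat (Suc i)" using le(2) i(1) order_trans by fastforce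
   ultimately have mem: "(i, p1 n i) \<in># R n" by simp
   show "m n <= enat i"
   proof (cases "m (Suc n) <= enat i")
    case True
    hence "sing p R n i" using eq[of i] n1 mem by (simp add: sing_def)
    thus ?thesis using first_le[OF True] m[of n] nN by auto
   next
    case False
    hence "Suc n = b" "m (Suc n) = q" using st i(1) mq[of b] bc by auto
    hence "enat i < l (Suc n)" using False lq[of b] bc by auto
    moreover have "l n <= enat i" using le i by auto
    moreover have "l (n - 1) <= l n" using l_mono[of "n-1" n] nN by auto
    ultimately have "p1 n i = p n i + 1" using n1 nN by (auto simp: p1_eq)
    thus ?thesis using valid_le[OF valid mem] by simp
   qed
  qed
  thus ?thesis using m'[of n] nN by auto
 qed
 assume "a < b"
 thus "a <= b - 1" by simp
 show "m' (b - 1) = m (b - 1)" using *[of "b - 1"] m'_mid[of b] bc by auto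
 fix n assume "a <= n" "n < b - 1" "m' (Suc n) = m (Suc n)"
 thus "m' n = m n" using *[of n] by auto
qed

end

end

section \<open>The two orders of removal give the same state\<close>

lemma two_removals:
 assumes "x \<in># A" "y \<in># A" "x ~= y"
 shows "A - {#x#} + U - {#y#} + V = A - {#y#} + V - {#x#} + U"
proof -
 obtain A' where A: "A = add_mset x A'" using assms(1) by (metis multi_member_split)
 hence "y \<in># A'" using assms by auto
 then obtain B where "A' = add_mset y B" by (metis multi_member_split)
 thus ?thesis using A by simp
qed

context crossing
begin

definition p1' where "p1' = upd N p m"
definition R1' where "R1' = rm N R m p p1'"

definition commuting :: "(nat => enat) => (nat => enat) => bool" where
 "commuting m' l' \<longleftrightarrow> m' (Suc N) = m (Suc N) & (\<forall>a\<le>N. m' a = first (sing p1 R1 a) (m' (Suc a))) &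
   l' 0 = l 0 & (\<forall>a\<le>N. l' (Suc a) = first (sing p1' R1' (Suc a)) (l' a))"

end

context crossing
begin

interpretation f: crossing N "N + 1 - c" "N + 1 - b" "flip N p" "flip N R" "flip N m" "flip N l" q by (rule flipped)

lemma f_p1: "f.p1 = flip N p1'" by (simp add: f.p1_def p1'_def flip_upd')
lemma f_R1: "f.R1 = flip N R1'" by (simp add: f.R1_def R1'_def flip_rm f_p1)

lemma f_r: "f.r = r"
proof (cases "b < c")
 case True
 hence "N + 1 - c < N + 1 - b" using bc by auto
 thus ?thesis using f.r_lt r_lt by simp
next
 case False
 hence *: "~ N + 1 - c < N + 1 - b" "b = c" using bc by auto
 have "N + 1 - (N + 1 - c) = b" "N + 1 - (N + 1 - c - 1) = b + 1" "N + 1 - (N + 1 - c + 1) = b - 1" using * bc by auto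
 thus ?thesis unfolding f.r_nlt[OF *(1)] r_nlt[OF False] by (simp add: flip_def max.commute)
qed

lemma f_p1': "f.p1' = flip N p1" by (simp add: f.p1'_def p1_def flip_upd')
lemma f_R1': "f.R1' = flip N R1" by (simp add: f.R1'_def R1_def flip_rm f_p1')

lemma p1'_eq: "1 <= a ==> a <= N ==> p1' a i = p a i + 2 * chi (m a) i - chi (m (a - 1)) i - chi (m (Suc a)) i" by (simp add: p1'_def upd_def)

lemma f_commuting: "commuting m' l' ==> f.commuting (flip N l') (flip N m')"
by (simp add: f.commuting_def f_p1 f_R1 f_p1' f_R1' commuting_def flip_def flip_sing Suc_diff_le)

lemma m'_eq:
 assumes "commuting m' l'" "a <= Suc N"
 shows "m' a = (if b <= a & a <= c then r else m a)"
proof -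
 have "m' (Suc N) = m (Suc N)" "!!a. a <= N ==> m' a = first (sing p1 R1 a) (m' (Suc a))" using assms by (auto simp: commuting_def)
 note * = m'_above[OF this] m'_mid[OF this] m'_below[OF this]
 show ?thesis using *[of a] assms(2) by auto
qed

lemma l'_eq:
 assumes "commuting m' l'" "a <= Suc N"
 shows "l' a = (if b <= a & a <= c then r else l a)"
proof -
 have *: "flip N l' (Suc N) = flip N l (Suc N)"
  "!!a. a <= N ==> flip N l' a = first (sing f.p1 f.R1 a) (flip N l' (Suc a))" using f_commuting[OF assms(1)] by (auto simp: f.commuting_def)
 note ** = f.m'_above[OF *] f.m'_mid[OF *] f.m'_below[OF *]
 have e: "flip N l' (N + 1 - a) = l' a" "flip N l (N + 1 - a) = l a" using assms(2) by (auto simp: flip_def)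
 show ?thesis
 proof (cases "b <= a & a <= c")
  case True
  hence "N + 1 - c <= N + 1 - a" "N + 1 - a <= N + 1 - b" by auto
  thus ?thesis using **(2)[of "N + 1 - a"] True e f_r by simp
 next
  case False
  hence "N + 1 - b < N + 1 - a \<or> N + 1 - a < N + 1 - c" using bc by auto
  hence "flip N l' (N + 1 - a) = flip N l (N + 1 - a)" using **(1,3)[of "N + 1 - a"] by auto
  thus ?thesis using False e by auto
 qed
qed

text \<open>At every node the pair \<open>l\<close>, \<open>m'\<close> equals the pair
  \<open>m\<close>, \<open>l'\<close> up to order: off the plateau the second chains equal the first
  ones, and on it they are q and r in both orders. Vacancy numbers depend only on the sum over the
  pair.\<close>

lemma p2_eq:
 assumes "commuting m' l'"
 shows "upd N p1 m' = upd N p1' l'"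
proof (intro ext)
 fix a i
 have *: "chi (l e) i + chi (m' e) i = chi (m e) i + chi (l' e) i" if "e <= Suc N" for e
  using m'_eq[OF assms that] l'_eq[OF assms that] lq[of e] mq[of e] by auto
 show "upd N p1 m' a i = upd N p1' l' a i"
 proof (cases "1 <= a & a <= N")
  case True
  hence "a - 1 <= Suc N" "a <= Suc N" "Suc a <= Suc N" by auto
  note *[OF this(1)] *[OF this(2)] *[OF this(3)]
  moreover have "upd N p1 m' a i = p a i + 2 * (chi (l a) i + chi (m' a) i)
    - (chi (l (a - 1)) i + chi (m' (a - 1)) i) - (chi (l (Suc a)) i + chi (m' (Suc a)) i)" using True by (simp add: upd_def p1_eq)
  moreover have "upd N p1' l' a i = p a i + 2 * (chi (m a) i + chi (l' a) i)
    - (chi (m (a - 1)) i + chi (l' (a - 1)) i) - (chi (m (Suc a)) i + chi (l' (Suc a)) i)" using True by (simp add: upd_def p1'_eq)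
  ultimately show ?thesis by simp
 qed (auto simp: upd_def p1_def p1'_def)
qed

text \<open>Equality of the final vacancy numbers is not enough, since riggings are attached at
  intermediate stages. Left of the plateau the two selected strings have different lengths, and the
  facts \<open>1\<close> to \<open>4\<close> say that the vacancy number used for each string does
  not feel the other removal.\<close>

lemma node_below:
 assumes c: "commuting m' l'" and a: "1 <= a" "a < b"
 shows "rm N R1 m' p1 (upd N p1 m') a = rm N R1' l' p1' (upd N p1' l') a"
proof -
 have aN: "a <= N" using a bc by auto
 have m'a: "m' a = m a" "l' a = l a" using m'_eq[OF c, of a] l'_eq[OF c, of a] a aN by auto
 have ls: "l (a - 1) <= l a" "l a <= l (Suc a)" using l_mono aN by auto
 have ms: "m (Suc a) <= m a" "m a <= m (a - 1)" using m_mono aN by auto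
 have lm: "l a < m (Suc a)" using H1 a by auto
 have Sa: "Suc a < b & m' (Suc a) = m (Suc a) & l' (Suc a) = l (Suc a) \<or> Suc a = b & m' (Suc a) = r & l' (Suc a) = r"
  using m'_eq[OF c, of "Suc a"] l'_eq[OF c, of "Suc a"] a bc by auto
 have lSa: "l (Suc a) <= m (Suc a)"
 proof (cases "Suc a < b")
  case True thus ?thesis using H1[of "Suc a"] m_mono[of "Suc a" "Suc (Suc a)"] bc by auto
 next
  case False thus ?thesis using Sa lq[of b] mq[of b] bc by auto
 qed
 have 1: "p1 a i = p a i" if "m a = enat i" for i using p1_above[of a i] a aN ms lSa that by auto
 have 2: "p1' a i = p a i" if "l a = enat i" for i using that lm ms p1'_eq a aN by simp
 have 3: "upd N p1 m' a (i - 1) = p1 a (i - 1)" if "l a = enat i" "1 <= i" for i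
 proof -
  have e: "enat (i - 1) < enat i" using that by simp
  have "l a <= m' (Suc a)" using Sa lm r_ge(1) by fastforce
  hence "enat (i - 1) < m' (Suc a)" using e that(1) by (metis order_less_le_trans)
  moreover have "m' (Suc a) <= m' a" using m'_eq[OF c, of a] Sa ms r_q mq[of b] bc by auto
  moreover have "m' a <= m' (a - 1)" using m'_eq[OF c, of a] m'_eq[OF c, of "a-1"] ms a aN by auto
  ultimately have "enat (i - 1) < m' (Suc a)" "enat (i - 1) < m' a" "enat (i - 1) < m' (a - 1)" by auto
  thus ?thesis by (simp add: upd_def)
 qed
 have 4: "upd N p1' l' a (i - 1) = p1' a (i - 1)" if "m a = enat i" "1 <= i" for i
 proof -
  have "l' (Suc a) <= enat (i - 1)"
  proof (cases "Suc a < b")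
   case True
   hence "l' (Suc a) < m (Suc (Suc a))" using H1[of "Suc a"] Sa by auto
   also have "\<dots> <= m a" using m_mono[of a "Suc (Suc a)"] True bc by auto
   finally show ?thesis using that by (cases "l' (Suc a)") auto
  next
   case False
   hence "l' (Suc a) = r" "q <= m a" using Sa ms mq[of b] bc by auto
   thus ?thesis using that q_Suc r_le by (cases q) (fastforce intro: order_trans)+
  qed
  moreover have "l' a <= l' (Suc a)" using Sa m'a ls r_ge(1) by auto
  moreover have "l' (a - 1) <= l' a" using l'_eq[OF c, of "a-1"] m'a ls a aN by auto
  ultimately have "l' (Suc a) <= enat (i - 1)" "l' a <= enat (i - 1)" "l' (a - 1) <= enat (i - 1)" by auto
  thus ?thesis by (simp add: upd_def)
 qed
 have p2: "upd N p1' l' = upd N p1 m'" using p2_eq[OF c] by simp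
 obtain i where i: "l a = enat i" using lm by (cases "l a") auto
 have S: "(i, p a i) \<in># R a" "1 <= i" using l_sing[of a i] i a aN valid_pos[OF valid] by (auto simp: sing_def)
 show ?thesis
 proof (cases "m a")
  case infinity
  thus ?thesis using i 2[OF i] 3[OF i S(2)] p2 by (simp add: rm_def m'a R1_def R1'_def)
 next
  case (enat j)
  have T: "(j, p a j) \<in># R a" "1 <= j" using m_sing[of a j] enat aN valid_pos[OF valid] by (auto simp: sing_def)
  have ij: "i ~= j" using lm ms i enat by auto
  have "R a - {#(i, p a i)#} + U - {#(j, p a j)#} + V = R a - {#(j, p a j)#} + V - {#(i, p a i)#} + U" for U V
   by (rule two_removals) (use S T ij in auto)
  note this[of "if 1 < i then {#(i - 1, p1 a (i - 1))#} else {#}" "if 1 < j then {#(j - 1, p1' a (j - 1))#} else {#}"]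
  thus ?thesis using i enat 1[OF enat] 2[OF i] 3[OF i S(2)] 4[OF enat T(2)] a aN p2
   by (cases "1 < i"; cases "1 < j") (simp_all add: rm_def m'a R1_def R1'_def)
 qed
qed

text \<open>Both orders select q and then r. If r = q - 1, the string shortened first is shortened
  again; otherwise b = c for finite r, and \<open>p1\<close> and \<open>p1'\<close> agree at the
  lengths between r and q that matter.\<close>

lemma node_mid:
 assumes c: "commuting m' l'" and a: "b <= a" "a <= c"
 shows "rm N R1 m' p1 (upd N p1 m') a = rm N R1' l' p1' (upd N p1' l') a"
proof -
 have aN: "1 <= a" "a <= N" using a bc by auto
 have e: "m' a = r" "l' a = r" "l a = q" "m a = q" using m'_eq[OF c, of a] l'_eq[OF c, of a] lq[OF a] mq[OF a] a aN by auto
 have p2: "upd N p1' l' = upd N p1 m'" using p2_eq[OF c] by simp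
 have pp: "p1 a i = p1' a i" if "b = c" "enat i < q" "r <= enat i" for i
 using a that r_ge l_mono[of a "Suc a"] m_mono[of "a - 1" a] e aN by (simp add: p1_eq p1'_eq)
 show ?thesis
 proof (cases q)
  case infinity
  show ?thesis
  proof (cases r)
   case infinity': infinity
   show ?thesis using e infinity infinity' by (simp add: rm_def R1_def R1'_def)
  next
   case (enat i)
   hence "~ b < c" using r_lt infinity by auto
   hence "p1 a i = p1' a i" using pp[of i] infinity enat bc by auto
   thus ?thesis using e infinity enat p2 by (simp add: rm_def R1_def R1'_def)
  qed
 next
  case (enat j')
  then obtain j where j: "q = enat (Suc j)" using q_Suc by blast
  obtain i where i: "r = enat i" "i <= j" using r_le[OF j] by (cases r) auto
  have "1 <= i" using order_trans[OF m_pos[of "Suc c"] r_ge(2)] i bc by (simp add: one_enat_def)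
  show ?thesis
  proof (cases "i = j")
   case True
   thus ?thesis using e j i p2 \<open>1 <= i\<close> by (simp add: rm_def R1_def R1'_def)
  next
   case False
   hence "~ b < c" using r_lt i j by (auto simp: one_enat_def)
   hence "p1 a i = p1' a i" "p1 a j = p1' a j" using pp[of i] pp[of j] i j bc by auto
   thus ?thesis using e j i aN p2 by (simp add: rm_def R1_def R1'_def)
  qed
 qed
qed

end

context crossing
begin

interpretation f: crossing N "N + 1 - c" "N + 1 - b" "flip N p" "flip N R" "flip N m" "flip N l" q by (rule flipped)

theorem commuting_final:
 assumes c: "commuting m' l'"
 shows "upd N p1 m' = upd N p1' l'"
  "rm N R1 m' p1 (upd N p1 m') = rm N R1' l' p1' (upd N p1' l')"
proof -
 show "upd N p1 m' = upd N p1' l'" by (rule p2_eq[OF c])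
 show "rm N R1 m' p1 (upd N p1 m') = rm N R1' l' p1' (upd N p1' l')"
 proof
  fix a
  consider "1 <= a & a < b" | "b <= a & a <= c" | "c < a & a <= N" | "~ (1 <= a & a <= N)" by linarith
  thus "rm N R1 m' p1 (upd N p1 m') a = rm N R1' l' p1' (upd N p1' l') a"
  proof cases
   \<comment> \<open>Nodes right of the plateau lie left of it in the flipped picture.\<close>
   case 3
   hence "1 <= N + 1 - a" "N + 1 - a < N + 1 - c" "N + 1 - (N + 1 - a) = a" by auto
   from f.node_below[OF f_commuting[OF c] this(1,2)] this(3)
   show ?thesis unfolding f_p1 f_R1 f_p1' f_R1' flip_upd'[symmetric] flip_rm[symmetric] by (simp add: flip_def)
  next
   case 4 thus ?thesis by (auto simp: rm_def R1_def R1'_def)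
  qed (use node_below[OF c] node_mid[OF c] in auto)
 qed
qed

end

section \<open>Upward and downward chains as operations on states\<close>

fun up :: "nat => vacancies => rigged => nat => enat" where
 "up k p R 0 = enat k"
| "up k p R (Suc a) = first (sing p R (Suc a)) (up k p R a)"

text \<open>Defined through the flip, so that facts on downward chains are mirror images of facts on
  upward ones; \<open>dn_rec\<close> recovers the recursion.\<close>

definition dn :: "nat => nat => vacancies => rigged => nat => enat" where
 "dn N k p R = flip N (up k (flip N p) (flip N R))"

type_synonym state = "vacancies \<times> rigged"

fun stp :: "nat => (nat => enat) => state => state" where
 "stp N s (p, R) = (upd N p s, rm N R s p (upd N p s))"

fun flipS :: "nat => state => state" where
 "flipS N (p, R) = (flip N p, flip N R)"

definition upS :: "nat => nat => state => state" where
 "upS N k X = stp N (up k (fst X) (snd X)) X"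

definition dnS :: "nat => nat => state => state" where
 "dnS N k X = stp N (dn N k (fst X) (snd X)) X"

definition letU :: "(nat => enat) => nat" where
 "letU s = (LEAST a. s a = \<infinity>)"

text \<open>An upward chain is finite exactly below its letter, a downward chain exactly from its
  letter on. The letters range over 1 to N + 1, which the flip reverses by a -> N + 2 - a.\<close>

definition letD :: "nat => (nat => enat) => nat" where
 "letD N s = N + 2 - letU (flip N s)"

definition validS :: "nat => state => bool" where
 "validS N X = valid N (fst X) (snd X)"

lemma dn_top [simp]: "dn N k p R (Suc N) = enat k" by (simp add: dn_def flip_def)

lemma dn_rec:
 assumes "a <= N"
 shows "dn N k p R a = first (sing p R a) (dn N k p R (Suc a))"
proof -
 have "N + 1 - a = Suc (N - a)" using assms by simp
 hence "dn N k p R a = first (sing (flip N p) (flip N R) (Suc (N - a))) (up k (flip N p) (flip N R) (N - a))"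
  by (simp add: dn_def flip_def[of N "up k (flip N p) (flip N R)"])
 also have "N + 1 - Suc (N - a) = a" using assms by simp
 hence "sing (flip N p) (flip N R) (Suc (N - a)) = sing p R a" by (simp add: flip_sing)
 finally show ?thesis by (simp add: dn_def flip_def[of N "up k (flip N p) (flip N R)"])
qed

lemma sing_off: "valid N p R ==> ~ (1 <= a & a <= N) ==> sing p R a = (%_. False)" by (auto simp: sing_def valid_def)

lemma up_end: "valid N p R ==> up k p R (Suc N) = \<infinity>" by (simp add: sing_off)

lemma dn_0: "valid N p R ==> dn N k p R 0 = \<infinity>" by (subst dn_rec) (auto simp: sing_off)

lemma up_mono: "a <= a' ==> up k p R a <= up k p R a'"
proof (induction a' rule: dec_induct)
 case (step n) thus ?case using first_ge by (auto intro: order_trans)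
qed simp

lemma dn_mono: "a <= a' ==> a' <= Suc N ==> dn N k p R a' <= dn N k p R a"
proof (induction a' rule: dec_induct)
 case (step n) thus ?case using first_ge dn_rec[of n N k p R] by (auto intro: order_trans)
qed simp

lemma up_sing: "up k p R (Suc a) = enat i ==> sing p R (Suc a) i" using first_sat[of "sing p R (Suc a)"] by simp

lemma up_sing': "1 <= a ==> up k p R a = enat i ==> sing p R a i" using up_sing by (cases a) auto

lemma dn_sing: "a <= N ==> dn N k p R a = enat i ==> sing p R a i" using first_sat[of "sing p R a"] dn_rec[of a N k p R] by simp

lemma up_ge: "enat k <= up k p R a" using up_mono[of 0 a k p R] by simp

lemma dn_ge: "enat k <= dn N k p R a" using dn_mono[of a "Suc N" N k p R] by (fastforce simp: dn_def flip_def)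

lemma flip_dn:
 assumes "valid N p R" "a <= Suc N"
 shows "dn N k (flip N p) (flip N R) a = flip N (up k p R) a" by (simp add: dn_def flip_flip_p[OF assms(1)] flip_flip_R[OF assms(1)])

lemma stp_cong: "(!!a. a <= Suc N ==> s a = t a) ==> stp N s X = stp N t X"
proof -
 assume h: "!!a. a <= Suc N ==> s a = t a"
 have "upd N p s = upd N p t" for p by (auto simp: upd_def fun_eq_iff h)
 moreover have "rm N R s p p' = rm N R t p p'" for R p p' by (auto simp: rm_def h)
 ultimately show ?thesis by (cases X) simp
qed

lemma flipS_stp: "flipS N (stp N s X) = stp N (flip N s) (flipS N X)" by (cases X) (simp add: flip_rm flip_upd')

lemma flipS_flipS: "validS N X ==> flipS N (flipS N X) = X" by (cases X) (simp add: validS_def flip_flip_p flip_flip_R)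

lemma flipS_upS: "validS N X ==> flipS N (upS N k X) = dnS N k (flipS N X)"
 by (cases X) (auto simp: upS_def dnS_def flipS_stp validS_def flip_dn simp del: stp.simps intro!: stp_cong)

lemma flipS_dnS: "validS N X ==> flipS N (dnS N k X) = upS N k (flipS N X)"
 by (cases X) (auto simp: upS_def dnS_def flipS_stp validS_def dn_def flip_flip simp del: stp.simps intro!: stp_cong)

lemma validS_flip: "validS N X ==> validS N (flipS N X)" by (cases X) (simp add: validS_def valid_flip)

text \<open>The vacancy number at node a drops only for lengths from \<open>l (a - 1)\<close> to
  below \<open>l a\<close>, and then by one. As \<open>l a\<close> is the first hit, no string of
  these lengths is singular, so every rigging there has room for the drop.\<close>

lemma valid_up:
 assumes v: "valid N p R" and k: "1 <= k"
 shows "valid N (upd N p (up k p R)) (rm N R (up k p R) p (upd N p (up k p R)))"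
proof -
 let ?l = "up k p R" let ?p = "upd N p ?l"
 { fix a i x assume m: "(i, x) \<in># rm N R ?l p ?p a"
  have "1 <= i & x <= ?p a i"
  proof (cases "(i, x) \<in># R a")
   case False
   thus ?thesis using m unfolding rm_def by (auto split: if_splits enat.splits dest: in_diffD)
  next
   case True
   hence a: "1 <= a" "a <= N" "1 <= i" "x <= p a i" using v by (auto simp: valid_def)
   have mono: "?l (a - 1) <= ?l a" "?l a <= ?l (Suc a)" using up_mono by (auto simp del: up.simps)
   show ?thesis
   proof (cases "?l (a - 1) <= enat i & enat i < ?l a")
    case t: True
    have "~ sing p R a i"
    proof
     assume "sing p R a i"
     hence "first (sing p R a) (?l (a - 1)) <= enat i" using t first_le by auto
     thus False using t a by (cases a) auto
    qed
    hence "x ~= p a i" using True by (auto simp: sing_def)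
    moreover have "enat i < ?l (Suc a)" using t mono by auto
    ultimately show ?thesis using a t by (simp add: upd_def)
   next
    case False
    thus ?thesis using a mono by (auto simp: upd_def chi_def)
   qed
  qed }
 moreover have "rm N R ?l p ?p a = {#} & ?p a = (%_. 0)" if "~ (1 <= a & a <= N)" for a using v that by (auto simp: valid_def rm_def upd_def)
 ultimately show ?thesis unfolding valid_def by blast
qed

lemma validS_upS: "validS N X ==> 1 <= k ==> validS N (upS N k X)" using valid_up by (cases X) (simp add: validS_def upS_def)

lemma validS_dnS: "validS N X ==> 1 <= k ==> validS N (dnS N k X)"
proof -
 assume a: "validS N X" "1 <= k"
 have "validS N (flipS N (upS N k (flipS N X)))" by (intro validS_flip validS_upS a)
 thus ?thesis using flipS_upS[OF validS_flip[OF a(1)]] flipS_flipS[OF a(1)] by simp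
qed

lemma valid_dn:
 assumes v: "valid N p R" and k: "1 <= k"
 shows "valid N (upd N p (dn N k p R)) (rm N R (dn N k p R) p (upd N p (dn N k p R)))"
 using validS_dnS[of N "(p, R)" k] assms by (simp add: validS_def dnS_def)

lemma letU_eq: "(!!a. a < y ==> s a ~= \<infinity>) ==> s y = \<infinity> ==> letU s = y"
 unfolding letU_def by (rule Least_equality) (assumption, metis not_le_imp_less)

lemma letU_up:
 assumes "valid N p R"
 shows "1 <= letU (up k p R)" "letU (up k p R) <= Suc N" "up k p R a = \<infinity> \<longleftrightarrow> letU (up k p R) <= a"
proof -
 let ?l = "up k p R"
 have i: "?l (letU ?l) = \<infinity>" unfolding letU_def by (rule LeastI[of _ "Suc N"]) (rule up_end[OF assms])
 show "letU ?l <= Suc N" unfolding letU_def by (rule Least_le) (rule up_end[OF assms])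
 show "1 <= letU ?l" using i by (cases "letU ?l") auto
 show "?l a = \<infinity> \<longleftrightarrow> letU ?l <= a" using up_mono[of "letU ?l" a k p R] i Least_le by (fastforce simp: letU_def)
qed

lemma letD_dn:
 assumes v: "valid N p R"
 shows "1 <= letD N (dn N k p R)" "letD N (dn N k p R) <= Suc N"
  "a <= Suc N ==> dn N k p R a = \<infinity> \<longleftrightarrow> a < letD N (dn N k p R)"
proof -
 let ?u = "up k (flip N p) (flip N R)"
 note u = letU_up[OF valid_flip[OF v], of k]
 have 1: "flip N (dn N k p R) a = ?u a" if "a <= Suc N" for a using that by (simp add: dn_def flip_flip)
 have "letU (flip N (dn N k p R)) = letU ?u" by (rule letU_eq) (use 1 u(2) u(3) in \<open>auto\<close>)
 hence e: "letD N (dn N k p R) = N + 2 - letU ?u" by (simp add: letD_def)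
 show "1 <= letD N (dn N k p R)" "letD N (dn N k p R) <= Suc N" using e u by auto
 assume "a <= Suc N"
 hence "dn N k p R a = ?u (N + 1 - a)" by (simp add: dn_def flip_def)
 thus "dn N k p R a = \<infinity> \<longleftrightarrow> a < letD N (dn N k p R)" using u(3)[of "N + 1 - a"] e \<open>a <= Suc N\<close> by auto
qed

lemma letD_flip:
 assumes "valid N p R"
 shows "letD N (dn N k (flip N p) (flip N R)) = N + 2 - letU (up k p R)"
proof -
 have "letU (flip N (dn N k (flip N p) (flip N R))) = letU (up k p R)"
 proof (rule letU_eq)
  note u = letU_up[OF assms, of k]
  have *: "flip N (dn N k (flip N p) (flip N R)) a = up k p R a" if "a <= Suc N" for a
   using that by (simp add: dn_def flip_flip_p[OF assms] flip_flip_R[OF assms] flip_flip)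
  show "!!a. a < letU (up k p R) ==> flip N (dn N k (flip N p) (flip N R)) a ~= \<infinity>" using * u by simp
  show "flip N (dn N k (flip N p) (flip N R)) (letU (up k p R)) = \<infinity>" using * u by auto
 qed
 thus ?thesis by (simp add: letD_def)
qed

lemma letU_flip:
 assumes "valid N p R"
 shows "letU (up k (flip N p) (flip N R)) = N + 2 - letD N (dn N k p R)"
 using letD_flip[OF valid_flip[OF assms], of k] letU_up[OF valid_flip[OF assms], of k] by (simp add: flip_flip_p[OF assms] flip_flip_R[OF assms])

lemma up_stop:
 assumes "up k p R (a - 1) <= enat i" "1 <= a" "sing p R a i"
 shows "up k p R a <= enat i" using assms first_le by (cases a) auto

lemma dn_stop:
 assumes "dn N k p R (Suc a) <= enat i" "a <= N" "sing p R a i"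
 shows "dn N k p R a <= enat i" using assms first_le dn_rec[of a N k p R] by simp

text \<open>The two chains of a square meet: this fails only if the first chain passes below the start of the
 second one, and degenerates only if both are constant.\<close>

lemma ex_crossing:
 assumes v: "valid N p R" and k: "1 <= k" "k <= k'" and N: "1 <= N"
  and nF: "~ (k < k' & up k p R N <= enat k')"
  and nE: "~ (k = k' & (\<forall>a. 1 <= a & a <= N --> up k p R a = enat k & dn N k' p R a = enat k))"
 shows "\<exists>b c q. crossing N b c p R (up k p R) (dn N k' p R) q"
proof -
 let ?l = "up k p R" let ?m = "dn N k' p R"
 \<comment> \<open>If \<open>m\<close> passes above \<open>l\<close> at node a, then it did not take
   the singular string selected by \<open>l\<close>, so its search must have started beyond that
   string. \<open>f2\<close> is the mirror image.\<close>
 have f1: "?l a < ?m (Suc a)" if h: "?l a < ?m a" "1 <= a" "a <= N" for a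
 proof (rule ccontr)
  assume n: "~ ?l a < ?m (Suc a)"
  obtain i where i: "?l a = enat i" using h by (cases "?l a") auto
  have "?m a <= enat i" by (rule dn_stop) (use n i that up_sing' in auto)
  thus False using that i by simp
 qed
 have f2: "?m a < ?l (a - 1)" if h: "?m a < ?l a" "1 <= a" "a <= N" for a
 proof (rule ccontr)
  assume n: "~ ?m a < ?l (a - 1)"
  obtain i where i: "?m a = enat i" using h by (cases "?m a") auto
  have "?l a <= enat i" by (rule up_stop) (use n i that dn_sing in auto)
  thus False using that i by simp
 qed
 have l0: "?l 0 < ?m 0" using dn_0[OF v, of k'] by simp
 \<comment> \<open>\<open>m\<close> is infinite at node 0 and \<open>l\<close> at node N + 1, so
   \<open>l\<close> starts below \<open>m\<close> and cannot end there.\<close>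
 define b where "b = (LEAST a. ~ ?l a < ?m a)"
 have bx: "~ ?l (Suc N) < ?m (Suc N)" using up_end[OF v, of k] by simp
 have bn: "~ ?l b < ?m b" unfolding b_def by (rule LeastI) (rule bx)
 have bl: "?l a < ?m a" if "a < b" for a using that not_less_Least unfolding b_def by blast
 have b1: "1 <= b" using l0 bn by (cases b) auto
 have bN: "b <= N"
 proof (rule ccontr)
  assume "~ b <= N"
  hence "?l N < ?m N" using bl by auto
  hence "?l N < enat k'" using f1[of N] N by simp
  moreover have "enat k <= ?l N" by (rule up_ge)
  ultimately show False using nF by (metis enat_ord_simps(2) order_le_less_trans order_less_imp_le)
 qed
 have "?l b = ?m b"
 proof (rule ccontr)
  assume "?l b ~= ?m b"
  hence "?m b < ?l b" using bn by auto
  hence mb: "?m b < ?l (b - 1)" using f2 b1 bN by auto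
  show False
  proof (cases "b = 1")
   case True
   have "enat k <= ?m b" using dn_ge[of k' N p R b] k by (meson enat_ord_simps(1) order_trans)
   thus False using mb True by simp
  next
   case False
   hence "?l (b - 1) < ?m (Suc (b - 1))" using f1[of "b - 1"] bl b1 bN by auto
   thus False using mb b1 by simp
  qed
 qed
 define c where "c = (GREATEST a. a <= N & ?l a <= ?m a)"
 have c: "c <= N & ?l c <= ?m c" unfolding c_def by (rule GreatestI_nat[of _ b N]) (use bN \<open>?l b = ?m b\<close> in auto)
 have bc: "b <= c" unfolding c_def by (rule Greatest_le_nat[of _ b N]) (use bN \<open>?l b = ?m b\<close> in auto)
 have ca: "?m a < ?l a" if "c < a" "a <= N" for a
 proof -
  have "~ (a <= N & ?l a <= ?m a)" using that Greatest_le_nat[of "%a. a <= N & ?l a <= ?m a" a N] unfolding c_def by auto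
  thus ?thesis using that by auto
 qed
 have eqs: "?l a = ?l b & ?m a = ?l b" if "b <= a" "a <= c" for a
 proof -
  have "?l b <= ?l a" "?l a <= ?l c" using that up_mono by auto
  moreover have "?m a <= ?m b" "?m c <= ?m a" using that c dn_mono by auto
  ultimately show ?thesis using c \<open>?l b = ?m b\<close> by auto
 qed
 \<comment> \<open>\<open>H1\<close> at node 0 and \<open>H2\<close> at node N compare the chains
   with each other's starting lengths. This is what the two excluded cases would violate.\<close>
 have start: "enat k < ?m 1 & enat k' < ?l N"
 proof (cases "k < k'")
  case True
  thus ?thesis using nF dn_ge[of k' N p R 1] by (auto intro: less_le_trans[of _ "enat k'"])
 next
  case False
  hence kk: "k' = k" using k by simp
  show ?thesis
  proof (rule ccontr)
   assume "~ ?thesis"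
   then consider "?m 1 = enat k" | "?l N = enat k" using kk dn_ge[of k' N p R 1] up_ge[of k p R N] by force
   thus False
   proof cases
    case 1
    have m: "?m a = enat k" if "1 <= a" "a <= N" for a using dn_mono[of 1 a N k' p R] dn_ge[of k' N p R a] that 1 kk by auto
    have "?l a = enat k" if "a <= N" for a using that
    proof (induction a)
     case (Suc a)
     have "?l (Suc a) <= enat k" by (rule up_stop) (use Suc m[of "Suc a"] dn_sing[of "Suc a"] in auto)
     thus ?case using up_ge[of k p R "Suc a"] by simp
    qed simp
    thus False using nE m kk by auto
   next
    case 2
    have l: "?l a = enat k" if "a <= N" for a using up_mono[of a N k p R] up_ge[of k p R a] that 2 by auto
    have "?m a = enat k" if "1 <= a" "a <= Suc N" for a using that(2,1)
    proof (induction rule: inc_induct)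
     case (step n)
     have "?m n <= enat k" by (rule dn_stop) (use step l[of n] up_sing'[of n] in auto)
     thus ?case using dn_ge[of k' N p R n] kk by simp
    qed (simp add: kk)
    thus False using nE l kk by auto
   qed
  qed
 qed
 have "crossing N b c p R ?l ?m (?l b)"
 proof (unfold_locales, goal_cases)
  case 1 show ?case by (rule v)
 next case 2 show ?case by (rule b1)
 next case 3 show ?case by (rule bc)
 next case 4 show ?case using c by simp
 next case 5 show ?case using k by (simp add: one_enat_def)
 next case 6 show ?case using k by (simp add: one_enat_def)
 next case (7 a) show ?case by simp
 next case (8 a) thus ?case by (rule dn_rec)
 next case (9 a)
  show ?case
  proof (cases "a = 0")
   case False thus ?thesis using f1[of a] bl 9 bN by auto
  qed (use start in auto)
 next case (10 a)
  show ?case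
  proof (cases "a = N")
   case False thus ?thesis using f2[of "Suc a"] ca[of "Suc a"] 10 by auto
  qed (use start in auto)
 next case (11 a) thus ?case using eqs[of a] by simp
 next case (12 a) thus ?case using eqs[of a] by simp
 qed
 thus ?thesis by blast
qed

definition uletter :: "nat => state => nat" where
 "uletter k X = letU (up k (fst X) (snd X))"

definition dletter :: "nat => nat => state => nat" where
 "dletter N k X = letD N (dn N k (fst X) (snd X))"

lemma uletter_eqI:
 assumes "validS N X" "y <= Suc N" "1 <= y" "up k (fst X) (snd X) (y - 1) ~= \<infinity>" "up k (fst X) (snd X) y = \<infinity>"
 shows "uletter k X = y" using letU_up(3)[of N "fst X" "snd X" k y] letU_up(3)[of N "fst X" "snd X" k "y - 1"] assms
 by (auto simp: validS_def uletter_def)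

lemma dletter_eqI:
 assumes "validS N X" "z <= Suc N" "1 <= z" "dn N k (fst X) (snd X) (z - 1) = \<infinity>" "dn N k (fst X) (snd X) z ~= \<infinity>"
 shows "dletter N k X = z" using letD_dn(3)[of N "fst X" "snd X" z k] letD_dn(3)[of N "fst X" "snd X" "z - 1" k] assms
 by (auto simp: validS_def dletter_def)

lemma up_fin: "validS N X ==> up k (fst X) (snd X) a ~= \<infinity> \<longleftrightarrow> a < uletter k X"
 using letU_up(3)[of N "fst X" "snd X" k a] by (auto simp: validS_def uletter_def)

lemma dn_fin: "validS N X ==> a <= Suc N ==> dn N k (fst X) (snd X) a ~= \<infinity> \<longleftrightarrow> dletter N k X <= a"
 using letD_dn(3)[of N "fst X" "snd X" a k] by (auto simp: validS_def dletter_def)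

lemma uletter_bounds: "validS N X ==> 1 <= uletter k X & uletter k X <= Suc N" using letU_up(1,2) by (auto simp: validS_def uletter_def)

lemma dletter_bounds: "validS N X ==> 1 <= dletter N k X & dletter N k X <= Suc N" using letD_dn(1,2) by (auto simp: validS_def dletter_def)

lemma uletter_cong:
 assumes "validS N X" "validS N X'"
  "!!a. a <= Suc N ==> up k (fst X) (snd X) a = \<infinity> \<longleftrightarrow> up k' (fst X') (snd X') a = \<infinity>"
 shows "uletter k X = uletter k' X'"
 using up_fin[OF assms(1), of k] up_fin[OF assms(2), of k'] assms(3) uletter_bounds[OF assms(2), of k'] by (metis le_antisym not_less order_refl)

lemma dletter_cong:
 assumes "validS N X" "validS N X'"
  "!!a. a <= Suc N ==> dn N k (fst X) (snd X) a = \<infinity> \<longleftrightarrow> dn N k' (fst X') (snd X') a = \<infinity>"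
 shows "dletter N k X = dletter N k' X'"
 using dn_fin[OF assms(1), of _ k] dn_fin[OF assms(2), of _ k'] assms(3) dletter_bounds[OF assms(2), of k'] by (metis le_antisym order_refl)

definition constant_chains :: "nat => nat => state => bool" where
 "constant_chains N k X \<longleftrightarrow> (\<forall>a. 1 <= a & a <= N \<longrightarrow>
   up k (fst X) (snd X) a = enat k & dn N k (fst X) (snd X) a = enat k)"

text \<open>Here the upward chain reaches node N without exceeding the start of the downward chain,
  whereas \<open>H2\<close> at node N asks for k' < \<open>l N\<close>.\<close>

definition failing :: "nat => nat => nat => state => bool" where
 "failing N k k' X \<longleftrightarrow> k < k' & up k (fst X) (snd X) N <= enat k'"

text \<open>\<open>z\<close> and \<open>y\<close> are the letters for the order dual row, row, and \<open>y'\<close> and \<open>z'\<close> those for the other order.\<close>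

definition local_rule :: "nat => nat => nat => nat => nat => bool" where
 "local_rule N z y y' z' \<longleftrightarrow> z ~= y & y' = y & z' = z \<or>
   z = y & y' = z' & (if y = 1 then y' = Suc N else y = Suc y')"

lemma crossing_commuting:
 assumes c: "crossing N b c p R (up k p R) (dn N k' p R) q" and X: "X = (p, R)"
 shows "crossing.commuting N p R (up k p R) (dn N k' p R)
  (dn N k' (fst (upS N k X)) (snd (upS N k X))) (up k (fst (dnS N k' X)) (snd (dnS N k' X)))"
proof -
 interpret crossing N b c p R "up k p R" "dn N k' p R" q by (rule c)
 have "upS N k X = (p1, R1)" "dnS N k' X = (p1', R1')" by (simp_all add: X upS_def dnS_def p1_def R1_def p1'_def R1'_def)
 thus ?thesis unfolding commuting_def using dn_rec by auto
qed

text \<open>If q is finite, both chains cover the plateau, so the dual letter is at most b, the row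
  letter exceeds c, and neither changes. If q is infinite, the row letter is b and the dual letter c
  + 1. They move only if r is finite: then b = c, each second chain covers one node more than
  before, and the equal letters b + 1 of one order become b in the other. Letters 1, 1 never arise,
  because b >= 1.\<close>

lemma crossing_square:
 assumes c: "crossing N b c p R (up k p R) (dn N k' p R) q" and X: "X = (p, R)"
  and k: "1 <= k" "1 <= k'"
 shows "dnS N k' (upS N k X) = upS N k (dnS N k' X)"
  and "local_rule N (dletter N k' X) (uletter k (dnS N k' X)) (uletter k X) (dletter N k' (upS N k X))"
  and "~ (dletter N k' X = 1 & uletter k (dnS N k' X) = 1)"
proof -
 interpret crossing N b c p R "up k p R" "dn N k' p R" q by (rule c)
 let ?l = "up k p R" and ?m = "dn N k' p R"
 let ?m' = "dn N k' (fst (upS N k X)) (snd (upS N k X))"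
 let ?l' = "up k (fst (dnS N k' X)) (snd (dnS N k' X))"
 have e: "upS N k X = (p1, R1)" "dnS N k' X = (p1', R1')" by (simp_all add: X upS_def dnS_def p1_def R1_def p1'_def R1'_def)
 have com: "commuting ?m' ?l'" using crossing_commuting[OF c X] .
 show "dnS N k' (upS N k X) = upS N k (dnS N k' X)" using commuting_final[OF com] unfolding e by (simp add: dnS_def upS_def)
 note m' = m'_eq[OF com] and l' = l'_eq[OF com]
 have vX: "validS N X" using valid by (simp add: validS_def X)
 have v1: "validS N (upS N k X)" "validS N (dnS N k' X)" using validS_upS validS_dnS vX k by auto
 have *: "local_rule N (dletter N k' X) (uletter k (dnS N k' X)) (uletter k X) (dletter N k' (upS N k X)) &
  ~ (dletter N k' X = 1 & uletter k (dnS N k' X) = 1)"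
 proof (cases q)
  case q: infinity
  have lb: "?l b = \<infinity>" "?m c = \<infinity>" using lq[of b] mq[of c] bc q by auto
  have "?l (b - 1) ~= \<infinity>" using lb_q by (cases "?l (b - 1)") (auto simp del: up.simps)
  hence y': "uletter k X = b" using lb bc by (intro uletter_eqI[OF vX]) (auto simp: X)
  have "?m (Suc c) ~= \<infinity>" using mc_q by (cases "?m (Suc c)") auto
  hence z: "dletter N k' X = Suc c" using lb bc by (intro dletter_eqI[OF vX]) (auto simp: X)
  show ?thesis
  proof (cases r)
   case r: infinity
   have "uletter k (dnS N k' X) = uletter k X" by (rule uletter_cong[OF v1(2) vX]) (use l' r q lq in \<open>auto simp: X\<close>)
   moreover have "dletter N k' (upS N k X) = dletter N k' X" by (rule dletter_cong[OF v1(1) vX]) (use m' r q mq in \<open>auto simp: X\<close>)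
   ultimately show ?thesis using y' z bc by (auto simp: local_rule_def)
  next
   case r: (enat i)
   have bc': "b = c" using r_lt q r bc by (cases "b < c") auto
   have "uletter k (dnS N k' X) = Suc b" using l'[of "Suc b"] bc bc' lb l'[of b] r uletter_eqI v1(2) by simp
   moreover have "dletter N k' (upS N k X) = b" using m' bc bc' lb m_mono[of "b - 1" b] r dletter_eqI v1(1) by simp
   ultimately show ?thesis using y' z bc bc' by (auto simp: local_rule_def)
  qed
 next
  case q: (enat j)
  then obtain i where r: "r = enat i" using r_q by (cases r) auto
  have "uletter k (dnS N k' X) = uletter k X" by (rule uletter_cong[OF v1(2) vX]) (use l' r q lq in \<open>auto simp: X\<close>)
  moreover have "dletter N k' (upS N k X) = dletter N k' X" by (rule dletter_cong[OF v1(1) vX]) (use m' r q mq in \<open>auto simp: X\<close>)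
  moreover have "c < uletter k X" using up_fin[OF vX, of k c] lq[of c] bc q by (auto simp: X)
  moreover have "dletter N k' X <= b" using dn_fin[OF vX, of b k'] mq[of b] bc q by (auto simp: X)
  ultimately show ?thesis using bc by (auto simp: local_rule_def)
 qed
 thus "local_rule N (dletter N k' X) (uletter k (dnS N k' X)) (uletter k X) (dletter N k' (upS N k X))"
  "~ (dletter N k' X = 1 & uletter k (dnS N k' X) = 1)" by auto
qed

lemma chi_const: "chi (enat k) i = of_bool (k <= i)" by simp

text \<open>Once an upward chain has run through length k at every node, the vacancy number at node
  N is higher by one from length k on. Nothing there is singular any more, so the downward chain
  stops at once. Letters 1, 1 in one order thus become N + 1, N + 1 in the other.\<close>

lemma constant_up:
 assumes v: "validS N X" and k: "1 <= k" and N: "1 <= N" and c: "constant_chains N k X"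
 shows "a <= N ==> dn N k (fst (upS N k X)) (snd (upS N k X)) a = \<infinity>"
  and "uletter k X = Suc N" and "dletter N k X = 1" and "dletter N k (upS N k X) = Suc N"
  and "1 <= a ==> a <= N ==> i < k ==> fst (upS N k X) a i = fst X a i"
proof -
 obtain p R where X: "X = (p, R)" by (cases X)
 let ?l = "up k p R" and ?m = "dn N k p R"
 let ?p1 = "upd N p ?l" let ?R1 = "rm N R ?l p ?p1"
 have vp: "valid N p R" using v by (simp add: validS_def X)
 have l: "?l a = enat k" if "a <= N" for a using c that by (cases a) (auto simp: constant_chains_def X simp del: up.simps(2))
 have m: "?m a = enat k" if "1 <= a" "a <= Suc N" for a using c that by (cases "a = Suc N") (auto simp: constant_chains_def X)
 have lN: "?l (Suc N) = \<infinity>" by (rule up_end[OF vp])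
 have e: "upS N k X = (?p1, ?R1)" by (simp add: upS_def X)
 have p1: "?p1 N i = p N i + of_bool (k <= i)" for i using N l[of N] l[of "N - 1"] lN by (simp add: upd_def)
 have "dn N k ?p1 ?R1 N = \<infinity>"
 proof -
  have "first (sing ?p1 ?R1 N) (enat k) = \<infinity>"
  proof (rule first_eqI)
   fix i assume i: "enat k <= enat i" "sing ?p1 ?R1 N i"
   have "?l N = enat (Suc i) \<or> (i, ?p1 N i) \<in># R N" using sing_rm_cases[OF vp i(2)] by auto
   hence "(i, p N i + 1) \<in># R N" using l[of N] i(1) p1[of i] by auto
   thus "\<infinity> <= enat i" using valid_le[OF vp] by fastforce
  qed auto
  thus ?thesis using dn_rec[of N N k ?p1 ?R1] by simp
 qed
 hence m': "dn N k ?p1 ?R1 a = \<infinity>" if "a <= N" for a using dn_mono[OF that, of N k ?p1 ?R1] by simp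
 thus "a <= N ==> dn N k (fst (upS N k X)) (snd (upS N k X)) a = \<infinity>" by (simp add: e)
 show "uletter k X = Suc N" by (rule uletter_eqI[OF v]) (use l lN in \<open>auto simp: X simp del: up.simps\<close>)
 show "dletter N k X = 1" by (rule dletter_eqI[OF v]) (use m dn_0[OF vp] N in \<open>auto simp: X\<close>)
 have v1: "validS N (upS N k X)" by (rule validS_upS[OF v k])
 show "dletter N k (upS N k X) = Suc N" by (rule dletter_eqI[OF v1]) (use m' in \<open>auto simp: e\<close>)
 show "1 <= a ==> a <= N ==> i < k ==> fst (upS N k X) a i = fst X a i" using l[of a] l[of "a - 1"] l[of "Suc a"] lN
  by (cases "a = N") (auto simp: upS_def X upd_def chi_const simp del: up.simps)
qed

lemma constant_flip:
 assumes v: "validS N X" and c: "constant_chains N k X"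
 shows "constant_chains N k (flipS N X)"
proof -
 obtain p R where X: "X = (p, R)" by (cases X)
 have vp: "valid N p R" using v by (simp add: validS_def X)
 { fix a assume a: "1 <= a" "a <= N"
  have "up k (flip N p) (flip N R) a = dn N k p R (N + 1 - a)" using a by (simp add: dn_def flip_def)
  moreover have "dn N k (flip N p) (flip N R) a = up k p R (N + 1 - a)" using a flip_dn[OF vp, of a k] by (simp add: flip_def)
  moreover have "1 <= N + 1 - a" "N + 1 - a <= N" using a by auto
  ultimately have "up k (flip N p) (flip N R) a = enat k & dn N k (flip N p) (flip N R) a = enat k" using c by (simp add: constant_chains_def X) }
 thus ?thesis by (simp add: constant_chains_def X)
qed

lemma uletter_flip: "validS N X ==> uletter k (flipS N X) = N + 2 - dletter N k X"
 using letU_flip[of N "fst X" "snd X" k] by (cases X) (simp add: uletter_def dletter_def validS_def)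

lemma dletter_flip: "validS N X ==> dletter N k (flipS N X) = N + 2 - uletter k X"
 using letD_flip[of N "fst X" "snd X" k] by (cases X) (simp add: uletter_def dletter_def validS_def)

lemma constant_dn:
 assumes v: "validS N X" and k: "1 <= k" and N: "1 <= N" and c: "constant_chains N k X"
 shows "1 <= a ==> a <= Suc N ==> up k (fst (dnS N k X)) (snd (dnS N k X)) a = \<infinity>"
  and "uletter k (dnS N k X) = 1"
  and "1 <= a ==> a <= N ==> i < k ==> fst (dnS N k X) a i = fst X a i"
proof -
 note v' = validS_flip[OF v] and c' = constant_flip[OF v c]
 have f: "flipS N (upS N k (flipS N X)) = dnS N k X" using flipS_upS[OF v'] flipS_flipS[OF v] by simp
 have v1: "validS N (dnS N k X)" by (rule validS_dnS[OF v k])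
 have f': "upS N k (flipS N X) = flipS N (dnS N k X)" using flipS_dnS[OF v] by simp
 show "uletter k (dnS N k X) = 1" using constant_up(4)[OF v' k N c'] dletter_flip[OF v1, of k] unfolding f' by linarith
 thus "1 <= a ==> a <= Suc N ==> up k (fst (dnS N k X)) (snd (dnS N k X)) a = \<infinity>" using up_fin[OF v1, of k a] by auto
 assume a: "1 <= a" "a <= N" "i < k"
 have "fst (upS N k (flipS N X)) (N + 1 - a) i = fst (flipS N X) (N + 1 - a) i" by (rule constant_up(5)[OF v' k N c']) (use a in auto)
 thus "fst (dnS N k X) a i = fst X a i" using a unfolding f[symmetric] by (cases X; cases "upS N k (flipS N X)") (simp add: flip_def)
qed

text \<open>In either order the first chain takes one box off a string of length k at each node and
  the second takes nothing. The vacancy numbers below k do not move, which fixes the new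
  rigging.\<close>

lemma constant_square:
 assumes v: "validS N X" and k: "1 <= k" and N: "1 <= N" and c: "constant_chains N k X"
 shows "dnS N k (upS N k X) = upS N k (dnS N k X)"
  and "1 <= a ==> a <= N ==> snd (dnS N k (upS N k X)) a
   = snd X a - {#(k, fst X a k)#} + (if 1 < k then {#(k - 1, fst X a (k - 1))#} else {#})"
  and "!!a. 1 <= a ==> a <= N ==> (k, fst X a k) \<in># snd X a"
proof -
 obtain p R where X: "X = (p, R)" by (cases X)
 have vp: "valid N p R" using v by (simp add: validS_def X)
 let ?l = "up k p R" and ?m = "dn N k p R"
 let ?p1 = "upd N p ?l" let ?R1 = "rm N R ?l p ?p1"
 let ?q1 = "upd N p ?m" let ?S1 = "rm N R ?m p ?q1"
 let ?m' = "dn N k ?p1 ?R1" and ?l' = "up k ?q1 ?S1"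
 have e: "upS N k X = (?p1, ?R1)" "dnS N k X = (?q1, ?S1)" by (simp_all add: upS_def dnS_def X)
 have l: "?l a = enat k" if "a <= N" for a using c that by (cases a) (auto simp: constant_chains_def X simp del: up.simps(2))
 have m: "?m a = enat k" if "1 <= a" "a <= Suc N" for a using c that by (cases "a = Suc N") (auto simp: constant_chains_def X)
 have lN: "?l (Suc N) = \<infinity>" "?m 0 = \<infinity>" using up_end[OF vp] dn_0[OF vp] by auto
 have m': "?m' a = \<infinity>" if "a <= N" for a using constant_up(1)[OF v k N c that] unfolding e by simp
 have l': "?l' a = \<infinity>" if "1 <= a" "a <= Suc N" for a using constant_dn(1)[OF v k N c that] unfolding e by simp
 have p1: "?p1 a i = p a i" if "1 <= a" "a <= N" "i < k" for a i using constant_up(5)[OF v k N c that] unfolding e by (simp add: X)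
 have q1: "?q1 a i = p a i" if "1 <= a" "a <= N" "i < k" for a i using constant_dn(3)[OF v k N c that] unfolding e by (simp add: X)
 have p2: "upd N ?p1 ?m' = upd N ?q1 ?l'"
 proof (intro ext)
  fix a i
  have *: "chi (?l e) i + chi (?m' e) i = chi (?m e) i + chi (?l' e) i" if he: "e <= Suc N" for e
  proof -
   consider "e = 0" | "1 <= e" "e <= N" | "e = Suc N" using he by linarith
   thus ?thesis using l[of e] m[of e] m'[of e] l'[of e] lN by cases auto
  qed
  show "upd N ?p1 ?m' a i = upd N ?q1 ?l' a i"
  proof (cases "1 <= a & a <= N")
   case True
   hence "a - 1 <= Suc N" "a <= Suc N" "Suc a <= Suc N" by auto
   note *[OF this(1)] *[OF this(2)] *[OF this(3)]
   moreover have "upd N ?p1 ?m' a i = p a i + 2 * (chi (?l a) i + chi (?m' a) i)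
     - (chi (?l (a - 1)) i + chi (?m' (a - 1)) i) - (chi (?l (Suc a)) i + chi (?m' (Suc a)) i)" using True by (simp add: upd_def)
   moreover have "upd N ?q1 ?l' a i = p a i + 2 * (chi (?m a) i + chi (?l' a) i)
     - (chi (?m (a - 1)) i + chi (?l' (a - 1)) i) - (chi (?m (Suc a)) i + chi (?l' (Suc a)) i)" using True by (simp add: upd_def)
   ultimately show ?thesis by simp
  qed (auto simp: upd_def)
 qed
 have R2: "rm N ?R1 ?m' ?p1 (upd N ?p1 ?m') = ?R1" using m' by (auto simp: rm_def)
 have S2: "rm N ?S1 ?l' ?q1 (upd N ?q1 ?l') = ?S1" using l' by (auto simp: rm_def)
 have R1: "?R1 a = R a - {#(k, p a k)#} + (if 1 < k then {#(k - 1, p a (k - 1))#} else {#})" if "1 <= a" "a <= N" for a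
  using that l[of a] p1[of a "k - 1"] by (auto simp: rm_def)
 have S1: "?S1 a = R a - {#(k, p a k)#} + (if 1 < k then {#(k - 1, p a (k - 1))#} else {#})" if "1 <= a" "a <= N" for a
  using that m[of a] q1[of a "k - 1"] by (auto simp: rm_def)
 have "?R1 = ?S1" using R1 S1 by (auto simp: rm_def)
 thus "dnS N k (upS N k X) = upS N k (dnS N k X)" using p2 R2 S2 unfolding e by (simp add: dnS_def upS_def)
 show "1 <= a ==> a <= N ==> snd (dnS N k (upS N k X)) a
   = snd X a - {#(k, fst X a k)#} + (if 1 < k then {#(k - 1, fst X a (k - 1))#} else {#})" using R1 R2 unfolding e by (simp add: dnS_def X)
 show "(k, fst X a k) \<in># snd X a" if "1 <= a" "a <= N" for a using dn_sing[of a N k p R k] m[of a] that by (simp add: sing_def X)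
qed

section \<open>The hexagon for chains that do not cross\<close>

lemma mem_rm_cases:
 assumes "valid N p R" "(i, x) \<in># rm N R s p p' a"
 shows "1 <= i & (s a = enat (Suc i) & x = p' a i \<or> (i, x) \<in># R a)" using assms(2) valid_pos[OF assms(1)] unfolding rm_def
 by (auto split: if_splits enat.splits dest: in_diffD)

lemma mem_rm_old: "(i, x) \<in># R a ==> s a ~= enat i ==> (i, x) \<in># rm N R s p p' a"
 unfolding rm_def by (auto split: enat.splits simp: in_diff_count)

lemma mem_rm_new: "s a = enat (Suc i) ==> 1 <= i ==> 1 <= a ==> a <= N ==> (i, p' a i) \<in># rm N R s p p' a" unfolding rm_def by auto

lemma less_Suc_enat: "x < enat (Suc n) \<longleftrightarrow> x <= enat n" by (cases x) auto

text \<open>Here k' = \<open>kk\<close> + 1. The chains \<open>l\<close>, \<open>m1\<close>,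
  \<open>m2\<close> belong to the order up, down from \<open>kk\<close> + 1, down from
  \<open>kk\<close>; the chains \<open>m\<close>, \<open>l1\<close>, \<open>m3\<close> to the order
  down from \<open>kk\<close> + 1, up, down from \<open>kk\<close>.\<close>

locale hexagon =
 fixes N k kk :: nat and p :: vacancies and R :: rigged
 assumes v: "valid N p R" and k: "1 <= k" "k <= kk" and N: "1 <= N"
  and lN: "up k p R N <= enat (Suc kk)"
begin

abbreviation "l \<equiv> up k p R"
abbreviation "m \<equiv> dn N (Suc kk) p R"
definition "p1 = upd N p l"
definition "R1 = rm N R l p p1"
abbreviation "m1 \<equiv> dn N (Suc kk) p1 R1"
definition "p11 = upd N p1 m1"
definition "R11 = rm N R1 m1 p1 p11"
abbreviation "m2 \<equiv> dn N kk p11 R11"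
definition "q1 = upd N p m"
definition "S1 = rm N R m p q1"
abbreviation "l1 \<equiv> up k q1 S1"
definition "q11 = upd N q1 l1"
definition "S11 = rm N S1 l1 q1 q11"
abbreviation "m3 \<equiv> dn N kk q11 S11"

text \<open>From b on \<open>l\<close> stays at \<open>kk\<close> + 1, the starting length of
  \<open>m\<close>, so there \<open>m\<close> takes the same strings (\<open>m_mid\<close>).\<close>

definition "b = (LEAST a. enat (Suc kk) <= l a)"

lemma l_end: "l (Suc N) = \<infinity>" by (rule up_end[OF v])

lemma b: "b <= Suc N" "1 <= b" "a < b ==> l a <= enat kk" "b <= a ==> a <= N ==> l a = enat (Suc kk)"
proof -
 have x: "enat (Suc kk) <= l (Suc N)" using l_end by simp
 show "b <= Suc N" unfolding b_def by (rule Least_le) (rule x)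
 have bb: "enat (Suc kk) <= l b" unfolding b_def by (rule LeastI) (rule x)
 thus "1 <= b" using k by (cases b) auto
 show "a < b ==> l a <= enat kk" using not_less_Least[of a "%a. enat (Suc kk) <= l a"] unfolding b_def by (simp add: not_le less_Suc_enat)
 show "b <= a ==> a <= N ==> l a = enat (Suc kk)" using bb up_mono[of b a k p R] up_mono[of a N k p R] lN by auto
qed

lemma l_le: "a <= N ==> l a <= enat (Suc kk)" using up_mono[of a N k p R] lN by auto

lemma m_ge: "enat (Suc kk) <= m a" by (rule dn_ge)

lemma m_mid: "b <= a ==> a <= Suc N ==> m a = enat (Suc kk)"
proof (rule inc_induct[of a "Suc N"])
 fix n assume n: "b <= a" "a <= n" "n < Suc N" "m (Suc n) = enat (Suc kk)"
 hence "l n = enat (Suc kk)" using b(4) by auto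
 hence "sing p R n (Suc kk)" using up_sing'[of n k p R] n b(2) by auto
 hence "m n <= enat (Suc kk)" using dn_stop n by auto
 thus "m n = enat (Suc kk)" using m_ge by (simp add: antisym)
qed auto

lemma p1_eq: "1 <= a ==> a <= N ==> p1 a i = p a i + 2 * chi (l a) i - chi (l (a - 1)) i - chi (l (Suc a)) i" by (simp add: p1_def upd_def)

lemma q1_eq: "1 <= a ==> a <= N ==> q1 a i = p a i + 2 * chi (m a) i - chi (m (a - 1)) i - chi (m (Suc a)) i" by (simp add: q1_def upd_def)

lemma q11_eq: "1 <= a ==> a <= N ==> q11 a i = q1 a i + 2 * chi (l1 a) i - chi (l1 (a - 1)) i - chi (l1 (Suc a)) i" by (simp add: q11_def upd_def)

lemma l_mono: "l (a - 1) <= l a" "l a <= l (Suc a)" using up_mono[of "a - 1" a k p R] up_mono[of a "Suc a" k p R] by auto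

lemma p1_above: "1 <= a ==> a <= N ==> l (Suc a) <= enat i ==> p1 a i = p a i" using l_mono[of a] by (auto simp: p1_eq)

lemma p1_N: "l N <= enat i ==> p1 N i = p N i + 1" using l_mono[of N] N l_end by (auto simp: p1_eq)

lemma v1: "valid N p1 R1" unfolding R1_def p1_def by (rule valid_up[OF v k(1)])

lemma vq1: "valid N q1 S1" unfolding S1_def q1_def by (rule valid_dn[OF v]) (use k in simp)

lemma vq11: "valid N q11 S11" unfolding S11_def q11_def by (rule valid_up[OF vq1 k(1)])

text \<open>At node N the removal of \<open>l\<close> raises the vacancy number by one for all
  lengths from \<open>kk\<close> + 1 on, so the downward chain finds nothing.\<close>

lemma m1: "a <= N ==> m1 a = \<infinity>"
proof -
 assume a: "a <= N"
 have "first (sing p1 R1 N) (enat (Suc kk)) = \<infinity>"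
 proof (rule first_eqI)
  fix i assume i: "enat (Suc kk) <= enat i" "sing p1 R1 N i"
  have "l N = enat (Suc i) \<or> (i, p1 N i) \<in># R N" using sing_rm_cases[OF v i(2)[unfolded R1_def]] by auto
  moreover have "l N <= enat i" using lN i(1) by (auto intro: order_trans)
  ultimately have "(i, p N i + 1) \<in># R N" using p1_N[of i] by auto
  thus "\<infinity> <= enat i" using valid_le[OF v] by fastforce
 qed auto
 hence "m1 N = \<infinity>" using dn_rec[of N N "Suc kk" p1 R1] by simp
 thus ?thesis using dn_mono[of a N N "Suc kk" p1 R1] a by simp
qed

lemma R11: "R11 = R1" unfolding R11_def using m1 by (auto simp: rm_def)

lemma p11: "1 <= a ==> a <= N ==> p11 a i = p1 a i - (if a = N & Suc kk <= i then 1 else 0)"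
 using m1[of a] m1[of "a - 1"] m1[of "Suc a"] by (cases "a = N") (auto simp: p11_def upd_def chi_const)

lemma v11: "valid N p11 R11" unfolding R11_def p11_def by (rule valid_dn[OF v1]) (use k in simp)

lemma R1_new: "b <= a ==> a <= N ==> (kk, p1 a kk) \<in># R1 a" unfolding R1_def by (rule mem_rm_new) (use b k in auto)

text \<open>Since \<open>m1\<close> took nothing, this chain takes over the role of
  \<open>m\<close>. From b on it hits the strings that \<open>l\<close> shortened to
  \<open>kk\<close>. Left of b it must follow \<open>m\<close> although it starts one lower: at
  length \<open>kk\<close> the vacancy number at the first such node exceeds \<open>p\<close> by
  one, so nothing is singular there.\<close>

lemma m2: "a <= N ==> m2 a = (if b <= a then enat kk else m a)"
proof (induction "N - a" arbitrary: a)
 case 0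
 hence a: "a = N" by simp
 have "first (sing p11 R11 N) (enat kk) = (if b <= N then enat kk else m N)"
 proof (cases "b <= N")
  case True
  thus ?thesis using R1_new[of N] p11[of N kk] N by (auto intro!: first_eqI simp: sing_def R11)
 next
  case False
  hence lk: "l N <= enat kk" using b(3)[of N] by simp
  have "first (sing p11 R11 N) (enat kk) = m N"
  proof (rule first_eqI)
   show "enat kk <= m N" using m_ge[of N] by (auto intro: order_trans[of _ "enat (Suc kk)"])
   fix i
   { assume i: "m N = enat i"
    have ik: "Suc kk <= i" using m_ge[of N] i by simp
    hence "l N <= enat i" using order_trans[OF lk, of "enat i"] by simp
    hence "p11 N i = p N i" using p11[of N i] p1_N[of i] N ik by simp
    moreover have "l N ~= enat i" using lk ik by auto
    moreover have "(i, p N i) \<in># R N" using dn_sing[of N N "Suc kk" p R i] i by (simp add: sing_def)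
    ultimately show "sing p11 R11 N i" unfolding sing_def R11 R1_def using mem_rm_old by metis }
   assume i: "enat kk <= enat i" "sing p11 R11 N i"
   have li: "l N <= enat i" using lk i(1) by (rule order_trans)
   hence "l N ~= enat (Suc i)" by auto
   hence mem: "(i, p11 N i) \<in># R N" using mem_rm_cases[OF v i(2)[unfolded sing_def R11 R1_def]] by auto
   show "m N <= enat i"
   proof (cases "Suc kk <= i")
    case True
    hence "p11 N i = p N i" using p11[of N i] p1_N[OF li] N by auto
    hence "sing p R N i" using mem by (simp add: sing_def)
    thus ?thesis using dn_stop[of N "Suc kk" p R N i] True by simp
   next
    case False
    hence "p11 N i = p N i + 1" using p11[of N i] p1_N[OF li] N by auto
    thus ?thesis using valid_le[OF v mem] by simp
   qed
  qed
  thus ?thesis using False by simp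
 qed
 thus ?case using dn_rec[of N N kk p11 R11] a by simp
next
 case (Suc d)
 hence aN: "a < N" by simp
 have IH: "m2 (Suc a) = (if b <= Suc a then enat kk else m (Suc a))" using Suc by auto
 have rec: "m2 a = first (sing p11 R11 a) (m2 (Suc a))" using dn_rec[of a N kk p11 R11] aN by simp
 have pp: "p11 a i = p1 a i" if "1 <= a" for i using p11[of a i] that aN by auto
 show ?case
 proof (cases "b <= a")
  case True
  hence "sing p11 R11 a kk" using R1_new[of a] pp[of kk] b(2) aN by (simp add: sing_def R11)
  hence "first (sing p11 R11 a) (enat kk) = enat kk" by (auto intro: first_eqI)
  thus ?thesis using rec IH True by simp
 next
  case False
  have lSa: "l (Suc a) <= m (Suc a)" using l_le[of "Suc a"] m_ge[of "Suc a"] aN by auto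
  have mm: "m (Suc a) <= m a" using dn_mono[of a "Suc a"] aN by auto
  have la: "l a <= enat kk" using b(3) False by auto
  have st: "m2 (Suc a) <= m (Suc a)" "enat kk <= m2 (Suc a)" using IH m_ge[of "Suc a"] by (auto intro: order_trans[of _ "enat (Suc kk)"])
  have "first (sing p11 R11 a) (m2 (Suc a)) = m a"
  proof (rule first_eqI)
   show "m2 (Suc a) <= m a" using st mm by auto
   fix i
   { assume i: "m a = enat i"
    have S: "(i, p a i) \<in># R a" using dn_sing[of a N "Suc kk" p R i] i aN by (simp add: sing_def)
    hence a1: "1 <= a" using v by (cases a) (auto simp: valid_def)
    have "l (Suc a) <= enat i" using lSa mm i by auto
    hence "p11 a i = p a i" using pp p1_above[of a i] a1 aN by auto
    moreover have "l a ~= enat i" using la m_ge[of a] i by auto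
    ultimately show "sing p11 R11 a i" using S unfolding sing_def R11 R1_def using mem_rm_old by metis }
   assume i: "m2 (Suc a) <= enat i" "sing p11 R11 a i"
   have a1: "1 <= a" using i(2) v11 by (cases a) (auto simp: valid_def sing_def)
   have ki: "kk <= i" using order_trans[OF st(2) i(1)] by simp
   have "l a ~= enat (Suc i)" using la ki by auto
   hence mem: "(i, p1 a i) \<in># R a" using mem_rm_cases[OF v i(2)[unfolded sing_def R11 R1_def]] pp a1 by auto
   show "m a <= enat i"
   proof (cases "m (Suc a) <= enat i")
    case True
    hence "l (Suc a) <= enat i" using lSa by auto
    hence "sing p R a i" using p1_above[of a i] a1 aN mem by (auto simp: sing_def)
    thus ?thesis using dn_stop[of N "Suc kk" p R a i] True aN by simp
   next
    case F: False
    hence "b = Suc a" using IH i(1) False by (auto split: if_splits)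
    hence "m (Suc a) = enat (Suc kk)" "l (Suc a) = enat (Suc kk)" using m_mid[of b] b(4)[of b] aN by auto
    hence "i = kk" using F ki by auto
    moreover have "l (a - 1) <= enat kk" using la l_mono(1)[of a] by (rule order_trans[rotated])
    ultimately have "p1 a i = p a i + 1" using la \<open>l (Suc a) = enat (Suc kk)\<close> a1 aN by (auto simp: p1_eq)
    thus ?thesis using valid_le[OF v mem] by simp
   qed
  qed
  thus ?thesis using rec False by simp
 qed
qed

lemma q1_low: "1 <= a ==> a <= N ==> i <= kk ==> q1 a i = p a i" using m_ge less_le_trans[of _ "enat (Suc kk)"] by (simp add: q1_eq)

text \<open>\<open>m\<close> only touches strings of length above \<open>kk\<close>, so
  \<open>l1\<close> repeats \<open>l\<close> left of b. From b on it stops at the strings that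
  \<open>m\<close> has just shortened to \<open>kk\<close>.\<close>

lemma l1: "a <= N ==> l1 a = (if b <= a then enat kk else l a)"
proof (induction a)
 case 0 thus ?case using b(2) by simp
next
 case (Suc a)
 hence IH: "l1 a = (if b <= a then enat kk else l a)" by simp
 have l1a: "l1 a <= enat kk" using IH b(3)[of a] by auto
 show ?case
 proof (cases "b <= Suc a")
  case True
  have "first (sing q1 S1 (Suc a)) (l1 a) = enat kk"
  proof (rule first_eqI)
   fix i
   { assume "enat kk = enat i"
    thus "sing q1 S1 (Suc a) i" unfolding sing_def S1_def by (intro mem_rm_new) (use m_mid[of "Suc a"] True Suc k in auto) }
   assume i: "l1 a <= enat i" "sing q1 S1 (Suc a) i"
   show "enat kk <= enat i"
   proof (rule ccontr)
    assume n: "~ enat kk <= enat i"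
    hence ba: "b = Suc a" using IH i(1) True by (auto split: if_splits)
    have "m (Suc a) ~= enat (Suc i)" using m_mid[of "Suc a"] True Suc n by auto
    hence "(i, q1 (Suc a) i) \<in># R (Suc a)" using mem_rm_cases[OF v i(2)[unfolded sing_def S1_def]] by auto
    hence "sing p R (Suc a) i" using q1_low[of "Suc a" i] n Suc by (simp add: sing_def)
    hence "l (Suc a) <= enat i" using i(1) IH ba first_le by auto
    thus False using b(4)[of "Suc a"] ba Suc n by simp
   qed
  qed (rule l1a)
  thus ?thesis using True by simp
 next
  case False
  have "first (sing q1 S1 (Suc a)) (l a) = l (Suc a)"
  proof (rule first_eqI)
   have lS: "l (Suc a) <= enat kk" using b(3)[of "Suc a"] False by simp
   show "l a <= l (Suc a)" by (rule l_mono)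
   fix i
   { assume i: "l (Suc a) = enat i"
    hence "(i, p (Suc a) i) \<in># R (Suc a)" using up_sing by (simp add: sing_def)
    moreover have "m (Suc a) ~= enat i" using m_ge[of "Suc a"] lS i by auto
    moreover have "q1 (Suc a) i = p (Suc a) i" using q1_low[of "Suc a" i] lS i Suc by simp
    ultimately show "sing q1 S1 (Suc a) i" unfolding sing_def S1_def using mem_rm_old by metis }
   assume i: "l a <= enat i" "sing q1 S1 (Suc a) i"
   show "l (Suc a) <= enat i"
   proof (cases "kk <= i")
    case True thus ?thesis using lS by (auto intro: order_trans)
   next
    case F: False
    have "m (Suc a) ~= enat (Suc i)" using m_ge[of "Suc a"] F by auto
    hence "(i, q1 (Suc a) i) \<in># R (Suc a)" using mem_rm_cases[OF v i(2)[unfolded sing_def S1_def]] by auto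
    hence "sing p R (Suc a) i" using q1_low[of "Suc a" i] F Suc by (simp add: sing_def)
    thus ?thesis using i(1) first_le by auto
   qed
  qed
  thus ?thesis using False IH by simp
 qed
qed

lemma l1_end: "l1 (Suc N) = \<infinity>" by (rule up_end[OF vq1])

lemma l1_kk: "a <= N ==> l1 a <= enat kk" using l1[of a] b(3)[of a] by auto

lemma m3: "a <= N ==> m3 a = \<infinity>"
proof -
 assume a: "a <= N"
 have "first (sing q11 S11 N) (enat kk) = \<infinity>"
 proof (rule first_eqI)
  fix i assume i: "enat kk <= enat i" "sing q11 S11 N i"
  have li: "l1 N <= enat i" "l1 (N - 1) <= enat i" using l1_kk[of N] l1_kk[of "N - 1"] i(1) by (auto intro: order_trans)
  have "l1 N ~= enat (Suc i)" using li by auto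
  hence mem: "(i, q11 N i) \<in># S1 N" using mem_rm_cases[OF vq1 i(2)[unfolded sing_def S11_def]] by auto
  have "q11 N i = q1 N i + 1" using li l1_end N by (simp add: q11_eq)
  thus "\<infinity> <= enat i" using valid_le[OF vq1 mem] by simp
 qed auto
 hence "m3 N = \<infinity>" using dn_rec[of N N kk q11 S11] by simp
 thus ?thesis using dn_mono[of a N N kk q11 S11] a by simp
qed

text \<open>On the nodes each order uses the same three lengths: \<open>kk\<close> + 1,
  \<open>kk\<close> and infinity from b on, and \<open>l\<close>, \<open>m\<close> and infinity left
  of b.\<close>

lemma final_p: "upd N p11 m2 = upd N q11 m3"
proof (intro ext)
 fix a i
 have *: "chi (l e) i + chi (m1 e) i + chi (m2 e) i = chi (m e) i + chi (l1 e) i + chi (m3 e) i" if he: "e <= Suc N" for e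
 proof (cases "e = Suc N")
  case True thus ?thesis using l_end l1_end by simp
 next
  case False
  hence "e <= N" using he by simp
  thus ?thesis using m1[of e] m2[of e] l1[of e] m3[of e] b(4)[of e] m_mid[of e] by auto
 qed
 show "upd N p11 m2 a i = upd N q11 m3 a i"
 proof (cases "1 <= a & a <= N")
  case True
  hence "a - 1 <= Suc N" "a <= Suc N" "Suc a <= Suc N" by auto
  note *[OF this(1)] *[OF this(2)] *[OF this(3)]
  moreover have "upd N p11 m2 a i = p a i + 2 * (chi (l a) i + chi (m1 a) i + chi (m2 a) i)
    - (chi (l (a - 1)) i + chi (m1 (a - 1)) i + chi (m2 (a - 1)) i)
    - (chi (l (Suc a)) i + chi (m1 (Suc a)) i + chi (m2 (Suc a)) i)" using True by (simp add: p1_def p11_def upd_def)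
  moreover have "upd N q11 m3 a i = p a i + 2 * (chi (m a) i + chi (l1 a) i + chi (m3 a) i)
    - (chi (m (a - 1)) i + chi (l1 (a - 1)) i + chi (m3 (a - 1)) i)
    - (chi (m (Suc a)) i + chi (l1 (Suc a)) i + chi (m3 (Suc a)) i)" using True by (simp add: q1_def q11_def upd_def)
  ultimately show ?thesis by simp
 qed (auto simp: upd_def p1_def p11_def q1_def q11_def)
qed

lemma pB: "1 <= a ==> a <= N ==> upd N q11 m3 a i = q11 a i - (if a = N & kk <= i then 1 else 0)"
 using m3[of a] m3[of "a - 1"] m3[of "Suc a"] by (cases "a = N") (auto simp: upd_def chi_const)

lemma S11_final: "rm N S11 m3 q11 (upd N q11 m3) = S11" using m3 by (auto simp: rm_def)

text \<open>From b on one string is shortened twice in both orders. Left of b the strings taken by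
  \<open>l\<close> and \<open>m\<close> lie on different sides of \<open>kk\<close>, so the removals
  do not interfere.\<close>

lemma final_node:
 assumes a: "1 <= a" "a <= N"
 shows "rm N R1 m2 p11 (upd N p11 m2) a = rm N S1 l1 q1 q11 a"
proof (cases "b <= a")
 case True
 have e: "l a = enat (Suc kk)" "m a = enat (Suc kk)" "m2 a = enat kk" "l1 a = enat kk" using True a b(4) m_mid[of a] m2[of a] l1[of a] by auto
 have 1: "p11 a kk = p1 a kk" using p11[of a kk] a by auto
 have 2: "upd N p11 m2 a (kk - 1) = q11 a (kk - 1)" if "1 < kk" using pB[of a "kk - 1"] a that final_p by auto
 show ?thesis using e 1 2 k by (auto simp: rm_def R1_def S1_def)
next
 case False
 have e: "m2 a = m a" "l1 a = l a" using False a m2 l1 by auto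
 have la: "l a <= enat kk" using b(3) False by auto
 then obtain i where i: "l a = enat i" by (cases "l a") auto
 have ik: "i <= kk" using la i by simp
 have S: "(i, p a i) \<in># R a" "1 <= i" using up_sing'[of a k p R i] i a valid_pos[OF v] by (auto simp: sing_def)
 have 2: "q1 a i = p a i" using q1_low a ik by auto
 have l1s: "l1 (a - 1) <= l1 a" "l1 a <= l1 (Suc a)" using up_mono[of "a - 1" a k q1 S1] up_mono[of a "Suc a" k q1 S1] by auto
 have 3: "q11 a (i - 1) = p1 a (i - 1)"
 proof -
  have "enat (i - 1) < l1 a" "enat (i - 1) < l a" using i e S by auto
  moreover have "enat (i - 1) < l1 (Suc a)" "enat (i - 1) < l (Suc a)" using calculation l1s(2) l_mono(2)[of a] by auto
  moreover have "l1 (a - 1) = l (a - 1)" using l1[of "a - 1"] False a by auto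
  moreover have "q1 a (i - 1) = p a (i - 1)" using q1_low a ik by auto
  ultimately show ?thesis using a by (simp add: q11_eq p1_eq)
 qed
 have 5: "upd N p11 m2 a (i - 1) = p1 a (i - 1)" using pB[of a "i - 1"] 3 a final_p ik S(2) by auto
 show ?thesis
 proof (cases "m a")
  case infinity
  thus ?thesis using e i 2 3 by (simp add: rm_def R1_def S1_def)
 next
  case (enat j)
  have kj: "Suc kk <= j" using m_ge[of a] enat by simp
  have T: "(j, p a j) \<in># R a" using dn_sing[of a N "Suc kk" p R j] enat a by (simp add: sing_def)
  have "l (a - 1) <= enat j" "l a <= enat j" using l_mono(1)[of a] la kj by (auto intro: order_trans[of _ "enat kk"])
  hence 1: "p11 a j = p a j"
  proof (cases "a = N")
   case True thus ?thesis using p11[of a j] p1_N[of j] a kj \<open>l a <= enat j\<close> by auto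
  next
   case F: False
   hence "l (Suc a) <= enat j" using l_le[of "Suc a"] a kj by (auto intro: order_trans)
   thus ?thesis using p11[of a j] p1_above[of a j] a F by auto
  qed
  have kj': "enat kk <= enat (j - 1)" using kj by simp
  have 4: "upd N p11 m2 a (j - 1) = q1 a (j - 1)"
  proof -
   have x: "l1 a <= enat (j - 1)" "l1 (a - 1) <= enat (j - 1)" using order_trans[OF l1_kk[of a] kj'] order_trans[OF l1_kk[of "a - 1"] kj'] a by auto
   show ?thesis
   proof (cases "a = N")
    case True
    thus ?thesis using pB[of a "j - 1"] x l1_end a kj' final_p by (simp add: q11_eq)
   next
    case F: False
    hence "l1 (Suc a) <= enat (j - 1)" using l1_kk[of "Suc a"] a kj' by (auto intro: order_trans)
    thus ?thesis using pB[of a "j - 1"] x a F final_p by (simp add: q11_eq)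
   qed
  qed
  have ij: "i ~= j" using ik kj by simp
  have "R a - {#(i, p a i)#} + U - {#(j, p a j)#} + V = R a - {#(j, p a j)#} + V - {#(i, p a i)#} + U" for U V
   by (rule two_removals) (use S T ij in auto)
  from this[of "if 1 < i then {#(i - 1, p1 a (i - 1))#} else {#}" "if 1 < j then {#(j - 1, q1 a (j - 1))#} else {#}"]
  show ?thesis using a e i enat 1 2 3 4 by (cases "1 < i"; cases "1 < j") (simp_all add: rm_def R1_def S1_def del: up.simps)
 qed
qed

lemma final_R: "rm N R11 m2 p11 (upd N p11 m2) = rm N S11 m3 q11 (upd N q11 m3)"
proof
 fix a
 have 1: "rm N R11 m2 p11 (upd N p11 m2) a = rm N R1 m2 p11 (upd N p11 m2) a" using fun_cong[OF R11, of a] by (simp add: rm_def split: enat.split)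
 have 2: "rm N R1 m2 p11 (upd N p11 m2) a = S11 a"
 proof (cases "1 <= a & a <= N")
  case True thus ?thesis unfolding S11_def using final_node by blast
 next
  case False
  hence "rm N Q s x y a = Q a" for Q s x y by (auto simp: rm_def)
  thus ?thesis by (simp only: S11_def R1_def S1_def)
 qed
 show "rm N R11 m2 p11 (upd N p11 m2) a = rm N S11 m3 q11 (upd N q11 m3) a" using 1 2 fun_cong[OF S11_final, of a] by simp
qed

end

text \<open>The row letter is N + 1 in both orders. Of the two dual letters one is N + 1 and the
  other is the dual letter of X; the orders only interchange the two.\<close>

theorem failing_hexagon:
 assumes v: "validS N X" and k: "1 <= k" and N: "1 <= N" and F: "failing N k k' X"
 shows "uletter k X = Suc N" "dletter N k' (upS N k X) = Suc N"
  "uletter k (dnS N k' X) = Suc N" "dletter N (k' - 1) (upS N k (dnS N k' X)) = Suc N"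
  "dletter N (k' - 1) (dnS N k' (upS N k X)) = dletter N k' X"
  "dnS N (k' - 1) (dnS N k' (upS N k X)) = dnS N (k' - 1) (upS N k (dnS N k' X))"
proof -
 obtain p R where X: "X = (p, R)" by (cases X)
 obtain kk where kk: "k' = Suc kk" "k <= kk" using F by (cases k') (auto simp: failing_def)
 interpret hexagon N k kk p R by unfold_locales (use v k N F kk in \<open>auto simp: validS_def failing_def X\<close>)
 have e: "upS N k X = (p1, R1)" "dnS N k' (p1, R1) = (p11, R11)" "dnS N k' X = (q1, S1)" "upS N k (q1, S1) = (q11, S11)"
  by (simp_all add: X kk upS_def dnS_def p1_def R1_def p11_def R11_def q1_def S1_def q11_def S11_def)
 have vs: "validS N (p, R)" "validS N (p1, R1)" "validS N (p11, R11)" "validS N (q1, S1)" "validS N (q11, S11)"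
  using v v1 v11 vq1 vq11 by (auto simp: validS_def)
 have lf: "l N ~= \<infinity>" "l1 N ~= \<infinity>" using lN l1_kk[of N] by (cases "l N"; cases "l1 N"; simp)+
 show "uletter k X = Suc N" unfolding X by (rule uletter_eqI[OF vs(1)]) (use lf l_end in \<open>auto simp del: up.simps\<close>)
 show "dletter N k' (upS N k X) = Suc N" unfolding e by (rule dletter_eqI[OF vs(2)]) (use m1[of N] in \<open>auto simp: kk\<close>)
 show "uletter k (dnS N k' X) = Suc N" unfolding e by (rule uletter_eqI[OF vs(4)]) (use lf l1_end in \<open>auto simp del: up.simps\<close>)
 show "dletter N (k' - 1) (upS N k (dnS N k' X)) = Suc N" unfolding e by (rule dletter_eqI[OF vs(5)]) (use m3[of N] in \<open>auto simp: kk\<close>)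
 show "dletter N (k' - 1) (dnS N k' (upS N k X)) = dletter N k' X" unfolding e unfolding X
 proof (rule dletter_cong[OF vs(3) vs(1)])
  fix a assume "a <= Suc N"
  thus "(dn N (k' - 1) (fst (p11, R11)) (snd (p11, R11)) a = \<infinity>) = (dn N k' (fst (p, R)) (snd (p, R)) a = \<infinity>)"
   by (cases "a = Suc N") (use m2[of a] m_mid[of a] in \<open>auto simp: kk\<close>)
 qed
 show "dnS N (k' - 1) (dnS N k' (upS N k X)) = dnS N (k' - 1) (upS N k (dnS N k' X))" unfolding e using final_p final_R by (simp add: dnS_def kk)
qed

section \<open>Whole rows and the exchange of a row with a dual row\<close>

fun cntU :: "nat => nat => state => nat => nat" where
 "cntU N 0 X a = 0"
| "cntU N (Suc k) X a = cntU N k (upS N (Suc k) X) a + of_bool (a = uletter (Suc k) X)"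

fun endU :: "nat => nat => state => state" where
 "endU N 0 X = X"
| "endU N (Suc k) X = endU N k (upS N (Suc k) X)"

fun cntD :: "nat => nat => state => nat => nat" where
 "cntD N 0 X a = 0"
| "cntD N (Suc k) X a = cntD N k (dnS N (Suc k) X) a + of_bool (a = dletter N (Suc k) X)"

fun endD :: "nat => nat => state => state" where
 "endD N 0 X = X"
| "endD N (Suc k) X = endD N k (dnS N (Suc k) X)"

lemma validS_endU: "validS N X ==> validS N (endU N k X)" by (induction k arbitrary: X) (simp_all add: validS_upS)

lemma validS_endD: "validS N X ==> validS N (endD N k X)" by (induction k arbitrary: X) (simp_all add: validS_dnS)

lemma endD_flip: "validS N X ==> endD N k (flipS N X) = flipS N (endU N k X)"
 by (induction k arbitrary: X) (simp_all add: flipS_upS[symmetric] validS_upS)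

lemma endU_flip: "validS N X ==> endU N k (flipS N X) = flipS N (endD N k X)"
 by (induction k arbitrary: X) (simp_all add: flipS_dnS[symmetric] validS_dnS)

lemma cntD_flip: "validS N X ==> 1 <= a ==> a <= Suc N ==> cntD N k (flipS N X) a = cntU N k X (N + 2 - a)"
proof (induction k arbitrary: X)
 case (Suc k)
 have "a = N + 2 - uletter (Suc k) X \<longleftrightarrow> N + 2 - a = uletter (Suc k) X" using uletter_bounds[OF Suc.prems(1), of "Suc k"] by auto
 thus ?case using Suc by (simp add: flipS_upS[symmetric] validS_upS dletter_flip)
qed simp

lemma cntU_flip: "validS N X ==> 1 <= a ==> a <= Suc N ==> cntU N k (flipS N X) a = cntD N k X (N + 2 - a)"
proof (induction k arbitrary: X)
 case (Suc k)
 have "a = N + 2 - dletter N (Suc k) X \<longleftrightarrow> N + 2 - a = dletter N (Suc k) X"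
  using dletter_bounds[OF Suc.prems(1), of "Suc k"] by auto
 thus ?case using Suc by (simp add: flipS_dnS[symmetric] validS_dnS uletter_flip)
qed simp

lemma cntU_sum: "validS N X ==> (\<Sum>a = 1..Suc N. cntU N k X a) = k"
proof (induction k arbitrary: X)
 case (Suc k)
 have "(\<Sum>a = 1..Suc N. of_bool (a = uletter (Suc k) X)) = (1::nat)" using uletter_bounds[OF Suc.prems, of "Suc k"] by simp
 thus ?case using Suc.IH[OF validS_upS[OF Suc.prems]] by (simp add: sum.distrib)
qed simp

lemma cntD_sum: "validS N X ==> (\<Sum>a = 1..Suc N. cntD N k X a) = k"
proof (induction k arbitrary: X)
 case (Suc k)
 have "(\<Sum>a = 1..Suc N. of_bool (a = dletter N (Suc k) X)) = (1::nat)" using dletter_bounds[OF Suc.prems, of "Suc k"] by simp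
 thus ?case using Suc.IH[OF validS_dnS[OF Suc.prems]] by (simp add: sum.distrib)
qed simp

text \<open>The strings shortened by a chain are singular, so the next chain, started one lower,
  finds something at least one shorter at each node. It gets at least as far, hence the letters of a
  row increase weakly.\<close>

lemma up_strict:
 assumes k: "1 <= k"
 shows "a <= N ==> up (Suc k) (fst X) (snd X) a = enat j ==>
  up k (fst (upS N (Suc k) X)) (snd (upS N (Suc k) X)) a <= enat (j - 1)"
proof (induction a arbitrary: j)
 case 0 thus ?case by auto
next
 case (Suc a)
 let ?l = "up (Suc k) (fst X) (snd X)"
 obtain p R where X: "X = (p, R)" by (cases X)
 have "enat (Suc k) <= ?l (Suc a)" by (rule up_ge)
 hence jk: "Suc k <= j" using Suc.prems by simp
 have "?l a <= ?l (Suc a)" using up_mono[of a "Suc a"] by simp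
 then obtain i where i: "?l a = enat i" "i <= j" using Suc.prems by (cases "?l a") auto
 have IH: "up k (fst (upS N (Suc k) X)) (snd (upS N (Suc k) X)) a <= enat (i - 1)" using Suc.IH[of i] Suc.prems i by simp
 have le: "up k (fst (upS N (Suc k) X)) (snd (upS N (Suc k) X)) a <= enat (j - 1)" using i(2) by (intro order_trans[OF IH]) auto
 have "sing (fst (upS N (Suc k) X)) (snd (upS N (Suc k) X)) (Suc a) (j - 1)" using jk k Suc.prems by (auto simp: upS_def X intro!: sing_rm_new)
 thus ?case using first_le[OF le] by simp
qed

lemma uletter_mono:
 assumes "validS N X" "1 <= k"
 shows "uletter (Suc k) X <= uletter k (upS N (Suc k) X)"
proof (rule ccontr)
 assume n: "~ ?thesis"
 let ?y = "uletter k (upS N (Suc k) X)"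
 have v1: "validS N (upS N (Suc k) X)" using assms by (intro validS_upS) auto
 have "up (Suc k) (fst X) (snd X) ?y ~= \<infinity>" using up_fin[OF assms(1), of "Suc k" ?y] n by simp
 then obtain j where j: "up (Suc k) (fst X) (snd X) ?y = enat j" by auto
 have "?y <= N" using n uletter_bounds[OF assms(1), of "Suc k"] by simp
 hence "up k (fst (upS N (Suc k) X)) (snd (upS N (Suc k) X)) ?y <= enat (j - 1)" using up_strict[OF assms(2) _ j] by blast
 thus False using up_fin[OF v1, of k ?y] by auto
qed

lemma dletter_mono:
 assumes "validS N X" "1 <= k"
 shows "dletter N k (dnS N (Suc k) X) <= dletter N (Suc k) X"
proof -
 have v': "validS N (flipS N X)" using assms by (simp add: validS_flip)
 have v1: "validS N (dnS N (Suc k) X)" using assms by (intro validS_dnS) auto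
 have "uletter (Suc k) (flipS N X) <= uletter k (upS N (Suc k) (flipS N X))" by (rule uletter_mono[OF v' assms(2)])
 thus ?thesis
  using dletter_bounds[OF assms(1), of "Suc k"] unfolding flipS_dnS[OF assms(1), symmetric] uletter_flip[OF assms(1)] uletter_flip[OF v1] by linarith
qed

lemma cntU_below: "validS N X ==> a < uletter k X ==> cntU N k X a = 0"
proof (induction k arbitrary: X)
 case (Suc k)
 thus ?case
 proof (cases k)
  case 0 thus ?thesis using Suc by auto
 next
  case (Suc k')
  have "a < uletter k (upS N (Suc k) X)" using Suc Suc.prems uletter_mono[OF Suc.prems(1), of k] by auto
  thus ?thesis using Suc.IH[OF validS_upS[OF Suc.prems(1)]] Suc.prems by simp
 qed
qed simp

lemma cntU_below_next:
 assumes "validS N X" "a < uletter k X" "1 <= k"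
 shows "cntU N (k - 1) (upS N k X) a = 0" using cntU_below[OF assms(1,2)] assms(3) by (cases k) auto

lemma cntD_above: "validS N X ==> dletter N k X < a ==> cntD N k X a = 0"
proof (induction k arbitrary: X)
 case (Suc k)
 thus ?case
 proof (cases k)
  case 0 thus ?thesis using Suc by auto
 next
  case (Suc k')
  have "dletter N k (dnS N (Suc k) X) < a" using Suc Suc.prems dletter_mono[OF Suc.prems(1), of k] by auto
  thus ?thesis using Suc.IH[OF validS_dnS[OF Suc.prems(1)]] Suc.prems by simp
 qed
qed simp

lemma cntD_above_next:
 assumes "validS N X" "dletter N k X < a" "1 <= k"
 shows "cntD N (k - 1) (dnS N k X) a = 0" using cntD_above[OF assms(1,2)] assms(3) by (cases k) auto

text \<open>The combinatorial R-matrix between a dual row (multiplicities \<open>d\<close>) and a row (multiplicities \<open>m\<close>):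
 the differences are kept and the common parts are shifted cyclically.\<close>

definition shifted :: "nat => (nat => nat) => (nat => nat) => (nat => nat) => (nat => nat) => bool" where
 "shifted N m d m' d' \<longleftrightarrow>
  (\<forall>a. 1 <= a & a <= Suc N --> m a + d' a = m' a + d a) &
  (\<forall>a. 1 <= a & a <= N --> min (m' a) (d' a) = min (m (Suc a)) (d (Suc a))) &
  min (m' (Suc N)) (d' (Suc N)) = min (m 1) (d 1)"

text \<open>Adds one row letter and one dual letter to a pair of rows. \<open>A\<close> is the inner
  pair, \<open>H\<close> and \<open>T\<close> extend it by one letter on one side. Distinct letters
  change corresponding minima by the same amount. An equal pair moves from y to y - 1, as the cyclic
  shift demands; there \<open>y\<close> and \<open>z'\<close> make the relevant multiplicities zero.
  The wrap from 1 to N + 1 needs the balance \<open>E\<close>.\<close>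

lemma shifted_square:
 assumes N: "1 <= N" and A: "shifted N mA dA mA' dA'"
  and H: "shifted N mh dh (%a. mA' a + of_bool (a = y)) dA'"
  and T: "shifted N mA (%a. dA a + of_bool (a = z')) mt' dt'"
  and rule: "local_rule N z y y' z'"
  and b: "1 <= y" "y <= Suc N" "1 <= z'" "z' <= Suc N"
  and y: "!!a. a < y ==> mA' a = 0" and z': "!!a. z' < a ==> dA a = 0"
  and E: "z = 1 ==> y = 1 ==> mA 1 = dA 1 & mA (Suc N) <= dA (Suc N)"
 shows "shifted N mh (%a. dh a + of_bool (a = z)) (%a. mt' a + of_bool (a = y')) dt'"
proof -
 have w: "mA a + dA' a = mA' a + dA a" "mh a + dA' a = mA' a + of_bool (a = y) + dh a"
  "mA a + dt' a = mt' a + dA a + of_bool (a = z')" if "1 <= a" "a <= Suc N" for a using A H T that unfolding shifted_def by auto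
 define s where "s a = (if a = Suc N then 1 else Suc a)" for a
 have s: "1 <= s a" "s a <= Suc N" if "1 <= a" "a <= Suc N" for a using that by (auto simp: s_def)
 have c: "min (mA' a) (dA' a) = min (mA (s a)) (dA (s a))"
  "min (mA' a + of_bool (a = y)) (dA' a) = min (mh (s a)) (dh (s a))"
  "min (mt' a) (dt' a) = min (mA (s a)) (dA (s a) + of_bool (s a = z'))" if "1 <= a" "a <= Suc N" for a
  using A H T that unfolding shifted_def s_def by auto
 have inc1: "min (x + of_bool P) v = min x v + of_bool (P & x < v)" for x v :: nat and P by auto
 have inc2: "min x (v + of_bool P) = min x v + of_bool (P & v < x)" for x v :: nat and P by auto
 \<comment> \<open>The increments of the minima on the two sides, with \<open>s\<close> the cyclic
   successor.\<close>
 have key: "of_bool (a = y' & mt' a < dt' a) + of_bool (s a = z' & dA (s a) < mA (s a)) =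
  (of_bool (s a = z & dh (s a) < mh (s a)) + of_bool (a = y & mA' a < dA' a) :: nat)"
  if a: "1 <= a" "a <= Suc N" for a
 proof (cases "z = y")
  case False
  hence "y' = y" "z' = z" "y ~= z" using rule by (auto simp: local_rule_def)
  thus ?thesis using w[OF a] w[OF s[OF a]] by auto
 next
  case True
  show ?thesis
  proof (cases "y = 1")
   case y1: True
   hence yz': "y' = Suc N" "z' = Suc N" using rule True by (auto simp: local_rule_def)
   have e: "mA 1 = dA 1" "mA (Suc N) <= dA (Suc N)" using E True y1 by auto
   show ?thesis using w[of 1] w[of "Suc N"] e y1 yz' True a by (auto simp: s_def)
  next
   case False
   hence yz': "y = Suc z'" "y' = z'" using rule True by (auto simp: local_rule_def)
   have "mA' z' = 0" "dA y = 0" using y z' yz' by auto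
   thus ?thesis using w[of y] w[of z'] yz' True b by (auto simp: s_def)
  qed
 qed
 have res: "min (mt' a + of_bool (a = y')) (dt' a) = min (mh (s a)) (dh (s a) + of_bool (s a = z))"
  if a: "1 <= a" "a <= Suc N" for a using key[OF a] c[OF a] unfolding inc1 inc2 by linarith
 have ww: "mh a + dt' a = mt' a + of_bool (a = y') + (dh a + of_bool (a = z))" if a: "1 <= a" "a <= Suc N" for a
  using w[OF a] rule N by (auto simp: local_rule_def)
 show ?thesis unfolding shifted_def using ww res by (simp add: s_def)
qed

text \<open>The step for a hexagon. All remaining row letters read first are N + 1
  (\<open>mt\<close>, \<open>mh1\<close>), so the minima at the positions up to N vanish and only
  the wrap from 1 to N + 1 has to be computed.\<close>

lemma shifted_hexagon:
 assumes N: "1 <= N"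
  and T: "shifted N mB (%a. dB a + of_bool (a = z) + of_bool (a = Suc N)) mt' dt'"
  and H1: "shifted N mB (%a. dB a + of_bool (a = Suc N)) mh1 dh'"
  and H: "shifted N mh dh (%a. mh1 a + of_bool (a = Suc N)) dh'"
  and mt: "!!a. a < Suc N ==> mt' a = 0" and mh1: "!!a. a < Suc N ==> mh1 a = 0"
 shows "shifted N mh (%a. dh a + of_bool (a = z)) (%a. mt' a + of_bool (a = Suc N)) dt'"
proof -
 have w: "mB a + dt' a = mt' a + (dB a + of_bool (a = z) + of_bool (a = Suc N))"
  "mB a + dh' a = mh1 a + (dB a + of_bool (a = Suc N))"
  "mh a + dh' a = mh1 a + of_bool (a = Suc N) + dh a" if "1 <= a" "a <= Suc N" for a using T H1 H that unfolding shifted_def by auto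
 have c: "min (mt' a) (dt' a) = min (mB (Suc a)) (dB (Suc a) + of_bool (Suc a = z) + of_bool (a = N))"
  "min (mh1 a) (dh' a) = min (mB (Suc a)) (dB (Suc a) + of_bool (a = N))"
  "min (mh1 a) (dh' a) = min (mh (Suc a)) (dh (Suc a))" if "1 <= a" "a <= N" for a using T H1 H that unfolding shifted_def by auto
 have c1: "min (mt' (Suc N)) (dt' (Suc N)) = min (mB 1) (dB 1 + of_bool (1 = z))"
  "min (mh1 (Suc N)) (dh' (Suc N)) = min (mB 1) (dB 1)"
  "min (mh1 (Suc N) + 1) (dh' (Suc N)) = min (mh 1) (dh 1)" using T H1 H N unfolding shifted_def by auto
 show ?thesis unfolding shifted_def
 proof (intro conjI allI impI)
  fix a assume a: "1 <= a & a <= Suc N"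
  show "mh a + dt' a = mt' a + of_bool (a = Suc N) + (dh a + of_bool (a = z))" using w[of a] a by auto
 next
  fix a assume a: "1 <= a & a <= N"
  have 0: "mt' a = 0" "mh1 a = 0" using mt mh1 a by auto
  have "min (mh (Suc a)) (dh (Suc a) + of_bool (Suc a = z)) = 0"
  proof (cases "Suc a = z")
   case True
   hence "mB (Suc a) = 0" using c(1)[of a] a 0 by auto
   thus ?thesis using w[of "Suc a"] c(3)[of a] a 0 by auto
  next
   case False thus ?thesis using c(3)[of a] a 0 by auto
  qed
  thus "min (mt' a + of_bool (a = Suc N)) (dt' a) = min (mh (Suc a)) (dh (Suc a) + of_bool (Suc a = z))" using a 0 by auto
 next
  have "mB (Suc N) = 0" using c(2)[of N] mh1[of N] N by auto
  thus "min (mt' (Suc N) + of_bool (Suc N = Suc N)) (dt' (Suc N)) = min (mh 1) (dh 1 + of_bool (1 = z))" using w[of "Suc N"] w[of 1] c1 by auto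
 qed
qed

definition exchange :: "nat => nat => nat => state => bool" where
 "exchange N k' k X \<longleftrightarrow> endU N k (endD N k' X) = endD N k' (endU N k X) &
   shifted N (cntU N k (endD N k' X)) (cntD N k' X) (cntU N k X) (cntD N k' (endU N k X))"

text \<open>The flip turns rows into dual rows and reverses the alphabet, and the cyclic shift of
  common parts is its own mirror image under both.\<close>

lemma exchange_flip:
 assumes v: "validS N X" and e: "exchange N k k' (flipS N X)"
 shows "exchange N k' k X"
proof -
 have vU: "validS N (endU N k X)" and vD: "validS N (endD N k' X)" using v by (auto intro: validS_endU validS_endD)
 have 1: "flipS N (endU N k (endD N k' X)) = flipS N (endD N k' (endU N k X))" using e unfolding exchange_def
  by (simp add: endD_flip endU_flip v vU vD)
 hence "endU N k (endD N k' X) = endD N k' (endU N k X)" by (metis flipS_flipS validS_endD validS_endU v)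
 moreover have "shifted N (cntU N k (endD N k' X)) (cntD N k' X) (cntU N k X) (cntD N k' (endU N k X))"
 proof -
  let ?m = "cntU N k (endD N k' X)" and ?d = "cntD N k' X" and ?m' = "cntU N k X" and ?d' = "cntD N k' (endU N k X)"
  have f: "cntU N k' (endD N k (flipS N X)) a = ?d' (N + 2 - a)" "cntD N k (flipS N X) a = ?m' (N + 2 - a)"
   "cntU N k' (flipS N X) a = ?d (N + 2 - a)" "cntD N k (endU N k' (flipS N X)) a = ?m (N + 2 - a)"
   if "1 <= a" "a <= Suc N" for a using that by (simp_all add: endD_flip endU_flip cntU_flip cntD_flip v vU vD)
  have s: "shifted N (cntU N k' (endD N k (flipS N X))) (cntD N k (flipS N X)) (cntU N k' (flipS N X)) (cntD N k (endU N k' (flipS N X)))"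
   using e by (simp add: exchange_def)
  show ?thesis unfolding shifted_def
  proof (intro conjI allI impI)
   fix a assume a: "1 <= a & a <= Suc N"
   hence "N + 2 - (N + 2 - a) = a" "1 <= N + 2 - a" "N + 2 - a <= Suc N" by auto
   thus "?m a + ?d' a = ?m' a + ?d a" using s f[of "N + 2 - a"] unfolding shifted_def by (metis add.commute)
  next
   fix a assume a: "1 <= a & a <= N"
   hence *: "N + 2 - (N + 1 - a) = Suc a" "1 <= N + 1 - a" "N + 1 - a <= N" "N + 2 - Suc (N + 1 - a) = a" by auto
   hence "min (cntU N k' (flipS N X) (N + 1 - a)) (cntD N k (endU N k' (flipS N X)) (N + 1 - a))
    = min (cntU N k' (endD N k (flipS N X)) (Suc (N + 1 - a))) (cntD N k (flipS N X) (Suc (N + 1 - a)))" using s unfolding shifted_def by blast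
   thus "min (?m' a) (?d' a) = min (?m (Suc a)) (?d (Suc a))" using f[of "N + 1 - a"] f[of "Suc (N + 1 - a)"] * a by (simp add: min.commute)
  next
   have "min (cntU N k' (flipS N X) (Suc N)) (cntD N k (endU N k' (flipS N X)) (Suc N))
    = min (cntU N k' (endD N k (flipS N X)) 1) (cntD N k (flipS N X) 1)" using s unfolding shifted_def by blast
   thus "min (?m' (Suc N)) (?d' (Suc N)) = min (?m 1) (?d 1)" using f[of 1] f[of "Suc N"] by simp
  qed
 qed
 ultimately show ?thesis by (simp add: exchange_def)
qed

text \<open>In the degenerate square both rows consist of the extreme letter, and what remains is balanced.\<close>

lemma degenerate_balanced:
 assumes N: "1 <= N"
  and A: "shifted N mA dA mA' dA'"
  and H: "shifted N mh dh (%a. mA' a + of_bool (a = 1)) dA'"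
  and T: "shifted N mA (%a. dA a + of_bool (a = Suc N)) mt' dt'"
  and mt: "!!a. a < Suc N ==> mt' a = 0" and dh: "!!a. 1 < a ==> dh a = 0"
  and sum: "(\<Sum>a = 1..Suc N. mA a) = (\<Sum>a = 1..Suc N. dA a)"
 shows "1 <= a ==> a <= Suc N ==> mA a = dA a"
  and "2 <= a ==> a <= Suc N ==> mA a = 0"
proof -
 have w: "mA a + dA' a = mA' a + dA a" "mh a + dA' a = mA' a + of_bool (a = 1) + dh a"
  "mA a + dt' a = mt' a + (dA a + of_bool (a = Suc N))" if "1 <= a" "a <= Suc N" for a using A H T that unfolding shifted_def by auto
 have c: "min (mt' a) (dt' a) = min (mA (Suc a)) (dA (Suc a) + of_bool (a = N))" if "1 <= a" "a <= N" for a using T that unfolding shifted_def by auto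
 have z: "mA (Suc N) = 0" using c[of N] mt[of N] N by auto
 have ge: "dA a <= mA a" if "2 <= a" "a <= Suc N" for a using w[of a] dh[of a] that by auto
 have le: "mA a <= dA a" if "1 <= a" "a <= N" for a using w[of a] mt[of a] that by auto
 have eq2: "mA a = dA a" if "2 <= a" "a <= Suc N" for a using ge[OF that] le[of a] z that by (cases "a = Suc N") auto
 have "{1..Suc N} = insert 1 {2..Suc N}" by auto
 \<comment> \<open>Balance is known at all positions except 1; the equal totals supply this last
   one.\<close>
 hence "mA 1 + (\<Sum>a = 2..Suc N. mA a) = dA 1 + (\<Sum>a = 2..Suc N. dA a)" using sum by simp
 moreover have "(\<Sum>a = 2..Suc N. mA a) = (\<Sum>a = 2..Suc N. dA a)" by (rule sum.cong) (use eq2 in auto)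
 ultimately have "mA 1 = dA 1" by simp
 thus "1 <= a ==> a <= Suc N ==> mA a = dA a" using eq2 by (cases "a = 1") auto
 show "2 <= a ==> a <= Suc N ==> mA a = 0" using c[of "a - 1"] mt[of "a - 1"] eq2[of a] by auto
qed


lemma up_le_start:
 assumes "validS N X" "1 <= k" "k <= k'" "1 <= N"
  and "~ failing N k k' X" "~ (k = k' & constant_chains N k X)"
 shows "\<exists>b c q. crossing N b c (fst X) (snd X) (up k (fst X) (snd X)) (dn N k' (fst X) (snd X)) q"
 by (rule ex_crossing) (use assms in \<open>auto simp: validS_def failing_def constant_chains_def\<close>)

text \<open>Induction on k + k', with k <= k' by the flip. Removing one letter of each kind closes a
  square or, for \<open>failing\<close>, a hexagon; the induction hypothesis covers the remaining
  rows at its other corners, and \<open>shifted_square\<close> or \<open>shifted_hexagon\<close>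
  puts the letters back.\<close>

theorem exchange_all:
 assumes N: "1 <= N"
 shows "validS N X ==> exchange N k' k X"
proof (induction "k + k'" arbitrary: k k' X rule: less_induct)
 case less
 note v = less.prems
 have main: "exchange N k' k X" if v: "validS N X" and kk: "k <= k'"
  and IH: "!!j j' Y. j + j' < k + k' ==> validS N Y ==> exchange N j' j Y" for k k' X
 proof (cases "k = 0")
  case True
  thus ?thesis by (auto simp: exchange_def shifted_def)
 next
  case k0: False
  hence k: "1 <= k" "1 <= k'" using kk by auto
  obtain j where j: "k = Suc j" using k by (cases k) auto
  obtain j' where j': "k' = Suc j'" using k by (cases k') auto
  let ?Xh = "dnS N k' X" and ?X1 = "upS N k X"
  have vh: "validS N ?Xh" and v1: "validS N ?X1" using v k validS_dnS validS_upS by auto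
  have Eh: "exchange N j' k ?Xh" and E1: "exchange N k' j ?X1" using IH vh v1 j j' by auto
  show ?thesis
  proof (cases "failing N k k' X")
   case F: True
   hence kk': "k < k'" by (simp add: failing_def)
   obtain i where i: "j' = Suc i" using j j' kk' by (cases j') auto
   note hex = failing_hexagon[OF v k(1) N F]
   have jj: "k' - 1 = j'" using j' by simp
   note hex = hex[unfolded jj]
   let ?X11 = "dnS N k' ?X1" and ?Xh1 = "upS N k ?Xh"
   let ?B = "dnS N j' ?X11"
   have vh1: "validS N ?Xh1" and v11: "validS N ?X11" using vh v1 k validS_dnS validS_upS by auto
   have B: "dnS N j' ?Xh1 = ?B" using hex by simp
   have Eh1: "exchange N j' j ?Xh1" using IH vh1 j j' by auto
   define z where "z = dletter N k' X"
   have mt: "cntU N j ?X1 a = 0" if "a < Suc N" for a using cntU_below_next[OF v, of a k] hex(1) that j by simp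
   have mh1: "cntU N j ?Xh1 a = 0" if "a < Suc N" for a using cntU_below_next[OF vh, of a k] hex(3) that j by simp
   have T: "shifted N (cntU N j (endD N i ?B)) (%a. cntD N i ?B a + of_bool (a = z) + of_bool (a = Suc N))
     (cntU N j ?X1) (cntD N k' (endU N j ?X1))"
   proof -
    have "cntD N k' ?X1 = (%a. cntD N i ?B a + of_bool (a = z) + of_bool (a = Suc N))" using hex(2,5) by (auto simp: j' i z_def)
    moreover have "endD N k' ?X1 = endD N i ?B" by (simp add: j' i)
    ultimately show ?thesis using E1 unfolding exchange_def by (metis (no_types))
   qed
   have H1: "shifted N (cntU N j (endD N i ?B)) (%a. cntD N i ?B a + of_bool (a = Suc N))
     (cntU N j ?Xh1) (cntD N j' (endU N j ?Xh1))"
   proof -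
    have "cntD N j' ?Xh1 = (%a. cntD N i ?B a + of_bool (a = Suc N))" using hex(4) B by (auto simp: i)
    moreover have "endD N j' ?Xh1 = endD N i ?B" using B by (simp add: i)
    ultimately show ?thesis using Eh1 unfolding exchange_def by (metis (no_types))
   qed
   have H: "shifted N (cntU N k (endD N j' ?Xh)) (cntD N j' ?Xh)
     (%a. cntU N j ?Xh1 a + of_bool (a = Suc N)) (cntD N j' (endU N j ?Xh1))"
   proof -
    have "cntU N k ?Xh = (%a. cntU N j ?Xh1 a + of_bool (a = Suc N))" using hex(3) by (auto simp: j)
    moreover have "endU N k ?Xh = endU N j ?Xh1" by (simp add: j)
    ultimately show ?thesis using Eh unfolding exchange_def by (metis (no_types))
   qed
   have S: "shifted N (cntU N k (endD N j' ?Xh)) (%a. cntD N j' ?Xh a + of_bool (a = z))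
     (%a. cntU N j ?X1 a + of_bool (a = Suc N)) (cntD N k' (endU N j ?X1))" by (rule shifted_hexagon[OF N T H1 H mt mh1])
   have "cntD N k' X = (%a. cntD N j' ?Xh a + of_bool (a = z))" by (auto simp: j' z_def)
   moreover have "cntU N k X = (%a. cntU N j ?X1 a + of_bool (a = Suc N))" using hex(1) by (auto simp: j)
   moreover have "endD N k' X = endD N j' ?Xh" "endU N k X = endU N j ?X1" by (simp_all add: j j')
   ultimately have S': "shifted N (cntU N k (endD N k' X)) (cntD N k' X) (cntU N k X) (cntD N k' (endU N k X))" using S by simp
   have "endU N k (endD N k' X) = endU N k (endD N j' ?Xh)" by (simp add: j')
   also have "\<dots> = endD N j' (endU N j ?Xh1)" using Eh by (simp add: exchange_def j)
   also have "\<dots> = endU N j (endD N j' ?Xh1)" using Eh1 by (simp add: exchange_def)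
   also have "\<dots> = endU N j (endD N k' ?X1)" using B by (simp add: j' i)
   also have "\<dots> = endD N k' (endU N k X)" using E1 by (simp add: exchange_def j)
   finally show ?thesis using S' by (simp add: exchange_def)
  next
   case nF: False
   define z y y' z' where "z = dletter N k' X" and "y = uletter k ?Xh" and "y' = uletter k X" and "z' = dletter N k' ?X1"
   have sq: "dnS N k' ?X1 = upS N k ?Xh & local_rule N z y y' z' & (z = 1 & y = 1 --> k = k')"
   proof (cases "k = k' & constant_chains N k X")
    case True
    hence c: "constant_chains N k X" and kke: "k' = k" by auto
    show ?thesis using constant_up[OF v k(1) N c] constant_dn[OF v k(1) N c] constant_square[OF v k(1) N c]
     by (simp add: z_def y_def y'_def z'_def kke local_rule_def)
   next
    case False
    then obtain b c q where c: "crossing N b c (fst X) (snd X) (up k (fst X) (snd X)) (dn N k' (fst X) (snd X)) q"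
     using up_le_start[OF v k(1) kk N nF] by auto
    have X: "X = (fst X, snd X)" by simp
    show ?thesis using crossing_square[OF c X k] by (auto simp: z_def y_def y'_def z'_def)
   qed
   let ?A = "dnS N k' ?X1"
   have A: "upS N k ?Xh = ?A" using sq by simp
   have vA: "validS N ?A" using v1 k validS_dnS by auto
   have EA: "exchange N j' j ?A" using IH vA j j' by auto
   have A1: "shifted N (cntU N j (endD N j' ?A)) (cntD N j' ?A) (cntU N j ?A) (cntD N j' (endU N j ?A))" using EA by (simp add: exchange_def)
   have H: "shifted N (cntU N k (endD N j' ?Xh)) (cntD N j' ?Xh)
     (%a. cntU N j ?A a + of_bool (a = y)) (cntD N j' (endU N j ?A))"
   proof -
    have "cntU N k ?Xh = (%a. cntU N j ?A a + of_bool (a = y))" using A by (auto simp: j y_def)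
    moreover have "endU N k ?Xh = endU N j ?A" using A by (simp add: j)
    ultimately show ?thesis using Eh unfolding exchange_def by (metis (no_types))
   qed
   have T: "shifted N (cntU N j (endD N j' ?A)) (%a. cntD N j' ?A a + of_bool (a = z'))
     (cntU N j ?X1) (cntD N k' (endU N j ?X1))"
   proof -
    have "cntD N k' ?X1 = (%a. cntD N j' ?A a + of_bool (a = z'))" by (auto simp: j' z'_def)
    moreover have "endD N k' ?X1 = endD N j' ?A" by (simp add: j')
    ultimately show ?thesis using E1 unfolding exchange_def by (metis (no_types))
   qed
   have yb: "1 <= y" "y <= Suc N" "1 <= z'" "z' <= Suc N" using uletter_bounds[OF vh, of k] dletter_bounds[OF v1, of k'] by (auto simp: y_def z'_def)
   have y0: "cntU N j ?A a = 0" if "a < y" for a using cntU_below_next[OF vh, of a k] that j A by (simp add: y_def)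
   have z0: "cntD N j' ?A a = 0" if "z' < a" for a using cntD_above_next[OF v1, of k' a] that j' by (simp add: z'_def)
   \<comment> \<open>Letters 1, 1 force k = k'. The rows that remain then have equal length, which
     is the total needed by \<open>degenerate_balanced\<close>.\<close>
   have E: "cntU N j (endD N j' ?A) 1 = cntD N j' ?A 1 & cntU N j (endD N j' ?A) (Suc N) <= cntD N j' ?A (Suc N)"
    if zy: "z = 1" "y = 1"
   proof -
    have yz': "y' = Suc N" "z' = Suc N" using sq zy by (auto simp: local_rule_def)
    have jj: "j = j'" using sq zy j j' by auto
    have mt: "cntU N j ?X1 a = 0" if "a < Suc N" for a using cntU_below_next[OF v, of a k] that j yz' by (simp add: y'_def)
    have dh: "cntD N j' ?Xh a = 0" if "1 < a" for a using cntD_above_next[OF v, of k' a] that j' zy by (simp add: z_def)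
    have sum: "(\<Sum>a = 1..Suc N. cntU N j (endD N j' ?A) a) = (\<Sum>a = 1..Suc N. cntD N j' ?A a)"
     using cntU_sum[OF validS_endD[OF vA], of j j'] cntD_sum[OF vA, of j'] jj by simp
    have "cntU N j (endD N j' ?A) a = cntD N j' ?A a" if "1 <= a" "a <= Suc N" for a
     by (rule degenerate_balanced(1)[OF N A1 H[unfolded zy] T[unfolded yz'] mt dh sum that])
    thus ?thesis by simp
   qed
   have S: "shifted N (cntU N k (endD N j' ?Xh)) (%a. cntD N j' ?Xh a + of_bool (a = z))
     (%a. cntU N j ?X1 a + of_bool (a = y')) (cntD N k' (endU N j ?X1))" by (rule shifted_square[OF N A1 H T _ yb y0 z0 E]) (use sq in auto)
   have "cntD N k' X = (%a. cntD N j' ?Xh a + of_bool (a = z))" by (auto simp: j' z_def)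
   moreover have "cntU N k X = (%a. cntU N j ?X1 a + of_bool (a = y'))" by (auto simp: j y'_def)
   moreover have "endD N k' X = endD N j' ?Xh" "endU N k X = endU N j ?X1" by (simp_all add: j j')
   ultimately have S': "shifted N (cntU N k (endD N k' X)) (cntD N k' X) (cntU N k X) (cntD N k' (endU N k X))" using S by simp
   have "endU N k (endD N k' X) = endU N k (endD N j' ?Xh)" by (simp add: j')
   also have "\<dots> = endD N j' (endU N j ?A)" using Eh A by (simp add: exchange_def j)
   also have "\<dots> = endU N j (endD N j' ?A)" using EA by (simp add: exchange_def)
   also have "\<dots> = endU N j (endD N k' ?X1)" by (simp add: j')
   also have "\<dots> = endD N k' (endU N k X)" using E1 by (simp add: exchange_def j)
   finally show ?thesis using S' by (simp add: exchange_def)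
  qed
 qed
 show ?case
 proof (cases "k <= k'")
  case True thus ?thesis using main[OF v True] less.hyps by blast
 next
  case False
  show ?thesis
  proof (rule exchange_flip[OF v], rule main)
   show "validS N (flipS N X)" using v by (rule validS_flip)
   show "k' <= k" using False by simp
   fix j j' Y assume "j + j' < k' + k" "validS N Y"
   thus "exchange N j' j Y" using less.hyps[of j j' Y] by simp
  qed
 qed
qed

section \<open>Rows of a flip-invariant configuration\<close>

context crossing
begin

lemma chi_pair:
 assumes "commuting m' l'" "e <= Suc N"
 shows "chi (l e) i + chi (m' e) i = chi (m e) i + chi (l' e) i" using m'_eq[OF assms] l'_eq[OF assms] lq[of e] mq[of e] by auto

text \<open>What both removals together do to a node of the plateau. In \<open>nearly\<close> and
  \<open>both\<close> a string with rigging one below its vacancy number is hit; at a node with even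
  vacancy numbers these are strings with odd rigging.\<close>

lemma mid_cases:
 fixes m' l'
 defines "p2 \<equiv> upd N p1 m'" and "R2 \<equiv> rm N R1 m' p1 (upd N p1 m')"
 assumes c: "commuting m' l'" and a: "b <= a" "a <= c"
 obtains (untouched) "q = \<infinity>" "r = \<infinity>" "R2 a = R a"
 | (nearly) i where "q = \<infinity>" "r = enat i" "b = c" "1 <= i" "(i, p a i - 1) \<in># R a"
   "R2 a = R a - {#(i, p a i - 1)#} + (if 1 < i then {#(i - 1, p2 a (i - 1))#} else {#})"
 | (twice) j where "q = enat (Suc j)" "1 <= j" "(Suc j, p a (Suc j)) \<in># R a"
   "R2 a = R a - {#(Suc j, p a (Suc j))#} + (if 1 < j then {#(j - 1, p2 a (j - 1))#} else {#})"
 | (both) i j where "q = enat (Suc j)" "i < j" "1 <= i" "(Suc j, p a (Suc j)) \<in># R a" "(i, p a i - 1) \<in># R a"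
   "R2 a = R a - {#(Suc j, p a (Suc j))#} + {#(j, p a j - 1)#} - {#(i, p a i - 1)#}
    + (if 1 < i then {#(i - 1, p2 a (i - 1))#} else {#})"
proof -
 have aN: "1 <= a" "a <= N" using a bc by auto
 have e: "m' a = r" "l a = q" "m a = q" using m'_eq[OF c, of a] lq[OF a] mq[OF a] a aN by auto
 have pp: "p1 a i = p a i - 1" if "b = c" "enat i < q" "r <= enat i" for i using a that r_ge l_mono[of a "Suc a"] e aN by (simp add: p1_eq)
 have mem: "(i, p a i - 1) \<in># R a" if "~ b < c" "r = enat i" "enat (Suc i) ~= q" for i using r_nlt that a bc first_sat by fastforce
 have pos: "1 <= i" if "r = enat i" for i using order_trans[OF m_pos[of "Suc c"] r_ge(2)] that bc by (simp add: one_enat_def)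
 show ?thesis
 proof (cases q)
  case q: infinity
  show ?thesis
  proof (cases r)
   case infinity
   thus ?thesis using e q untouched by (simp add: rm_def R1_def R2_def)
  next
   case (enat i)
   hence nb: "~ b < c" using r_lt q by auto
   hence "p1 a i = p a i - 1" using pp[of i] q enat bc by auto
   thus ?thesis using e q enat aN nb mem[of i] bc pos[of i] by (intro nearly[of i]) (auto simp: rm_def R1_def R2_def p2_def)
  qed
 next
  case (enat j')
  then obtain j where j: "q = enat (Suc j)" using q_Suc by blast
  obtain i where i: "r = enat i" "i <= j" using r_le[OF j] by (cases r) auto
  have i1: "1 <= i" using pos i by auto
  have S: "(Suc j, p a (Suc j)) \<in># R a" using l_sing[of a "Suc j"] e j aN by (auto simp: sing_def)
  show ?thesis
  proof (cases "i = j")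
   case True
   thus ?thesis using e j i aN i1 S by (intro twice[of j]) (auto simp: rm_def R1_def R2_def p2_def)
  next
   case False
   hence nb: "~ b < c" using r_lt i j by (auto simp: one_enat_def)
   hence "p1 a i = p a i - 1" "p1 a j = p a j - 1" using pp[of i] pp[of j] i j bc by auto
   thus ?thesis using e j i aN i1 S mem[of i] nb False by (intro both[of j i]) (auto simp: rm_def R1_def R2_def p2_def)
  qed
 qed
qed

end

text \<open>Fixed points of the exchange followed by the flip: read in the other order, the row has
  the multiplicities of the dual row reversed, and vice versa.\<close>

definition virtual_counts :: "nat => (nat => nat) => (nat => nat) => bool" where
 "virtual_counts N m d \<longleftrightarrow> shifted N m d (%a. d (N + 2 - a)) (%a. m (N + 2 - a))"

lemma shifted_cong:
 assumes "!!a. 1 <= a ==> a <= Suc N ==> m a = M a & d a = D a & m' a = M' a & d' a = D' a"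
 shows "shifted N m d m' d' \<longleftrightarrow> shifted N M D M' D'" unfolding shifted_def using assms by auto

text \<open>Two numbers are determined by their difference and their minimum.\<close>

lemma shifted_unique:
 assumes "shifted N m d m' d'" "shifted N m d m'' d''" "1 <= a" "a <= Suc N"
 shows "m' a = m'' a & d' a = d'' a"
proof -
 have 1: "m a + d' a = m' a + d a" "m a + d'' a = m'' a + d a" using assms unfolding shifted_def by auto
 have 2: "min (m' a) (d' a) = min (m'' a) (d'' a)" using assms unfolding shifted_def by (cases "a = Suc N") auto
 show ?thesis using 1 2 by auto
qed

text \<open>For an invariant state, reading the row first is the mirror image of reading the dual
  row first, so the exchange relation turns into a condition on one pair of multiplicities.\<close>

lemma symmetric_counts:
 assumes N: "1 <= N" and v: "validS N X" and s: "flipS N X = X"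
 shows "virtual_counts N (cntU N k (endD N k X)) (cntD N k X)"
  and "flipS N (endU N k (endD N k X)) = endU N k (endD N k X)"
proof -
 have vD: "validS N (endD N k X)" using v by (rule validS_endD)
 have e: "endU N k X = flipS N (endD N k X)" using endU_flip[OF v, of k] s by simp
 have ex: "exchange N k k X" using exchange_all[OF N v] .
 have 1: "cntU N k X a = cntD N k X (N + 2 - a)" if "1 <= a" "a <= Suc N" for a using cntU_flip[OF v that, of k] s by simp
 have 2: "cntD N k (endU N k X) a = cntU N k (endD N k X) (N + 2 - a)" if "1 <= a" "a <= Suc N" for a using cntD_flip[OF vD that, of k] e by simp
 show "virtual_counts N (cntU N k (endD N k X)) (cntD N k X)" using conjunct2[OF ex[unfolded exchange_def]] unfolding virtual_counts_def
  by (rule iffD1[OF shifted_cong, rotated]) (use 1 2 in simp)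
 have "flipS N (endU N k (endD N k X)) = endD N k (endU N k X)" using endD_flip[OF vD, of k] e by simp
 thus "flipS N (endU N k (endD N k X)) = endU N k (endD N k X)" using ex by (simp add: exchange_def)
qed

text \<open>A partial converse: X and its flip have the same letters and the same remainder. That
  they are equal is concluded later from the injectivity of the bijection.\<close>

lemma virtual_counts_flip:
 assumes N: "1 <= N" and v: "validS N X"
  and c: "virtual_counts N (cntU N k (endD N k X)) (cntD N k X)"
  and E: "flipS N (endU N k (endD N k X)) = endU N k (endD N k X)"
  and a: "1 <= a" "a <= Suc N"
 shows "cntU N k (endD N k (flipS N X)) a = cntU N k (endD N k X) a"
  and "cntD N k (flipS N X) a = cntD N k X a"
  and "endU N k (endD N k (flipS N X)) = endU N k (endD N k X)"
proof -
 have vU: "validS N (endU N k X)" using v by (rule validS_endU)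
 have ex: "exchange N k k X" using exchange_all[OF N v] .
 have ab: "1 <= N + 2 - a" "N + 2 - a <= Suc N" "N + 2 - (N + 2 - a) = a" using a by auto
 have *: "cntU N k X (N + 2 - a) = cntD N k X a & cntD N k (endU N k X) (N + 2 - a) = cntU N k (endD N k X) a"
  using shifted_unique[OF conjunct2[OF ex[unfolded exchange_def]] c[unfolded virtual_counts_def] ab(1,2)] ab(3) by simp
 show "cntD N k (flipS N X) a = cntD N k X a" using cntD_flip[OF v a, of k] * by simp
 show "cntU N k (endD N k (flipS N X)) a = cntU N k (endD N k X) a" using cntU_flip[OF vU a, of k] endD_flip[OF v, of k] * by simp
 have "endU N k (endD N k (flipS N X)) = flipS N (endD N k (endU N k X))" using endD_flip[OF v, of k] endU_flip[OF vU, of k] by simp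
 thus "endU N k (endD N k (flipS N X)) = endU N k (endD N k X)" using E ex by (simp add: exchange_def)
qed

subsection \<open>Parity at the middle node\<close>

text \<open>With even vacancy numbers at the middle node n, singular strings there have even
  riggings and strings one below singular have odd ones.\<close>

definition symS :: "nat => state => bool" where
 "symS n X \<longleftrightarrow> 1 <= n & validS (2 * n - 1) X & flipS (2 * n - 1) X = X & (\<forall>i. even (fst X n i))"

definition even_rig :: "nat => state => bool" where
 "even_rig n X \<longleftrightarrow> (\<forall>(i, x) \<in># snd X n. even x)"

definition length_rig :: "nat => state => bool" where
 "length_rig n X \<longleftrightarrow> (\<forall>(i, x) \<in># snd X n. even x \<longleftrightarrow> even i)"

definition diag :: "nat => nat => state => state" where
 "diag n k X = dnS (2 * n - 1) k (upS (2 * n - 1) k X)"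

lemma symS_dn:
 assumes "symS n X"
 shows "dnS (2 * n - 1) k X = flipS (2 * n - 1) (upS (2 * n - 1) k X)" using flipS_upS[of "2 * n - 1" X k] assms by (simp add: symS_def)

lemma not_failing: "~ failing N k k X" by (simp add: failing_def)

lemma diag_cases:
 assumes s: "symS n X" and k: "1 <= k"
 obtains (const) "constant_chains (2 * n - 1) k X"
 | (cross) b c q where "crossing (2 * n - 1) b c (fst X) (snd X) (up k (fst X) (snd X)) (dn (2 * n - 1) k (fst X) (snd X)) q"
proof (cases "constant_chains (2 * n - 1) k X")
 case False
 have "validS (2 * n - 1) X" "1 <= 2 * n - 1" using s by (auto simp: symS_def)
 from up_le_start[OF this(1) k order_refl this(2) not_failing] False show ?thesis using cross by blast
qed (rule const)

lemma diag_commutes: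
 assumes s: "symS n X" and k: "1 <= k"
 shows "upS (2 * n - 1) k (dnS (2 * n - 1) k X) = diag n k X"
proof -
 have v: "validS (2 * n - 1) X" "1 <= 2 * n - 1" using s by (auto simp: symS_def)
 show ?thesis
 proof (cases rule: diag_cases[OF s k])
  case 1 thus ?thesis using constant_square(1)[OF v(1) k v(2)] by (simp add: diag_def)
 next
  case (2 b c q) thus ?thesis using crossing_square(1)[OF 2 _ k k] by (simp add: diag_def)
 qed
qed

lemma diag_flip:
 assumes s: "symS n X" and k: "1 <= k"
 shows "flipS (2 * n - 1) (diag n k X) = diag n k X" using s k flipS_dnS symS_dn diag_commutes validS_upS by (simp add: symS_def diag_def)

text \<open>By symmetry both neighbours of the middle node contribute equally, so its vacancy
  numbers change by an even amount.\<close>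

lemma upd_even:
 assumes N: "N = 2 * n - 1" "1 <= n"
  and c: "!!e. e <= Suc N ==> chi (l e) i + chi (m' e) i = chi (l (N + 1 - e)) i + chi (m' (N + 1 - e)) i"
  and p: "even (p n i)"
 shows "even (upd N (upd N p l) m' n i)"
proof -
 have "N + 1 - (n - 1) = Suc n" "n - 1 <= Suc N" using N by auto
 hence "chi (l (n - 1)) i + chi (m' (n - 1)) i = chi (l (Suc n)) i + chi (m' (Suc n)) i" using c[of "n - 1"] by simp
 hence "upd N (upd N p l) m' n i = p n i + 2 * (chi (l n) i + chi (m' n) i - (chi (l (Suc n)) i + chi (m' (Suc n)) i))" using N by (simp add: upd_def)
 thus ?thesis using p by simp
qed

lemma diag_symS:
 assumes s: "symS n X" and k: "1 <= k"
 shows "symS n (diag n k X)"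
proof -
 let ?N = "2 * n - 1"
 have v: "validS ?N X" "1 <= n" "flipS ?N X = X" "!!i. even (fst X n i)" using s by (auto simp: symS_def)
 have v2: "validS ?N (diag n k X)" unfolding diag_def using v k by (intro validS_dnS validS_upS)
 obtain p R where X: "X = (p, R)" by (cases X)
 let ?l = "up k p R" and ?m = "dn ?N k p R"
 let ?X1 = "upS ?N k X" and ?Y1 = "dnS ?N k X"
 let ?m' = "dn ?N k (fst ?X1) (snd ?X1)" and ?l' = "up k (fst ?Y1) (snd ?Y1)"
 have vp: "valid ?N p R" using v(1) by (simp add: validS_def X)
 have lm: "?m e = ?l (?N + 1 - e)" if "e <= Suc ?N" for e using flip_dn[OF vp that, of k] v(3) by (simp add: X flip_def)
 have lm': "?l' e = ?m' (?N + 1 - e)" if "e <= Suc ?N" for e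
 proof -
  have "?Y1 = flipS ?N ?X1" by (rule symS_dn[OF s])
  hence "?l' = up k (flip ?N (fst ?X1)) (flip ?N (snd ?X1))" by (cases ?X1) simp
  thus ?thesis using that by (simp add: dn_def flip_def)
 qed
 have e2: "fst (diag n k X) = upd ?N (upd ?N p ?l) ?m'" unfolding diag_def dnS_def by (simp add: upS_def X)
 have "even (fst (diag n k X) n i)" for i
 proof (cases rule: diag_cases[OF s k])
  case 1
  have le: "?l e = (if e <= ?N then enat k else \<infinity>)" if "e <= Suc ?N" for e
  proof (cases "e = Suc ?N")
   case True thus ?thesis using up_end[OF vp, of k] by simp
  next
   case False
   thus ?thesis using 1 that by (cases "e = 0") (auto simp: constant_chains_def X simp del: up.simps(2))
  qed
  have m'e: "?m' e = (if e <= ?N then \<infinity> else enat k)" if "e <= Suc ?N" for e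
  proof (cases "e = Suc ?N")
   case True thus ?thesis by simp
  next
   case False
   have "1 <= ?N" using v(2) by simp
   thus ?thesis using constant_up(1)[OF v(1) k _ 1, of e] that False by simp
  qed
  have "upd ?N (upd ?N p ?l) ?m' n i = p n i + 2 * (chi (?l n) i + chi (?m' n) i)
    - chi (?l (n - 1)) i - chi (?l (Suc n)) i - chi (?m' (n - 1)) i - chi (?m' (Suc n)) i" using v(2) by (simp add: upd_def)
  moreover have "chi (?l (n - 1)) i + chi (?l (Suc n)) i + chi (?m' (n - 1)) i + chi (?m' (Suc n)) i = 2 * chi (enat k) i"
   using le[of "n - 1"] le[of "Suc n"] m'e[of "n - 1"] m'e[of "Suc n"] by auto
  ultimately have eq: "upd ?N (upd ?N p ?l) ?m' n i = p n i + 2 * (chi (?l n) i + chi (?m' n) i - chi (enat k) i)" by simp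
  have "even (p n i)" using v(4)[of i] X by simp
  thus ?thesis unfolding e2 eq by simp
 next
  case (2 b c q)
  hence c: "crossing ?N b c p R ?l ?m q" by (simp add: X)
  interpret crossing ?N b c p R ?l ?m q by (rule c)
  have com: "commuting ?m' ?l'" by (rule crossing_commuting[OF c X])
  have "even (upd ?N (upd ?N p ?l) ?m' n i)"
  proof (rule upd_even)
   fix e assume e: "e <= Suc ?N"
   show "chi (?l e) i + chi (?m' e) i = chi (?l (?N + 1 - e)) i + chi (?m' (?N + 1 - e)) i" using chi_pair[OF com e] lm[OF e] lm'[OF e] by simp
  qed (use v X in auto)
  thus ?thesis by (simp add: e2)
 qed
 thus ?thesis using v v2 diag_flip[OF s k] by (simp add: symS_def)
qed

lemma parity_swap:
 fixes P :: "nat \<times> int => bool"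
 assumes "u \<in># A" "P u \<longleftrightarrow> (\<forall>y\<in>#V. P y)" "B = A - {#u#} + V"
 shows "(\<forall>y\<in>#A. P y) \<longleftrightarrow> (\<forall>y\<in>#B. P y)"
proof -
 obtain C where "A = add_mset u C" using assms(1) by (metis multi_member_split)
 thus ?thesis using assms by auto
qed

text \<open>By symmetry the plateau contains the middle node, so \<open>mid_cases\<close> applies. A
  hit string of rigging p - 1 is odd. If it is the only one, both letters are n + 1
  (\<open>zero\<close>). If it comes after a string of length \<open>Suc j\<close>, that string is
  left with the odd rigging p - 1, and \<open>even_rig\<close> fails before and after.
  \<open>length_rig\<close> survives throughout: length and rigging of a shortened string change
  parity together.\<close>

lemma diag_middle:
 assumes s: "symS n X" and k: "1 <= k" and c: "~ constant_chains (2 * n - 1) k X"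
 defines "X' \<equiv> diag n k X"
 obtains (zero) "dletter (2 * n - 1) k X = Suc n" "uletter k (dnS (2 * n - 1) k X) = Suc n" "~ even_rig n X"
   "length_rig n X \<longleftrightarrow> length_rig n X'"
 | (regular) "dletter (2 * n - 1) k X ~= uletter k (dnS (2 * n - 1) k X)"
   "even_rig n X \<longleftrightarrow> even_rig n X'" "length_rig n X \<longleftrightarrow> length_rig n X'"
proof -
 let ?N = "2 * n - 1"
 have v: "validS ?N X" "1 <= n" "flipS ?N X = X" and pe: "!!i. even (fst X n i)" using s by (auto simp: symS_def)
 have pe': "!!i. even (fst X' n i)" using diag_symS[OF s k] by (auto simp: symS_def X'_def)
 obtain p R where X: "X = (p, R)" by (cases X)
 let ?l = "up k p R" and ?m = "dn ?N k p R"
 let ?X1 = "upS ?N k X" and ?Y1 = "dnS ?N k X"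
 let ?m' = "dn ?N k (fst ?X1) (snd ?X1)" and ?l' = "up k (fst ?Y1) (snd ?Y1)"
 have vp: "valid ?N p R" using v(1) by (simp add: validS_def X)
 have nm: "?l n = ?m n" using flip_dn[OF vp, of n k] v(3) v(2) by (simp add: X flip_def)
 show ?thesis
 proof (cases rule: diag_cases[OF s k])
  case 1 thus ?thesis using c by simp
 next
  case (2 b c q)
  hence cr: "crossing ?N b c p R ?l ?m q" by (simp add: X)
  interpret crossing ?N b c p R ?l ?m q by (rule cr)
  have com: "commuting ?m' ?l'" by (rule crossing_commuting[OF cr X])
  have e1: "?X1 = (p1, R1)" by (simp only: upS_def X p1_def R1_def fst_conv snd_conv stp.simps)
  have X': "X' = (upd ?N p1 ?m', rm ?N R1 ?m' p1 (upd ?N p1 ?m'))" unfolding X'_def diag_def e1 by (simp add: dnS_def)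
  have nN: "n <= ?N" by simp
  have "b <= n"
  proof (rule ccontr)
   assume "~ b <= n"
   hence "?l n < ?m (Suc n)" using H1[of n] by simp
   thus False using nm m_mono[of n "Suc n"] nN by auto
  qed
  moreover have "n <= c"
  proof (rule ccontr)
   assume "~ n <= c"
   hence "?m n < ?l (n - 1)" using H2[of "n - 1"] by auto
   thus False using nm l_mono[of "n - 1" n] nN by auto
  qed
  ultimately have bcn: "b <= n" "n <= c" by auto
  note letters = crossing_square(2,3)[OF cr X k k]
  have pn: "!!i. even (p n i)" using pe by (simp add: X)
  have p2n: "!!i. even (upd ?N p1 ?m' n i)" using pe' by (simp add: X')
  show ?thesis
  proof (cases rule: mid_cases[OF com bcn])
   case 1
   have ne: "dletter ?N k X ~= uletter k ?Y1"
   proof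
    assume eq: "dletter ?N k X = uletter k ?Y1"
    have vY: "validS ?N ?Y1" using v(1) k by (rule validS_dnS)
    have "?m c = \<infinity>" using mq[of c] bc 1 by auto
    moreover have "c <= Suc ?N" using bc by simp
    ultimately have "c < dletter ?N k X" using dn_fin[OF v(1), of c k] unfolding X by auto
    moreover have "?l' b = \<infinity>" using l'_eq[OF com, of b] bc 1 by auto
    hence "uletter k ?Y1 <= b" using up_fin[OF vY, of k b] by auto
    ultimately show False using eq bc by simp
   qed
   show ?thesis by (rule regular[OF ne]) (use 1 in \<open>auto simp: even_rig_def length_rig_def X' X\<close>)
  next
   case (2 i)
   have vY: "validS ?N ?Y1" using v(1) k by (rule validS_dnS)
   have bn: "b = n" "c = n" using 2 bcn by auto
   have z: "dletter ?N k X = Suc n"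
   proof (rule dletter_eqI[OF v(1)])
    show "dn ?N k (fst X) (snd X) (Suc n) ~= \<infinity>" using mc_q bn by (cases "?m (Suc n)") (auto simp: X)
    show "dn ?N k (fst X) (snd X) (Suc n - 1) = \<infinity>" using mq[of n] bn 2 by (simp add: X)
   qed (use nN in auto)
   have y: "uletter k ?Y1 = Suc n"
   proof (rule uletter_eqI[OF vY])
    show "?l' (Suc n) = \<infinity>" using l'_eq[OF com, of "Suc n"] bn 2 lq[of n] by auto
    show "?l' (Suc n - 1) ~= \<infinity>" using l'_eq[OF com, of n] bn 2 by auto
   qed (use nN in auto)
   show ?thesis
   proof (rule zero[OF z y])
    show "~ even_rig n X" using 2(5) pn[of i] by (auto simp: even_rig_def X intro!: bexI[of _ "(i, p n i - 1)"])
    have mem: "(i, p n i - 1) \<in># snd X n" and eq: "snd X' n = snd X n - {#(i, p n i - 1)#}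
      + (if 1 < i then {#(i - 1, upd ?N p1 ?m' n (i - 1))#} else {#})" using 2(5,6) unfolding X X' by simp_all
    show "length_rig n X \<longleftrightarrow> length_rig n X'" unfolding length_rig_def by (rule parity_swap[OF mem _ eq]) (use 2 pn p2n in auto)
   qed
  next
   case (3 j)
   have ne: "dletter ?N k X ~= uletter k ?Y1"
   proof
    assume eq: "dletter ?N k X = uletter k ?Y1"
    have vY: "validS ?N ?Y1" using v(1) k by (rule validS_dnS)
    have "?m b ~= \<infinity>" using mq[of b] bc 3 by auto
    hence "dletter ?N k X <= b" using dn_fin[OF v(1), of b k] bc by (auto simp: X)
    moreover have "r ~= \<infinity>" using r_le[OF 3(1)] by (cases r) auto
    hence "?l' c ~= \<infinity>" using l'_eq[OF com, of c] bc by auto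
    hence "c < uletter k ?Y1" using up_fin[OF vY, of k c] by auto
    ultimately show False using eq bc by simp
   qed
   have mem: "(Suc j, p n (Suc j)) \<in># snd X n" and eq: "snd X' n = snd X n - {#(Suc j, p n (Suc j))#}
     + (if 1 < j then {#(j - 1, upd ?N p1 ?m' n (j - 1))#} else {#})" using 3(3,4) unfolding X X' by simp_all
   show ?thesis
   proof (rule regular[OF ne])
    show "even_rig n X \<longleftrightarrow> even_rig n X'" unfolding even_rig_def by (rule parity_swap[OF mem _ eq]) (use 3(2) pn p2n in auto)
    show "length_rig n X \<longleftrightarrow> length_rig n X'" unfolding length_rig_def by (rule parity_swap[OF mem _ eq]) (use 3(2) pn p2n in auto)
   qed
  next
   case (4 i j)
   have ne: "dletter ?N k X ~= uletter k ?Y1"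
   proof
    assume eq: "dletter ?N k X = uletter k ?Y1"
    have vY: "validS ?N ?Y1" using v(1) k by (rule validS_dnS)
    have "?m b ~= \<infinity>" using mq[of b] bc 4 by auto
    hence "dletter ?N k X <= b" using dn_fin[OF v(1), of b k] bc by (auto simp: X)
    moreover have "r ~= \<infinity>" using r_le[OF 4(1)] by (cases r) auto
    hence "?l' c ~= \<infinity>" using l'_eq[OF com, of c] bc by auto
    hence "c < uletter k ?Y1" using up_fin[OF vY, of k c] by auto
    ultimately show False using eq bc by simp
   qed
   let ?M = "R n - {#(Suc j, p n (Suc j))#} + {#(j, p n j - 1)#}"
   have m2: "(i, p n i - 1) \<in># ?M" using 4(2,5) by (auto simp: in_diff_count)
    have mem: "(Suc j, p n (Suc j)) \<in># snd X n" using 4(4) by (simp add: X)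
    have eq1: "?M = snd X n - {#(Suc j, p n (Suc j))#} + {#(j, p n j - 1)#}" by (simp add: X)
    have eq2: "snd X' n = ?M - {#(i, p n i - 1)#} + (if 1 < i then {#(i - 1, upd ?N p1 ?m' n (i - 1))#} else {#})" using 4(6) unfolding X' by simp
   show ?thesis
   proof (rule regular[OF ne])
    have "~ even_rig n X" using 4(5) pn[of i] by (auto simp: even_rig_def X intro!: bexI[of _ "(i, p n i - 1)"])
    moreover have "(j, p n j - 1) \<in># snd X' n" unfolding eq2 using 4(2) by auto
    hence "~ even_rig n X'" using pn[of j] by (auto simp: even_rig_def intro!: bexI[of _ "(j, p n j - 1)"])
    ultimately show "even_rig n X \<longleftrightarrow> even_rig n X'" by simp
    have "length_rig n X \<longleftrightarrow> (\<forall>(i, x)\<in>#?M. even x \<longleftrightarrow> even i)" unfolding length_rig_def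
     by (rule parity_swap[OF mem _ eq1]) (use pn in auto)
    also have "\<dots> \<longleftrightarrow> length_rig n X'" unfolding length_rig_def by (rule parity_swap[OF m2 _ eq2]) (use 4(3) pn p2n in auto)
    finally show "length_rig n X \<longleftrightarrow> length_rig n X'" .
   qed
  qed
 qed
qed


lemma diag_letters:
 assumes s: "symS n X" and k: "1 <= k"
 shows "local_rule (2 * n - 1) (dletter (2 * n - 1) k X) (uletter k (dnS (2 * n - 1) k X))
   (uletter k X) (dletter (2 * n - 1) k (upS (2 * n - 1) k X))"
  and "uletter k X = 2 * n + 1 - dletter (2 * n - 1) k X"
  and "constant_chains (2 * n - 1) k X \<longleftrightarrow>
   dletter (2 * n - 1) k X = 1 & uletter k (dnS (2 * n - 1) k X) = 1"
proof -
 let ?N = "2 * n - 1"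
 have v: "validS ?N X" "1 <= ?N" and f: "flipS ?N X = X" using s by (auto simp: symS_def)
 have "local_rule ?N (dletter ?N k X) (uletter k (dnS ?N k X)) (uletter k X) (dletter ?N k (upS ?N k X)) &
  (constant_chains ?N k X \<longleftrightarrow> dletter ?N k X = 1 & uletter k (dnS ?N k X) = 1)"
 proof (cases "constant_chains ?N k X")
  case True
  thus ?thesis using constant_up[OF v(1) k v(2)] constant_dn[OF v(1) k v(2)] by (auto simp: local_rule_def)
 next
  case False
  thus ?thesis
  proof (cases rule: diag_cases[OF s k])
   case (2 b c q) thus ?thesis using crossing_square[OF 2 _ k k] False by auto
  qed auto
 qed
 thus "local_rule ?N (dletter ?N k X) (uletter k (dnS ?N k X)) (uletter k X) (dletter ?N k (upS ?N k X))"
  "constant_chains ?N k X \<longleftrightarrow> dletter ?N k X = 1 & uletter k (dnS ?N k X) = 1" by auto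
 show "uletter k X = 2 * n + 1 - dletter ?N k X" using uletter_flip[OF v(1), of k] s by (simp add: symS_def)
qed

text \<open>Relates the multiplicities of X to those of the state A after one letter of each kind.
  As A is symmetric again, its row-first multiplicities are the reversed dual ones, and the exchange
  relation after the first dual letter becomes a formula in \<open>mA\<close> and \<open>dA\<close>
  alone.\<close>

lemma diag_counts:
 fixes n j :: nat and X :: state
 assumes s: "symS n X"
 defines "N \<equiv> 2 * n - 1" and "A \<equiv> diag n (Suc j) X"
 defines "m \<equiv> cntU N (Suc j) (endD N (Suc j) X)" and "d \<equiv> cntD N (Suc j) X"
  and "mA \<equiv> cntU N j (endD N j A)" and "dA \<equiv> cntD N j A"
  and "y \<equiv> uletter (Suc j) (dnS N (Suc j) X)" and "z \<equiv> dletter N (Suc j) X"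
 shows "1 <= a ==> a <= N ==> min (m (Suc a)) (d (Suc a)) = min (mA (Suc a)) (dA (Suc a))
   + of_bool (a = y & dA (N + 2 - a) < mA (N + 2 - a))
   + of_bool (Suc a = z & dA (Suc a) < mA (Suc a) + of_bool (Suc a = y))"
  and "min (m 1) (d 1) = min (mA 1) (dA 1) + of_bool (Suc N = y & dA 1 < mA 1)
   + of_bool (1 = z & dA 1 < mA 1 + of_bool (1 = y))"
  and "virtual_counts N mA dA"
  and "a < y ==> 1 <= a ==> dA (N + 2 - a) = 0"
  and "dletter N (Suc j) (upS N (Suc j) X) < a ==> dA a = 0"
  and "constant_chains N (Suc j) X ==>
   mA 1 = j & dA 1 = j & (\<forall>a. 2 <= a & a <= Suc N --> mA a = 0 & dA a = 0)"
  and "1 <= a ==> a <= Suc N ==> m a + dA a + of_bool (a = z) = mA a + of_bool (a = y) + d a"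
proof -
 let ?Xh = "dnS N (Suc j) X" and ?X1 = "upS N (Suc j) X"
 have v: "validS N X" and N: "1 <= N" using s by (auto simp: symS_def N_def)
 have vh: "validS N ?Xh" and v1: "validS N ?X1" using v validS_dnS validS_upS by auto
 have sA: "symS n A" unfolding A_def using s by (rule diag_symS) simp
 have vA: "validS N A" and fA: "flipS N A = A" using sA by (auto simp: symS_def N_def)
 have A: "upS N (Suc j) ?Xh = A" using diag_commutes[OF s, of "Suc j"] by (simp add: A_def N_def)
 have A': "dnS N (Suc j) ?X1 = A" by (simp add: A_def diag_def N_def)
 show vc: "virtual_counts N mA dA" unfolding mA_def dA_def by (rule symmetric_counts(1)[OF N vA fA])
 have cU: "cntU N j A a = dA (N + 2 - a)" if "1 <= a" "a <= Suc N" for a using cntU_flip[OF vA that, of j] fA by (simp add: dA_def)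
 have cD: "cntD N j (endU N j A) a = mA (N + 2 - a)" if "1 <= a" "a <= Suc N" for a
  using cntD_flip[OF validS_endD[OF vA] that, of j j] endU_flip[OF vA, of j] fA by (simp add: mA_def)
 define dh where "dh = cntD N j ?Xh"
 have H: "shifted N m dh (%a. cntU N j A a + of_bool (a = y)) (cntD N j (endU N j A))"
 proof -
  have "cntU N (Suc j) ?Xh = (%a. cntU N j A a + of_bool (a = y))" using A by (auto simp: y_def)
  moreover have "endU N (Suc j) ?Xh = endU N j A" using A by simp
  moreover have "exchange N j (Suc j) ?Xh" by (rule exchange_all[OF N vh])
  ultimately show ?thesis unfolding exchange_def m_def dh_def by simp
 qed
 have d: "d a = dh a + of_bool (a = z)" for a by (simp add: d_def dh_def z_def)
 have wA: "mA a + mA (N + 2 - a) = dA (N + 2 - a) + dA a" if "1 <= a" "a <= Suc N" for a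
  using vc that unfolding virtual_counts_def shifted_def by auto
 have w: "m a + dA a = mA a + of_bool (a = y) + dh a" if "1 <= a" "a <= Suc N" for a
 proof -
  have "m a + cntD N j (endU N j A) a = cntU N j A a + of_bool (a = y) + dh a" using H that unfolding shifted_def by blast
  hence "m a + mA (N + 2 - a) = dA (N + 2 - a) + of_bool (a = y) + dh a" unfolding cU[OF that] cD[OF that] .
  thus ?thesis using wA[OF that] by linarith
 qed
 show "1 <= a ==> a <= Suc N ==> m a + dA a + of_bool (a = z) = mA a + of_bool (a = y) + d a" using w[of a] d[of a] by simp
 have cA: "min (dA (N + 2 - a)) (mA (N + 2 - a)) = min (mA (Suc a)) (dA (Suc a))" if "1 <= a" "a <= N" for a
  using vc that unfolding virtual_counts_def shifted_def by auto
 have inc1: "min (x + of_bool P) v = min x v + of_bool (P & x < v)" for x v :: nat and P by auto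
 have inc2: "min x (v + of_bool P) = min x v + of_bool (P & v < x)" for x v :: nat and P by auto
 { assume a: "1 <= a" "a <= N"
  hence a': "1 <= a" "a <= Suc N" "1 <= Suc a" "Suc a <= Suc N" by auto
  have "min (cntU N j A a + of_bool (a = y)) (cntD N j (endU N j A) a) = min (m (Suc a)) (dh (Suc a))" using H a unfolding shifted_def by blast
  hence "min (m (Suc a)) (dh (Suc a)) = min (dA (N + 2 - a) + of_bool (a = y)) (mA (N + 2 - a))" unfolding cU[OF a'(1,2)] cD[OF a'(1,2)] by (rule sym)
  moreover have "dh (Suc a) < m (Suc a) \<longleftrightarrow> dA (Suc a) < mA (Suc a) + of_bool (Suc a = y)" using w[OF a'(3,4)] by auto
  ultimately show "min (m (Suc a)) (d (Suc a)) = min (mA (Suc a)) (dA (Suc a))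
   + of_bool (a = y & dA (N + 2 - a) < mA (N + 2 - a))
   + of_bool (Suc a = z & dA (Suc a) < mA (Suc a) + of_bool (Suc a = y))" unfolding d inc1 inc2 cA[OF a] by simp }
 {
  have "min (cntU N j A (Suc N) + of_bool (Suc N = y)) (cntD N j (endU N j A) (Suc N)) = min (m 1) (dh 1)" using H unfolding shifted_def by blast
  moreover have "cntU N j A (Suc N) = dA 1" "cntD N j (endU N j A) (Suc N) = mA 1" using cU[of "Suc N"] cD[of "Suc N"] by simp_all
  ultimately have "min (m 1) (dh 1) = min (dA 1 + of_bool (Suc N = y)) (mA 1)" by simp
  moreover have "dh 1 < m 1 \<longleftrightarrow> dA 1 < mA 1 + of_bool (1 = y)" using w[of 1] by auto
  ultimately show "min (m 1) (d 1) = min (mA 1) (dA 1) + of_bool (Suc N = y & dA 1 < mA 1)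
   + of_bool (1 = z & dA 1 < mA 1 + of_bool (1 = y))" unfolding d inc2 by (simp add: min.commute) }
 show "a < y ==> 1 <= a ==> dA (N + 2 - a) = 0"
  using cntU_below_next[OF vh, of a "Suc j"] A cU[of a] uletter_bounds[OF vh, of "Suc j"] by (simp add: y_def)
 show "dletter N (Suc j) ?X1 < a ==> dA a = 0" using cntD_above_next[OF v1, of "Suc j" a] A' by (simp add: dA_def)
 assume c: "constant_chains N (Suc j) X"
 have z1: "z = 1" "y = 1" using diag_letters(3)[OF s, of "Suc j"] c by (auto simp: z_def y_def N_def)
 have z': "dletter N (Suc j) ?X1 = Suc N" and y': "uletter (Suc j) X = Suc N" using constant_up[OF v _ N c] by auto
 have T: "shifted N mA (%a. dA a + of_bool (a = Suc N)) (cntU N j ?X1) (cntD N (Suc j) (endU N j ?X1))"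
 proof -
  have "cntD N (Suc j) ?X1 = (%a. dA a + of_bool (a = Suc N))" using A' z' by (auto simp: dA_def)
  moreover have "endD N (Suc j) ?X1 = endD N j A" using A' by simp
  moreover have "exchange N (Suc j) j ?X1" by (rule exchange_all[OF N v1])
  ultimately show ?thesis unfolding exchange_def mA_def by simp
 qed
 have A1: "shifted N mA dA (cntU N j A) (cntD N j (endU N j A))" using exchange_all[OF N vA, of j j] unfolding exchange_def mA_def dA_def by simp
 have mt: "cntU N j ?X1 a = 0" if "a < Suc N" for a using cntU_below_next[OF v, of a "Suc j"] that y' by simp
 have dh0: "dh a = 0" if "1 < a" for a using cntD_above_next[OF v, of "Suc j" a] that z1 by (simp add: dh_def z_def)
 have sums: "(\<Sum>a = 1..Suc N. mA a) = j" "(\<Sum>a = 1..Suc N. dA a) = j"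
  unfolding mA_def dA_def using cntU_sum[OF validS_endD[OF vA], of j j] cntD_sum[OF vA, of j] by simp_all
 have eq: "mA a = dA a" if "1 <= a" "a <= Suc N" for a by (rule degenerate_balanced(1)[OF N A1 H[unfolded z1] T mt dh0 _ that]) (use sums in simp_all)
 have z0: "mA a = 0" if "2 <= a" "a <= Suc N" for a by (rule degenerate_balanced(2)[OF N A1 H[unfolded z1] T mt dh0 _ that]) (use sums in simp_all)
 have "{1..Suc N} = insert 1 {2..Suc N}" by auto
 hence "mA 1 + (\<Sum>a = 2..Suc N. mA a) = j" using sums(1) by simp
 moreover have "(\<Sum>a = 2..Suc N. mA a) = 0" by (rule sum.neutral) (use z0 in auto)
 ultimately have "mA 1 = j" by simp
 thus "mA 1 = j & dA 1 = j & (\<forall>a. 2 <= a & a <= Suc N --> mA a = 0 & dA a = 0)" using eq z0 by force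
qed

text \<open>Lets an induction take off a dual letter and a row letter together, although the rows
  are read one after the other.\<close>

lemma endU_endD_diag:
 assumes s: "symS n X"
 shows "endU (2 * n - 1) (Suc j) (endD (2 * n - 1) (Suc j) X)
  = endU (2 * n - 1) j (endD (2 * n - 1) j (diag n (Suc j) X))"
proof -
 let ?N = "2 * n - 1"
 let ?Xh = "dnS ?N (Suc j) X"
 have v: "validS ?N X" and N: "1 <= ?N" using s by (auto simp: symS_def)
 have vh: "validS ?N ?Xh" using v validS_dnS by auto
 have A: "upS ?N (Suc j) ?Xh = diag n (Suc j) X" using diag_commutes[OF s, of "Suc j"] by simp
 have vA: "validS ?N (diag n (Suc j) X)" using diag_symS[OF s, of "Suc j"] by (simp add: symS_def)
 have "endU ?N (Suc j) (endD ?N (Suc j) X) = endU ?N (Suc j) (endD ?N j ?Xh)" by simp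
 also have "\<dots> = endD ?N j (endU ?N (Suc j) ?Xh)" using exchange_all[OF N vh, of j "Suc j"] by (simp only: exchange_def)
 also have "\<dots> = endD ?N j (endU ?N j (diag n (Suc j) X))" using A by simp
 also have "\<dots> = endU ?N j (endD ?N j (diag n (Suc j) X))" using exchange_all[OF N vA, of j j] by (simp only: exchange_def)
 finally show ?thesis .
qed

lemma constant_diag_vacancy:
 assumes s: "symS n X" and k: "1 <= k" and c: "constant_chains (2 * n - 1) k X" and i: "i < k"
 shows "fst (diag n k X) n i = fst X n i"
proof -
 let ?N = "2 * n - 1"
 have v: "validS ?N X" and N: "1 <= ?N" "1 <= n" "n <= ?N" using s by (auto simp: symS_def)
 let ?X1 = "upS ?N k X"
 let ?m' = "dn ?N k (fst ?X1) (snd ?X1)"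
 have m': "enat i < ?m' e" if "e <= Suc ?N" for e
 proof (cases "e = Suc ?N")
  case True thus ?thesis using i by simp
 next
  case False thus ?thesis using constant_up(1)[OF v k N(1) c, of e] that by simp
 qed
 have "fst (diag n k X) = upd ?N (fst ?X1) ?m'" unfolding diag_def dnS_def by (cases ?X1) simp
 hence "fst (diag n k X) n i = fst ?X1 n i" using m'[of n] m'[of "n - 1"] m'[of "Suc n"] by (simp add: upd_def)
 thus ?thesis using constant_up(5)[OF v k N(1) c N(2,3) i] by simp
qed

lemma constant_step:
 assumes s: "symS n X" and c: "constant_chains (2 * n - 1) (Suc j) X"
  and A: "snd (diag n (Suc j) X) n = M + (if 0 < j then {#(j, fst (diag n (Suc j) X) n j)#} else {#})"
 shows "snd X n = M + {#(Suc j, fst X n (Suc j))#}"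
using s constant_square(2) c constant_diag_vacancy A constant_square(3) by (auto simp: symS_def diag_def split: if_splits)

text \<open>If all letters are 1, every diagonal step is constant, and at the middle node the steps
  shorten one and the same singular string until it vanishes. The whole pair therefore accounts for
  one string of length k.\<close>

lemma pure_row:
 "symS n X ==> (\<forall>a. 2 <= a & a <= 2 * n --> cntD (2 * n - 1) k X a = 0 & cntU (2 * n - 1) k (endD (2 * n - 1) k X) a = 0) ==>
  snd X n = snd (endU (2 * n - 1) k (endD (2 * n - 1) k X)) n + (if 0 < k then {#(k, fst X n k)#} else {#})"
proof (induction k arbitrary: X)
 case (Suc j)
 let ?N = "2 * n - 1"
 note s = Suc.prems(1)
 have v: "validS ?N X" and n: "1 <= n" and N: "1 <= ?N" and SN: "Suc ?N = 2 * n" using s by (auto simp: symS_def)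
 define A where "A = diag n (Suc j) X"
 have sA: "symS n A" unfolding A_def using s by (rule diag_symS) simp
 define m d mA dA where "m = cntU ?N (Suc j) (endD ?N (Suc j) X)" and "d = cntD ?N (Suc j) X"
  and "mA = cntU ?N j (endD ?N j A)" and "dA = cntD ?N j A"
 define y z where "y = uletter (Suc j) (dnS ?N (Suc j) X)" and "z = dletter ?N (Suc j) X"
 note dc = diag_counts[OF s, where j = j, folded A_def, folded m_def d_def mA_def dA_def y_def z_def]
 have md: "m a = 0 & d a = 0" if "2 <= a" "a <= 2 * n" for a using Suc.prems(2) that by (simp add: m_def d_def)
 have zb: "1 <= z" "z <= Suc ?N" using dletter_bounds[OF v, of "Suc j"] by (simp_all add: z_def)
 have "d z ~= 0" by (simp add: d_def z_def)
 hence z1: "z = 1" using md[of z] zb SN by (cases "2 <= z") auto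
 \<comment> \<open>The alternative for z = 1 is y = 2 * n. It contradicts the count of letters 1 in
   rows that consist of nothing else.\<close>
 have y1: "y = 1"
 proof (rule ccontr)
  assume y: "y ~= 1"
  have "y = 2 * n" using diag_letters(1,2)[OF s, of "Suc j", folded y_def z_def] y z1 unfolding local_rule_def by auto
  hence "dA (2 * n) = 0" using dc(4)[of 1] n by simp
  moreover have "mA 1 + mA (2 * n) = dA (2 * n) + dA 1" using dc(3) SN unfolding virtual_counts_def shifted_def by auto
  moreover have "m 1 + dA 1 + 1 = mA 1 + d 1" using dc(7)[of 1] y z1 by simp
  moreover have "m 1 = Suc j & d 1 = Suc j"
  proof -
   have e: "{1..Suc ?N} = insert 1 {2..Suc ?N}" by auto
   have "(\<Sum>a = 2..Suc ?N. m a) = 0" "(\<Sum>a = 2..Suc ?N. d a) = 0" by (rule sum.neutral, use md SN in auto)+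
   thus ?thesis using cntU_sum[OF validS_endD[OF v, of "Suc j"], of "Suc j"] cntD_sum[OF v, of "Suc j"]
    unfolding e m_def[symmetric] d_def[symmetric] by simp
  qed
  ultimately show False by simp
 qed
 have c: "constant_chains ?N (Suc j) X" using diag_letters(3)[OF s, of "Suc j"] y1 z1 by (simp add: y_def z_def)
 have "\<forall>a. 2 <= a & a <= 2 * n --> dA a = 0 & mA a = 0" using dc(6)[OF c] by auto
 from Suc.IH[OF sA this[unfolded mA_def dA_def]]
 have "snd A n = snd (endU ?N j (endD ?N j A)) n + (if 0 < j then {#(j, fst A n j)#} else {#})" .
 from constant_step[OF s c, folded A_def, OF this]
 show ?case using endU_endD_diag[OF s, of j] by (simp add: A_def)
qed simp

text \<open>Induction along the diagonal. In the constant case a single string of length k and even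
  rigging is removed while the minimum at letter 1 is k. In the case \<open>zero\<close> the minimum
  at n + 1 rises from 0 to 1, matching the odd rigging. Otherwise y = 2 * n + 1 - z, and the two
  correction terms in each minimum are 0 or 1 together.\<close>

theorem symmetric_parity:
 "symS n X ==>
  (even_rig n X \<longleftrightarrow> even_rig n (endU (2 * n - 1) k (endD (2 * n - 1) k X)) &
   even (min (cntU (2 * n - 1) k (endD (2 * n - 1) k X) (Suc n)) (cntD (2 * n - 1) k X (Suc n)))) &
  (length_rig n X \<longleftrightarrow> length_rig n (endU (2 * n - 1) k (endD (2 * n - 1) k X)) &
   even (min (cntU (2 * n - 1) k (endD (2 * n - 1) k X) 1) (cntD (2 * n - 1) k X 1)))"
proof (induction k arbitrary: X)
 case 0 thus ?case by simp
next
 case (Suc j)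
 let ?N = "2 * n - 1"
 note s = Suc.prems(1)
 have v: "validS ?N X" and n: "1 <= n" and N: "1 <= ?N" "n <= ?N" and SN: "Suc ?N = 2 * n"
  and Nn: "?N + 2 - n = Suc n" and pe: "!!i. even (fst X n i)" using s by (auto simp: symS_def)
 define A where "A = diag n (Suc j) X"
 have sA: "symS n A" unfolding A_def using s by (rule diag_symS) simp
 define m d mA dA where "m = cntU ?N (Suc j) (endD ?N (Suc j) X)" and "d = cntD ?N (Suc j) X"
  and "mA = cntU ?N j (endD ?N j A)" and "dA = cntD ?N j A"
 define y z where "y = uletter (Suc j) (dnS ?N (Suc j) X)" and "z = dletter ?N (Suc j) X"
 define E where "E = endU ?N j (endD ?N j A)"
 have E: "endU ?N (Suc j) (endD ?N (Suc j) X) = E" using endU_endD_diag[OF s, of j] by (simp add: E_def A_def)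
 note dc = diag_counts[OF s, where j = j, folded A_def, folded m_def d_def mA_def dA_def y_def z_def]
 have IH: "even_rig n A \<longleftrightarrow> even_rig n E & even (min (mA (Suc n)) (dA (Suc n)))"
  "length_rig n A \<longleftrightarrow> length_rig n E & even (min (mA 1) (dA 1))" using Suc.IH[OF sA] by (simp_all add: mA_def dA_def E_def)
 have c1: "min (m (Suc n)) (d (Suc n)) = min (mA (Suc n)) (dA (Suc n))
   + of_bool (n = y & dA (Suc n) < mA (Suc n)) + of_bool (Suc n = z & dA (Suc n) < mA (Suc n) + of_bool (Suc n = y))" using dc(1)[of n] Nn by simp
 have c2: "min (m 1) (d 1) = min (mA 1) (dA 1) + of_bool (2 * n = y & dA 1 < mA 1)
   + of_bool (1 = z & dA 1 < mA 1 + of_bool (1 = y))" using dc(2) SN by simp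
 have sj: "1 <= Suc j" by simp
 have "(even_rig n X \<longleftrightarrow> even_rig n E & even (min (m (Suc n)) (d (Suc n)))) &
  (length_rig n X \<longleftrightarrow> length_rig n E & even (min (m 1) (d 1)))"
 proof (cases "constant_chains ?N (Suc j) X")
  case True
  have yz: "y = 1" "z = 1" using diag_letters(3)[OF s sj] True by (simp_all add: y_def z_def)
  have p: "mA 1 = j" "dA 1 = j" "!!a. 2 <= a ==> a <= 2 * n ==> mA a = 0 & dA a = 0" using dc(6)[OF True] by auto
  have "\<forall>a. 2 <= a & a <= 2 * n --> dA a = 0 & mA a = 0" using p(3) by auto
  from pure_row[OF sA this[unfolded mA_def dA_def]]
  have "snd A n = snd E n + (if 0 < j then {#(j, fst A n j)#} else {#})" by (simp add: E_def)
  from constant_step[OF s True, folded A_def, OF this]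
  have X: "snd X n = snd E n + {#(Suc j, fst X n (Suc j))#}" .
  have "min (m (Suc n)) (d (Suc n)) = 0" using c1 p(3)[of "Suc n"] yz n by auto
  moreover have "min (m 1) (d 1) = Suc j" using c2 p yz by auto
  ultimately show ?thesis using X pe[of "Suc j"] by (auto simp: even_rig_def length_rig_def)
 next
  case False
  show ?thesis
  proof (cases rule: diag_middle[OF s sj False])
   case 1
   hence yz: "z = Suc n" "y = Suc n" by (simp_all add: y_def z_def)
   define z' where "z' = dletter ?N (Suc j) (upS ?N (Suc j) X)"
   have "local_rule ?N z y (uletter (Suc j) X) z'" unfolding z_def y_def z'_def by (rule diag_letters(1)[OF s sj])
   hence "z' = n" using yz n unfolding local_rule_def by auto
   hence z': "dletter ?N (Suc j) (upS ?N (Suc j) X) = n" by (simp only: z'_def)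
   have "dA (Suc n) = 0" using dc(5)[of "Suc n"] z' by simp
   hence "min (m (Suc n)) (d (Suc n)) = 1" using c1 yz by auto
   moreover have "min (m 1) (d 1) = min (mA 1) (dA 1)"
   proof (cases "n = 1")
    case True
    have "dA 2 = 0" using \<open>dA (Suc n) = 0\<close> True by (simp add: numeral_2_eq_2)
    moreover have "mA 1 + mA 2 = dA 2 + dA 1"
     using conjunct1[OF dc(3)[unfolded virtual_counts_def shifted_def], rule_format, of 1] True by (simp add: numeral_2_eq_2)
    ultimately show ?thesis using c2 yz n by auto
   next
    case False thus ?thesis using c2 yz n by auto
   qed
   ultimately show ?thesis using 1 IH by (auto simp: A_def)
  next
   case 2
   hence ne: "z ~= y" by (simp add: y_def z_def)
   have "y = 2 * n + 1 - z" using diag_letters(1,2)[OF s sj, folded y_def z_def] ne unfolding local_rule_def by auto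
   moreover have "1 <= z" "z <= 2 * n" using dletter_bounds[OF v, of "Suc j"] SN by (simp_all add: z_def)
   ultimately have yz: "n = y \<longleftrightarrow> Suc n = z" "2 * n = y \<longleftrightarrow> 1 = z" by auto
   have e: "even (of_bool (n = y & dA (Suc n) < mA (Suc n))
     + of_bool (Suc n = z & dA (Suc n) < mA (Suc n) + of_bool (Suc n = y)) :: nat)" using ne yz(1) by (cases "n = y") auto
   have e': "even (of_bool (2 * n = y & dA 1 < mA 1) + of_bool (1 = z & dA 1 < mA 1 + of_bool (1 = y)) :: nat)"
    using ne yz(2) by (cases "2 * n = y") auto
   have "even (min (m (Suc n)) (d (Suc n))) \<longleftrightarrow> even (min (mA (Suc n)) (dA (Suc n)))"
    "even (min (m 1) (d 1)) \<longleftrightarrow> even (min (mA 1) (dA 1))"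
    unfolding c1 c2 add.assoc using e e' by (simp_all only: even_add[of "min _ _"] simp_thms)
   thus ?thesis using 2 IH by (simp add: A_def)
  qed
 qed
 thus ?case unfolding m_def d_def E .
qed

section \<open>String lengths in tensor products\<close>

text \<open>\<open>sg b\<close> is the pair (phi, eps), described through single operator steps
  instead of a maximum. The set S may exceed the crystal: for tableaux it is the set of all words of
  columns, which makes closure under the operators immediate.\<close>

definition strg :: "'b crystal => nat => 'b set => ('b => nat \<times> nat) => bool" where
 "strg C i S sg \<longleftrightarrow>
  (\<forall>b\<in>S. case e_op C i b of None => snd (sg b) = 0
    | Some b' => b' : S & snd (sg b) = Suc (snd (sg b')) & fst (sg b') = Suc (fst (sg b))) &
  (\<forall>b\<in>S. case f_op C i b of None => fst (sg b) = 0
    | Some b' => b' : S & fst (sg b) = Suc (fst (sg b')) & snd (sg b') = Suc (snd (sg b)))"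

lemma strgE:
 "strg C i S sg ==> b : S ==> case e_op C i b of None => snd (sg b) = 0
    | Some b' => b' : S & snd (sg b) = Suc (snd (sg b')) & fst (sg b') = Suc (fst (sg b))" unfolding strg_def by blast

lemma strgF:
 "strg C i S sg ==> b : S ==> case f_op C i b of None => fst (sg b) = 0
    | Some b' => b' : S & fst (sg b) = Suc (fst (sg b')) & snd (sg b') = Suc (snd (sg b))" unfolding strg_def by blast

lemma opt_pow_string:
 assumes "!!b. b : S ==> case g b of None => h b = 0 | Some b' => b' : S & h b = Suc (h b')"
 shows "b : S ==> opt_pow k g b ~= None \<longleftrightarrow> k <= h b"
proof (induction k arbitrary: b)
 case (Suc k)
 thus ?case using assms[OF Suc.prems] by (cases "g b") auto
qed simp

lemma Greatest_le: "(GREATEST k. k <= (n::nat)) = n" by (rule Greatest_equality) auto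

lemma strg_eps: "strg C i S sg ==> b : S ==> eps C i b = snd (sg b)"
proof -
 assume a: "strg C i S sg" "b : S"
 have "opt_pow k (e_op C i) b ~= None \<longleftrightarrow> k <= snd (sg b)" for k
 proof (rule opt_pow_string[where S = S and g = "e_op C i" and h = "%b. snd (sg b)"])
  fix b assume "b : S"
  from strgE[OF a(1) this] show "case e_op C i b of None => snd (sg b) = 0 | Some b' => b' : S & snd (sg b) = Suc (snd (sg b'))"
   by (cases "e_op C i b") simp_all
 qed (rule a(2))
 thus ?thesis by (simp only: eps_def Greatest_le)
qed

lemma strg_phi: "strg C i S sg ==> b : S ==> phi C i b = fst (sg b)"
proof -
 assume a: "strg C i S sg" "b : S"
 have "opt_pow k (f_op C i) b ~= None \<longleftrightarrow> k <= fst (sg b)" for k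
 proof (rule opt_pow_string[where S = S and g = "f_op C i" and h = "%b. fst (sg b)"])
  fix b assume "b : S"
  from strgF[OF a(1) this] show "case f_op C i b of None => fst (sg b) = 0 | Some b' => b' : S & fst (sg b) = Suc (fst (sg b'))"
   by (cases "f_op C i b") simp_all
 qed (rule a(2))
 thus ?thesis by (simp only: phi_def Greatest_le)
qed

text \<open>The multiplication of the bicyclic monoid: eps of the left factor cancels against phi of
  the right one. Its associativity allows passing from factors to concatenated words.\<close>

fun bic :: "nat \<times> nat => nat \<times> nat => nat \<times> nat" where
 "bic (p2, e2) (p1, e1) = (p2 + (p1 - e2), e1 + (e2 - p1))"

lemma bic_assoc: "bic (bic x y) z = bic x (bic y z)" by (cases x; cases y; cases z) auto

lemma bic_0 [simp]: "bic (0, 0) x = x" "bic x (0, 0) = x" by (cases x; simp)+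

lemma bic_diff: "int (fst (bic x y)) - int (snd (bic x y)) = int (fst x) - int (snd x) + (int (fst y) - int (snd y))" by (cases x; cases y) auto

lemma bic_snd_0: "snd (bic x y) = 0 \<longleftrightarrow> snd y = 0 & snd x <= fst y" by (cases x; cases y) auto

lemma strg_tensor_Cons:
 assumes C: "strg C i S sg" and D: "strg (tensor Cs) i T sg'"
 shows "strg (tensor (C # Cs)) i {b # bs | b bs. b : S & bs : T} (%w. bic (sg (hd w)) (sg' (tl w)))"
proof -
 { fix b bs assume b: "b : S" "bs : T"
  have e: "eps C i b = snd (sg b)" "phi (tensor Cs) i bs = fst (sg' bs)" using strg_eps[OF C b(1)] strg_phi[OF D b(2)] by auto
  obtain p2 e2 where s2: "sg b = (p2, e2)" by force
  obtain p1 e1 where s1: "sg' bs = (p1, e1)" by force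
  have "case e_op (tensor (C # Cs)) i (b # bs) of None => snd (bic (sg b) (sg' bs)) = 0
    | Some w' => w' : {b # bs | b bs. b : S & bs : T} & snd (bic (sg b) (sg' bs)) = Suc (snd (bic (sg (hd w')) (sg' (tl w')))) &
      fst (bic (sg (hd w')) (sg' (tl w'))) = Suc (fst (bic (sg b) (sg' bs)))"
  proof (cases "p1 < e2")
   case True
   have "case e_op C i b of None => snd (sg b) = 0
    | Some b' => b' : S & snd (sg b) = Suc (snd (sg b')) & fst (sg b') = Suc (fst (sg b))" using C b(1) by (simp add: strg_def)
   then obtain b' where "e_op C i b = Some b'" "b' : S" "snd (sg b) = Suc (snd (sg b'))" "fst (sg b') = Suc (fst (sg b))"
    using True s2 by (cases "e_op C i b") auto
   thus ?thesis using True e s1 s2 b by (cases "sg b'") (auto simp: Let_def)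
  next
   case False
   have "case e_op (tensor Cs) i bs of None => snd (sg' bs) = 0
    | Some b' => b' : T & snd (sg' bs) = Suc (snd (sg' b')) & fst (sg' b') = Suc (fst (sg' bs))" using D b(2) by (simp add: strg_def)
   note D' = this
   show ?thesis
   proof (cases "e_op (tensor Cs) i bs")
    case None thus ?thesis using False e s1 s2 D' by (auto simp: Let_def)
   next
    case (Some w)
    thus ?thesis using False e s1 s2 b D' by (cases "sg' w") (auto simp: Let_def)
   qed
  qed
  moreover have "case f_op (tensor (C # Cs)) i (b # bs) of None => fst (bic (sg b) (sg' bs)) = 0
    | Some w' => w' : {b # bs | b bs. b : S & bs : T} & fst (bic (sg b) (sg' bs)) = Suc (fst (bic (sg (hd w')) (sg' (tl w')))) &
      snd (bic (sg (hd w')) (sg' (tl w'))) = Suc (snd (bic (sg b) (sg' bs)))"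
  proof (cases "p1 <= e2")
   case True
   have "case f_op C i b of None => fst (sg b) = 0
    | Some b' => b' : S & fst (sg b) = Suc (fst (sg b')) & snd (sg b') = Suc (snd (sg b))" using C b(1) by (simp add: strg_def)
   note C' = this
   show ?thesis
   proof (cases "f_op C i b")
    case None thus ?thesis using True e s1 s2 C' by (auto simp: Let_def)
   next
    case (Some w)
    thus ?thesis using True e s1 s2 b C' by (cases "sg w") (auto simp: Let_def)
   qed
  next
   case False
   have "case f_op (tensor Cs) i bs of None => fst (sg' bs) = 0
    | Some b' => b' : T & fst (sg' bs) = Suc (fst (sg' b')) & snd (sg' b') = Suc (snd (sg' bs))" using D b(2) by (simp add: strg_def)
   then obtain b' where "f_op (tensor Cs) i bs = Some b'" "b' : T" "fst (sg' bs) = Suc (fst (sg' b'))" "snd (sg' b') = Suc (snd (sg' bs))"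
    using False s1 by (cases "f_op (tensor Cs) i bs") auto
   thus ?thesis using False e s1 s2 b by (cases "sg' b'") (auto simp: Let_def)
  qed
  ultimately have "(case e_op (tensor (C # Cs)) i (b # bs) of None => snd (bic (sg b) (sg' bs)) = 0
    | Some w' => w' : {b # bs | b bs. b : S & bs : T} & snd (bic (sg b) (sg' bs)) = Suc (snd (bic (sg (hd w')) (sg' (tl w')))) &
      fst (bic (sg (hd w')) (sg' (tl w'))) = Suc (fst (bic (sg b) (sg' bs)))) &
   (case f_op (tensor (C # Cs)) i (b # bs) of None => fst (bic (sg b) (sg' bs)) = 0
    | Some w' => w' : {b # bs | b bs. b : S & bs : T} & fst (bic (sg b) (sg' bs)) = Suc (fst (bic (sg (hd w')) (sg' (tl w')))) &
      snd (bic (sg (hd w')) (sg' (tl w'))) = Suc (snd (bic (sg b) (sg' bs))))" by blast }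
 note main = this
 show ?thesis unfolding strg_def
 proof (intro conjI ballI, goal_cases)
  case (1 w)
  then obtain b bs where "w = b # bs" "b : S" "bs : T" by auto
  thus ?case using conjunct1[OF main[of b bs]] by (simp only: list.sel)
 next
  case (2 w)
  then obtain b bs where "w = b # bs" "b : S" "bs : T" by auto
  thus ?case using conjunct2[OF main[of b bs]] by (simp only: list.sel)
 qed
qed

fun lists_of :: "'b set list => 'b list set" where
 "lists_of [] = {[]}"
| "lists_of (S # Ss) = {b # bs | b bs. b : S & bs : lists_of Ss}"

definition bicsum :: "('b => nat \<times> nat) => 'b list => nat \<times> nat" where
 "bicsum sg w = foldr (%b. bic (sg b)) w (0, 0)"

lemma bicsum_simps [simp]: "bicsum sg [] = (0, 0)" "bicsum sg (b # w) = bic (sg b) (bicsum sg w)" by (simp_all add: bicsum_def)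

lemma bicsum_append: "bicsum sg (u @ w) = bic (bicsum sg u) (bicsum sg w)" by (induction u) (auto simp: bic_assoc)

lemma bicsum_concat: "bicsum (bicsum sg) ws = bicsum sg (concat ws)" by (induction ws) (auto simp: bicsum_append)

lemma lists_of_iff: "w : lists_of Ss \<longleftrightarrow> list_all2 (%S b. b : S) Ss w"
proof (induction Ss arbitrary: w)
 case (Cons S Ss) thus ?case by (cases w) auto
qed auto

lemma strg_cong: "strg C i S sg ==> (!!b. b : S ==> sg b = sg' b) ==> strg C i S sg'"
proof -
 assume s: "strg C i S sg" and h: "!!b. b : S ==> sg b = sg' b"
 { fix b assume b: "b : S"
  have "case e_op C i b of None => snd (sg b) = 0
    | Some b' => b' : S & snd (sg b) = Suc (snd (sg b')) & fst (sg b') = Suc (fst (sg b))" using s b unfolding strg_def by blast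
  hence "case e_op C i b of None => snd (sg' b) = 0
    | Some b' => b' : S & snd (sg' b) = Suc (snd (sg' b')) & fst (sg' b') = Suc (fst (sg' b))"
   using h[OF b] h[of "the (e_op C i b)"] by (cases "e_op C i b") auto }
 moreover
 { fix b assume b: "b : S"
  have "case f_op C i b of None => fst (sg b) = 0
    | Some b' => b' : S & fst (sg b) = Suc (fst (sg b')) & snd (sg b') = Suc (snd (sg b))" using s b unfolding strg_def by blast
  hence "case f_op C i b of None => fst (sg' b) = 0
    | Some b' => b' : S & fst (sg' b) = Suc (fst (sg' b')) & snd (sg' b') = Suc (snd (sg' b))"
   using h[OF b] h[of "the (f_op C i b)"] by (cases "f_op C i b") auto }
 ultimately show ?thesis unfolding strg_def by blast
qed

lemma strg_tensor:
 "list_all2 (%C S. strg C i S sg) Cs Ss ==> strg (tensor Cs) i (lists_of Ss) (bicsum sg)"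
proof (induction Cs Ss rule: list_all2_induct)
 case Nil thus ?case by (simp add: strg_def)
next
 case (Cons C Cs S Ss)
 show ?case unfolding lists_of.simps by (rule strg_cong[OF strg_tensor_Cons[OF Cons(1,3)]]) auto
qed

lemma elems_tensor: "elems (tensor Cs) = lists_of (map elems Cs)" by (induction Cs) (auto simp: Let_def)

subsection \<open>Columns\<close>

fun colsig :: "ytype => nat => column => nat \<times> nat" where
 "colsig (TypeA N) i c = (of_bool (int i : set c & int i + 1 \<notin> set c), of_bool (int i + 1 : set c & int i \<notin> set c))"
| "colsig (TypeD N) i c =
  (of_bool (D_letter_f N i (hd c) ~= None), of_bool (D_letter_e N i (hd c) ~= None))"

lemma sorted_map_replace:
 fixes c :: "int list"
 assumes "sorted_wrt (<) c" "x : set c" "y \<notin> set c" "!!z. z : set c ==> z ~= x ==> (z < x \<longleftrightarrow> z < y) & (x < z \<longleftrightarrow> y < z)"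
 shows "sorted_wrt (<) (map (%z. if z = x then y else z) c)" unfolding sorted_wrt_map by (smt (verit) assms(4) sorted_wrt_mono_rel assms(1))

lemma strg_col_A:
 assumes i: "1 <= i" "i <= N"
 shows "strg (col_crystal (TypeA N) r) i (columns (TypeA N) r) (colsig (TypeA N) i)"
proof -
 { fix c assume c: "c : columns (TypeA N) r" and h: "int i + 1 : set c" "int i \<notin> set c"
  let ?c = "map (%x. if x = int i + 1 then int i else x) c"
  have "sorted_wrt (<) ?c"
  proof (rule sorted_map_replace, goal_cases)
   case (4 z)
   hence "z ~= int i" "z ~= int i + 1" using h by auto
   thus ?case by linarith
  qed (use c h in auto)
  moreover have "set ?c = insert (int i) (set c - {int i + 1})" using h by auto
  ultimately have "?c : columns (TypeA N) r & int i : set ?c & int i + 1 \<notin> set ?c" using c i by auto }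
 note E = this
 { fix c assume c: "c : columns (TypeA N) r" and h: "int i : set c" "int i + 1 \<notin> set c"
  let ?c = "map (%x. if x = int i then int i + 1 else x) c"
  have "sorted_wrt (<) ?c"
  proof (rule sorted_map_replace, goal_cases)
   case (4 z)
   hence "z ~= int i" "z ~= int i + 1" using h by auto
   thus ?case by linarith
  qed (use c h in auto)
  moreover have "set ?c = insert (int i + 1) (set c - {int i})" using h by auto
  ultimately have "?c : columns (TypeA N) r & int i + 1 : set ?c & int i \<notin> set ?c" using c i by auto }
 note F = this
 show ?thesis unfolding strg_def col_crystal_def using E F i by auto
qed

lemma strg_col_D:
 assumes i: "1 <= i" "i <= N" and N: "4 <= N"
 shows "strg (col_crystal (TypeD N) r) i (columns (TypeD N) r) (colsig (TypeD N) i)"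
 unfolding strg_def col_crystal_def using N by (auto simp: D_letter_e_def D_letter_f_def)

definition wf_ytype :: "ytype => bool" where
 "wf_ytype Y = (case Y of TypeA N => 1 <= N | TypeD N => 4 <= N)"

lemma strg_col: "wf_ytype Y ==> i : nodes Y ==> strg (col_crystal Y r) i (columns Y r) (colsig Y i)"
 by (cases Y) (simp_all add: wf_ytype_def strg_col_A strg_col_D del: columns.simps)

definition tabsig :: "ytype => nat => tableau => nat \<times> nat" where
 "tabsig Y i = bicsum (colsig Y i)"

lemma strg_KR:
 assumes "wf_ytype Y" "i : nodes Y"
 shows "strg (KR Y r s) i (lists_of (replicate s (columns Y r))) (tabsig Y i)"
proof -
 have i: "i ~= 0" using assms by (cases Y) auto
 have "list_all2 (%C S. strg C i S (colsig Y i)) (replicate s (col_crystal Y r)) (replicate s (columns Y r))"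
  using strg_col[OF assms] by (simp add: list_all2_conv_all_nth)
 from strg_tensor[OF this] show ?thesis using i by (simp add: strg_def KR_def tabsig_def)
qed

lemma strg_path:
 assumes "wf_ytype Y" "i : nodes Y"
 shows "strg (path_crystal Y B) i (lists_of (map (%(r, s). lists_of (replicate s (columns Y r))) B)) (bicsum (tabsig Y i))" unfolding path_crystal_def
 by (rule strg_tensor) (use strg_KR[OF assms] in \<open>auto simp: list_all2_conv_all_nth split: prod.split\<close>)

definition wf_path :: "ytype => factors => path => bool" where
 "wf_path Y B p \<longleftrightarrow> list_all2 (%(r, s) T. T : tableaux Y r s) B p"

lemma elems_path: "elems (path_crystal Y B) = {p. wf_path Y B p}"
 by (auto simp: path_crystal_def elems_tensor lists_of_iff wf_path_def list_all2_map1 KR_def split_def)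

lemma tableaux_lists: "T : tableaux Y r s ==> T : lists_of (replicate s (columns Y r))"
 by (auto simp: tableaux_def lists_of_iff list_all2_conv_all_nth)

lemma wf_path_lists: "wf_path Y B p ==> p : lists_of (map (%(r, s). lists_of (replicate s (columns Y r))) B)"
 unfolding wf_path_def lists_of_iff list_all2_map1 by (erule list_all2_mono) (auto simp: tableaux_lists lists_of_iff[symmetric])

lemma path_eps:
 assumes "wf_ytype Y" "i : nodes Y" "wf_path Y B p"
 shows "eps (path_crystal Y B) i p = snd (tabsig Y i (concat p))"
  and "phi (path_crystal Y B) i p = fst (tabsig Y i (concat p))" using strg_eps[OF strg_path[OF assms(1,2)] wf_path_lists[OF assms(3)]]
  strg_phi[OF strg_path[OF assms(1,2)] wf_path_lists[OF assms(3)]] by (simp_all add: tabsig_def bicsum_concat)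

definition hw_word :: "ytype => tableau => bool" where
 "hw_word Y w \<longleftrightarrow> (\<forall>i\<in>nodes Y. snd (tabsig Y i w) = 0)"

definition word_wt :: "ytype => tableau => weight" where
 "word_wt Y w i = (if i : nodes Y then int (fst (tabsig Y i w)) - int (snd (tabsig Y i w)) else 0)"

lemma hw_vectors_path:
 "wf_ytype Y ==> hw_vectors (nodes Y) (path_crystal Y B) = {p. wf_path Y B p & hw_word Y (concat p)}"
 by (auto simp: hw_vectors_def elems_path hw_word_def path_eps)

lemma wt_path:
 "wf_ytype Y ==> wf_path Y B p ==> wt (nodes Y) (path_crystal Y B) p = word_wt Y (concat p)" by (auto simp: wt_def word_wt_def path_eps)

lemma hw_word_dominant: "hw_word Y w ==> word_wt Y w : dominant (nodes Y)" by (auto simp: dominant_def word_wt_def hw_word_def)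

lemma hw_word_append: "hw_word Y (u @ w) ==> hw_word Y w" by (auto simp: hw_word_def tabsig_def bicsum_append bic_snd_0)

lemma word_wt_append: "word_wt Y (u @ w) i = word_wt Y u i + word_wt Y w i" using bic_diff by (auto simp: word_wt_def tabsig_def bicsum_append)

lemma hw_wt_path:
 "wf_ytype Y ==> hw_vectors_wt (nodes Y) (path_crystal Y B) lam
  = {p. wf_path Y B p & hw_word Y (concat p) & word_wt Y (concat p) = lam}" by (auto simp: hw_vectors_wt_def hw_vectors_path wt_path)

section \<open>Vacancy numbers of type A configurations as states\<close>

definition msum :: "nat multiset => nat => int" where
 "msum M i = int (\<Sum>j\<in>#M. min i j)"

lemma msum_simps [simp]: "msum {#} i = 0" "msum (add_mset j M) i = int (min i j) + msum M i"
 "msum (M + M') i = msum M i + msum M' i" by (simp_all add: msum_def)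

lemma msum_diff: "j \<in># M ==> msum (M - {#j#}) i = msum M i - int (min i j)" by (auto dest!: multi_member_split)

lemma cartan_A_sum:
 assumes "1 <= a" "a <= N"
 shows "(\<Sum>b\<in>nodes (TypeA N). cartan (TypeA N) a b * f b)
  = 2 * f a - (if 1 < a then f (a - 1) else 0) - (if a < N then f (a + 1) else 0)"
proof -
 have "(\<Sum>b\<in>nodes (TypeA N). cartan (TypeA N) a b * f b)
  = (\<Sum>b\<in>{1..N}. (if b = a then 2 * f b else 0) - (if b = a - 1 then f b else 0) - (if b = a + 1 then f b else 0))"
  by (rule sum.cong) (use assms in auto)
 also have "\<dots> = 2 * f a - (if 1 < a then f (a - 1) else 0) - (if a < N then f (a + 1) else 0)"
  using assms by (simp add: sum_subtractf sum.delta) auto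
 finally show ?thesis .
qed

lemma vacancy_A:
 assumes "1 <= a" "a <= N"
 shows "vacancy (TypeA N) L nu a i = msum (L a) i - 2 * msum (nu a) i
  + (if 1 < a then msum (nu (a - 1)) i else 0) + (if a < N then msum (nu (a + 1)) i else 0)"
 unfolding vacancy_def msum_def[symmetric] using cartan_A_sum[OF assms, of "%b. msum (nu b) i"] by simp

text \<open>Chains see the array L only through the vacancy numbers, so a state carries these
  instead of L. They are zero off the diagram, as \<open>valid\<close> asks.\<close>

definition stateA :: "nat => arr => rigged => state" where
 "stateA N L R = ((%a i. if 1 <= a & a <= N then vacancy (TypeA N) L (shape R) a i else 0), R)"

lemma snd_stateA [simp]: "snd (stateA N L R) = R" by (simp add: stateA_def)

lemma stateA_fst: "1 <= a ==> a <= N ==> fst (stateA N L R) a i = vacancy (TypeA N) L (shape R) a i" by (simp add: stateA_def)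

lemma RC_wt_validS: "R : RC_wt (TypeA N) L lam ==> validS N (stateA N L R)" by (auto simp: validS_def valid_def RC_wt_def stateA_def)

lemma shape_rm:
 assumes "!!i. s a = enat i ==> 1 <= a ==> a <= N ==> (i, p a i) \<in># R a"
 shows "shape (rm N R s p p') a = (if 1 <= a & a <= N then (case s a of \<infinity> => shape R a
  | enat i => shape R a - {#i#} + (if 1 < i then {#i - 1#} else {#})) else shape R a)"
 using assms by (auto simp: shape_def rm_def image_mset_Diff split: enat.split)

lemma msum_rm:
 assumes "!!i. s a = enat i ==> (i, p a i) \<in># R a & 1 <= i" "1 <= a" "a <= N"
 shows "msum (shape (rm N R s p p') a) i = msum (shape R a) i - chi (s a) i"
proof (cases "s a")
 case infinity
 thus ?thesis using assms(2,3) by (subst shape_rm) auto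
next
 case (enat j)
 have "j \<in># shape R a" using assms(1)[OF enat] by (force simp: shape_def)
 hence "msum (shape R a - {#j#}) i = msum (shape R a) i - int (min i j)" by (rule msum_diff)
 thus ?thesis using enat assms by (subst shape_rm) (auto simp: chi_def min_def)
qed

lemma stateA_step:
 assumes s: "!!a i. s a = enat i ==> 1 <= a ==> a <= N ==> (i, p a i) \<in># R a & 1 <= i"
  and L: "!!a i. 1 <= a ==> a <= N ==>
   msum (L' a) i = msum (L a) i - (if a = 1 then chi (s 0) i else 0) - (if a = N then chi (s (Suc N)) i else 0)"
 shows "fst (stateA N L' (rm N R s p p')) = upd N (fst (stateA N L R)) s"
proof (intro ext)
 fix a i
 show "fst (stateA N L' (rm N R s p p')) a i = upd N (fst (stateA N L R)) s a i" using L msum_rm s by (auto simp: stateA_def vacancy_A upd_def)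
qed

lemma up_props:
 assumes "valid N p R" "up k p R a = enat i" "1 <= a"
 shows "(i, p a i) \<in># R a & 1 <= i" using up_sing'[OF assms(3,2)] valid_pos[OF assms(1)] by (auto simp: sing_def)

lemma dn_props:
 assumes "valid N p R" "dn N k p R a = enat i" "a <= N"
 shows "(i, p a i) \<in># R a & 1 <= i" using dn_sing[OF assms(3,2)] valid_pos[OF assms(1)] by (auto simp: sing_def)

lemma stp_eq: "stp N s X = (upd N (fst X) s, rm N (snd X) s (fst X) (upd N (fst X) s))" by (cases X) simp

lemma stateA_upS:
 assumes v: "validS N (stateA N L R)"
  and L: "!!a i. 1 <= a ==> a <= N ==> msum (L' a) i = msum (L a) i - of_bool (a = 1 & k <= i)"
 shows "stateA N L' (snd (upS N k (stateA N L R))) = upS N k (stateA N L R)"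
proof -
 let ?X = "stateA N L R"
 let ?s = "up k (fst ?X) R"
 have "fst (stateA N L' (rm N R ?s (fst ?X) (upd N (fst ?X) ?s))) = upd N (fst ?X) ?s"
  by (rule stateA_step) (use v L up_props[of N "fst ?X" R k] up_end[of N "fst ?X" R k] in \<open>auto simp: validS_def chi_const simp del: up.simps(2)\<close>)
 thus ?thesis unfolding upS_def stp_eq snd_stateA snd_conv by (intro prod_eqI) simp_all
qed

lemma stateA_dnS:
 assumes v: "validS N (stateA N L R)"
  and L: "!!a i. 1 <= a ==> a <= N ==> msum (L' a) i = msum (L a) i - of_bool (a = N & k <= i)"
 shows "stateA N L' (snd (dnS N k (stateA N L R))) = dnS N k (stateA N L R)"
proof -
 let ?X = "stateA N L R"
 let ?s = "dn N k (fst ?X) R"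
 have "fst (stateA N L' (rm N R ?s (fst ?X) (upd N (fst ?X) ?s))) = upd N (fst ?X) ?s"
  by (rule stateA_step) (use v L dn_props[of N "fst ?X" R k] dn_0[of N "fst ?X" R k] in \<open>auto simp: validS_def chi_const\<close>)
 thus ?thesis unfolding dnS_def stp_eq snd_stateA snd_conv by (intro prod_eqI) simp_all
qed

subsection \<open>The algorithm as a selection of strings\<close>

definition enat_of :: "nat option => enat" where
 "enat_of z = (case z of None => \<infinity> | Some i => enat i)"

lemma enat_of_simps [simp]: "enat_of None = \<infinity>" "enat_of (Some i) = enat i" by (simp_all add: enat_of_def)

lemma enat_of_first_from: "enat_of (first_from Q k) = first Q (enat k)"
proof (cases "\<exists>i\<ge>k. Q i")
 case True
 then obtain i where i: "k <= i & Q i" by auto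
 have *: "k <= (LEAST i. k <= i & Q i) & Q (LEAST i. k <= i & Q i)" by (rule LeastI) (rule i)
 have "first Q (enat k) = enat (LEAST i. k <= i & Q i)" by (rule first_eqI) (use * in \<open>auto intro: Least_le\<close>)
 thus ?thesis using True by (simp add: first_from_def)
next
 case False
 have "first Q (enat k) = \<infinity>" by (rule first_eqI) (use False in auto)
 thus ?thesis using False by (auto simp: first_from_def)
qed

lemma enat_of_bind: "enat_of (Option.bind z (first_from Q)) = first Q (enat_of z)" by (cases z) (simp_all add: enat_of_first_from)

lemma num_singular_sing:
 assumes "1 <= a" "a <= N"
 shows "1 <= num_singular (TypeA N) L R a i \<longleftrightarrow> sing (fst (stateA N L R)) R a i"
 using assms by (simp add: num_singular_def sing_def stateA_def)

lemma ell_up: "1 <= a ==> a <= N ==> enat_of (ell_chain (TypeA N) L R a) = up 1 (fst (stateA N L R)) R a"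
proof (induction a)
 case (Suc a)
 have Q: "(%i. 1 <= num_singular (TypeA N) L R (Suc a) i) = sing (fst (stateA N L R)) R (Suc a)"
  using num_singular_sing[of "Suc a" N] Suc.prems by auto
 show ?case
 proof (cases "a = 0")
  case True
  thus ?thesis using Q by (simp add: enat_of_first_from)
 next
  case False
  hence "enat_of (ell_chain (TypeA N) L R a) = up 1 (fst (stateA N L R)) R a" using Suc by auto
  thus ?thesis using Q by (simp add: enat_of_bind)
 qed
qed simp

text \<open>Asks for positive string lengths and empty multisets off the diagram rather than for a
  valid state, so that it also applies at the intermediate stages of
  \<open>column_stage\<close>.\<close>

lemma delta_rm:
 assumes t: "!!a. 1 <= a ==> a <= N ==> t a = up 1 (fst (stateA N L R)) R a" "t 0 = 1" "t (Suc N) = \<infinity>"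
  and v: "!!a. ~ (1 <= a & a <= N) ==> R a = {#}" "!!a i x. (i, x) \<in># R a ==> 1 <= i"
  and L: "1 \<in># L 1"
 shows "delta (TypeA N) L R = rm N R t (fst (stateA N L R)) (upd N (fst (stateA N L R)) t)"
proof -
 let ?p = "fst (stateA N L R)"
 define sel where "sel = selected (TypeA N) L R"
 define L' where "L' = L(1 := L 1 - {#1#})"
 define nu' where "nu' = (%a. shape R a - sel a + {# i - 1. i \<in># filter_mset (%i. i > 1) (sel a) #})"
 have sel: "sel a = (case t a of \<infinity> => {#} | enat i => {#i#})" if "1 <= a" "a <= N" for a
  using trans[OF t(1)[OF that] ell_up[OF that, of L R, symmetric]] that by (cases "ell_chain (TypeA N) L R a") (simp_all add: sel_def opt_mset_def)
 have sel0: "sel a = {#}" if "~ (1 <= a & a <= N)" for a using that by (auto simp: sel_def)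
 have mem: "(i, ?p a i) \<in># R a & 1 <= i" if "t a = enat i" "1 <= a" "a <= N" for a i
  using up_sing'[of a 1 ?p R i] t(1) that v(2) by (auto simp: sing_def)
 have nu': "nu' = shape (rm N R t ?p q)" for q
 proof
  fix a
  show "nu' a = shape (rm N R t ?p q) a"
  proof (cases "1 <= a & a <= N")
   case True
   thus ?thesis using sel[of a] mem[of a] by (subst shape_rm) (auto simp: nu'_def split: enat.split)
  next
   case False
   thus ?thesis using sel0 by (simp add: nu'_def) (auto simp: shape_def rm_def)
  qed
 qed
 have st: "fst (stateA N L' (rm N R t ?p q)) = upd N ?p t" for q
 using msum_diff L t(2,3) stateA_step mem by (fastforce simp: L'_def chi_def one_enat_def)
 have vac: "vacancy (TypeA N) L' nu' a i = upd N ?p t a i" if "1 <= a" "a <= N" for a i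
  using stateA_fst[OF that, of L' "rm N R t ?p ?p" i] st[of ?p] nu'[of ?p] by simp
 show ?thesis
 proof
  fix a
  have d: "delta (TypeA N) L R a = R a - {# (i, vacancy (TypeA N) L (shape R) a i). i \<in># sel a #}
    + {# (i - 1, vacancy (TypeA N) L' nu' a (i - 1)). i \<in># filter_mset (%i. i > 1) (sel a) #}" by (simp add: delta_def sel_def L'_def nu'_def)
  show "delta (TypeA N) L R a = rm N R t ?p (upd N ?p t) a"
  proof (cases "1 <= a & a <= N")
   case True
   thus ?thesis unfolding d using sel[of a] vac[of a] by (cases "t a") (auto simp: rm_def stateA_def)
  next
   case False
   thus ?thesis unfolding d using sel0[of a] by (auto simp: rm_def)
  qed
 qed
qed

text \<open>No rigging reaches p + 1, so raising the vacancy numbers at node 1 for lengths up to k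
  makes the strings of these lengths non-singular there and changes nothing else about the
  search.\<close>

lemma split_up:
 assumes v: "valid N p R" and N: "1 <= N"
  and p2: "!!a i. 1 <= a ==> a <= N ==> p2 a i = p a i + of_bool (a = 1 & 1 <= i & i <= k)"
 shows "1 <= a ==> up 1 p2 R a = up (Suc k) p R a"
  and "rm N R (up 1 p2 R) p2 (upd N p2 (up 1 p2 R)) = rm N R (up (Suc k) p R) p (upd N p (up (Suc k) p R))"
proof -
 have S: "sing p2 R a i \<longleftrightarrow> sing p R a i & ~ (a = 1 & i <= k)" for a i
 proof (cases "1 <= a & a <= N")
  case True
  have "(i, p a i + 1) \<notin># R a" using valid_le[OF v, of i "p a i + 1" a] by auto
  moreover have "(0, x) \<notin># R a" for x using valid_pos[OF v, of 0 x a] by auto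
  ultimately show ?thesis using p2[of a i] True by (cases "i = 0") (auto simp: sing_def)
 next
  case False thus ?thesis using v by (auto simp: sing_def valid_def)
 qed
 have e: "1 <= a ==> up 1 p2 R a = up (Suc k) p R a" for a
 proof (induction a)
  case (Suc a)
  show ?case
  proof (cases "a = 0")
   case True
   have "first (sing p2 R 1) 1 = first (sing p R 1) (enat (Suc k))"
   proof (rule first_eqI)
    show "1 <= first (sing p R 1) (enat (Suc k))" using first_ge[of "enat (Suc k)"] by (rule order_trans[rotated]) (simp add: one_enat_def)
    fix i
    { assume i: "first (sing p R 1) (enat (Suc k)) = enat i"
     have "Suc k <= i" using first_ge[of "enat (Suc k)" "sing p R 1"] i by simp
     thus "sing p2 R 1 i" using first_sat[OF i] S by auto }
    assume "1 <= enat i" "sing p2 R 1 i"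
    thus "first (sing p R 1) (enat (Suc k)) <= enat i" using S by (intro first_le) auto
   qed
   thus ?thesis using True by (simp add: one_enat_def)
  next
   case False
   hence "sing p2 R (Suc a) = sing p R (Suc a)" using S by auto
   thus ?thesis using Suc False by simp
  qed
 qed simp
 show "1 <= a ==> up 1 p2 R a = up (Suc k) p R a" by (rule e)
 show "rm N R (up 1 p2 R) p2 (upd N p2 (up 1 p2 R)) = rm N R (up (Suc k) p R) p (upd N p (up (Suc k) p R))"
 proof
  fix a
  show "rm N R (up 1 p2 R) p2 (upd N p2 (up 1 p2 R)) a = rm N R (up (Suc k) p R) p (upd N p (up (Suc k) p R)) a"
  proof (cases "1 <= a & a <= N")
   case True
   let ?s = "up (Suc k) p R"
   have e': "up 1 p2 R a = ?s a" "up 1 p2 R (Suc a) = ?s (Suc a)" "1 < a ==> up 1 p2 R (a - 1) = ?s (a - 1)" using e True by (auto simp del: up.simps)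
   show ?thesis
   proof (cases "?s a")
    case infinity thus ?thesis using e' by (simp add: rm_def)
   next
    case (enat i)
    have ik: "Suc k <= i" using up_ge[of "Suc k" p R a] enat by simp
    have 1: "p2 a i = p a i" using p2[of a i] True ik by auto
    have 2: "upd N p2 (up 1 p2 R) a (i - 1) = upd N p ?s a (i - 1)" if "1 < i"
     using p2[of a "i - 1"] True e' that by (cases "a = 1") (auto simp: upd_def chi_const simp del: up.simps(2))
    show ?thesis using e'(1) enat 1 2 by (auto simp: rm_def)
   qed
  qed (auto simp: rm_def)
 qed
qed

lemma split_dn:
 assumes v: "valid N p R" and N: "1 <= N" and v2: "valid N p2 R"
  and p2: "!!a i. 1 <= a ==> a <= N ==> p2 a i = p a i + of_bool (a = N & 1 <= i & i <= k)"
 shows "snd (dnS N 1 (p2, R)) = snd (dnS N (Suc k) (p, R))"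
  and "a <= N ==> dn N 1 p2 R a = dn N (Suc k) p R a"
proof -
 have q: "flip N p2 a i = flip N p a i + of_bool (a = 1 & 1 <= i & i <= k)" if "1 <= a" "a <= N" for a i using that p2 by (simp add: flip_def)
 note u = split_up[OF valid_flip[OF v] N q]
 have "snd (upS N 1 (flipS N (p2, R))) = snd (upS N (Suc k) (flipS N (p, R)))" using u(2) by (simp add: upS_def)
 hence "snd (flipS N (upS N 1 (flipS N (p2, R)))) = snd (flipS N (upS N (Suc k) (flipS N (p, R))))" by (metis flipS.simps prod.collapse snd_conv)
 thus "snd (dnS N 1 (p2, R)) = snd (dnS N (Suc k) (p, R))"
  using flipS_upS[of N "flipS N (p2, R)"] flipS_upS[of N "flipS N (p, R)"] flipS_flipS[of N "(p2, R)"] flipS_flipS[of N "(p, R)"]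
   validS_flip[of N "(p2, R)"] validS_flip[of N "(p, R)"] v v2 by (simp add: validS_def)
 assume "a <= N"
 hence "1 <= N + 1 - a" by simp
 thus "dn N 1 p2 R a = dn N (Suc k) p R a"
  unfolding dn_def flip_def[of N "up 1 (flip N p2) (flip N R)"] flip_def[of N "up (Suc k) (flip N p) (flip N R)"] by (intro u(1)) auto
qed

text \<open>One round for a column of height r, when the downward chain has been removed at the
  nodes above r. The added strings of length one lead the search through the nodes below r and
  disappear again. At r the vacancy numbers are such that exactly \<open>m r\<close> is selected,
  and at r + 1 they exceed every rigging, so the search stops. The round thus extends the removal to
  node r.\<close>

lemma column_stage:
 fixes N r :: nat and p2 :: vacancies and R :: rigged
 defines "m \<equiv> dn N 1 p2 R"
 defines "pf \<equiv> upd N p2 m"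
 defines "s \<equiv> %r a. if r < a then m a else \<infinity>"
 assumes v: "valid N p2 R" and r: "1 <= r" "r <= N"
  and P: "!!a i. 1 <= a ==> a <= N ==> 1 <= i ==> P a i = upd N p2 (s r) a i + of_bool (a = r)"
  and Rp: "!!a. Rp a = rm N R (s r) p2 pf a + (if 1 <= a & a < r then {#(1, P a 1)#} else {#})"
  and PL: "P = fst (stateA N L4 Rp)" and L4: "1 \<in># L4 1"
 shows "delta (TypeA N) L4 Rp = rm N R (s (r - 1)) p2 pf"
proof -
 define t where "t = (%a. if a < r then 1 else if a = r then m r else \<infinity>)"
 have off: "Rp a = {#}" if "~ (1 <= a & a <= N)" for a using v that r by (auto simp: valid_def Rp rm_def)
 have pos: "1 <= i" if "(i, x) \<in># Rp a" for a i x using that mem_rm_cases[OF v, of i x "s r" pf a] by (auto simp: Rp split: if_splits)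
 have same: "Rp a = R a" if "a = r" for a using that by (simp add: Rp rm_def s_def)
 have mSr: "m (Suc r) <= m r" "m (Suc (Suc r)) <= m (Suc r)" if "Suc r <= N"
  using that dn_mono[of r "Suc r" N 1 p2 R] dn_mono[of "Suc r" "Suc (Suc r)" N 1 p2 R] by (auto simp: m_def)
 have Pr: "P r i = p2 r i + 1 - chi (m (Suc r)) i" if "1 <= i" for i using P[OF r that] r by (simp add: upd_def s_def)
 have up_t: "up 1 P Rp a = t a" if "a <= N" for a using that
 proof (induction a)
  case 0 thus ?case using r by (simp add: t_def one_enat_def)
 next
  case (Suc a)
  hence IH: "up 1 P Rp a = t a" by simp
  consider "Suc a < r" | "Suc a = r" | "a = r" | "r < a" by linarith
  thus ?case
  proof cases
   case 1
   have "sing P Rp (Suc a) 1" using 1 by (simp add: sing_def Rp)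
   hence "first (sing P Rp (Suc a)) 1 = 1" by (intro first_eqI) (auto simp: one_enat_def)
   thus ?thesis using IH 1 by (simp add: t_def)
  next
   case 2
   have "first (sing P Rp r) 1 = m r"
   proof (rule first_eqI)
    show "1 <= m r" using dn_ge[of 1 N p2 R r] by (simp add: m_def one_enat_def)
    fix i
    { assume i: "m r = enat i"
     have S: "sing p2 R r i" using dn_sing[of r N 1 p2 R i] i r by (simp add: m_def)
     hence i1: "1 <= i" using valid_pos[OF v] by (auto simp: sing_def)
     have "m (Suc r) <= enat i" using dn_mono[of r "Suc r" N 1 p2 R] r i by (simp add: m_def)
     hence "P r i = p2 r i" using Pr[OF i1] by simp
     thus "sing P Rp r i" using S same by (simp add: sing_def) }
    assume i: "1 <= enat i" "sing P Rp r i"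
    hence i1: "1 <= i" by (simp add: one_enat_def)
    have mem: "(i, P r i) \<in># R r" using i(2) same by (simp add: sing_def)
    show "m r <= enat i"
    proof (cases "m (Suc r) <= enat i")
     case True
     hence "sing p2 R r i" using Pr[OF i1] mem by (simp add: sing_def)
     thus ?thesis using dn_stop[of N 1 p2 R r i] True r by (simp add: m_def)
    next
     case False
     hence "P r i = p2 r i + 1" using Pr[OF i1] by simp
     thus ?thesis using valid_le[OF v mem] by simp
    qed
   qed
   thus ?thesis using IH 2 by (auto simp: t_def)
  next
   case 3
   have aN: "Suc r <= N" using Suc.prems 3 by simp
   have "first (sing P Rp (Suc r)) (m r) = \<infinity>"
   proof (rule first_eqI)
    fix i assume i: "m r <= enat i" "sing P Rp (Suc r) i"
    have le: "m (Suc r) <= enat i" "m (Suc (Suc r)) <= enat i" using mSr[OF aN] i(1) by auto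
    have mem: "(i, P (Suc r) i) \<in># rm N R (s r) p2 pf (Suc r)" using i(2) by (simp add: sing_def Rp)
    have i1: "1 <= i" using mem_rm_cases[OF v mem] by simp
    have "s r (Suc r) ~= enat (Suc i)" using le by (auto simp: s_def)
    hence mem': "(i, P (Suc r) i) \<in># R (Suc r)" using mem_rm_cases[OF v mem] by auto
    have "P (Suc r) i = p2 (Suc r) i + 1" using P[of "Suc r" i] aN i1 le by (simp add: upd_def s_def)
    thus "\<infinity> <= enat i" using valid_le[OF v mem'] by simp
   qed auto
   thus ?thesis using IH 3 by (simp add: t_def)
  next
   case 4 thus ?thesis using IH by (simp add: t_def)
  qed
 qed
 have d: "delta (TypeA N) L4 Rp = rm N Rp t P (upd N P t)"
  unfolding PL by (rule delta_rm) (use up_t PL off pos L4 r in \<open>auto simp: t_def\<close>)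
 show ?thesis unfolding d
 proof
  fix a
  show "rm N Rp t P (upd N P t) a = rm N R (s (r - 1)) p2 pf a"
  proof (cases "1 <= a & a <= N")
   case True
   consider "a < r" | "a = r" | "r < a" by linarith
   thus ?thesis
   proof cases
    case 1
    hence "~ r - 1 < a" "~ r < a" by auto
    thus ?thesis using True 1 by (simp add: rm_def t_def Rp s_def one_enat_def)
   next
    case 2
    show ?thesis
    proof (cases "m r")
     case infinity thus ?thesis using 2 same[of a] by (simp add: rm_def t_def s_def)
    next
     case (enat i)
     have "sing p2 R r i" using dn_sing[of r N 1 p2 R i] enat r by (simp add: m_def)
     hence i1: "1 <= i" using valid_pos[OF v] by (auto simp: sing_def)
     have le: "m (Suc r) <= enat i" using dn_mono[of r "Suc r" N 1 p2 R] r enat by (simp add: m_def)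
     hence 1: "P r i = p2 r i" using Pr[OF i1] by simp
     have 3: "upd N P t r (i - 1) = pf r (i - 1)" if "1 < i"
     proof -
      have "m r <= m (r - 1)" using dn_mono[of "r - 1" r N 1 p2 R] r by (simp add: m_def)
      moreover have mr: "enat (i - 1) < m r" using enat that by simp
      ultimately have "enat (i - 1) < m (r - 1)" by (rule less_le_trans[rotated])
      note mr this
      moreover have "t (r - 1) = 1" "t (Suc r) = \<infinity>" "t r = m r" using r by (auto simp: t_def)
      ultimately show ?thesis using Pr[of "i - 1"] that r by (simp add: upd_def pf_def one_enat_def)
     qed
     show ?thesis using 2 same[of a] enat 1 3 by (simp add: rm_def t_def s_def)
    qed
   next
    case 3
    hence "s (r - 1) a = s r a" by (auto simp: s_def)
    thus ?thesis using 3 by (simp add: rm_def t_def Rp)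
   qed
  next
   case False
   hence "R a = {#}" using v unfolding valid_def by blast
   thus ?thesis using False off[OF False] by (auto simp: rm_def)
  qed
 qed
qed

lemma msum_mult_array: "msum (mult_array ((r, s) # B) a) i = msum (mult_array B a) i + (if r = a then int (min i s) else 0)"
 by (simp add: mult_array_def)

lemma mult_array_Cons: "mult_array ((r, s) # B) a = (if r = a then {#s#} else {#}) + mult_array B a" by (simp add: mult_array_def)

text \<open>The strings of length one at the nodes below r cancel the contributions of the factors
  at nodes 1 and r - 1 and leave an extra one at node r. The factor at node N is accounted for by
  the finite end value of the chain.\<close>

lemma column_stage_vacancy:
 fixes N r :: nat and R :: rigged and B :: factors
 defines "p2 \<equiv> fst (stateA N (mult_array ((N, 1) # B)) R)"
 defines "m \<equiv> dn N 1 p2 R"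
 defines "s \<equiv> %a. if r < a then m a else \<infinity>"
 assumes v: "valid N p2 R" and r: "1 <= r" "r <= N"
  and Rp: "!!a. shape Rp a = shape (rm N R s p2 pf) a + (if 1 <= a & a < r then {#1#} else {#})"
  and L4: "L4 = mult_array (if r = 1 then (1, 1) # B else (1, 1) # (r - 1, 1) # B)"
  and a: "1 <= a" "a <= N" and i: "1 <= i"
 shows "vacancy (TypeA N) L4 (shape Rp) a i = upd N p2 s a i + of_bool (a = r)"
proof -
 have sh: "msum (shape Rp b) i = msum (shape R b) i - chi (s b) i + of_bool (1 <= b & b < r)" if "1 <= b" "b <= N" for b
 using i msum_rm that dn_props[OF v, of 1 b] by (fastforce simp: s_def m_def Rp)
 have L: "msum (L4 a) i = msum (mult_array B a) i + of_bool (a = 1) + of_bool (1 < r & a = r - 1)" using i r by (auto simp: L4 msum_mult_array)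
 have mN: "chi (m (Suc N)) i = 1" using i by (simp add: m_def)
 have p2: "p2 a i = msum (mult_array B a) i + of_bool (a = N) - 2 * msum (shape R a) i
  + (if 1 < a then msum (shape R (a - 1)) i else 0) + (if a < N then msum (shape R (a + 1)) i else 0)"
  using a i by (simp add: p2_def stateA_fst vacancy_A msum_mult_array)
 have u: "upd N p2 s a i = p2 a i + 2 * chi (s a) i - (if 1 < a then chi (s (a - 1)) i else 0)
   - (if a < N then chi (s (a + 1)) i else 1)" using a r mN by (auto simp: upd_def s_def)
 show ?thesis unfolding vacancy_A[OF a] u p2 L using sh[of a] sh[of "a - 1"] sh[of "a + 1"] a r by auto
qed

subsection \<open>Paths and single steps\<close>

definition hw_path :: "ytype => factors => path => bool" where
 "hw_path Y B p \<longleftrightarrow> admissible Y B & wf_path Y B p & hw_word Y (concat p)"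

lemma Phi_RC:
 assumes "rc_bijection Y Phi" "wf_ytype Y" "hw_path Y B p"
 shows "Phi B p : RC_wt Y (mult_array B) (word_wt Y (concat p))"
using assms hw_word_dominant by (fastforce simp: rc_bijection_def hw_path_def bij_betw_def hw_wt_path)

lemma Phi_inj:
 assumes "rc_bijection Y Phi" "wf_ytype Y" "hw_path Y B p" "hw_path Y B p'" "Phi B p = Phi B p'"
  and "word_wt Y (concat p) = word_wt Y (concat p')"
 shows "p = p'"
proof -
 have "bij_betw (Phi B) (hw_vectors_wt (nodes Y) (path_crystal Y B) (word_wt Y (concat p)))
   (RC_wt Y (mult_array B) (word_wt Y (concat p)))" using assms hw_word_dominant unfolding rc_bijection_def hw_path_def by blast
 hence "inj_on (Phi B) (hw_vectors_wt (nodes Y) (path_crystal Y B) (word_wt Y (concat p)))" by (simp add: bij_betw_def)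
 thus ?thesis by (rule inj_onD) (use assms in \<open>auto simp: hw_wt_path hw_path_def\<close>)
qed

lemma Phi_surj:
 assumes "rc_bijection Y Phi" "wf_ytype Y" "admissible Y B" "lam : dominant (nodes Y)" "R : RC_wt Y (mult_array B) lam"
 obtains p where "hw_path Y B p" "word_wt Y (concat p) = lam" "Phi B p = R"
proof -
 have "bij_betw (Phi B) (hw_vectors_wt (nodes Y) (path_crystal Y B) lam) (RC_wt Y (mult_array B) lam)" using assms unfolding rc_bijection_def by blast
 hence "R : Phi B ` hw_vectors_wt (nodes Y) (path_crystal Y B) lam" using assms(5) by (simp add: bij_betw_def)
 then obtain p where "p : hw_vectors_wt (nodes Y) (path_crystal Y B) lam" "Phi B p = R" by blast
 thus ?thesis using that assms by (auto simp: hw_wt_path hw_path_def)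
qed

lemma Phi_lh:
 assumes "rc_bijection Y Phi" "wf_ytype Y" "hw_path Y ((1, 1) # B) (T # p)"
 shows "Phi B p = delta Y (mult_array ((1, 1) # B)) (Phi ((1, 1) # B) (T # p))"
using assms by (fastforce simp: rc_bijection_def hw_path_def hw_vectors_path lh_def)

lemma Phi_ls:
 assumes "rc_bijection Y Phi" "wf_ytype Y" "hw_path Y ((r, Suc k) # B) ((c # cs) # p)" "1 <= k"
 shows "Phi ((r, 1) # (r, k) # B) ([c] # cs # p) = Phi ((r, Suc k) # B) ((c # cs) # p)"
proof -
 have "\<forall>r s B b. 2 <= s & admissible Y ((r, s) # B) & b : hw_vectors (nodes Y) (path_crystal Y ((r, s) # B)) \<longrightarrow>
    Phi ((r, 1) # (r, s - 1) # B) (ls b) = Phi ((r, s) # B) b" using assms(1) unfolding rc_bijection_def by blast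
 from this[rule_format, of "Suc k" r B "(c # cs) # p"] show ?thesis using assms by (simp add: hw_path_def hw_vectors_path)
qed

lemma Phi_lb:
 assumes "rc_bijection Y Phi" "wf_ytype Y" "hw_path Y ((r, 1) # B) ([c] # p)" "2 <= r"
 shows "Phi ((1, 1) # (r - 1, 1) # B) ([[last c]] # [butlast c] # p)
  = i_bar Y (mult_array ((1, 1) # (r - 1, 1) # B)) r (Phi ((r, 1) # B) ([c] # p))"
using assms by (fastforce simp: rc_bijection_def hw_path_def hw_vectors_path)

lemma hw_path_tl: "hw_path Y (b # B) (T # p) ==> hw_path Y B p" by (auto simp: hw_path_def admissible_def wf_path_def intro: hw_word_append)

lemma hw_path_ls:
 assumes "hw_path Y ((r, Suc k) # B) ((c # cs) # p)" "1 <= k"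
 shows "hw_path Y ((r, 1) # (r, k) # B) ([c] # cs # p)"
proof -
 have "admissible_factor Y (r, 1) & admissible_factor Y (r, k)" using assms by (cases Y) (auto simp: hw_path_def admissible_def)
 moreover have "[c] : tableaux Y r 1" "cs : tableaux Y r k" using assms by (auto simp: hw_path_def wf_path_def tableaux_def successively_Cons)
 ultimately show ?thesis using assms by (auto simp: hw_path_def admissible_def wf_path_def)
qed

definition fac :: "nat => nat => factors" where
 "fac r k = (if k = 0 then [] else [(r, k)])"

definition tabs :: "tableau => path" where
 "tabs T = (if T = [] then [] else [T])"

lemma msum_fac: "msum (mult_array (fac r k @ B) a) i = msum (mult_array B a) i + (if r = a then int (min i k) else 0)"
 by (simp add: fac_def msum_mult_array)

lemma hw_path_split:
 assumes "hw_path Y ((r, Suc k) # B) ((c # cs) # p)"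
 shows "hw_path Y ((r, 1) # fac r k @ B) ([c] # tabs cs @ p)"
proof (cases "k = 0")
 case True
 hence "cs = []" using assms by (auto simp: hw_path_def wf_path_def tableaux_def)
 thus ?thesis using assms True by (simp add: fac_def tabs_def)
next
 case False
 hence "cs ~= []" using assms by (auto simp: hw_path_def wf_path_def tableaux_def)
 thus ?thesis using hw_path_ls[OF assms] False by (simp add: fac_def tabs_def)
qed

lemma Phi_split:
 assumes "rc_bijection Y Phi" "wf_ytype Y" "hw_path Y ((r, Suc k) # B) ((c # cs) # p)"
 shows "Phi ((r, 1) # fac r k @ B) ([c] # tabs cs @ p) = Phi ((r, Suc k) # B) ((c # cs) # p)"
using assms Phi_ls[OF assms] by (auto simp: hw_path_def wf_path_def tableaux_def fac_def tabs_def)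

lemma colsig_split:
 assumes "c : columns (TypeA N) r" "2 <= r"
 shows "colsig (TypeA N) i c = bic (colsig (TypeA N) i [last c]) (colsig (TypeA N) i (butlast c))"
proof -
 obtain d x where c: "c = d @ [x]" using assms by (cases c rule: rev_cases) auto
 have "\<forall>y\<in>set d. y < x" using assms c by (auto simp: sorted_wrt_append)
 hence "int i : set d ==> int i < x" "int i + 1 : set d ==> int i + 1 < x" by auto
 thus ?thesis unfolding c by auto
qed

lemma hw_path_lb:
 assumes "hw_path (TypeA N) ((r, 1) # B) ([c] # p)" "2 <= r"
 shows "hw_path (TypeA N) ((1, 1) # (r - 1, 1) # B) ([[last c]] # [butlast c] # p)"
proof -
 have c: "c : columns (TypeA N) r" and r: "r <= N" and ad: "admissible (TypeA N) B"
  using assms by (auto simp: hw_path_def wf_path_def tableaux_def admissible_def)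
 have b: "[last c] : columns (TypeA N) 1" "butlast c : columns (TypeA N) (r - 1)"
 proof -
  obtain d x where d: "c = d @ [x]" using c assms(2) by (cases c rule: rev_cases) auto
  show "[last c] : columns (TypeA N) 1" "butlast c : columns (TypeA N) (r - 1)" using c by (auto simp: d sorted_wrt_append)
 qed
 have "tabsig (TypeA N) i (concat ([[last c]] # [butlast c] # p)) = tabsig (TypeA N) i (concat ([c] # p))" for i
  using colsig_split[OF c assms(2), of i] by (simp add: tabsig_def bic_assoc del: colsig.simps)
 moreover have "1 <= r - 1" "r - 1 <= N" using assms(2) r by auto
 ultimately show ?thesis using assms b by (simp add: hw_path_def wf_path_def tableaux_def admissible_def hw_word_def)
qed

text \<open>Taking a column apart from the bottom, the round at height r performs the downward chain
  at node r. Downward induction on r collects the rounds.\<close>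

lemma Phi_column:
 assumes Phi: "rc_bijection (TypeA N) Phi" and N: "1 <= N"
  and hw: "hw_path (TypeA N) ((N, 1) # B) ([c] # p)"
 defines "R \<equiv> Phi ((N, 1) # B) ([c] # p)"
 shows "Phi B p = snd (dnS N 1 (stateA N (mult_array ((N, 1) # B)) R))"
proof -
 have wf: "wf_ytype (TypeA N)" using N by (simp add: wf_ytype_def)
 define p2 where "p2 = fst (stateA N (mult_array ((N, 1) # B)) R)"
 define m where "m = dn N 1 p2 R"
 define pf where "pf = upd N p2 m"
 define s where "s = (%r a. if r < a then m a else \<infinity>)"
 have v: "valid N p2 R" using RC_wt_validS[OF Phi_RC[OF Phi wf hw]] by (simp add: validS_def p2_def R_def)
 have lenc: "length c = N" using hw by (auto simp: hw_path_def wf_path_def tableaux_def)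
 have sN: "rm N R (s N) p2 pf = R" by (auto simp: rm_def s_def)
 have main: "hw_path (TypeA N) ((r, 1) # B) ([take r c] # p) & Phi ((r, 1) # B) ([take r c] # p) = rm N R (s r) p2 pf"
  if "1 <= r" "r <= N" for r using that(2,1)
 proof (induction rule: inc_induct)
  case base thus ?case using hw lenc sN by (simp add: R_def)
 next
  case (step r)
  let ?r = "Suc r"
  have r: "2 <= ?r" "1 <= ?r" "?r <= N" using step by auto
  note IH = step.IH[OF r(2)]
  have tk: "butlast (take ?r c) = take r c" using lenc r by (simp add: butlast_take)
  let ?L4 = "mult_array ((1, 1) # (r, 1) # B)"
  let ?B4 = "(1, 1) # (r, 1) # B"
  have hw4: "hw_path (TypeA N) ?B4 ([[last (take ?r c)]] # [take r c] # p)" using hw_path_lb[OF conjunct1[OF IH] r(1)] tk by simp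
  let ?Rp = "Phi ?B4 ([[last (take ?r c)]] # [take r c] # p)"
  have Rp: "?Rp = i_bar (TypeA N) ?L4 ?r (rm N R (s ?r) p2 pf)" using Phi_lb[OF Phi wf conjunct1[OF IH] r(1)] tk IH by simp
  have shp: "shape ?Rp a = shape (rm N R (s ?r) p2 pf) a + (if 1 <= a & a < ?r then {#1#} else {#})" for a
   unfolding Rp by (simp add: i_bar_def shape_def)
  have Rp': "?Rp a = rm N R (s ?r) p2 pf a + (if 1 <= a & a < ?r then {#(1, fst (stateA N ?L4 ?Rp) a 1)#} else {#})" for a
  proof -
   have "shape ?Rp = (%a. shape (rm N R (s ?r) p2 pf) a + (if 1 <= a & a < ?r then {#1#} else {#}))" using shp by blast
   thus ?thesis using r by (subst Rp) (auto simp: i_bar_def Let_def stateA_fst)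
  qed
  have "delta (TypeA N) ?L4 ?Rp = rm N R (s (?r - 1)) p2 pf" unfolding s_def pf_def m_def
  proof (rule column_stage[where P = "fst (stateA N ?L4 ?Rp)", OF v r(2,3)])
   show "?Rp a = rm N R (%a. if ?r < a then dn N 1 p2 R a else \<infinity>) p2 (upd N p2 (dn N 1 p2 R)) a
     + (if 1 <= a & a < ?r then {#(1, fst (stateA N ?L4 ?Rp) a 1)#} else {#})" for a using Rp'[of a] unfolding s_def pf_def m_def .
   show "1 \<in># ?L4 1" by (simp add: mult_array_Cons)
   fix a i :: nat assume a: "1 <= a" "a <= N" "1 <= i"
   have "vacancy (TypeA N) ?L4 (shape ?Rp) a i = upd N p2 (s ?r) a i + of_bool (a = ?r)" unfolding s_def p2_def m_def
    by (rule column_stage_vacancy[OF v[unfolded p2_def] r(2,3) shp[unfolded s_def m_def p2_def] _ a]) (use r in simp)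
   moreover have "(%a. if ?r < a then dn N 1 p2 R a else \<infinity>) = s ?r" unfolding s_def m_def by simp
   ultimately show "fst (stateA N ?L4 ?Rp) a i = upd N p2 (%a. if ?r < a then dn N 1 p2 R a else \<infinity>) a i + of_bool (a = ?r)"
    using a by (simp add: stateA_fst)
  qed simp
  hence "Phi ((r, 1) # B) ([take r c] # p) = rm N R (s r) p2 pf" using Phi_lh[OF Phi wf hw4] by simp
  thus ?case using hw_path_tl[OF hw4] by simp
 qed
 have N1: "(1::nat) <= 1" by simp
 \<comment> \<open>At height one nothing is left to split, so the last round is \<open>delta\<close>
   alone, with no strings added.\<close>
 note IH = main[OF N1 N]
 let ?R1 = "rm N R (s 1) p2 pf" and ?L1 = "mult_array ((1, 1) # B)"
 have "delta (TypeA N) ?L1 ?R1 = rm N R (s (1 - 1)) p2 pf" unfolding s_def pf_def m_def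
 proof (rule column_stage[where P = "fst (stateA N ?L1 (rm N R (%a. if 1 < a then dn N 1 p2 R a else \<infinity>) p2 (upd N p2 (dn N 1 p2 R))))", OF v _ N])
  show "(1::nat) <= 1" by simp
  show "1 \<in># ?L1 1" by (simp add: mult_array_Cons)
  show "rm N R (%a. if 1 < a then dn N 1 p2 R a else \<infinity>) p2 (upd N p2 (dn N 1 p2 R)) a =
   rm N R (%a. if 1 < a then dn N 1 p2 R a else \<infinity>) p2 (upd N p2 (dn N 1 p2 R)) a
   + (if 1 <= a & a < 1 then {#(1, fst (stateA N ?L1 (rm N R (%a. if 1 < a then dn N 1 p2 R a else \<infinity>) p2 (upd N p2 (dn N 1 p2 R)))) a 1)#} else {#})" for a
   by simp
  fix a i :: nat assume a: "1 <= a" "a <= N" "1 <= i"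
  have sh1: "shape ?R1 b = shape (rm N R (s 1) p2 pf) b + (if 1 <= b & b < 1 then {#1#} else {#})" for b by simp
  have "vacancy (TypeA N) ?L1 (shape ?R1) a i = upd N p2 (s 1) a i + of_bool (a = 1)"
   using column_stage_vacancy[OF v[unfolded p2_def] _ N sh1[unfolded s_def m_def p2_def] _ a] unfolding s_def p2_def m_def by simp
  moreover have "(%a. if 1 < a then dn N 1 p2 R a else \<infinity>) = s 1" "upd N p2 (dn N 1 p2 R) = pf" unfolding s_def pf_def m_def by simp_all
  ultimately show "fst (stateA N ?L1 (rm N R (%a. if 1 < a then dn N 1 p2 R a else \<infinity>) p2 (upd N p2 (dn N 1 p2 R)))) a i
    = upd N p2 (%a. if 1 < a then dn N 1 p2 R a else \<infinity>) a i + of_bool (a = 1)" using a by (simp add: stateA_fst)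
 qed simp
 hence "Phi B p = rm N R (s 0) p2 pf" using Phi_lh[OF Phi wf conjunct1[OF IH]] IH by simp
 also have "rm N R (s 0) p2 pf = rm N R m p2 pf" by (auto simp: rm_def s_def)
 finally show ?thesis unfolding dnS_def stp_eq by (simp add: p2_def m_def pf_def)
qed

lemma hw_path_split_tl:
 "hw_path Y ((r, Suc k) # B) ((c # cs) # p) ==> hw_path Y (fac r k @ B) (tabs cs @ p)" using hw_path_tl[OF hw_path_split] .

lemma Phi_row_step:
 assumes Phi: "rc_bijection (TypeA N) Phi" and N: "1 <= N"
  and hw: "hw_path (TypeA N) ((1, Suc k) # B) ((c # cs) # p)"
 shows "stateA N (mult_array (fac 1 k @ B)) (Phi (fac 1 k @ B) (tabs cs @ p))
  = upS N (Suc k) (stateA N (mult_array ((1, Suc k) # B)) (Phi ((1, Suc k) # B) ((c # cs) # p)))"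
proof -
 have wf: "wf_ytype (TypeA N)" using N by (simp add: wf_ytype_def)
 define R where "R = Phi ((1, Suc k) # B) ((c # cs) # p)"
 let ?L = "mult_array ((1, Suc k) # B)" and ?L2 = "mult_array ((1, 1) # fac 1 k @ B)" and ?L' = "mult_array (fac 1 k @ B)"
 note hw2 = hw_path_split[OF hw]
 have R2: "Phi ((1, 1) # fac 1 k @ B) ([c] # tabs cs @ p) = R" unfolding R_def by (rule Phi_split[OF Phi wf hw])
 have v: "validS N (stateA N ?L R)" and v2: "validS N (stateA N ?L2 R)"
  using RC_wt_validS[OF Phi_RC[OF Phi wf hw]] RC_wt_validS[OF Phi_RC[OF Phi wf hw2]] R2 by (simp_all add: R_def)
 let ?p = "fst (stateA N ?L R)" and ?p2 = "fst (stateA N ?L2 R)"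
 have vp: "valid N ?p R" "valid N ?p2 R" using v v2 by (auto simp: validS_def)
 have "Phi (fac 1 k @ B) (tabs cs @ p) = delta (TypeA N) ?L2 R" using Phi_lh[OF Phi wf hw2] R2 by simp
 also have "\<dots> = rm N R (up 1 ?p2 R) ?p2 (upd N ?p2 (up 1 ?p2 R))"
  by (rule delta_rm) (use vp(2) up_end[OF vp(2), of 1] in \<open>auto simp: valid_def one_enat_def mult_array_Cons simp del: up.simps(2)\<close>)
 also have "\<dots> = rm N R (up (Suc k) ?p R) ?p (upd N ?p (up (Suc k) ?p R))"
 proof (rule split_up(2)[OF vp(1) N])
  fix a i :: nat assume a: "1 <= a" "a <= N"
  show "?p2 a i = ?p a i + of_bool (a = 1 & 1 <= i & i <= k)" using a by (auto simp: stateA_fst vacancy_A msum_mult_array msum_fac)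
 qed
 also have "\<dots> = snd (upS N (Suc k) (stateA N ?L R))" by (simp add: upS_def stp_eq)
 finally have e: "Phi (fac 1 k @ B) (tabs cs @ p) = snd (upS N (Suc k) (stateA N ?L R))" .
 show ?thesis unfolding e R_def[symmetric] by (rule stateA_upS[OF v]) (auto simp: msum_mult_array msum_fac)
qed

lemma Phi_column_step:
 assumes Phi: "rc_bijection (TypeA N) Phi" and N: "1 <= N"
  and hw: "hw_path (TypeA N) ((N, Suc k) # B) ((c # cs) # p)"
 shows "stateA N (mult_array (fac N k @ B)) (Phi (fac N k @ B) (tabs cs @ p))
  = dnS N (Suc k) (stateA N (mult_array ((N, Suc k) # B)) (Phi ((N, Suc k) # B) ((c # cs) # p)))"
proof -
 have wf: "wf_ytype (TypeA N)" using N by (simp add: wf_ytype_def)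
 define R where "R = Phi ((N, Suc k) # B) ((c # cs) # p)"
 let ?L = "mult_array ((N, Suc k) # B)" and ?L2 = "mult_array ((N, 1) # fac N k @ B)" and ?L' = "mult_array (fac N k @ B)"
 note hw2 = hw_path_split[OF hw]
 have R2: "Phi ((N, 1) # fac N k @ B) ([c] # tabs cs @ p) = R" unfolding R_def by (rule Phi_split[OF Phi wf hw])
 have v: "validS N (stateA N ?L R)" and v2: "validS N (stateA N ?L2 R)"
  using RC_wt_validS[OF Phi_RC[OF Phi wf hw]] RC_wt_validS[OF Phi_RC[OF Phi wf hw2]] R2 by (simp_all add: R_def)
 let ?p = "fst (stateA N ?L R)" and ?p2 = "fst (stateA N ?L2 R)"
 have vp: "valid N ?p R" "valid N ?p2 R" using v v2 by (auto simp: validS_def)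
 have "Phi (fac N k @ B) (tabs cs @ p) = snd (dnS N 1 (?p2, R))" using Phi_column[OF Phi N hw2] R2 by (metis prod.collapse snd_stateA)
 also have "\<dots> = snd (dnS N (Suc k) (?p, R))"
 proof (rule split_dn(1)[OF vp(1) N vp(2)])
  fix a i :: nat assume a: "1 <= a" "a <= N"
  show "?p2 a i = ?p a i + of_bool (a = N & 1 <= i & i <= k)" using a by (auto simp: stateA_fst vacancy_A msum_mult_array msum_fac)
 qed
 also have "\<dots> = snd (dnS N (Suc k) (stateA N ?L R))" by (metis prod.collapse snd_stateA)
 finally have e: "Phi (fac N k @ B) (tabs cs @ p) = snd (dnS N (Suc k) (stateA N ?L R))" .
 show ?thesis unfolding e R_def[symmetric] by (rule stateA_dnS[OF v]) (auto simp: msum_mult_array msum_fac)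
qed

subsection \<open>Letters\<close>

definition ssum :: "nat multiset => int" where "ssum M = int (\<Sum>\<^sub># M)"

lemma ssum_simps [simp]: "ssum {#} = 0" "ssum (add_mset j M) = int j + ssum M" "ssum (M + M') = ssum M + ssum M'" by (simp_all add: ssum_def)

lemma ssum_diff: "j \<in># M ==> ssum (M - {#j#}) = ssum M - int j" by (auto dest!: multi_member_split)

lemma ssum_rm:
 assumes "!!i. s a = enat i ==> (i, p a i) \<in># R a & 1 <= i" "1 <= a" "a <= N"
 shows "ssum (shape (rm N R s p p') a) = ssum (shape R a) - of_bool (s a ~= \<infinity>)"
proof (cases "s a")
 case infinity
 thus ?thesis using assms(2,3) by (subst shape_rm) auto
next
 case (enat j)
 have j: "j \<in># shape R a" "1 <= j" using assms(1)[OF enat] by (force simp: shape_def)+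
 have "ssum (shape R a - {#j#}) = ssum (shape R a) - int j" using j(1) by (rule ssum_diff)
 thus ?thesis using enat assms j by (subst shape_rm) (auto simp: of_nat_diff)
qed

lemma RC_wt_weight:
 assumes "R : RC_wt (TypeA N) L lam" "1 <= a" "a <= N"
 shows "lam a = ssum (L a) - 2 * ssum (shape R a) + (if 1 < a then ssum (shape R (a - 1)) else 0)
   + (if a < N then ssum (shape R (a + 1)) else 0)"
proof -
 have "(\<Sum>b\<in>nodes (TypeA N). cartan (TypeA N) a b * ssum (shape R b)) = ssum (L a) - lam a" using assms by (auto simp: RC_wt_def ssum_def)
 thus ?thesis using cartan_A_sum[OF assms(2,3), of "%b. ssum (shape R b)"] by simp
qed

lemma weight_step:
 assumes R: "R : RC_wt (TypeA N) L lam" and R': "rm N R s p q : RC_wt (TypeA N) L' lam'"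
  and s: "!!a i. s a = enat i ==> 1 <= a ==> a <= N ==> (i, p a i) \<in># R a & 1 <= i"
  and a: "1 <= a" "a <= N"
 shows "lam a - lam' a = ssum (L a) - ssum (L' a) - 2 * of_bool (s a ~= \<infinity>)
  + of_bool (1 < a & s (a - 1) ~= \<infinity>) + of_bool (a < N & s (a + 1) ~= \<infinity>)"
using a ssum_rm s by (fastforce simp: RC_wt_weight[OF R a] RC_wt_weight[OF R' a])

lemma ssum_fac: "ssum (mult_array (fac r k @ B) a) = ssum (mult_array B a) + (if r = a then int k else 0)" by (simp add: fac_def mult_array_Cons)

lemma ssum_mult_array: "ssum (mult_array ((r, s) # B) a) = ssum (mult_array B a) + (if r = a then int s else 0)" by (simp add: mult_array_Cons)

lemma word_wt_singleton:
 "1 <= a ==> a <= N ==> word_wt (TypeA N) [[x]] a = of_bool (x = int a) - of_bool (x = int a + 1)" by (auto simp: word_wt_def tabsig_def)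

lemma word_wt_column_diff:
 "word_wt Y (concat ((c # cs) # p)) a - word_wt Y (concat (tabs cs @ p)) a = word_wt Y [c] a"
 using word_wt_append[of Y "[c]" "cs @ concat p" a] by (cases cs) (simp_all add: tabs_def)

text \<open>The weights before and after the step are given by the sizes of the partitions, hence by
  the nodes at which the chain is finite. Their difference is the weight of the letter, which
  determines it.\<close>

lemma Phi_row_letter:
 assumes Phi: "rc_bijection (TypeA N) Phi" and N: "1 <= N"
  and hw: "hw_path (TypeA N) ((1, Suc k) # B) ((c # cs) # p)"
 shows "c = [int (uletter (Suc k) (stateA N (mult_array ((1, Suc k) # B)) (Phi ((1, Suc k) # B) ((c # cs) # p))))]"
proof -
 have wf: "wf_ytype (TypeA N)" using N by (simp add: wf_ytype_def)
 let ?L = "mult_array ((1, Suc k) # B)" and ?L' = "mult_array (fac 1 k @ B)"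
 let ?R = "Phi ((1, Suc k) # B) ((c # cs) # p)" and ?R' = "Phi (fac 1 k @ B) (tabs cs @ p)"
 let ?X = "stateA N ?L ?R"
 define y where "y = uletter (Suc k) ?X"
 have R: "?R : RC_wt (TypeA N) ?L (word_wt (TypeA N) (concat ((c # cs) # p)))" by (rule Phi_RC[OF Phi wf hw])
 have R': "?R' : RC_wt (TypeA N) ?L' (word_wt (TypeA N) (concat (tabs cs @ p)))" by (rule Phi_RC[OF Phi wf hw_path_split_tl[OF hw]])
 have v: "validS N ?X" by (rule RC_wt_validS[OF R])
 have yb: "1 <= y" "y <= Suc N" using uletter_bounds[OF v] by (auto simp: y_def)
 have e: "?R' = rm N ?R (up (Suc k) (fst ?X) ?R) (fst ?X) (upd N (fst ?X) (up (Suc k) (fst ?X) ?R))"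
  using Phi_row_step[OF Phi N hw] by (metis snd_stateA upS_def stp_eq snd_conv)
 obtain x where x: "c = [x]" "1 <= x" "x <= int N + 1" using hw by (auto simp: hw_path_def wf_path_def tableaux_def length_Suc_conv)
 have fin: "up (Suc k) (fst ?X) ?R a ~= \<infinity> \<longleftrightarrow> a < y" for a using up_fin[OF v, of "Suc k" a] by (simp add: y_def)
 have eq: "of_bool (x = int a) - of_bool (x = int a + 1) = (of_bool (y = a) - of_bool (y = a + 1) :: int)"
  if a: "1 <= a" "a <= N" for a
 proof -
  have "word_wt (TypeA N) [c] a = ssum (?L a) - ssum (?L' a) - 2 * of_bool (a < y)
   + of_bool (1 < a & a - 1 < y) + of_bool (a < N & a + 1 < y)" unfolding word_wt_column_diff[symmetric, of _ c a cs p] fin[symmetric]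
   by (rule weight_step[OF R R'[unfolded e] _ a]) (use up_props[of N "fst ?X" ?R "Suc k"] v in \<open>auto simp: validS_def\<close>)
  thus ?thesis using a yb by (auto simp: x word_wt_singleton ssum_fac ssum_mult_array)
 qed
 have "int y = x"
 proof (cases "y = Suc N")
  case True thus ?thesis using eq[of N] N by (auto simp: of_bool_def split: if_splits)
 next
  case False thus ?thesis using eq[of y] yb by (auto simp: of_bool_def split: if_splits)
 qed
 thus ?thesis using x by (simp add: y_def)
qed

lemma columns_N:
 assumes "c : columns (TypeA N) N"
 obtains z where "1 <= z" "z <= Suc N" "set c = {1..int N + 1} - {int z}"
proof -
 have d: "distinct c" "length c = N" "set c \<subseteq> {1..int N + 1}" using assms by (auto simp: strict_sorted_iff)
 hence "card (set c) = N" by (simp add: distinct_card)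
 hence "card ({1..int N + 1} - set c) = 1" using d(3) by (simp add: card_Diff_subset)
 then obtain x where x: "{1..int N + 1} - set c = {x}" by (auto simp: card_1_singleton_iff)
 hence "1 <= x" "x <= int N + 1" by auto
 thus ?thesis using that[of "nat x"] x d(3) double_diff[of "set c" "{1..int N + 1}" "{1..int N + 1}"] by auto
qed

lemma word_wt_dual:
 assumes "set c = {1..int N + 1} - {int z}" "1 <= a" "a <= N"
 shows "word_wt (TypeA N) [c] a = of_bool (z = a + 1) - of_bool (z = a)" using assms by (auto simp: word_wt_def tabsig_def)

lemma Phi_column_letter:
 assumes Phi: "rc_bijection (TypeA N) Phi" and N: "1 <= N"
  and hw: "hw_path (TypeA N) ((N, Suc k) # B) ((c # cs) # p)"
 shows "set c = {1..int N + 1} - {int (dletter N (Suc k) (stateA N (mult_array ((N, Suc k) # B)) (Phi ((N, Suc k) # B) ((c # cs) # p))))}"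
proof -
 have wf: "wf_ytype (TypeA N)" using N by (simp add: wf_ytype_def)
 let ?L = "mult_array ((N, Suc k) # B)" and ?L' = "mult_array (fac N k @ B)"
 let ?R = "Phi ((N, Suc k) # B) ((c # cs) # p)" and ?R' = "Phi (fac N k @ B) (tabs cs @ p)"
 let ?X = "stateA N ?L ?R"
 define y where "y = dletter N (Suc k) ?X"
 have R: "?R : RC_wt (TypeA N) ?L (word_wt (TypeA N) (concat ((c # cs) # p)))" by (rule Phi_RC[OF Phi wf hw])
 have R': "?R' : RC_wt (TypeA N) ?L' (word_wt (TypeA N) (concat (tabs cs @ p)))" by (rule Phi_RC[OF Phi wf hw_path_split_tl[OF hw]])
 have v: "validS N ?X" by (rule RC_wt_validS[OF R])
 have yb: "1 <= y" "y <= Suc N" using dletter_bounds[OF v] by (auto simp: y_def)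
 have e: "?R' = rm N ?R (dn N (Suc k) (fst ?X) ?R) (fst ?X) (upd N (fst ?X) (dn N (Suc k) (fst ?X) ?R))"
  using Phi_column_step[OF Phi N hw] by (metis snd_stateA dnS_def stp_eq snd_conv)
 have "c : columns (TypeA N) N" using hw by (auto simp: hw_path_def wf_path_def tableaux_def)
 then obtain z where z: "1 <= z" "z <= Suc N" "set c = {1..int N + 1} - {int z}" by (rule columns_N)
 have fin: "dn N (Suc k) (fst ?X) ?R a ~= \<infinity> \<longleftrightarrow> y <= a" if "a <= Suc N" for a
  using dn_fin[OF v that, of "Suc k"] by (simp add: y_def)
 have eq: "of_bool (z = a + 1) - of_bool (z = a) = (of_bool (y = a + 1) - of_bool (y = a) :: int)"
  if a: "1 <= a" "a <= N" for a
 proof -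
  have "word_wt (TypeA N) [c] a = ssum (?L a) - ssum (?L' a) - 2 * of_bool (dn N (Suc k) (fst ?X) ?R a ~= \<infinity>)
   + of_bool (1 < a & dn N (Suc k) (fst ?X) ?R (a - 1) ~= \<infinity>) + of_bool (a < N & dn N (Suc k) (fst ?X) ?R (a + 1) ~= \<infinity>)"
   unfolding word_wt_column_diff[symmetric, of _ c a cs p]
   by (rule weight_step[OF R R'[unfolded e] _ a]) (use dn_props[of N "fst ?X" ?R "Suc k"] v in \<open>auto simp: validS_def\<close>)
  also have "\<dots> = ssum (?L a) - ssum (?L' a) - 2 * of_bool (y <= a)
   + of_bool (1 < a & y <= a - 1) + of_bool (a < N & y <= a + 1)" using fin[of a] fin[of "a - 1"] fin[of "a + 1"] a by auto
  finally show ?thesis using a yb unfolding word_wt_dual[OF z(3) a] by (auto simp: ssum_fac ssum_mult_array)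
 qed
 have "y = z"
 proof (cases "y = Suc N")
  case True thus ?thesis using eq[of N] N by (auto simp: of_bool_def split: if_splits)
 next
  case False thus ?thesis using eq[of y] yb by (auto simp: of_bool_def split: if_splits)
 qed
 thus ?thesis using z(3) by (simp add: y_def)
qed

definition rcount :: "tableau => nat => nat" where
 "rcount T a = length (filter (%c. int a : set c) T)"

text \<open>A column of height N stands for the dual of the one letter it misses.\<close>

definition dcount :: "tableau => nat => nat" where
 "dcount T a = length (filter (%c. int a \<notin> set c) T)"

lemma Phi_row:
 assumes Phi: "rc_bijection (TypeA N) Phi" and N: "1 <= N"
 shows "hw_path (TypeA N) (fac 1 k @ B) (tabs T @ p) ==> length T = k ==>
  endU N k (stateA N (mult_array (fac 1 k @ B)) (Phi (fac 1 k @ B) (tabs T @ p))) = stateA N (mult_array B) (Phi B p) &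
  (\<forall>a. cntU N k (stateA N (mult_array (fac 1 k @ B)) (Phi (fac 1 k @ B) (tabs T @ p))) a = rcount T a)"
proof (induction k arbitrary: T)
 case 0 thus ?case by (simp add: fac_def tabs_def rcount_def)
next
 case (Suc k)
 then obtain c cs where T: "T = c # cs" "length cs = k" by (cases T) auto
 have hw: "hw_path (TypeA N) ((1, Suc k) # B) ((c # cs) # p)" using Suc.prems T by (simp add: fac_def tabs_def)
 note st = Phi_row_step[OF Phi N hw] and lt = Phi_row_letter[OF Phi N hw]
 note IH = Suc.IH[OF hw_path_split_tl[OF hw] T(2)]
 have fs: "fac 1 (Suc k) @ B = (1, Suc k) # B" "tabs T @ p = (c # cs) # p" by (simp_all add: fac_def tabs_def T)
 have "rcount T a = rcount cs a + of_bool (int a : set c)" for a by (simp add: rcount_def T)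
 moreover have "int a : set c \<longleftrightarrow> a = uletter (Suc k) (stateA N (mult_array ((1, Suc k) # B)) (Phi ((1, Suc k) # B) ((c # cs) # p)))" for a
  by (subst lt) simp
 ultimately show ?case unfolding fs using IH unfolding st by simp
qed

lemma Phi_dual_row:
 assumes Phi: "rc_bijection (TypeA N) Phi" and N: "1 <= N"
 shows "hw_path (TypeA N) (fac N k @ B) (tabs T @ p) ==> length T = k ==>
  endD N k (stateA N (mult_array (fac N k @ B)) (Phi (fac N k @ B) (tabs T @ p))) = stateA N (mult_array B) (Phi B p) &
  (\<forall>a. 1 <= a & a <= Suc N --> cntD N k (stateA N (mult_array (fac N k @ B)) (Phi (fac N k @ B) (tabs T @ p))) a = dcount T a)"
proof (induction k arbitrary: T)
 case 0 thus ?case by (simp add: fac_def tabs_def dcount_def)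
next
 case (Suc k)
 then obtain c cs where T: "T = c # cs" "length cs = k" by (cases T) auto
 have hw: "hw_path (TypeA N) ((N, Suc k) # B) ((c # cs) # p)" using Suc.prems T by (simp add: fac_def tabs_def)
 note st = Phi_column_step[OF Phi N hw] and lt = Phi_column_letter[OF Phi N hw]
 note IH = Suc.IH[OF hw_path_split_tl[OF hw] T(2)]
 have fs: "fac N (Suc k) @ B = (N, Suc k) # B" "tabs T @ p = (c # cs) # p" by (simp_all add: fac_def tabs_def T)
 have "dcount T a = dcount cs a + of_bool (int a \<notin> set c)" for a by (simp add: dcount_def T)
 moreover have "int a \<notin> set c \<longleftrightarrow> a = dletter N (Suc k) (stateA N (mult_array ((N, Suc k) # B)) (Phi ((N, Suc k) # B) ((c # cs) # p)))"
  if "1 <= a" "a <= Suc N" for a using that by (subst lt) auto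
 ultimately show ?case unfolding fs using IH unfolding st by simp
qed

lemma virtual_counts_cong:
 assumes "!!a. 1 <= a ==> a <= Suc N ==> m a = m' a & d a = d' a"
 shows "virtual_counts N m d \<longleftrightarrow> virtual_counts N m' d'" unfolding virtual_counts_def by (rule shifted_cong) (use assms in auto)

lemma RC_wt_unique:
 assumes "R : RC_wt Y L lam" "R : RC_wt Y L lam'" "lam : dominant (nodes Y)" "lam' : dominant (nodes Y)"
 shows "lam = lam'"
proof
 fix a show "lam a = lam' a" using assms by (cases "a : nodes Y") (auto simp: RC_wt_def dominant_def)
qed

lemma word_wt_dominant: "hw_path Y B p ==> word_wt Y (concat p) : dominant (nodes Y)" by (simp add: hw_path_def hw_word_dominant)

text \<open>A configuration determines its weight, so injectivity for each weight gives injectivity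
  on all paths.\<close>

lemma Phi_inj':
 assumes "rc_bijection Y Phi" "wf_ytype Y" "hw_path Y B p" "hw_path Y B p'" "Phi B p = Phi B p'"
 shows "p = p'" using Phi_inj[OF assms] RC_wt_unique Phi_RC[OF assms(1,2,3)] Phi_RC[OF assms(1,2,4)] assms(3-5)
  word_wt_dominant by metis

text \<open>Common to the flip in type A and the exchange of the spin nodes in type D.\<close>

definition diagram_auto :: "ytype => (nat => nat) => bool" where
 "diagram_auto Y \<sigma> \<longleftrightarrow> bij_betw \<sigma> (nodes Y) (nodes Y) & (\<forall>a. \<sigma> a : nodes Y --> a : nodes Y) &
   (\<forall>a\<in>nodes Y. \<forall>b\<in>nodes Y. cartan Y (\<sigma> a) (\<sigma> b) = cartan Y a b)"

lemma auto_mem: "diagram_auto Y \<sigma> ==> \<sigma> a : nodes Y \<longleftrightarrow> a : nodes Y" by (auto simp: diagram_auto_def bij_betw_def)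

lemma auto_sum:
 assumes "diagram_auto Y \<sigma>" "a : nodes Y"
 shows "(\<Sum>b\<in>nodes Y. cartan Y a b * f (\<sigma> b)) = (\<Sum>b\<in>nodes Y. cartan Y (\<sigma> a) b * f b)"
proof -
 have "(\<Sum>b\<in>nodes Y. cartan Y a b * f (\<sigma> b)) = (\<Sum>b\<in>nodes Y. cartan Y (\<sigma> a) (\<sigma> b) * f (\<sigma> b))"
  using assms by (intro sum.cong) (simp_all add: diagram_auto_def)
 thus ?thesis using assms(1) sum.reindex_bij_betw[of \<sigma> "nodes Y" "nodes Y" "%b. cartan Y (\<sigma> a) b * f b"] by (simp add: diagram_auto_def)
qed

lemma auto_vacancy:
 assumes "diagram_auto Y \<sigma>" "a : nodes Y" "L (\<sigma> a) = L a"
 shows "vacancy Y L (%a. nu (\<sigma> a)) a i = vacancy Y L nu (\<sigma> a) i"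
 unfolding vacancy_def auto_sum[OF assms(1,2), of "%b. int (\<Sum>j\<in>#nu b. min i j)"] assms(3) ..

lemma auto_RC_wt:
 assumes s: "diagram_auto Y \<sigma>" and L: "!!a. a : nodes Y ==> L (\<sigma> a) = L a" and R: "R : RC_wt Y L lam"
 shows "(%a. R (\<sigma> a)) : RC_wt Y L (%a. lam (\<sigma> a))"
proof -
 have sh: "shape (%a. R (\<sigma> a)) = (%a. shape R (\<sigma> a))" by (simp add: shape_def fun_eq_iff)
 have w: "(\<Sum>b\<in>nodes Y. cartan Y a b * int (\<Sum>\<^sub># (shape R (\<sigma> b)))) = int (\<Sum>\<^sub># (L a)) - lam (\<sigma> a)" if a: "a : nodes Y" for a
  using R a auto_mem[OF s, of a] L[OF a] unfolding auto_sum[OF s a, of "%b. int (\<Sum>\<^sub># (shape R b))"] RC_wt_def by auto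
 have v: "vacancy Y L (%a. shape R (\<sigma> a)) a i = vacancy Y L (shape R) (\<sigma> a) i" if "a : nodes Y" for a i
  by (rule auto_vacancy[OF s that L[OF that]])
 show ?thesis unfolding RC_wt_def mem_Collect_eq sh
 proof (intro conjI ballI allI impI)
  fix a z assume a: "a : nodes Y" and "z \<in># R (\<sigma> a)"
  thus "case z of (i, x) => 1 <= i & 0 <= x & x <= vacancy Y L (%a. shape R (\<sigma> a)) a i"
   using R auto_mem[OF s, of a] unfolding v[OF a] RC_wt_def by blast
 qed (use R auto_mem[OF s] w v in \<open>auto simp: RC_wt_def\<close>)
qed

lemma auto_dominant: "diagram_auto Y \<sigma> ==> lam : dominant (nodes Y) ==> (%a. lam (\<sigma> a)) : dominant (nodes Y)"
 unfolding dominant_def using auto_mem by blast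

lemma flip_auto: "diagram_auto (TypeA N) (%a. N + 1 - a)"
proof -
 have "bij_betw (%a. N + 1 - a) {1..N} {1..N}" by (rule bij_betw_byWitness[of _ "%a. N + 1 - a"]) auto
 moreover have "a : {1..N}" if "N + 1 - a : {1..N}" for a using that by auto
 moreover have "cartan (TypeA N) (N + 1 - a) (N + 1 - b) = cartan (TypeA N) a b" if "a : {1..N}" "b : {1..N}" for a b
 proof -
  have "N + 1 - a = N + 1 - b \<longleftrightarrow> a = b" "N + 1 - a = N + 1 - b + 1 \<longleftrightarrow> b = a + 1" "N + 1 - b = N + 1 - a + 1 \<longleftrightarrow> a = b + 1"
   using that by auto
  thus ?thesis by simp
 qed
 ultimately show ?thesis unfolding diagram_auto_def nodes.simps by blast
qed

lemma flip_shape: "shape (flip N R) a = shape R (N + 1 - a)" by (simp add: shape_def flip_def)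

lemma flip_stateA:
 assumes "!!a. 1 <= a ==> a <= N ==> L (N + 1 - a) = L a"
 shows "stateA N L (flip N R) = flipS N (stateA N L R)"
proof -
 have "vacancy (TypeA N) L (shape (flip N R)) a i = vacancy (TypeA N) L (shape R) (N + 1 - a) i"
  if a: "1 <= a" "a <= N" for a i using auto_vacancy[OF flip_auto, of a N L "shape R" i] assms[OF a] a unfolding flip_shape[abs_def] by simp
 thus ?thesis by (auto simp: stateA_def flip_def fun_eq_iff)
qed

lemma flip_RC_wt:
 assumes "!!a. 1 <= a ==> a <= N ==> L (N + 1 - a) = L a" "R : RC_wt (TypeA N) L lam"
 shows "flip N R : RC_wt (TypeA N) L (flip N lam)" using auto_RC_wt[OF flip_auto _ assms(2)] assms(1) unfolding flip_def[abs_def] by simp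

lemma flip_dominant: "lam : dominant (nodes (TypeA N)) ==> flip N lam : dominant (nodes (TypeA N))"
 using auto_dominant[OF flip_auto] unfolding flip_def[abs_def] .

subsection \<open>Tableaux and their contents\<close>

lemma lists_eq_of_keys:
 fixes k :: "'a => 'b::linorder"
 assumes "sorted (map k T)" "sorted (map k T')" "inj_on k A" "set T \<subseteq> A" "set T' \<subseteq> A"
  and "!!v. length (filter (%c. k c = v) T) = length (filter (%c. k c = v) T')"
 shows "T = T'"
proof -
 have "count (mset (map k T)) v = count (mset (map k T')) v" for v
 proof -
  have "count (mset (map k U)) v = length (filter (%c. k c = v) U)" for U by (induction U) auto
  thus ?thesis using assms(6) by simp
 qed
 hence "mset (map k T) = mset (map k T')" by (rule multiset_eqI)
 hence "map k T = map k T'" using assms(1,2) by (metis properties_for_sort)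
 thus ?thesis using assms(3,4,5) by (metis inj_on_map_eq_map inj_on_subset Un_subset_iff)
qed

lemma columns_1: "columns (TypeA N) 1 = (%x. [x]) ` {1..int N + 1}" by (auto simp: length_Suc_conv)

lemma row_sorted:
 assumes "U : tableaux (TypeA N) 1 s"
 shows "sorted (map hd U)"
proof -
 have U: "!!c. c : set U ==> \<exists>x. c = [x]" "successively (list_all2 (\<le>)) U" using assms by (auto simp: tableaux_def length_Suc_conv)
 have "successively (%c d. hd c <= hd d) U" by (rule successively_mono[OF U(2)]) (auto dest!: U(1))
 thus ?thesis by (subst successively_conv_sorted_wrt[symmetric]) (auto simp: successively_map transp_def)
qed

lemma row_eq:
 assumes T: "T : tableaux (TypeA N) 1 s" "T' : tableaux (TypeA N) 1 s"
  and c: "!!a. 1 <= a ==> a <= Suc N ==> rcount T a = rcount T' a"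
 shows "T = T'"
proof -
 have cols: "set T \<subseteq> columns (TypeA N) 1" "set T' \<subseteq> columns (TypeA N) 1" using T by (auto simp: tableaux_def)
 have "length (filter (%c. hd c = v) T) = length (filter (%c. hd c = v) T')" for v
 proof (cases "1 <= v & v <= int N + 1")
  case True
  have "filter (%c. hd c = v) U = filter (%c. int (nat v) : set c) U" if h: "set U \<subseteq> columns (TypeA N) 1" for U
  proof (rule filter_cong)
   fix c assume "c : set U"
   then obtain x where "c = [x]" using h unfolding columns_1 by auto
   thus "hd c = v \<longleftrightarrow> int (nat v) : set c" using True by auto
  qed simp
  moreover have "1 <= nat v" "nat v <= Suc N" using True by auto
  ultimately show ?thesis using c[of "nat v"] cols by (simp add: rcount_def)
 next
  case False
  have "filter (%c. hd c = v) U = []" if "set U \<subseteq> columns (TypeA N) 1" for U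
   using that False unfolding columns_1 by (auto simp: filter_empty_conv)
  thus ?thesis using cols by simp
 qed
 moreover have "inj_on hd (columns (TypeA N) 1)" unfolding columns_1 by (auto simp: inj_on_def)
 ultimately show ?thesis using lists_eq_of_keys[OF row_sorted[OF T(1)] row_sorted[OF T(2)] _ cols] by blast
qed

text \<open>The entry sum recovers the missing letter and is monotone for the entrywise order, so it
  serves as a numerical sorting key for dual rows.\<close>

lemma sum_columns_N:
 assumes "c : columns (TypeA N) N"
 obtains z where "1 <= z" "z <= Suc N" "set c = {1..int N + 1} - {int z}" "sum_list c = (\<Sum>{1..int N + 1}) - int z"
using columns_N assms by (auto simp: strict_sorted_iff distinct_sum_list_conv_Sum sum_diff1)

lemma dual_row_sorted:
 assumes "U : tableaux (TypeA N) N s"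
 shows "sorted (map sum_list U)"
proof -
 have "successively (list_all2 (\<le>)) U" using assms by (auto simp: tableaux_def)
 hence "successively (%c d. sum_list c <= sum_list d) U"
 proof (rule successively_mono)
  fix c d :: column assume "list_all2 (\<le>) c d"
  thus "sum_list c <= sum_list d" by (induction rule: list_all2_induct) auto
 qed
 thus ?thesis by (subst successively_conv_sorted_wrt[symmetric]) (auto simp: successively_map transp_def)
qed

lemma dual_row_eq:
 assumes T: "T : tableaux (TypeA N) N s" "T' : tableaux (TypeA N) N s"
  and c: "!!a. 1 <= a ==> a <= Suc N ==> dcount T a = dcount T' a"
 shows "T = T'"
proof -
 let ?S = "\<Sum>{1..int N + 1}"
 have cols: "set T \<subseteq> columns (TypeA N) N" "set T' \<subseteq> columns (TypeA N) N" using T by (auto simp: tableaux_def)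
 have key: "sum_list c = v \<longleftrightarrow> int (nat (?S - v)) \<notin> set c & 1 <= ?S - v & ?S - v <= int N + 1" if "c : columns (TypeA N) N" for c v
  using sum_columns_N[OF that] by (smt (verit) Diff_iff atLeastAtMost_iff insert_iff nat_0_le empty_iff of_nat_1 of_nat_Suc of_nat_le_iff)
 have "length (filter (%c. sum_list c = v) T) = length (filter (%c. sum_list c = v) T')" for v
 proof (cases "1 <= ?S - v & ?S - v <= int N + 1")
  case True
  have "filter (%c. sum_list c = v) U = filter (%c. int (nat (?S - v)) \<notin> set c) U" if "set U \<subseteq> columns (TypeA N) N" for U
   by (rule filter_cong) (use that key[of _ v] True in \<open>simp_all del: columns.simps add: subset_iff\<close>)
  thus ?thesis using c[of "nat (?S - v)"] True cols by (simp add: dcount_def nat_le_iff le_nat_iff)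
 next
  case False
  have "filter (%c. sum_list c = v) U = []" if "set U \<subseteq> columns (TypeA N) N" for U
   using that False key[of _ v] by (auto simp: filter_empty_conv simp del: columns.simps)
  thus ?thesis using cols by simp
 qed
 moreover have "inj_on sum_list (columns (TypeA N) N)"
 proof (rule inj_onI)
  fix c d assume cd: "c : columns (TypeA N) N" "d : columns (TypeA N) N" "sum_list c = sum_list d"
  obtain z where z: "set c = {1..int N + 1} - {int z}" "sum_list c = ?S - int z" using sum_columns_N[OF cd(1)] .
  obtain w where w: "set d = {1..int N + 1} - {int w}" "sum_list d = ?S - int w" using sum_columns_N[OF cd(2)] .
  have "set c = set d" using z w cd(3) by simp
  moreover have "sorted c" "distinct c" "sorted d" "distinct d" using cd by (auto simp: strict_sorted_iff)
  ultimately show "c = d" by (metis sorted_distinct_set_unique)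
 qed
 ultimately show ?thesis using lists_eq_of_keys[OF dual_row_sorted[OF T(1)] dual_row_sorted[OF T(2)] _ cols] by blast
qed

subsection \<open>One virtual factor\<close>

lemma pair_counts:
 assumes Phi: "rc_bijection (TypeA N) Phi" and N: "1 <= N" and s: "1 <= s"
  and hw: "hw_path (TypeA N) ((N, s) # (1, s) # B) (T1 # T2 # p)"
 defines "X \<equiv> stateA N (mult_array ((N, s) # (1, s) # B)) (Phi ((N, s) # (1, s) # B) (T1 # T2 # p))"
 shows "endU N s (endD N s X) = stateA N (mult_array B) (Phi B p)"
  and "cntU N s (endD N s X) a = rcount T2 a"
  and "1 <= a ==> a <= Suc N ==> cntD N s X a = dcount T1 a"
proof -
 have len: "length T1 = s" "length T2 = s" using hw by (auto simp: hw_path_def wf_path_def tableaux_def)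
 have f: "fac N s @ (1, s) # B = (N, s) # (1, s) # B" "fac 1 s @ B = (1, s) # B"
  "tabs T1 @ T2 # p = T1 # T2 # p" "tabs T2 @ p = T2 # p" using s len by (auto simp: fac_def tabs_def)
 have D: "endD N s X = stateA N (mult_array ((1, s) # B)) (Phi ((1, s) # B) (T2 # p))"
  "1 <= a ==> a <= Suc N ==> cntD N s X a = dcount T1 a" using Phi_dual_row[OF Phi N, of s "(1, s) # B" T1 "T2 # p"] hw len unfolding f X_def by auto
 have U: "endU N s (endD N s X) = stateA N (mult_array B) (Phi B p)" "cntU N s (endD N s X) a = rcount T2 a"
  using Phi_row[OF Phi N, of s B T2 p] hw_path_tl[OF hw] len unfolding f D by auto
 show "endU N s (endD N s X) = stateA N (mult_array B) (Phi B p)" "cntU N s (endD N s X) a = rcount T2 a"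
  "1 <= a ==> a <= Suc N ==> cntD N s X a = dcount T1 a" by (fact U D)+
qed

lemma hw_path_Cons:
 assumes "hw_path Y (b # B) q" obtains T p where "q = T # p" using assms by (cases q) (auto simp: hw_path_def wf_path_def)

lemma hw_path_tableaux: "hw_path Y ((r, s) # B) (T # p) ==> T : tableaux Y r s" by (simp add: hw_path_def wf_path_def)

text \<open>Forwards this is \<open>symmetric_counts\<close>. Backwards, the flipped configuration
  is the image of some path; by \<open>virtual_counts_flip\<close> that path has the same two rows
  and the same remaining configuration, so it is the given path.\<close>

theorem pair_symmetric:
 assumes Phi: "rc_bijection (TypeA N) Phi" and N: "1 <= N" and s: "1 <= s"
  and L: "!!a. 1 <= a ==> a <= N ==> mult_array B (N + 1 - a) = mult_array B a"
  and hw: "hw_path (TypeA N) ((N, s) # (1, s) # B) (T1 # T2 # p)"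
 defines "R \<equiv> Phi ((N, s) # (1, s) # B) (T1 # T2 # p)" and "R' \<equiv> Phi B p"
 shows "flip N R = R \<longleftrightarrow> flip N R' = R' & virtual_counts N (rcount T2) (dcount T1)"
proof -
 let ?B = "(N, s) # (1, s) # B"
 have wf: "wf_ytype (TypeA N)" using N by (simp add: wf_ytype_def)
 have L2: "mult_array ?B (N + 1 - a) = mult_array ?B a" if "1 <= a" "a <= N" for a using L[OF that] that by (auto simp: mult_array_Cons)
 define X where "X = stateA N (mult_array ?B) R"
 note pc = pair_counts[OF Phi N s hw, folded R_def, folded X_def]
 have RC: "R : RC_wt (TypeA N) (mult_array ?B) (word_wt (TypeA N) (concat (T1 # T2 # p)))" unfolding R_def by (rule Phi_RC[OF Phi wf hw])
 have v: "validS N X" unfolding X_def by (rule RC_wt_validS[OF RC])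
 have vc: "virtual_counts N (cntU N s (endD N s X)) (cntD N s X) \<longleftrightarrow> virtual_counts N (rcount T2) (dcount T1)"
  by (rule virtual_counts_cong) (simp add: pc)
 have fX: "stateA N (mult_array ?B) (flip N R) = flipS N X" unfolding X_def by (rule flip_stateA) (rule L2)
 have fE: "stateA N (mult_array B) (flip N R') = flipS N (stateA N (mult_array B) R')" by (rule flip_stateA) (rule L)
 show ?thesis
 proof
  assume e: "flip N R = R"
  hence sX: "flipS N X = X" using fX by (simp add: X_def)
  have "flipS N (stateA N (mult_array B) R') = stateA N (mult_array B) R'" using symmetric_counts(2)[OF N v sX, of s] pc(1) by (simp add: R'_def)
  hence "flip N R' = R'" using fE by (metis snd_stateA)
  thus "flip N R' = R' & virtual_counts N (rcount T2) (dcount T1)" using symmetric_counts(1)[OF N v sX, of s] vc by simp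
 next
  assume h: "flip N R' = R' & virtual_counts N (rcount T2) (dcount T1)"
  hence c: "virtual_counts N (cntU N s (endD N s X)) (cntD N s X)" using vc by simp
  have E: "flipS N (endU N s (endD N s X)) = endU N s (endD N s X)" using h pc(1) fE by (simp add: R'_def)
  have dom: "word_wt (TypeA N) (concat (T1 # T2 # p)) : dominant (nodes (TypeA N))" by (rule word_wt_dominant[OF hw])
  have adm: "admissible (TypeA N) ?B" using hw by (simp add: hw_path_def)
  have "flip N R : RC_wt (TypeA N) (mult_array ?B) (flip N (word_wt (TypeA N) (concat (T1 # T2 # p))))" by (rule flip_RC_wt[OF L2 RC])
  from Phi_surj[OF Phi wf adm flip_dominant[OF dom] this]
  obtain q where q: "hw_path (TypeA N) ?B q" "Phi ?B q = flip N R" by metis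
  obtain U1 q1 where q1: "q = U1 # q1" by (rule hw_path_Cons[OF q(1)])
  obtain U2 r where q2: "q1 = U2 # r" by (rule hw_path_Cons[OF hw_path_tl[OF q(1)[unfolded q1]]])
  note hq = q(1)[unfolded q1 q2] and pq = q(2)[unfolded q1 q2]
  note pd = pair_counts[OF Phi N s hq, unfolded pq fX]
  note vf = virtual_counts_flip[OF N v c E]
  have "U2 = T2" by (rule row_eq[OF hw_path_tableaux[OF hw_path_tl[OF hq]] hw_path_tableaux[OF hw_path_tl[OF hw]]])
    (use vf(1) pd(2) pc(2) in auto)
  moreover have "U1 = T1" by (rule dual_row_eq[OF hw_path_tableaux[OF hq] hw_path_tableaux[OF hw]])
    (use vf(2) pd(3) pc(3) in auto)
  moreover have "stateA N (mult_array B) (Phi B r) = stateA N (mult_array B) (Phi B p)" using vf(3)[OF order_refl] pd(1) pc(1) by simp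
  hence "Phi B r = Phi B p" by (metis snd_stateA)
  hence "r = p" by (rule Phi_inj'[OF Phi wf hw_path_tl[OF hw_path_tl[OF hq]] hw_path_tl[OF hw_path_tl[OF hw]]])
  ultimately show "flip N R = R" using pq by (simp add: R_def)
 qed
qed

section \<open>Virtual configurations and virtual pairs of rows in type A\<close>

text \<open>The conditions on virtual configurations reduced to the flip and the middle node. For
  \<open>XC\<close> both parities apply, and together they say that riggings and lengths are
  even.\<close>

definition vclass :: "xtype => nat => rigged => bool" where
 "vclass X n R \<longleftrightarrow> flip (2 * n - 1) R = R &
   (X : {XC, XAeven} --> (\<forall>(i, x)\<in>#R n. even x)) &
   (X : {XC, XAdag} --> (\<forall>(i, x)\<in>#R n. even x \<longleftrightarrow> even i))"

text \<open>In coordinates the minimum at n + 1 has the parity of \<open>x 0\<close>, and the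
  minimum at 1 is the slack between s and the coordinate sum; see \<open>vcoords\<close>.\<close>

definition vfac :: "xtype => nat => tableau => tableau => bool" where
 "vfac X n T1 T2 \<longleftrightarrow> virtual_counts (2 * n - 1) (rcount T2) (dcount T1) &
   (X : {XC, XAeven} --> even (min (rcount T2 (Suc n)) (dcount T1 (Suc n)))) &
   (X : {XC, XAdag} --> even (min (rcount T2 1) (dcount T1 1)))"

fun vpath :: "xtype => nat => path => bool" where
 "vpath X n (T1 # T2 # p) \<longleftrightarrow> vfac X n T1 T2 & vpath X n p"
| "vpath X n p \<longleftrightarrow> True"

lemma hat_factors_list_Cons_A:
 "X \<notin> {XB, XAodd} ==> hat_factors_list X n (s # ss) = (2 * n - 1, s) # (1, s) # hat_factors_list X n ss"
 by (simp add: hat_factors_list_def hat_factors_def)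

lemma hat_factors_list_Nil [simp]: "hat_factors_list X n [] = []" by (simp add: hat_factors_list_def)

lemma hat_flip:
 "X \<notin> {XB, XAodd} ==> 1 <= a ==> a <= 2 * n - 1 ==>
  mult_array (hat_factors_list X n ss) (2 * n - 1 + 1 - a) = mult_array (hat_factors_list X n ss) a"
proof (induction ss)
 case Nil thus ?case by (simp add: mult_array_def)
next
 case (Cons s ss)
 have "2 * n - 1 = 2 * n - 1 + 1 - a \<longleftrightarrow> 1 = a" "1 = 2 * n - 1 + 1 - a \<longleftrightarrow> 2 * n - 1 = a" using Cons.prems by auto
 thus ?case using Cons.IH[OF Cons.prems] unfolding hat_factors_list_Cons_A[OF Cons.prems(1)] mult_array_Cons by auto
qed

text \<open>Factors sit at nodes 1 and 2 * n - 1. Either is the middle node only for n = 1, and then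
  each pair contributes twice.\<close>

lemma hat_middle:
 assumes "X \<notin> {XB, XAodd}" "1 <= n"
 shows "even (msum (mult_array (hat_factors_list X n ss) n) i)" "even (ssum (mult_array (hat_factors_list X n ss) n))"
proof (induction ss)
 case Nil show "even (msum (mult_array (hat_factors_list X n []) n) i)" "even (ssum (mult_array (hat_factors_list X n []) n))"
  by (simp_all add: mult_array_def)
next
 case (Cons s ss)
 have e: "2 * n - 1 = n \<longleftrightarrow> 1 = n" using assms by auto
 show "even (msum (mult_array (hat_factors_list X n (s # ss)) n) i)"
  "even (ssum (mult_array (hat_factors_list X n (s # ss)) n))" unfolding hat_factors_list_Cons_A[OF assms(1)] mult_array_Cons e using Cons by auto
qed

lemma symS_hat:
 assumes X: "X \<notin> {XB, XAodd}" "1 <= n" and f: "flip (2 * n - 1) R = R"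
  and R: "R : RC_wt (TypeA (2 * n - 1)) (mult_array (hat_factors_list X n ss)) lam"
 shows "symS n (stateA (2 * n - 1) (mult_array (hat_factors_list X n ss)) R)"
proof -
 let ?N = "2 * n - 1" and ?L = "mult_array (hat_factors_list X n ss)"
 have "stateA ?N ?L (flip ?N R) = flipS ?N (stateA ?N ?L R)" by (rule flip_stateA) (rule hat_flip[OF X(1)])
 moreover have "even (fst (stateA ?N ?L R) n i)" for i
 proof -
  have n: "1 <= n" "n <= ?N" using X by auto
  have "?N + 1 - (n + 1) = n - 1" by simp
  hence "shape R (n + 1) = shape R (n - 1)" using flip_shape[of "2 * n - 1" R "n + 1"] f by simp
  thus ?thesis unfolding stateA_fst[OF n] vacancy_A[OF n] using hat_middle(1)[OF X, of ss i] by auto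
 qed
 ultimately show ?thesis using RC_wt_validS[OF R] X f by (simp add: symS_def)
qed

text \<open>Induction over the factors: \<open>pair_symmetric\<close> handles the flip, and once the
  configuration is symmetric \<open>symmetric_parity\<close> handles the middle node.\<close>

lemma vclass_path:
 assumes Phi: "rc_bijection (TypeA (2 * n - 1)) Phi" and X: "X \<notin> {XB, XAodd}" and n: "1 <= n"
 shows "\<forall>s\<in>set ss. 1 <= s ==> hw_path (TypeA (2 * n - 1)) (hat_factors_list X n ss) p ==>
  vclass X n (Phi (hat_factors_list X n ss) p) \<longleftrightarrow> vpath X n p"
proof (induction ss arbitrary: p)
 case Nil
 hence "p = []" "Phi [] [] = (%a. {#})" using Phi by (simp_all add: hw_path_def wf_path_def rc_bijection_def)
 thus ?case by (simp add: vclass_def flip_def fun_eq_iff)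
next
 case (Cons s ss)
 let ?N = "2 * n - 1" and ?B = "hat_factors_list X n ss"
 have N: "1 <= ?N" using n by simp
 have wf: "wf_ytype (TypeA ?N)" using N by (simp add: wf_ytype_def)
 note hC = hat_factors_list_Cons_A[OF X, of n s ss]
 have s: "1 <= s" using Cons.prems by simp
 obtain T1 q where q: "p = T1 # q" by (rule hw_path_Cons[OF Cons.prems(2)[unfolded hC]])
 obtain T2 r where r: "q = T2 # r" by (rule hw_path_Cons[OF hw_path_tl[OF Cons.prems(2)[unfolded hC q]]])
 note hw = Cons.prems(2)[unfolded hC q r]
 have IH: "vclass X n (Phi ?B r) \<longleftrightarrow> vpath X n r" using Cons.IH[OF _ hw_path_tl[OF hw_path_tl[OF hw]]] Cons.prems(1) by simp
 let ?R = "Phi ((?N, s) # (1, s) # ?B) (T1 # T2 # r)" and ?R' = "Phi ?B r"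
 have sym: "flip ?N ?R = ?R \<longleftrightarrow> flip ?N ?R' = ?R' & virtual_counts ?N (rcount T2) (dcount T1)"
  by (rule pair_symmetric[OF Phi N s _ hw]) (rule hat_flip[OF X])
 define S where "S = stateA ?N (mult_array ((?N, s) # (1, s) # ?B)) ?R"
 note pc = pair_counts[OF Phi N s hw, folded S_def]
 have RC: "?R : RC_wt (TypeA ?N) (mult_array ((?N, s) # (1, s) # ?B)) (word_wt (TypeA ?N) (concat (T1 # T2 # r)))" by (rule Phi_RC[OF Phi wf hw])
 have par: "(even_rig n S \<longleftrightarrow> even_rig n (stateA ?N (mult_array ?B) ?R') & even (min (rcount T2 (Suc n)) (dcount T1 (Suc n)))) &
   (length_rig n S \<longleftrightarrow> length_rig n (stateA ?N (mult_array ?B) ?R') & even (min (rcount T2 1) (dcount T1 1)))"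
  if "flip ?N ?R = ?R"
 proof -
  have "symS n S" unfolding S_def hC[symmetric] by (rule symS_hat[OF X n _ RC[folded hC]]) (use that hC in simp)
  from symmetric_parity[OF this, of s] show ?thesis using pc by simp
 qed
 have er: "even_rig n (stateA M L Q) \<longleftrightarrow> (\<forall>(i, x)\<in>#Q n. even x)"
  "length_rig n (stateA M L Q) \<longleftrightarrow> (\<forall>(i, x)\<in>#Q n. even x \<longleftrightarrow> even i)" for M L Q
  by (simp_all add: even_rig_def length_rig_def)
 show ?case unfolding hC q r vpath.simps IH[symmetric] vclass_def vfac_def using sym par unfolding S_def er by argo
qed

text \<open>Supplies the divisibility that makes the weight a value of \<open>Psi_wt\<close>; the
  even coefficient at n is needed where \<open>gamma\<close> is 2 there.\<close>

lemma vclassI_dominant: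
 assumes X: "X \<notin> {XB, XAodd}" "1 <= n" and f: "flip (2 * n - 1) R = R"
  and R: "R : RC_wt (TypeA (2 * n - 1)) (mult_array (hat_factors_list X n ss)) lam"
  and lam: "lam : dominant (nodes (TypeA (2 * n - 1)))"
 shows "flip (2 * n - 1) lam = lam" "even (lam n)"
proof -
 let ?N = "2 * n - 1" and ?L = "mult_array (hat_factors_list X n ss)"
 have "R : RC_wt (TypeA ?N) ?L (flip ?N lam)" using flip_RC_wt[of ?N ?L R lam] hat_flip[OF X(1)] R f by auto
 thus "flip ?N lam = lam" using RC_wt_unique[OF _ R flip_dominant[OF lam] lam] by simp
 have n: "1 <= n" "n <= ?N" using X by auto
 have "?N + 1 - (n + 1) = n - 1" by simp
 hence "shape R (n + 1) = shape R (n - 1)" using flip_shape[of "2 * n - 1" R "n + 1"] f by simp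
 thus "even (lam n)" unfolding RC_wt_weight[OF R n] using hat_middle(2)[OF X, of ss] by auto
qed

lemma shape_count: "count (shape R a) i = size (riggings R a i)"
proof -
 have "size (filter_mset (%(j, x). j = i) M) = count (image_mset fst M) i" for M :: "(nat \<times> int) multiset" by (induction M) auto
 thus ?thesis by (simp add: shape_def riggings_def)
qed

lemma riggings_mem: "x \<in># riggings R a i \<longleftrightarrow> (i, x) \<in># R a" by (force simp: riggings_def)

lemma riggings_count: "count (riggings R a i) x = count (R a) (i, x)"
proof -
 have "count (image_mset snd (filter_mset (%(j, x). j = i) M)) x = count M (i, x)" for M :: "(nat \<times> int) multiset" by (induction M) auto
 thus ?thesis by (simp add: riggings_def)
qed

lemma riggings_eqI:
 assumes "!!i. 1 <= i ==> riggings R a i = riggings R b i"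
  and "!!i x. (i, x) \<in># R a ==> 1 <= i" "!!i x. (i, x) \<in># R b ==> 1 <= i"
 shows "R a = R b"
proof (rule multiset_eqI)
 fix z :: "nat \<times> int" obtain i x where z: "z = (i, x)" by force
 show "count (R a) z = count (R b) z" by (metis assms(1) assms(2,3) riggings_count z not_in_iff)
qed

subsection \<open>Strings of the coordinate crystals\<close>

text \<open>(phi, eps) at node i in the coordinates. At a short node n the letter 0 is a stop
  halfway between n and its barred letter, hence the factor 2 and the summand
  \<open>x 0\<close>.\<close>

definition xsig :: "xtype => nat => nat => coords => nat \<times> nat" where
 "xsig X n i x =
  (if i < n then
    (nat (x (int i) + max 0 (x (- (int i + 1)) - x (int i + 1))), nat (x (- int i) + max 0 (x (int i + 1) - x (- (int i + 1)))))
   else if X : {XB, XAdag, XD} then (nat (2 * x (int n) + x 0), nat (2 * x (- int n) + x 0))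
   else (nat (x (int n)), nat (x (- int n))))"

lemma sum_fun_upd: "finite A ==> a : A ==> (\<Sum>c\<in>A. (x(a := v)) c) = (\<Sum>c\<in>A. x c) - x a + (v::int)"
 by (subst (1 2) sum.remove[of A a]) (auto intro!: sum.cong)

lemma move_sum:
 fixes x :: coords
 assumes "a ~= b" "a : {- int n..int n}" "b : {- int n..int n}"
 shows "(\<Sum>c=- int n..int n. (x(a := x a + 1, b := x b - 1)) c) = (\<Sum>c=- int n..int n. x c)"
 using assms by (subst sum_fun_upd, simp, simp, subst sum_fun_upd) auto

text \<open>Moving a unit keeps the coordinate sum, so once coordinate 0 is allowed as a target, the
  source being positive is the only obstruction.\<close>

lemma move_elems:
 assumes x: "x : KRX_elems X n s" and ab: "a ~= b" "\<bar>a\<bar> <= int n" "\<bar>b\<bar> <= int n"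
  and a: "a = 0 ==> X : {XB, XAdag, XD} & x 0 = 0"
 shows "x(a := x a + 1, b := x b - 1) : KRX_elems X n s \<longleftrightarrow> 1 <= x b"
proof -
 have s: "(\<Sum>c=- int n..int n. (x(a := x a + 1, b := x b - 1)) c) = (\<Sum>c=- int n..int n. x c)" by (rule move_sum) (use ab in auto)
 have nn: "!!c. 0 <= x c" using x by (simp add: KRX_elems_def)
 show ?thesis
 proof
  assume "x(a := x a + 1, b := x b - 1) : KRX_elems X n s"
  hence "0 <= (x(a := x a + 1, b := x b - 1)) b" unfolding KRX_elems_def by blast
  thus "1 <= x b" by simp
 next
  assume "1 <= x b"
  thus "x(a := x a + 1, b := x b - 1) : KRX_elems X n s" using x ab a nn unfolding KRX_elems_def mem_Collect_eq Let_def s by (auto split: if_splits)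
 qed
qed

lemma strg_KRX:
 assumes i: "1 <= i" "i <= n"
 shows "strg (KRX X n s) i (KRX_elems X n s) (xsig X n i)" unfolding strg_def
proof (intro conjI ballI)
 fix x assume x: "x : KRX_elems X n s"
 have nn: "!!c. 0 <= x c" using x by (simp add: KRX_elems_def)
 have x0: "x 0 <= 1" "X \<notin> {XB, XAdag, XD} ==> x 0 = 0" using x by (auto simp: KRX_elems_def split: if_splits)
 note mv = move_elems[OF x]
 have tw: "x(a := x a - 1, b := x b + 1) = x(b := x b + 1, a := x a - 1)" if "a ~= b" for a b :: int using that by auto
 show "case e_op (KRX X n s) i x of None => snd (xsig X n i x) = 0
    | Some b' => b' : KRX_elems X n s & snd (xsig X n i x) = Suc (snd (xsig X n i b')) & fst (xsig X n i b') = Suc (fst (xsig X n i x))"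
 proof (cases "i < n")
  case True
  let ?i = "int i"
  show ?thesis
  proof (cases "x (?i + 1) > x (- (?i + 1))")
   case lt: True
   have "x(?i := x ?i + 1, ?i + 1 := x (?i + 1) - 1) : KRX_elems X n s" using lt nn[of "- (?i + 1)"] i True by (subst mv) auto
   thus ?thesis using True lt i nn[of ?i] nn[of "- ?i"] by (auto simp: KRX_def KRX_e_def mid_e_def xsig_def)
  next
   case ge: False
   have "x(-(?i + 1) := x (-(?i + 1)) + 1, -?i := x (-?i) - 1) : KRX_elems X n s \<longleftrightarrow> 1 <= x (-?i)" using i True by (subst mv) auto
   thus ?thesis using True ge i nn[of ?i] by (auto simp: KRX_def KRX_e_def mid_e_def xsig_def)
  qed
 next
  case False
  hence [simp]: "i = n" using i by simp
  have n: "1 <= n" using i by simp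
  show ?thesis
  proof (cases "X : {XB, XAdag, XD}")
   case X: True
   show ?thesis
   proof (cases "x 0 = 0")
    case 0: True
    have "x(0 := 1, - int n := x (- int n) - 1) : KRX_elems X n s \<longleftrightarrow> 1 <= x (- int n)" using mv[of 0 "- int n"] X 0 n by simp
    thus ?thesis using X 0 n nn[of "int n"] by (auto simp: KRX_def KRX_e_def short_en_def xsig_def)
   next
    case 1: False
    hence "x 0 = 1" using x0 nn[of 0] by auto
    hence "x(int n := x (int n) + 1, 0 := 0) : KRX_elems X n s" using mv[of "int n" 0] n by simp
    thus ?thesis using X \<open>x 0 = 1\<close> n nn[of "int n"] nn[of "- int n"] by (auto simp: KRX_def KRX_e_def short_en_def xsig_def)
   qed
  next
   case X: False
   have "x(int n := x (int n) + 1, - int n := x (- int n) - 1) : KRX_elems X n s \<longleftrightarrow> 1 <= x (- int n)"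
    using mv[of "int n" "- int n"] n by simp
   thus ?thesis using X n nn[of "int n"] by (auto simp: KRX_def KRX_e_def long_en_def xsig_def)
  qed
 qed
 show "case f_op (KRX X n s) i x of None => fst (xsig X n i x) = 0
    | Some b' => b' : KRX_elems X n s & fst (xsig X n i x) = Suc (fst (xsig X n i b')) & snd (xsig X n i b') = Suc (snd (xsig X n i x))"
 proof (cases "i < n")
  case True
  let ?i = "int i"
  show ?thesis
  proof (cases "x (?i + 1) \<ge> x (- (?i + 1))")
   case lt: True
   have "x(?i := x ?i - 1, ?i + 1 := x (?i + 1) + 1) : KRX_elems X n s \<longleftrightarrow> 1 <= x ?i"
    using i True by (subst tw, simp, subst mv) auto
   thus ?thesis using True lt i nn[of "- ?i"] by (auto simp: KRX_def KRX_f_def mid_f_def xsig_def)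
  next
   case ge: False
   have "x(-(?i + 1) := x (-(?i + 1)) - 1, -?i := x (-?i) + 1) : KRX_elems X n s" using i True ge nn[of "?i + 1"] by (subst tw, simp, subst mv) auto
   thus ?thesis using True ge i nn[of ?i] nn[of "- ?i"] by (auto simp: KRX_def KRX_f_def mid_f_def xsig_def)
  qed
 next
  case False
  hence [simp]: "i = n" using i by simp
  have n: "1 <= n" using i by simp
  show ?thesis
  proof (cases "X : {XB, XAdag, XD}")
   case X: True
   show ?thesis
   proof (cases "x 0 = 0")
    case 0: True
    have "x(int n := x (int n) - 1, 0 := 1) : KRX_elems X n s \<longleftrightarrow> 1 <= x (int n)"
     using mv[of 0 "int n"] tw[of "int n" 0] X 0 n by simp
    thus ?thesis using X 0 n nn[of "- int n"] by (auto simp: KRX_def KRX_f_def short_fn_def xsig_def)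
   next
    case 1: False
    hence "x 0 = 1" using x0 nn[of 0] by auto
    hence "x(0 := 0, - int n := x (- int n) + 1) : KRX_elems X n s" using mv[of "- int n" 0] tw[of 0 "- int n"] n by simp
    thus ?thesis using X \<open>x 0 = 1\<close> n nn[of "int n"] nn[of "- int n"] by (auto simp: KRX_def KRX_f_def short_fn_def xsig_def)
   qed
  next
   case X: False
   have "x(int n := x (int n) - 1, - int n := x (- int n) + 1) : KRX_elems X n s \<longleftrightarrow> 1 <= x (int n)"
    using mv[of "- int n" "int n"] tw[of "int n" "- int n"] n by simp
   thus ?thesis using X n nn[of "- int n"] by (auto simp: KRX_def KRX_f_def long_fn_def xsig_def)
  qed
 qed
qed

subsection \<open>The image of the virtual embedding\<close>

lemma valid_rank_wf: "valid_rank X n ==> wf_ytype (Y_of X n)" by (cases X) (auto simp: wf_ytype_def Y_of_def)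

lemma valid_rank_pos: "valid_rank X n ==> 1 <= n" by (cases X) auto

lemma gamma_pos: "1 <= gamma X n i" by (cases X) auto

lemma iota_nodes:
 assumes "valid_rank X n" "i : {1..n}" "j : set (iota X n i)"
 shows "j : nodes (Y_of X n)" using assms by (auto simp: iota_def Y_of_def split: if_splits)

lemma nodes_iota:
 assumes "valid_rank X n" "j : nodes (Y_of X n)"
 obtains i where "i : {1..n}" "j : set (iota X n i)"
proof (cases "X : {XB, XAodd}")
 case True
 thus ?thesis using that[of "min j n"] assms by (auto simp: iota_def Y_of_def min_def)
next
 case False
 hence j: "1 <= j" "j <= 2 * n - 1" using assms by (auto simp: Y_of_def)
 show ?thesis
 proof (cases "j <= n")
  case True thus ?thesis using that[of j] j by (simp add: iota_def)
 next
  case False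
  hence "1 <= 2 * n - j" "2 * n - j <= n" "2 * n - j ~= n" "2 * n - (2 * n - j) = j" using j by auto
  thus ?thesis using that[of "2 * n - j"] \<open>X \<notin> {XB, XAodd}\<close> by (simp add: iota_def)
 qed
qed

lemma psi_signature:
 assumes X: "valid_rank X n" and emb: "virtual_embedding X n s psi" and x: "x : KRX_elems X n s"
 shows "wf_path (Y_of X n) (hat_factors X n s) (psi x)"
  and "i : {1..n} ==> j : set (iota X n i) ==> tabsig (Y_of X n) j (concat (psi x))
   = (gamma X n i * fst (xsig X n i x), gamma X n i * snd (xsig X n i x))"
proof -
 let ?V = "path_crystal (Y_of X n) (hat_factors X n s)"
 have el: "elems (KRX X n s) = KRX_elems X n s" by (simp add: KRX_def)
 show wf: "wf_path (Y_of X n) (hat_factors X n s) (psi x)" using emb x unfolding virtual_embedding_def Let_def el elems_path by blast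
 assume i: "i : {1..n}" and j: "j : set (iota X n i)"
 have "phi ?V j (psi x) = gamma X n i * phi (KRX X n s) i x & eps ?V j (psi x) = gamma X n i * eps (KRX X n s) i x"
  using emb x i j unfolding virtual_embedding_def Let_def el by auto
 thus "tabsig (Y_of X n) j (concat (psi x)) = (gamma X n i * fst (xsig X n i x), gamma X n i * snd (xsig X n i x))"
  using path_eps[OF valid_rank_wf[OF X] iota_nodes[OF X i j] wf] strg_eps[OF strg_KRX x] strg_phi[OF strg_KRX x] i by (simp add: prod_eq_iff)
qed

lemma bic_scale: "bic (c * a, c * b) (c * a', c * b') = (c * fst (bic (a, b) (a', b')), c * snd (bic (a, b) (a', b')))"
 by (simp add: diff_mult_distrib2 distrib_left)

definition coords_list :: "xtype => nat => nat list => coords list => bool" where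
 "coords_list X n ss b \<longleftrightarrow> list_all2 (%s x. x : KRX_elems X n s) ss b"

lemma Psi_signature:
 assumes X: "valid_rank X n" 
 shows "\<forall>s\<in>set ss. virtual_embedding X n s (psi s) ==> coords_list X n ss b ==>
   wf_path (Y_of X n) (hat_factors_list X n ss) (Psi_path psi ss b) &
   (\<forall>i\<in>{1..n}. \<forall>j\<in>set (iota X n i). tabsig (Y_of X n) j (concat (Psi_path psi ss b))
   = (gamma X n i * fst (bicsum (xsig X n i) b), gamma X n i * snd (bicsum (xsig X n i) b)))"
proof (induction ss arbitrary: b)
 case Nil thus ?case by (simp add: Psi_path_def coords_list_def wf_path_def tabsig_def)
next
 case (Cons s ss)
 then obtain x b' where b: "b = x # b'" "x : KRX_elems X n s" "coords_list X n ss b'" by (auto simp: coords_list_def list_all2_Cons1)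
 have emb: "virtual_embedding X n s (psi s)" using Cons.prems by simp
 note IH = Cons.IH[OF _ b(3)] and ps = psi_signature[OF X emb b(2)]
 have P: "Psi_path psi (s # ss) b = psi s x @ Psi_path psi ss b'" by (simp add: Psi_path_def b)
 have H: "hat_factors_list X n (s # ss) = hat_factors X n s @ hat_factors_list X n ss" by (simp add: hat_factors_list_def)
 show ?case
 proof (intro conjI ballI)
  show "wf_path (Y_of X n) (hat_factors_list X n (s # ss)) (Psi_path psi (s # ss) b)"
   unfolding P H wf_path_def using ps(1) IH Cons.prems(1) by (intro list_all2_appendI) (auto simp: wf_path_def)
  fix i j assume ij: "i : {1..n}" "j : set (iota X n i)"
  let ?g = "gamma X n i"
  have "tabsig (Y_of X n) j (concat (Psi_path psi (s # ss) b)) = bic (?g * fst (xsig X n i x), ?g * snd (xsig X n i x))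
   (?g * fst (bicsum (xsig X n i) b'), ?g * snd (bicsum (xsig X n i) b'))"
   using ps(2)[OF ij] IH Cons.prems(1) ij by (simp add: P tabsig_def bicsum_append)
  thus "tabsig (Y_of X n) j (concat (Psi_path psi (s # ss) b))
   = (?g * fst (bicsum (xsig X n i) b), ?g * snd (bicsum (xsig X n i) b))" unfolding bic_scale by (simp add: b)
 qed
qed

lemma P_X_coords:
 assumes n: "1 <= n"
 shows "b : P_X X n ss \<longleftrightarrow> coords_list X n ss b & (\<forall>i\<in>{1..n}. snd (bicsum (xsig X n i) b) = 0)"
proof -
 have el: "elems (tensor (map (KRX X n) ss)) = lists_of (map (KRX_elems X n) ss)" by (simp add: elems_tensor KRX_def comp_def)
 have c: "b : lists_of (map (KRX_elems X n) ss) \<longleftrightarrow> coords_list X n ss b" by (simp add: lists_of_iff coords_list_def list_all2_map1)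
 have "eps (tensor (map (KRX X n) ss)) i b = snd (bicsum (xsig X n i) b)"
  if "b : lists_of (map (KRX_elems X n) ss)" "i : {1..n}" for i
  by (rule strg_eps[OF strg_tensor that(1)]) (use strg_KRX that(2) in \<open>auto simp: list_all2_map1 list_all2_map2 list_all2_same\<close>)
 thus ?thesis unfolding P_X_def hw_vectors_def el mem_Collect_eq c by auto
qed

text \<open>The embedding multiplies all string lengths by \<open>gamma\<close>, which is positive,
  and every node of Y lies in some \<open>iota\<close>. So an element is highest weight exactly if
  its image is.\<close>

lemma P_virtual_image:
 assumes X: "valid_rank X n" and emb: "\<forall>s\<in>set ss. virtual_embedding X n s (psi s)"
 shows "P_virtual X n psi ss = {p : P_hat X n ss. \<exists>b. coords_list X n ss b & p = Psi_path psi ss b}"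
proof -
 have "b : P_X X n ss \<longleftrightarrow> Psi_path psi ss b : P_hat X n ss" if b: "coords_list X n ss b" for b
 proof -
  note S = Psi_signature[OF X emb b]
  have "hw_word (Y_of X n) (concat (Psi_path psi ss b)) \<longleftrightarrow>
   (\<forall>i\<in>{1..n}. \<forall>j\<in>set (iota X n i). snd (tabsig (Y_of X n) j (concat (Psi_path psi ss b))) = 0)"
   unfolding hw_word_def by (meson nodes_iota[OF X] iota_nodes[OF X])
  also have "\<dots> \<longleftrightarrow> (\<forall>i\<in>{1..n}. snd (bicsum (xsig X n i) b) = 0)"
  proof (rule ball_cong[OF refl])
   fix i assume i: "i : {1..n}"
   have "set (iota X n i) ~= {}" by (simp add: iota_def)
   moreover have "snd (tabsig (Y_of X n) j (concat (Psi_path psi ss b))) = 0 \<longleftrightarrow> snd (bicsum (xsig X n i) b) = 0"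
    if "j : set (iota X n i)" for j using S i that gamma_pos[of X n i] by simp
   ultimately show "(\<forall>j\<in>set (iota X n i). snd (tabsig (Y_of X n) j (concat (Psi_path psi ss b))) = 0)
    \<longleftrightarrow> snd (bicsum (xsig X n i) b) = 0" by (metis ex_in_conv)
  qed
  finally show ?thesis using S b P_X_coords[OF valid_rank_pos[OF X]] hw_vectors_path[OF valid_rank_wf[OF X]] by (simp add: P_hat_def)
 qed
 thus ?thesis using P_X_coords[OF valid_rank_pos[OF X]] unfolding P_virtual_def by blast
qed

definition str_cond :: "xtype => nat => nat => nat => nat \<times> int => bool" where
 "str_cond X n a b = (%(i, x). (gamma X n a dvd i \<or> X : {XAeven, XAdag} & b = n) & int (gamma X n a) dvd x &
   (X = XAdag & b = n --> (even x \<longleftrightarrow> even i)))"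

definition virtual_rc :: "xtype => nat => rigged => bool" where
 "virtual_rc X n R \<longleftrightarrow> (\<forall>a\<in>{1..n}. \<forall>b\<in>set (iota X n a). R b = R a & (\<forall>z\<in>#R b. str_cond X n a b z))"

lemma iota_disjoint:
 "i : {1..n} ==> i' : {1..n} ==> j : set (iota X n i) ==> j : set (iota X n i') ==> i = i'" by (auto simp: iota_def split: if_splits)

lemma iota_self: "i : {1..n} ==> i : set (iota X n i)" by (auto simp: iota_def)

lemma Psi_wt_iota:
 assumes "i : {1..n}" "j : set (iota X n i)"
 shows "Psi_wt X n lam j = int (gamma X n i) * lam i"
proof -
 have "Psi_wt X n lam j = (\<Sum>i'=1..n. if i' = i then int (gamma X n i') * lam i' else 0)"
  unfolding Psi_wt_def by (rule sum.cong) (use iota_disjoint assms in auto)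
 thus ?thesis using assms(1) by simp
qed

lemma Psi_wt_off:
 assumes "valid_rank X n" "j \<notin> nodes (Y_of X n)" shows "Psi_wt X n lam j = 0"
 unfolding Psi_wt_def by (rule sum.neutral) (use iota_nodes[OF assms(1)] assms(2) in auto)

text \<open>Under \<open>wt\<close> the weight of a configuration that satisfies the string
  conditions is constant on each \<open>iota\<close> and divisible by \<open>gamma\<close>; dividing
  it gives the weight \<open>lam\<close>.\<close>

lemma RC_virtual_iff:
 assumes V: "valid_rank X n"
  and wt: "!!R mu a b. R : RC_wt (Y_of X n) (mult_array (hat_factors_list X n ss)) mu ==> mu : dominant (nodes (Y_of X n)) ==>
   virtual_rc X n R ==> a : {1..n} ==> b : set (iota X n a) ==> mu b = mu a & int (gamma X n a) dvd mu a"
 shows "RC_virtual X n ss = {R : RC_hat X n ss. virtual_rc X n R}"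
proof (intro set_eqI iffI)
 let ?Y = "Y_of X n" and ?L = "mult_array (hat_factors_list X n ss)"
 fix R
 { assume "R : RC_virtual X n ss"
  then obtain lam where lam: "lam : dominant {1..n}" and R: "R : RC_virtual_wt X n ss lam" by (auto simp: RC_virtual_def)
  hence RC: "R : RC_wt ?Y ?L (Psi_wt X n lam)" by (simp add: RC_virtual_wt_def)
  have "0 <= Psi_wt X n lam j" for j using lam unfolding Psi_wt_def by (intro sum_nonneg) (auto simp: dominant_def)
  hence hat: "R : RC_hat X n ss" using RC Psi_wt_off[OF V] by (auto simp: RC_hat_def RC_def dominant_def)
  have pos: "1 <= i" if "(i, x) \<in># R a" for a i x using RC that unfolding RC_wt_def by (cases "a : nodes ?Y") fastforce+
  show "R : {R : RC_hat X n ss. virtual_rc X n R}" unfolding virtual_rc_def mem_Collect_eq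
  proof (intro conjI ballI hat)
   fix a b assume ab: "a : {1..n}" "b : set (iota X n a)"
   have "riggings R b i = riggings R a i" if "1 <= i" for i using R ab iota_self[OF ab(1)] that unfolding RC_virtual_wt_def mem_Collect_eq by blast
   thus "R b = R a" using pos by (intro riggings_eqI) auto
   fix z assume z: "z \<in># R b"
   obtain i x where zx: "z = (i, x)" by force
   have i: "1 <= i" and x: "x \<in># riggings R b i" and ne: "count (shape R b) i ~= 0"
    using z pos unfolding zx by (auto simp: riggings_mem shape_def intro: image_eqI[of _ fst "(i, x)"])
   have "\<forall>j\<ge>1. ~ gamma X n a dvd j & ~ (X : {XAeven, XAdag} & b = n) --> count (shape R b) j = 0"
    "\<forall>i\<ge>1. \<forall>x\<in>#riggings R b i. int (gamma X n a) dvd x" using R ab unfolding RC_virtual_wt_def mem_Collect_eq by meson+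
   hence "gamma X n a dvd i \<or> X : {XAeven, XAdag} & b = n" "int (gamma X n a) dvd x" using i x ne by meson+
   moreover have "even x \<longleftrightarrow> even i" if "X = XAdag" "b = n" using R x i that unfolding RC_virtual_wt_def mem_Collect_eq by meson
   ultimately show "str_cond X n a b z" by (simp add: zx str_cond_def)
  qed }
 { assume h: "R : {R : RC_hat X n ss. virtual_rc X n R}"
  then obtain mu where mu: "mu : dominant (nodes ?Y)" "R : RC_wt ?Y ?L mu" by (auto simp: RC_hat_def RC_def)
  have v: "R b = R a" "!!z. z \<in># R b ==> str_cond X n a b z" if "a : {1..n}" "b : set (iota X n a)" for a b
   using h that unfolding virtual_rc_def by blast+
  define lam where "lam = (%i. if i : {1..n} then mu i div int (gamma X n i) else 0)"
  have P: "Psi_wt X n lam = mu"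
  proof
   fix j show "Psi_wt X n lam j = mu j"
   proof (cases "j : nodes ?Y")
    case True
    then obtain i where "i : {1..n}" "j : set (iota X n i)" by (rule nodes_iota[OF V])
    thus ?thesis using wt[OF mu(2,1), of i j] h by (simp add: Psi_wt_iota lam_def)
   qed (use mu(1) Psi_wt_off[OF V] in \<open>simp add: dominant_def\<close>)
  qed
  have "lam : dominant {1..n}" using mu(1) by (auto simp: dominant_def lam_def pos_imp_zdiv_nonneg_iff gamma_pos[THEN less_le_trans[OF zero_less_one]])
  moreover have "R : RC_virtual_wt X n ss lam" unfolding RC_virtual_wt_def mem_Collect_eq
  proof (intro conjI ballI allI impI)
   show "R : RC_wt ?Y ?L (Psi_wt X n lam)" using mu P by simp
  next
   fix a b b' i assume "a : {1..n}" "b : set (iota X n a)" "b' : set (iota X n a)"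
   hence "R b = R b'" using v(1) by metis
   thus "count (shape R b) i = count (shape R b') i" "riggings R b i = riggings R b' i" by (simp_all add: shape_def riggings_def)
  next
   fix a b i :: nat and x assume "a : {1..n}" "b : set (iota X n a)" "x \<in># riggings R b i"
   thus "int (gamma X n a) dvd x" using v(2)[of a b "(i, x)"] by (simp add: str_cond_def riggings_mem)
  next
   fix a b j assume a: "a : {1..n}" "b : set (iota X n a)" "~ gamma X n a dvd j & ~ (X : {XAeven, XAdag} & b = n)"
   hence "~ x \<in># riggings R b j" for x using v(2)[of a b "(j, x)"] by (auto simp: str_cond_def riggings_mem)
   thus "count (shape R b) j = 0" by (metis multiset_nonemptyE shape_count size_empty)
  next
   fix i x assume "X = XAdag" "x \<in># riggings R n i"
   thus "even x \<longleftrightarrow> even i" using v(2)[of n n "(i, x)"] iota_self[of n n X] valid_rank_pos[OF V]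
    by (auto simp: str_cond_def riggings_mem)
  qed
  ultimately show "R : RC_virtual X n ss" unfolding RC_virtual_def by blast }
qed

lemma RC_virtual_A:
 assumes V: "valid_rank X n" and X: "X \<notin> {XB, XAodd}"
 shows "RC_virtual X n ss = {R : RC_hat X n ss. vclass X n R}"
proof -
 let ?N = "2 * n - 1"
 have n: "1 <= n" by (rule valid_rank_pos[OF V])
 have Y: "Y_of X n = TypeA ?N" using X by (simp add: Y_of_def)
 have g: "gamma X n i = (if i = n & X : {XC, XAeven} then 2 else 1)" if "i : {1..n}" for i using X that by (cases X) auto
 have io: "set (iota X n a) = {a, 2 * n - a}" if "a : {1..n}" for a using X that by (auto simp: iota_def)
 have vc: "virtual_rc X n R \<longleftrightarrow> vclass X n R" if R: "R : RC_wt (TypeA ?N) L mu" for R L mu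
 proof
  assume h: "virtual_rc X n R"
  have "R (2 * n - a) = R a" for a
  proof (cases "1 <= a & a <= ?N")
   case True
   hence "min a (2 * n - a) : {1..n}" "{min a (2 * n - a), 2 * n - min a (2 * n - a)} = {a, 2 * n - a}" by (auto simp: min_def)
   thus ?thesis using h io unfolding virtual_rc_def by (metis insertCI)
  next
   case False
   hence "a \<notin> nodes (TypeA ?N)" "2 * n - a \<notin> nodes (TypeA ?N)" by auto
   thus ?thesis using R unfolding RC_wt_def mem_Collect_eq by metis
  qed
  hence "flip ?N R = R" using n by (simp add: flip_def fun_eq_iff)
  moreover have "str_cond X n n n z" if "z \<in># R n" for z using h that io[of n] n unfolding virtual_rc_def by auto
  ultimately show "vclass X n R" by (auto simp: vclass_def str_cond_def)
 next
  assume h: "vclass X n R"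
  have "R (2 * n - a) = R a" for a
  proof -
   have "R a = flip ?N R a" using h by (simp add: vclass_def)
   thus ?thesis using n by (simp add: flip_def)
  qed
  hence "R b = R a" if "a : {1..n}" "b : set (iota X n a)" for a b using io that by auto
  moreover have "str_cond X n a b z" if "a : {1..n}" "b : set (iota X n a)" "z \<in># R b" for a b z
  proof (cases "a = n")
   case True
   hence "b = n" using that io by auto
   thus ?thesis using h that(3) True g[of n] n by (cases X; cases z) (auto simp: vclass_def str_cond_def)
  next
   case False
   hence "b ~= n" "gamma X n a = 1" using that io[of a] g[of a] by auto
   thus ?thesis by (cases z) (simp add: str_cond_def)
  qed
  ultimately show "virtual_rc X n R" unfolding virtual_rc_def by blast
 qed
 have "RC_virtual X n ss = {R : RC_hat X n ss. virtual_rc X n R}"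
 proof (rule RC_virtual_iff[OF V])
  fix R mu a b assume R: "R : RC_wt (Y_of X n) (mult_array (hat_factors_list X n ss)) mu" and mu: "mu : dominant (nodes (Y_of X n))"
   and v: "virtual_rc X n R" and ab: "a : {1..n}" "b : set (iota X n a)"
  have f: "flip ?N R = R" using v vc R unfolding Y vclass_def by blast
  note d = vclassI_dominant[OF X n f R[unfolded Y] mu[unfolded Y]]
  have "mu a = flip ?N mu a" using d(1) by simp
  hence "mu (2 * n - a) = mu a" using n by (simp add: flip_def)
  thus "mu b = mu a & int (gamma X n a) dvd mu a" using ab d(2) io[OF ab(1)] g[OF ab(1)] by auto
 qed
 thus ?thesis using vc unfolding RC_hat_def RC_def Y by blast
qed

text \<open>The sorting condition puts no P letter to the right of a Q letter, so nothing
  cancels.\<close>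

lemma bicsum_counts:
 assumes "!!c. c : set U ==> sg c = (of_bool (P c), of_bool (Q c))" "!!c. c : set U ==> ~ (P c & Q c)"
  and "sorted_wrt (%c d. Q c --> ~ P d) U"
 shows "bicsum sg U = (length (filter P U), length (filter Q U))" using assms
proof (induction U)
 case (Cons c U)
 have IH: "bicsum sg U = (length (filter P U), length (filter Q U))"
 proof (rule Cons.IH)
  fix d assume "d : set U"
  hence "d : set (c # U)" by simp
  from Cons.prems(1,2)[OF this] show "sg d = (of_bool (P d), of_bool (Q d))" "~ (P d & Q d)" .
 qed (use Cons.prems(3) in simp)
 show ?case
 proof (cases "Q c")
  case True
  hence "~ P d" if "d : set U" for d using Cons.prems(3) that by simp
  hence "filter P U = []" by simp
  thus ?thesis using Cons.prems(1)[of c] IH by auto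
 next
  case False thus ?thesis using Cons.prems(1)[of c] IH by auto
 qed
qed simp

lemma row_signature:
 assumes T: "T : tableaux (TypeA N) 1 s" and i: "1 <= i" "i <= N"
 shows "tabsig (TypeA N) i T = (rcount T i, rcount T (i + 1))"
proof -
 have c: "\<exists>x. c = [x]" if "c : set T" for c using T that by (auto simp: tableaux_def length_Suc_conv)
 have "bicsum (colsig (TypeA N) i) T = (length (filter (%c. int i : set c) T), length (filter (%c. int i + 1 : set c) T))"
 proof (rule bicsum_counts)
  fix d assume "d : set T"
  then obtain x where "d = [x]" using c by blast
  thus "colsig (TypeA N) i d = (of_bool (int i : set d), of_bool (int i + 1 : set d))"
   "~ (int i : set d & int i + 1 : set d)" by auto
 next
  have "sorted_wrt (%c d. hd c <= hd d) T" using row_sorted[OF T] by (simp add: sorted_map)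
  thus "sorted_wrt (%c d. int i + 1 : set c --> ~ int i : set d) T" by (rule sorted_wrt_mono_rel[rotated]) (auto dest!: c)
 qed
 thus ?thesis by (simp add: tabsig_def rcount_def add.commute)
qed

lemma dual_row_signature:
 assumes T: "T : tableaux (TypeA N) N s" and i: "1 <= i" "i <= N"
 shows "tabsig (TypeA N) i T = (dcount T (i + 1), dcount T i)"
proof -
 have c: "c : columns (TypeA N) N" if "c : set T" for c using T that by (auto simp: tableaux_def)
 have "bicsum (colsig (TypeA N) i) T = (length (filter (%c. int i + 1 \<notin> set c) T), length (filter (%c. int i \<notin> set c) T))"
 proof (rule bicsum_counts)
  fix d assume "d : set T"
  from columns_N[OF c[OF this]] obtain z where "1 <= z" "z <= Suc N" "set d = {1..int N + 1} - {int z}" .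
  thus "colsig (TypeA N) i d = (of_bool (int i + 1 \<notin> set d), of_bool (int i \<notin> set d))"
   "~ (int i + 1 \<notin> set d & int i \<notin> set d)" using i by auto
 next
  have "sorted_wrt (%c d. sum_list c <= sum_list d) T" using dual_row_sorted[OF T] by (simp add: sorted_map)
  thus "sorted_wrt (%c d. int i \<notin> set c --> ~ int i + 1 \<notin> set d) T"
  proof (rule sorted_wrt_mono_rel[rotated])
   fix d e assume d: "d : set T" "e : set T" "sum_list d <= sum_list e"
   from sum_columns_N[OF c[OF d(1)]] obtain z where z: "set d = {1..int N + 1} - {int z}" "sum_list d = (\<Sum>{1..int N + 1}) - int z" .
   from sum_columns_N[OF c[OF d(2)]] obtain w where w: "set e = {1..int N + 1} - {int w}" "sum_list e = (\<Sum>{1..int N + 1}) - int w" .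
   show "int i \<notin> set d --> ~ int i + 1 \<notin> set e" using z w d(3) i by auto
  qed
 qed
 thus ?thesis by (simp add: tabsig_def dcount_def add.commute)
qed

lemma sum_length_filter:
 assumes "!!c. c : set T ==> \<exists>!a. a : A & P a c" "finite A"
 shows "(\<Sum>a\<in>A. length (filter (P a) T)) = length T" using assms(1)
proof (induction T)
 case (Cons c T)
 obtain b where b: "b : A" "P b c" "!!a. a : A ==> P a c ==> a = b" using Cons.prems[of c] by auto
 have "(\<Sum>a\<in>A. length (filter (P a) (c # T))) = (\<Sum>a\<in>A. length (filter (P a) T) + (if a = b then 1 else 0))"
 proof (rule sum.cong)
  fix a assume "a : A"
  hence "P a c \<longleftrightarrow> a = b" using b by blast
  thus "length (filter (P a) (c # T)) = length (filter (P a) T) + (if a = b then 1 else 0)" by simp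
 qed simp
 moreover have "(\<Sum>a\<in>A. length (filter (P a) T)) = length T" by (rule Cons.IH) (rule Cons.prems, simp)
 ultimately show ?case using b(1) assms(2) by (simp add: sum.distrib)
qed simp

lemma rcount_total:
 assumes "T : tableaux (TypeA N) 1 s"
 shows "(\<Sum>a=1..Suc N. rcount T a) = s"
proof -
 have "(\<Sum>a\<in>{1..Suc N}. length (filter (%c. int a : set c) T)) = length T"
 proof (rule sum_length_filter)
  fix c assume "c : set T"
  then obtain x where "c = [x]" "1 <= x" "x <= int N + 1" using assms by (auto simp: tableaux_def length_Suc_conv)
  thus "\<exists>!a. a : {1..Suc N} & int a : set c" by (auto intro!: ex1I[of _ "nat x"])
 qed simp
 thus ?thesis using assms by (simp add: rcount_def tableaux_def)
qed

lemma dcount_total: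
 assumes "T : tableaux (TypeA N) N s"
 shows "(\<Sum>a=1..Suc N. dcount T a) = s"
proof -
 have "(\<Sum>a\<in>{1..Suc N}. length (filter (%c. int a \<notin> set c) T)) = length T"
 proof (rule sum_length_filter)
  fix c assume "c : set T"
  hence "c : columns (TypeA N) N" using assms by (auto simp: tableaux_def)
  from columns_N[OF this] obtain z where z: "1 <= z" "z <= Suc N" "set c = {1..int N + 1} - {int z}" .
  have "a : {1..Suc N} & int a \<notin> set c \<longleftrightarrow> a = z" for a unfolding z(3) using z(1,2) by auto
  thus "\<exists>!a. a : {1..Suc N} & int a \<notin> set c" by metis
 qed simp
 thus ?thesis using assms by (simp add: dcount_def tableaux_def)
qed

lemma sum_fold_middle:
 fixes f :: "nat => 'a::comm_monoid_add"
 shows "(\<Sum>a=1..2 * n. f a) = (\<Sum>i=1..n. f i + f (2 * n + 1 - i))"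
proof -
 have "(\<Sum>a=n + 1..2 * n. f a) = (\<Sum>i=1..n. f (2 * n + 1 - i))"
  by (rule sum.reindex_bij_witness[of _ "%i. 2 * n + 1 - i" "%i. 2 * n + 1 - i"]) auto
 moreover have "(\<Sum>a=1..2 * n. f a) = (\<Sum>a=1..n. f a) + (\<Sum>a=n + 1..2 * n. f a)" using sum.ub_add_nat[of 1 n f n] by (simp add: mult_2)
 ultimately show ?thesis by (simp add: sum.distrib)
qed

lemma sum_symmetric_interval:
 fixes x :: coords
 shows "(\<Sum>a=- int n..int n. x a) = x 0 + (\<Sum>i=1..n. x (int i) + x (- int i))"
proof (induction n)
 case (Suc n)
 have "{- int (Suc n)..int (Suc n)} = insert (int (Suc n)) (insert (- int (Suc n)) {- int n..int n})" by auto
 thus ?case using Suc by simp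
qed simp

text \<open>The two counting functions of a factor are recovered from their difference and their minimum.\<close>

definition vcoords :: "nat => nat => coords => (nat => nat) => (nat => nat) => bool" where
 "vcoords n s x m d \<longleftrightarrow>
  (\<forall>i\<in>{1..n}. int (m i) - int (d i) = x (int i) - x (- int i) &
    int (m (2 * n + 1 - i)) - int (d (2 * n + 1 - i)) = x (- int i) - x (int i)) &
  (\<forall>i. 1 <= i & i < n --> int (min (m (Suc i)) (d (Suc i))) = min (x (int i)) (x (- int i)) &
    int (min (m (2 * n + 1 - i)) (d (2 * n + 1 - i))) = min (x (int i)) (x (- int i))) &
  int (min (m (Suc n)) (d (Suc n))) = 2 * min (x (int n)) (x (- int n)) + x 0 &
  int (min (m 1) (d 1)) = int s - (\<Sum>a=- int n..int n. x a)"

lemma vcoords_unique: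
 assumes n: "1 <= n" and v: "vcoords n s x m d" "vcoords n s x m' d'" and a: "1 <= a" "a <= 2 * n"
 shows "m a = m' a & d a = d' a"
proof -
 have "int (m a) - int (d a) = int (m' a) - int (d' a)"
 proof (cases "a <= n")
  case True thus ?thesis using v a unfolding vcoords_def by simp
 next
  case False
  hence "2 * n + 1 - a : {1..n}" "2 * n + 1 - (2 * n + 1 - a) = a" using a by auto
  thus ?thesis using v unfolding vcoords_def by metis
 qed
 moreover have "int (min (m a) (d a)) = int (min (m' a) (d' a))"
 proof -
  consider "a = 1" | "a = Suc n" | i where "1 <= i" "i < n" "a = Suc i" | i where "1 <= i" "i < n" "a = 2 * n + 1 - i"
  proof -
   have "a = 1 \<or> a = Suc n \<or> (1 <= a - 1 & a - 1 < n & a = Suc (a - 1))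
    \<or> (1 <= 2 * n + 1 - a & 2 * n + 1 - a < n & a = 2 * n + 1 - (2 * n + 1 - a))" using a by linarith
   thus ?thesis using that by blast
  qed
  thus ?thesis
  proof cases
   case 1 thus ?thesis using v unfolding vcoords_def by metis
  next
   case 2 thus ?thesis using v unfolding vcoords_def by metis
  next
   case 3 thus ?thesis using v unfolding vcoords_def by metis
  next
   case 4 thus ?thesis using v unfolding vcoords_def by metis
  qed
 qed
 ultimately show ?thesis by auto
qed

lemma xsig_int:
 assumes x: "x : KRX_elems X n s" and X: "X \<notin> {XB, XAodd}" and i: "i : {1..n}"
 shows "int (gamma X n i * fst (xsig X n i x)) = (if i < n
   then x (int i) + max 0 (x (- (int i + 1)) - x (int i + 1)) else 2 * x (int n) + x 0)"
  and "int (gamma X n i * snd (xsig X n i x)) = (if i < n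
   then x (- int i) + max 0 (x (int i + 1) - x (- (int i + 1))) else 2 * x (- int n) + x 0)"
proof -
 have nn: "!!c. 0 <= x c" using x by (simp add: KRX_elems_def)
 have x0: "X \<notin> {XB, XAdag, XD} ==> x 0 = 0" using x by (auto simp: KRX_elems_def)
 show "int (gamma X n i * fst (xsig X n i x)) = (if i < n
   then x (int i) + max 0 (x (- (int i + 1)) - x (int i + 1)) else 2 * x (int n) + x 0)"
  "int (gamma X n i * snd (xsig X n i x)) = (if i < n
   then x (- int i) + max 0 (x (int i + 1) - x (- (int i + 1))) else 2 * x (- int n) + x 0)"
  using X x0 nn i by (cases X; auto simp: xsig_def add_nonneg_nonneg)+
qed

lemma sum_shift_first:
 fixes c :: "nat => 'a::comm_monoid_add"
 shows "1 <= n ==> (\<Sum>i=1..n. c i) = c 1 + (\<Sum>i=1..<n. c (Suc i))" by (induction n rule: dec_induct) (simp_all add: add.assoc)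

text \<open>Subtracting the equations for phi and eps at a node gives the difference of consecutive
  values of \<open>w\<close> = m - d, and the equal row lengths fix the constant. The minima follow
  from the same equations, except the one at letter 1, which is what remains of the total s.\<close>

lemma vcoords_of_signature:
 fixes m d :: "nat => nat"
 assumes x: "x : KRX_elems X n s" and X: "X \<notin> {XB, XAodd}" and n: "1 <= n"
  and sg: "!!i j. i : {1..n} ==> j = i \<or> j = 2 * n - i ==>
   (d (j + 1) + (m j - d j), m (j + 1) + (d j - m j)) = (gamma X n i * fst (xsig X n i x), gamma X n i * snd (xsig X n i x))"
  and tot: "(\<Sum>a=1..2 * n. m a) = s" "(\<Sum>a=1..2 * n. d a) = s"
 shows "vcoords n s x m d"
proof -
 define w where "w a = int (m a) - int (d a)" for a
 \<comment> \<open>The values that \<open>w\<close> will turn out to have, antisymmetric about the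
   middle.\<close>
 define v where "v a = (if a <= n then x (int a) - x (- int a) else x (- int (2 * n + 1 - a)) - x (int (2 * n + 1 - a)))" for a
 have P: "int (d (j + 1)) + max 0 (w j) = (if i < n
   then x (int i) + max 0 (x (- (int i + 1)) - x (int i + 1)) else 2 * x (int n) + x 0)"
  and M: "int (m (j + 1)) + max 0 (- w j) = (if i < n
   then x (- int i) + max 0 (x (int i + 1) - x (- (int i + 1))) else 2 * x (- int n) + x 0)"
  if "i : {1..n}" "j = i \<or> j = 2 * n - i" for i j
 proof -
  have "int (d (j + 1)) + max 0 (w j) = int (gamma X n i * fst (xsig X n i x))"
   "int (m (j + 1)) + max 0 (- w j) = int (gamma X n i * snd (xsig X n i x))" using sg[OF that] by (auto simp: w_def simp flip: of_nat_mult)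
  thus "int (d (j + 1)) + max 0 (w j) = (if i < n
   then x (int i) + max 0 (x (- (int i + 1)) - x (int i + 1)) else 2 * x (int n) + x 0)"
   "int (m (j + 1)) + max 0 (- w j) = (if i < n
   then x (- int i) + max 0 (x (int i + 1) - x (- (int i + 1))) else 2 * x (- int n) + x 0)" unfolding xsig_int[OF x X that(1)] by blast+
 qed
 have st: "w j - w (Suc j) = v j - v (Suc j)" if j: "1 <= j" "j <= 2 * n - 1" for j
 proof -
  define i where "i = min j (2 * n - j)"
  have i: "i : {1..n}" "j = i \<or> j = 2 * n - i" using j by (auto simp: i_def)
  have "w j - w (Suc j) = (if i < n then (x (int i) - x (- int i)) - (x (int i + 1) - x (- (int i + 1)))
    else 2 * (x (int n) - x (- int n)))" using P[OF i] M[OF i] unfolding w_def[of "Suc j"] by auto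
  also have "\<dots> = v j - v (Suc j)"
  proof (cases "j < n")
   case True thus ?thesis by (simp add: i_def v_def algebra_simps)
  next
   case False
   hence "2 * n + 1 - j = Suc i" "2 * n + 1 - Suc j = i" "j = n \<longleftrightarrow> i = n" "i <= n" using j by (auto simp: i_def)
   thus ?thesis using False by (auto simp: v_def algebra_simps)
  qed
  finally show ?thesis .
 qed
 have const: "w a - v a = w 1 - v 1" if "1 <= a" "a <= 2 * n" for a using that(1) that(2)
 proof (induction a rule: dec_induct)
  case (step b)
  hence "b <= 2 * n - 1" by simp
  from st[OF step(1) this] step(3,4) show ?case by simp
 qed simp
 have "(\<Sum>a=1..2 * n. w a - v a) = 0"
 proof -
  have "(\<Sum>a=1..2 * n. v a) = (\<Sum>i=1..n. v i + v (2 * n + 1 - i))" by (rule sum_fold_middle)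
  also have "\<dots> = 0" by (rule sum.neutral) (auto simp: v_def)
  finally have "(\<Sum>a=1..2 * n. v a) = 0" .
  moreover have "(\<Sum>a=1..2 * n. w a) = int (\<Sum>a=1..2 * n. m a) - int (\<Sum>a=1..2 * n. d a)"
   unfolding w_def of_nat_sum by (rule sum_subtractf)
  moreover have "(\<Sum>a=1..2 * n. w a - v a) = (\<Sum>a=1..2 * n. w a) - (\<Sum>a=1..2 * n. v a)" by (rule sum_subtractf)
  ultimately show ?thesis unfolding tot by linarith
 qed
 moreover have "(\<Sum>a=1..2 * n. w a - v a) = (\<Sum>a=1..2 * n. w 1 - v 1)"
 proof (rule sum.cong)
  fix a assume "a : {1..2 * n}"
  thus "w a - v a = w 1 - v 1" using const[of a] by (simp only: atLeastAtMost_iff)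
 qed simp
 ultimately have "w 1 - v 1 = 0" using n by simp
 hence wv: "w a = v a" if "1 <= a" "a <= 2 * n" for a using const[OF that] by simp
 have W: "w i = x (int i) - x (- int i)" "w (2 * n + 1 - i) = x (- int i) - x (int i)" if "1 <= i" "i <= n" for i
  using wv[of i] wv[of "2 * n + 1 - i"] that by (auto simp: v_def)
 have mn: "int (min (m a) (d a)) = int (d a) + min 0 (w a)" for a by (auto simp: w_def)
 have C1: "int (min (m (Suc i)) (d (Suc i))) = min (x (int i)) (x (- int i))" if "1 <= i" "i < n" for i
  using P[of i i] W(1)[of i] W(1)[of "Suc i"] that unfolding mn by (auto simp: algebra_simps)
 have C2: "int (min (m (2 * n + 1 - i)) (d (2 * n + 1 - i))) = min (x (int i)) (x (- int i))" if "1 <= i" "i < n" for i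
 proof -
  have e: "2 * n - i + 1 = 2 * n + 1 - i" "2 * n + 1 - Suc i = 2 * n - i" "i : {1..n}" "~ n <= i" using that by auto
  from P[OF e(3), of "2 * n - i"] e(4) have "int (d (2 * n + 1 - i)) + max 0 (w (2 * n + 1 - Suc i)) = x (int i) + max 0 (x (- (int i + 1)) - x (int i + 1))"
   unfolding e(1,2) by simp
  thus ?thesis using W(2)[of i] W(2)[of "Suc i"] that unfolding mn by (simp add: algebra_simps max_def split: if_splits)
 qed
 have C3: "int (min (m (Suc n)) (d (Suc n))) = 2 * min (x (int n)) (x (- int n)) + x 0" using P[of n n] W[of n] n unfolding mn by auto
 have C4: "int (min (m 1) (d 1)) = int s - (\<Sum>a=- int n..int n. x a)"
 proof -
  define c where "c a = int (min (m a) (d a))" for a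
  have "int s = (\<Sum>a=1..2 * n. int (m a))" unfolding of_nat_sum[symmetric] tot(1) ..
  also have "\<dots> = (\<Sum>a=1..2 * n. c a + max 0 (w a))" by (rule sum.cong) (auto simp: c_def w_def)
  also have "\<dots> = (\<Sum>i=1..n. (c i + max 0 (w i)) + (c (2 * n + 1 - i) + max 0 (w (2 * n + 1 - i))))" by (rule sum_fold_middle)
  also have "\<dots> = (\<Sum>i=1..n. c i + c (2 * n + 1 - i) + \<bar>x (int i) - x (- int i)\<bar>)" by (rule sum.cong) (use W in auto)
  also have "\<dots> = (\<Sum>i=1..n. c i) + (\<Sum>i=1..n. c (2 * n + 1 - i)) + (\<Sum>i=1..n. \<bar>x (int i) - x (- int i)\<bar>)"
   by (simp add: sum.distrib)
  also have "(\<Sum>i=1..n. c i) = c 1 + (\<Sum>i=1..<n. c (Suc i))" by (rule sum_shift_first[OF n])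
  also have "(\<Sum>i=1..<n. c (Suc i)) = (\<Sum>i=1..<n. min (x (int i)) (x (- int i)))"
   by (rule sum.cong) (use C1 in \<open>auto simp: c_def\<close>)
  also have "(\<Sum>i=1..n. c (2 * n + 1 - i)) = (\<Sum>i=1..<n. c (2 * n + 1 - i)) + c (Suc n)"
   using n by (simp flip: atLeastLessThanSuc_atLeastAtMost)
  also have "(\<Sum>i=1..<n. c (2 * n + 1 - i)) = (\<Sum>i=1..<n. min (x (int i)) (x (- int i)))"
   by (rule sum.cong) (use C2 in \<open>auto simp: c_def\<close>)
  also have "c (Suc n) = 2 * min (x (int n)) (x (- int n)) + x 0" using C3 by (simp add: c_def)
  finally have "int s = c 1 + x 0 + ((\<Sum>i=1..<n. 2 * min (x (int i)) (x (- int i))) + 2 * min (x (int n)) (x (- int n)))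
   + (\<Sum>i=1..n. \<bar>x (int i) - x (- int i)\<bar>)" by (simp add: sum_distrib_left[symmetric])
  also have "(\<Sum>i=1..<n. 2 * min (x (int i)) (x (- int i))) + 2 * min (x (int n)) (x (- int n))
   = (\<Sum>i=1..n. 2 * min (x (int i)) (x (- int i)))" using n by (simp flip: atLeastLessThanSuc_atLeastAtMost)
  also have "c 1 + x 0 + (\<Sum>i=1..n. 2 * min (x (int i)) (x (- int i))) + (\<Sum>i=1..n. \<bar>x (int i) - x (- int i)\<bar>)
   = c 1 + (x 0 + (\<Sum>i=1..n. 2 * min (x (int i)) (x (- int i)) + \<bar>x (int i) - x (- int i)\<bar>))" by (simp add: sum.distrib)
  also have "(\<Sum>i=1..n. 2 * min (x (int i)) (x (- int i)) + \<bar>x (int i) - x (- int i)\<bar>) = (\<Sum>i=1..n. x (int i) + x (- int i))"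
   by (rule sum.cong) auto
  finally show ?thesis by (simp add: c_def sum_symmetric_interval)
 qed
 show ?thesis unfolding vcoords_def
 proof (intro conjI ballI allI impI)
  fix i assume "i : {1..n}"
  thus "int (m i) - int (d i) = x (int i) - x (- int i)"
   "int (m (2 * n + 1 - i)) - int (d (2 * n + 1 - i)) = x (- int i) - x (int i)" using W[of i] by (simp_all add: w_def)
 qed (use C1 C2 C3 C4 in blast)+
qed

lemma psi_vcoords:
 assumes X: "valid_rank X n" "X \<notin> {XB, XAodd}" and emb: "virtual_embedding X n s psi" and x: "x : KRX_elems X n s"
 obtains T1 T2 where "psi x = [T1, T2]" "T1 : tableaux (TypeA (2 * n - 1)) (2 * n - 1) s" "T2 : tableaux (TypeA (2 * n - 1)) 1 s"
  "vcoords n s x (rcount T2) (dcount T1)"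
proof -
 let ?N = "2 * n - 1"
 have n: "1 <= n" by (rule valid_rank_pos[OF X(1)])
 have Y: "Y_of X n = TypeA ?N" using X(2) by (simp add: Y_of_def)
 have h: "hat_factors X n s = [(?N, s), (1, s)]" using X(2) by (simp add: hat_factors_def)
 have "wf_path (TypeA ?N) [(?N, s), (1, s)] (psi x)" using psi_signature(1)[OF X(1) emb x] by (simp only: Y h)
 then obtain T1 T2 where T: "psi x = [T1, T2]" "T1 : tableaux (TypeA ?N) ?N s" "T2 : tableaux (TypeA ?N) 1 s"
  unfolding wf_path_def list_all2_Cons1 by auto
 have N: "Suc ?N = 2 * n" using n by simp
 have "vcoords n s x (rcount T2) (dcount T1)"
 proof (rule vcoords_of_signature[OF x X(2) n])
  fix i j assume i: "i : {1..n}" and j: "j = i \<or> j = 2 * n - i"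
  hence jN: "1 <= j" "j <= ?N" by auto
  have "j : set (iota X n i)" if "~ (i = n & j ~= i)" using X(2) i j by (auto simp: iota_def)
  moreover have "~ (i = n & j ~= i)" using j by auto
  ultimately have "tabsig (TypeA ?N) j (T1 @ T2) = (gamma X n i * fst (xsig X n i x), gamma X n i * snd (xsig X n i x))"
   using psi_signature(2)[OF X(1) emb x i, of j] by (simp only: Y T(1)) simp
  moreover have "tabsig (TypeA ?N) j (T1 @ T2) = bic (tabsig (TypeA ?N) j T1) (tabsig (TypeA ?N) j T2)" by (simp add: tabsig_def bicsum_append)
  ultimately show "(dcount T1 (j + 1) + (rcount T2 j - dcount T1 j), rcount T2 (j + 1) + (dcount T1 j - rcount T2 j))
   = (gamma X n i * fst (xsig X n i x), gamma X n i * snd (xsig X n i x))" unfolding row_signature[OF T(3) jN] dual_row_signature[OF T(2) jN] by simp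
 qed (use rcount_total[OF T(3)] dcount_total[OF T(2)] N in simp_all)
 thus ?thesis using that T by blast
qed

lemma vfac_of_vcoords:
 assumes n: "1 <= n" and X: "X \<notin> {XB, XAodd}" and x: "x : KRX_elems X n s"
  and v: "vcoords n s x (rcount T2) (dcount T1)"
 shows "vfac X n T1 T2"
proof -
 define m d where "m = rcount T2" and "d = dcount T1"
 note v = v[folded m_def d_def, unfolded vcoords_def]
 have N: "2 * n - 1 + 2 = 2 * n + 1" "Suc (2 * n - 1) = 2 * n" using n by auto
 have D: "int (m a) - int (d a) = int (d (2 * n + 1 - a)) - int (m (2 * n + 1 - a))" if a: "1 <= a" "a <= 2 * n" for a
 proof (cases "a <= n")
  case True
  hence "a : {1..n}" using a by simp
  hence "int (m a) - int (d a) = x (int a) - x (- int a)"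
   "int (m (2 * n + 1 - a)) - int (d (2 * n + 1 - a)) = x (- int a) - x (int a)" using v by blast+
  thus ?thesis by linarith
 next
  case False
  hence "2 * n + 1 - a : {1..n}" "2 * n + 1 - (2 * n + 1 - a) = a" using a by auto
  thus ?thesis using v by (metis minus_diff_eq)
 qed
 have C: "min (d (2 * n + 1 - a)) (m (2 * n + 1 - a)) = min (m (Suc a)) (d (Suc a))" if a: "1 <= a" "a <= 2 * n - 1" for a
 proof -
  consider "a < n" | "a = n" | "n < a" by linarith
  thus ?thesis
  proof cases
   case 1
   hence "int (min (m (2 * n + 1 - a)) (d (2 * n + 1 - a))) = int (min (m (Suc a)) (d (Suc a)))" using v a by metis
   thus ?thesis by simp
  next
   case 2
   hence "2 * n + 1 - a = Suc a" by simp
   thus ?thesis by simp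
  next
   case 3
   hence "1 <= 2 * n - a" "2 * n - a < n" "Suc (2 * n - a) = 2 * n + 1 - a" "2 * n + 1 - (2 * n - a) = Suc a" using a by auto
   hence "int (min (m (2 * n + 1 - a)) (d (2 * n + 1 - a))) = int (min (m (Suc a)) (d (Suc a)))" using v by metis
   thus ?thesis by simp
  qed
 qed
 have "shifted (2 * n - 1) m d (%a. d (2 * n + 1 - a)) (%a. m (2 * n + 1 - a))" unfolding shifted_def N
 proof (intro conjI allI impI)
  fix a assume "1 <= a & a <= 2 * n"
  thus "m a + m (2 * n + 1 - a) = d (2 * n + 1 - a) + d a" using D[of a] by linarith
 next
  fix a assume "1 <= a & a <= 2 * n - 1"
  thus "min (d (2 * n + 1 - a)) (m (2 * n + 1 - a)) = min (m (Suc a)) (d (Suc a))" using C by blast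
 qed (simp add: min.commute)
 hence vc: "virtual_counts (2 * n - 1) m d" unfolding virtual_counts_def N .
 have "even (int (min (m (Suc n)) (d (Suc n))))" if "X : {XC, XAeven}"
 proof -
  have "x 0 = 0" using x that by (auto simp: KRX_elems_def)
  thus ?thesis using v by simp
 qed
 moreover have "even (int (min (m 1) (d 1)))" if "X : {XC, XAdag}"
 proof -
  have "even (int s - (\<Sum>a=- int n..int n. x a))" using x that by (auto simp: KRX_elems_def)
  thus ?thesis using v by metis
 qed
 ultimately show ?thesis using vc unfolding vfac_def m_def d_def by simp
qed

lemma int_halves: "int (k mod 2) + 2 * int (k div 2) = int k" by presburger

lemma vcoords_of_vfac:
 assumes n: "1 <= n" and X: "X \<notin> {XB, XAodd}" and v: "vfac X n T1 T2"
  and T: "T1 : tableaux (TypeA (2 * n - 1)) (2 * n - 1) s" "T2 : tableaux (TypeA (2 * n - 1)) 1 s"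
 obtains x where "x : KRX_elems X n s" "vcoords n s x (rcount T2) (dcount T1)"
proof -
 define m d where "m = rcount T2" and "d = dcount T1"
 define c where "c a = min (m a) (d a)" for a
 define w where "w a = int (m a) - int (d a)" for a
 \<comment> \<open>\<open>k i\<close> is to become the minimum of \<open>x i\<close> and
   \<open>x (- i)\<close>. At n the common part is 2 * \<open>k n\<close> + \<open>x 0\<close> with
   \<open>x 0\<close> at most 1, hence quotient and remainder modulo 2.\<close>
 define k where "k i = (if i < n then int (c (Suc i)) else int (c (Suc n) div 2))" for i
 define x :: coords where "x a = (if a = 0 then int (c (Suc n) mod 2) else if int n < \<bar>a\<bar> then 0
   else if 0 < a then k (nat a) + max 0 (w (nat a)) else k (nat (- a)) + max 0 (- w (nat (- a))))" for a
 have N: "2 * n - 1 + 2 = 2 * n + 1" "Suc (2 * n - 1) = 2 * n" using n by auto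
 have xp: "x (int i) = k i + max 0 (w i)" "x (- int i) = k i + max 0 (- w i)" if "1 <= i" "i <= n" for i using that by (auto simp: x_def)
 have sh: "shifted (2 * n - 1) m d (%a. d (2 * n + 1 - a)) (%a. m (2 * n + 1 - a))"
  using v unfolding vfac_def virtual_counts_def m_def d_def N by blast
 have D: "w (2 * n + 1 - a) = - w a" if "1 <= a" "a <= 2 * n" for a using sh that by (auto simp: shifted_def w_def)
 have C: "c (2 * n + 1 - a) = c (Suc a)" if "1 <= a" "a <= 2 * n - 1" for a
 proof -
  have "min (d (2 * n + 1 - a)) (m (2 * n + 1 - a)) = min (m (Suc a)) (d (Suc a))" using sh that unfolding shifted_def by blast
  thus ?thesis unfolding c_def by (simp only:)
 qed
 have k0: "0 <= k i" for i by (simp add: k_def)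
 have total: "int s = int (c 1) + (\<Sum>a=- int n..int n. x a)"
 proof -
  have "int s = (\<Sum>a=1..2 * n. int (m a))" unfolding of_nat_sum[symmetric] using rcount_total[OF T(2)] unfolding N m_def by simp
  also have "\<dots> = (\<Sum>a=1..2 * n. int (c a) + max 0 (w a))" by (rule sum.cong) (auto simp: c_def w_def)
  also have "\<dots> = (\<Sum>i=1..n. (int (c i) + max 0 (w i)) + (int (c (2 * n + 1 - i)) + max 0 (w (2 * n + 1 - i))))" by (rule sum_fold_middle)
  also have "\<dots> = (\<Sum>i=1..n. int (c i) + int (c (Suc i)) + \<bar>w i\<bar>)"
  proof (rule sum.cong)
   fix i assume "i : {1..n}"
   thus "(int (c i) + max 0 (w i)) + (int (c (2 * n + 1 - i)) + max 0 (w (2 * n + 1 - i))) = int (c i) + int (c (Suc i)) + \<bar>w i\<bar>"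
    using D[of i] C[of i] by auto
  qed simp
  also have "\<dots> = int (c 1) + (x 0 + (\<Sum>i=1..n. x (int i) + x (- int i)))"
  proof -
   \<comment> \<open>Replaces c i + c (i + 1) by 2 * c (i + 1); the differences telescope.\<close>
   have "(\<Sum>i=1..j. int (c i) + int (c (Suc i)) + \<bar>w i\<bar>) = int (c 1) - int (c (Suc j)) + (\<Sum>i=1..j. 2 * int (c (Suc i)) + \<bar>w i\<bar>)" for j
    by (induction j) (simp_all add: c_def)
   from this[of n] have "(\<Sum>i=1..n. int (c i) + int (c (Suc i)) + \<bar>w i\<bar>)
    = int (c 1) - int (c (Suc n)) + ((\<Sum>i=1..<n. 2 * int (c (Suc i)) + \<bar>w i\<bar>) + 2 * int (c (Suc n)) + \<bar>w n\<bar>)"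
    using n by (simp flip: atLeastLessThanSuc_atLeastAtMost)
   moreover have "(\<Sum>i=1..n. x (int i) + x (- int i)) = (\<Sum>i=1..<n. 2 * int (c (Suc i)) + \<bar>w i\<bar>) + (2 * int (c (Suc n) div 2) + \<bar>w n\<bar>)"
   proof -
    have "(\<Sum>i=1..n. x (int i) + x (- int i)) = (\<Sum>i=1..n. 2 * k i + \<bar>w i\<bar>)" by (rule sum.cong) (use xp in auto)
    also have "\<dots> = (\<Sum>i=1..<n. 2 * k i + \<bar>w i\<bar>) + (2 * k n + \<bar>w n\<bar>)"
     using n by (simp flip: atLeastLessThanSuc_atLeastAtMost)
    also have "(\<Sum>i=1..<n. 2 * k i + \<bar>w i\<bar>) = (\<Sum>i=1..<n. 2 * int (c (Suc i)) + \<bar>w i\<bar>)"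
     by (rule sum.cong) (auto simp: k_def)
    finally show ?thesis by (simp add: k_def)
   qed
   moreover have "x 0 + 2 * int (c (Suc n) div 2) = int (c (Suc n))" using int_halves unfolding x_def by simp
   ultimately show ?thesis by simp
  qed
  finally show ?thesis by (simp add: sum_symmetric_interval)
 qed
 have cc: "c (Suc n) = min (rcount T2 (Suc n)) (dcount T1 (Suc n))" "c 1 = min (rcount T2 1) (dcount T1 1)" by (simp_all add: c_def m_def d_def)
 have "x : KRX_elems X n s"
 proof -
  have "0 <= x a" for a using k0 by (auto simp: x_def)
  moreover have "\<forall>a. int n < \<bar>a\<bar> --> x a = 0" by (auto simp: x_def)
  moreover have "x 0 <= 1" by (simp add: x_def)
  moreover have "x 0 = 0" if "X \<notin> {XB, XAdag, XD}"
  proof -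
   have "X : {XC, XAeven}" using that X by (cases X) auto
   hence "even (c (Suc n))" using v unfolding vfac_def cc by blast
   thus ?thesis by (simp add: x_def)
  qed
  moreover have "even (int s - (\<Sum>a=- int n..int n. x a))" if "X \<notin> {XB, XAodd, XAeven, XD}"
  proof -
   have "X : {XC, XAdag}" using that by (cases X) auto
   hence "even (c 1)" using v unfolding vfac_def cc by blast
   thus ?thesis using total by simp
  qed
  ultimately show ?thesis using X total unfolding KRX_elems_def by auto
 qed
 moreover have "vcoords n s x m d" unfolding vcoords_def
 proof (intro conjI ballI allI impI)
  fix i assume "i : {1..n}"
  hence i: "1 <= i" "i <= n" "1 <= i" "i <= 2 * n" by auto
  show "int (m i) - int (d i) = x (int i) - x (- int i)"
   "int (m (2 * n + 1 - i)) - int (d (2 * n + 1 - i)) = x (- int i) - x (int i)" unfolding w_def[symmetric] D[OF i(3,4)] xp[OF i(1,2)] by auto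
 next
  fix i assume "1 <= i & i < n"
  hence i: "1 <= i" "i <= n" "i < n" "i <= 2 * n - 1" by auto
  show "int (min (m (Suc i)) (d (Suc i))) = min (x (int i)) (x (- int i))"
   "int (min (m (2 * n + 1 - i)) (d (2 * n + 1 - i))) = min (x (int i)) (x (- int i))"
   unfolding c_def[symmetric] C[OF i(1,4)] xp[OF i(1,2)] using i by (auto simp: k_def)
 next
  note int_halves[of "c (Suc n)"]
  moreover have "min (x (int n)) (x (- int n)) = int (c (Suc n) div 2)" unfolding xp[OF n order_refl] by (auto simp: k_def)
  ultimately show "int (min (m (Suc n)) (d (Suc n))) = 2 * min (x (int n)) (x (- int n)) + x 0" unfolding c_def[symmetric] by (simp add: x_def)
  show "int (min (m 1) (d 1)) = int s - (\<Sum>a=- int n..int n. x a)" unfolding c_def[symmetric] using total by simp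
 qed
 ultimately show ?thesis using that unfolding m_def d_def by blast
qed

text \<open>For surjectivity, coordinates are built from the multiplicities of the given pair. Their
  image has the same multiplicities by \<open>vcoords_unique\<close>, and these determine a pair of
  tableaux.\<close>

lemma factor_image_A:
 assumes X: "valid_rank X n" "X \<notin> {XB, XAodd}" and emb: "virtual_embedding X n s psi"
  and T: "T1 : tableaux (TypeA (2 * n - 1)) (2 * n - 1) s" "T2 : tableaux (TypeA (2 * n - 1)) 1 s"
 shows "(\<exists>x\<in>KRX_elems X n s. psi x = [T1, T2]) \<longleftrightarrow> vfac X n T1 T2"
proof
 have n: "1 <= n" by (rule valid_rank_pos[OF X(1)])
 { assume "\<exists>x\<in>KRX_elems X n s. psi x = [T1, T2]"
  then obtain x where x: "x : KRX_elems X n s" "psi x = [T1, T2]" by blast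
  obtain U1 U2 where "psi x = [U1, U2]" "vcoords n s x (rcount U2) (dcount U1)" by (rule psi_vcoords[OF X emb x(1)])
  thus "vfac X n T1 T2" using vfac_of_vcoords[OF n X(2) x(1)] x(2) by simp }
 { assume "vfac X n T1 T2"
  then obtain x where x: "x : KRX_elems X n s" "vcoords n s x (rcount T2) (dcount T1)" using vcoords_of_vfac[OF n X(2) _ T] by metis
  obtain U1 U2 where U: "psi x = [U1, U2]" "U1 : tableaux (TypeA (2 * n - 1)) (2 * n - 1) s" "U2 : tableaux (TypeA (2 * n - 1)) 1 s"
   "vcoords n s x (rcount U2) (dcount U1)" by (rule psi_vcoords[OF X emb x(1)])
  have N: "Suc (2 * n - 1) = 2 * n" using n by simp
  have "U1 = T1" by (rule dual_row_eq[OF U(2) T(1)]) (use vcoords_unique[OF n U(4) x(2)] N in metis)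
  moreover have "U2 = T2" by (rule row_eq[OF U(3) T(2)]) (use vcoords_unique[OF n U(4) x(2)] N in metis)
  ultimately show "\<exists>x\<in>KRX_elems X n s. psi x = [T1, T2]" using U(1) x(1) by blast }
qed

lemma path_image_A:
 assumes X: "valid_rank X n" "X \<notin> {XB, XAodd}"
 shows "\<forall>s\<in>set ss. virtual_embedding X n s (psi s) ==> wf_path (TypeA (2 * n - 1)) (hat_factors_list X n ss) p ==>
  (\<exists>b. coords_list X n ss b & p = Psi_path psi ss b) \<longleftrightarrow> vpath X n p"
proof (induction ss arbitrary: p)
 case Nil thus ?case by (simp add: wf_path_def coords_list_def Psi_path_def)
next
 case (Cons s ss)
 let ?N = "2 * n - 1"
 obtain T1 T2 q where p: "p = T1 # T2 # q" and T: "T1 : tableaux (TypeA ?N) ?N s" "T2 : tableaux (TypeA ?N) 1 s"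
  and q: "wf_path (TypeA ?N) (hat_factors_list X n ss) q"
  using Cons.prems(2) unfolding hat_factors_list_Cons_A[OF X(2)] wf_path_def list_all2_Cons1 by auto
 have emb: "virtual_embedding X n s (psi s)" using Cons.prems(1) by simp
 have IH: "(\<exists>b. coords_list X n ss b & q = Psi_path psi ss b) \<longleftrightarrow> vpath X n q" using Cons.IH[OF _ q] Cons.prems(1) by simp
 have len: "\<exists>U1 U2. psi s x = [U1, U2]" if x: "x : KRX_elems X n s" for x by (metis psi_vcoords X emb x)
 have "(\<exists>b. coords_list X n (s # ss) b & p = Psi_path psi (s # ss) b) \<longleftrightarrow>
  (\<exists>x b. x : KRX_elems X n s & coords_list X n ss b & p = psi s x @ Psi_path psi ss b)"
 by (fastforce simp: coords_list_def list_all2_Cons1 Psi_path_def)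
 also have "\<dots> \<longleftrightarrow> (\<exists>x b. x : KRX_elems X n s & coords_list X n ss b & psi s x = [T1, T2] & q = Psi_path psi ss b)"
 using len p by fastforce
 also have "\<dots> \<longleftrightarrow> vpath X n p" using factor_image_A[OF X emb T] IH unfolding p vpath.simps by blast
 finally show ?case .
qed

section \<open>Two consecutive steps of the folded type D algorithm\<close>

text \<open>Multisets, because a step may take two strings at a node, even two with the same length
  and rigging.\<close>

definition strs :: "vacancies => nat => enat => (nat \<times> int) multiset" where
 "strs p a x = (case x of \<infinity> => {#} | enat i => {#(i, p a i)#})"

definition shorts :: "vacancies => nat => enat => (nat \<times> int) multiset" where
 "shorts p a x = (case x of \<infinity> => {#} | enat i => if 1 < i then {#(i - 1, p a (i - 1))#} else {#})"

lemma strs_simps [simp]: "strs p a \<infinity> = {#}" "strs p a (enat i) = {#(i, p a i)#}" by (simp_all add: strs_def)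

lemma shorts_simps [simp]: "shorts p a \<infinity> = {#}" "1 < i ==> shorts p a (enat i) = {#(i - 1, p a (i - 1))#}"
 "shorts p a (enat 1) = {#}" by (simp_all add: shorts_def)

lemma select_mem:
 "(if c then 2 else 1) <= count M x ==> x \<in># M" "(if c then 2 else 1) <= count M x ==> Suc 0 <= count M x"
 by (auto simp: count_greater_zero_iff[symmetric] simp del: count_greater_zero_iff split: if_splits)

definition even_str :: "nat \<times> int => bool" where
 "even_str z \<longleftrightarrow> even (fst z) & even (snd z)"

text \<open>A step of the type D algorithm on a configuration invariant under the exchange of the spin nodes.
 The two spin nodes are folded into the node \<open>n\<close>, where both searches select \<open>l n = b n\<close>.\<close>

locale dsel =
 fixes n k :: nat and p :: vacancies and R :: rigged and l b :: "nat => enat"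
 assumes n: "2 <= n" and k: "1 <= k"
  and l_0: "l 0 = enat k"
  and l_first: "1 <= a ==> a <= n ==> l a = first (sing p R a) (l (a - 1))"
  and b_0: "b 0 = \<infinity>" and b_n: "b n = l n"
  and b_first: "1 <= a ==> a < n ==> b a = first (%i. (if l a = enat i then 2 else 1) <= count (R a) (i, p a i)) (b (a + 1))"
begin

lemma l_mono: "c <= a ==> a <= n ==> l c <= l a"
proof (induction a rule: dec_induct)
 case (step a)
 have "l (Suc a) = first (sing p R (Suc a)) (l a)" using l_first[of "Suc a"] step by simp
 hence "l a <= l (Suc a)" by (simp add: first_ge)
 thus ?case using step by auto
qed simp

lemma b_ge: "1 <= a ==> a < n ==> b (a + 1) <= b a" using b_first[of a] by (simp add: first_ge)

lemma b_antimono: "c <= a ==> a <= n ==> b a <= b c"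
proof (induction a rule: dec_induct)
 case (step a)
 thus ?case using b_ge[of a] b_0 by (cases "a = 0") (auto intro: order_trans)
qed simp

lemma l_le_b: "a <= n ==> c <= n ==> l a <= b c" using l_mono[of a n] b_antimono[of c n] b_n by auto

lemma k_le: "a <= n ==> enat k <= l a" using l_mono[of 0 a] l_0 by simp

lemma l_sing: "1 <= a ==> a <= n ==> l a = enat i ==> (i, p a i) \<in># R a"
 using l_first[of a] first_sat[of "sing p R a" "l (a - 1)" i] by (simp add: sing_def)

lemma b_sing:
 assumes "1 <= a" "a < n" "b a = enat i"
 shows "(if l a = enat i then 2 else 1) <= count (R a) (i, p a i)"
 using first_sat[of "%i. (if l a = enat i then 2 else 1) <= count (R a) (i, p a i)" "b (a + 1)" i] b_first[OF assms(1,2)] assms(3) by simp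

lemma b_mem: "1 <= a ==> a < n ==> b a = enat i ==> (i, p a i) \<in># R a" by (rule select_mem(1)[OF b_sing])

lemma strs_subset:
 assumes a: "1 <= a" "a < n"
 shows "strs p a (l a) + strs p a (b a) \<subseteq># R a"
proof (cases "b a")
 case infinity
 thus ?thesis using l_sing[of a] a by (cases "l a") auto
next
 case (enat j)
 then obtain i where i: "l a = enat i" using l_le_b[of a a] a by (cases "l a") auto
 have 1: "(i, p a i) \<in># R a" "(j, p a j) \<in># R a" using l_sing[of a i] b_mem[of a j] a i enat by auto
 show ?thesis
 proof (cases "i = j")
  case True
  hence "2 <= count (R a) (i, p a i)" using b_sing[of a j] a enat i by simp
  thus ?thesis using enat i True by (auto simp: subseteq_mset_def)
 next
  case False
  thus ?thesis using enat i 1 by (auto simp: subseteq_mset_def)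
 qed
qed

end

text \<open>The node before n is adjacent to both spin nodes; their equal selections enter its
  vacancy update as \<open>chi (l n) + chi (b n)\<close>.\<close>

locale dstep = dsel +
 fixes p1 :: vacancies and R1 :: rigged
 assumes R1_eq: "1 <= a ==> a < n ==> R1 a = R a - strs p a (l a) - strs p a (b a) + shorts p1 a (l a) + shorts p1 a (b a)"
  and R1_n: "R1 n = R n - strs p n (l n) + shorts p1 n (l n)"
  and p1_eq: "1 <= a ==> a < n ==> p1 a i = p a i + 2 * (chi (l a) i + chi (b a) i)
   - (chi (l (a - 1)) i + chi (b (a - 1)) i + chi (l (a + 1)) i + chi (b (a + 1)) i)"
begin

lemma R1_decomp:
 assumes a: "1 <= a" "a < n"
 obtains C where "R a = C + strs p a (l a) + strs p a (b a)" "R1 a = C + shorts p1 a (l a) + shorts p1 a (b a)"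
proof -
 obtain C where C: "R a = C + (strs p a (l a) + strs p a (b a))" using strs_subset[OF a] by (metis subset_mset.diff_add)
 show ?thesis using C by (intro that[of C]) (simp_all add: R1_eq[OF a] add.assoc)
qed

lemma shorts_mem: "z \<in># shorts q a x ==> \<exists>i. x = enat i & 1 < i & z = (i - 1, q a (i - 1))"
 by (cases x) (auto simp: shorts_def split: if_splits)

lemma R1_cases:
 assumes a: "1 <= a" "a < n" and m: "(j, x) \<in># R1 a"
 obtains (old) "(j, x) \<in># R a" | (unbarred) "l a = enat (Suc j)" | (barred) "b a = enat (Suc j)"
proof -
 obtain C where C: "R a = C + strs p a (l a) + strs p a (b a)" "R1 a = C + shorts p1 a (l a) + shorts p1 a (b a)" by (rule R1_decomp[OF a])
 from m have "(j, x) \<in># C \<or> (j, x) \<in># shorts p1 a (l a) \<or> (j, x) \<in># shorts p1 a (b a)" by (auto simp: C(2))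
 thus ?thesis using C(1) that by (auto dest!: shorts_mem)
qed

end

text \<open>A row of even length is read in pairs, so the first step of a pair starts at an even
  length and the second at the odd length k.\<close>

locale two_steps = one: dstep n "Suc k" p R l b p1 R1 + two: dstep n k p1 R1 l' b' p2 R2
 for n k p R l b p1 R1 l' b' p2 R2 +
 assumes k_odd: "odd k"
begin

lemma l_two: "a <= n ==> l a = enat i ==> 2 <= i" using one.k_le[of a] two.k by simp

lemma b_two: "a <= n ==> b a = enat i ==> 2 <= i" using order_trans[OF one.k_le[of a] one.l_le_b[of a a]] two.k by simp

lemma short_l:
 assumes a: "1 <= a" "a <= n" and i: "l a = enat i"
 shows "(i - 1, p1 a (i - 1)) \<in># R1 a"
proof -
 have "1 < i" using l_two[OF a(2) i] by simp
 thus ?thesis using one.R1_eq[of a] one.R1_n i a by (cases "a = n") auto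
qed

lemma short_b:
 assumes a: "1 <= a" "a < n" and i: "b a = enat i"
 shows "(if l a = enat i then 2 else 1) <= count (R1 a) (i - 1, p1 a (i - 1))"
proof -
 have "1 < i" using b_two[OF _ i] a by simp
 thus ?thesis using one.R1_eq[OF a] i by auto
qed

text \<open>The strings shortened in the first step are singular, so the second search stops no
  later than there.\<close>

lemma l'_le: "a <= n ==> l a = enat i ==> l' a <= enat (i - 1)"
proof (induction a arbitrary: i)
 case 0 thus ?case using one.l_0 two.l_0 by simp
next
 case (Suc a)
 have "l a <= enat i" using one.l_mono[of a "Suc a"] Suc.prems by simp
 then obtain j where j: "l a = enat j" "j <= i" by (cases "l a") auto
 have "l' a <= enat (i - 1)" using Suc.IH[OF _ j(1)] Suc.prems j(2) by (auto intro: order_trans)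
 thus ?case using two.l_first[of "Suc a"] short_l[of "Suc a" i] Suc.prems by (auto intro!: first_le simp: sing_def)
qed

lemma b'_le: "a <= n ==> b a = enat i ==> b' a <= enat (i - 1)"
proof (induction a arbitrary: i rule: inc_induct)
 case base thus ?case using l'_le[of n i] one.b_n two.b_n by simp
next
 case (step a)
 show ?case
 proof (cases "a = 0")
  case True thus ?thesis using step.prems one.b_0 by simp
 next
  case False
  hence a: "1 <= a" "a < n" using step by auto
  have "b (Suc a) <= enat i" using one.b_ge[OF a] step.prems by simp
  then obtain j where j: "b (Suc a) = enat j" "j <= i" by (cases "b (Suc a)") auto
  have "b' (a + 1) <= enat (i - 1)" using step.IH[OF j(1)] j(2) by (auto intro: order_trans)
  \<comment> \<open>If \<open>l'\<close> has already taken a string of length i - 1, then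
    \<open>l a\<close> was also i, and the first step left two singular strings of length i -
    1.\<close>
  moreover have "(if l' a = enat (i - 1) then 2 else 1) <= count (R1 a) (i - 1, p1 a (i - 1))"
  proof (cases "l' a = enat (i - 1)")
   case True
   obtain m where m: "l a = enat m" "m <= i" using one.l_le_b[of a a] step.prems a by (cases "l a") auto
   hence "i - 1 <= m - 1" using l'_le[OF _ m(1)] a True by simp
   hence "m = i" using l_two[OF _ m(1)] m(2) a by simp
   thus ?thesis using short_b[OF a step.prems] m True by simp
  next
   case False thus ?thesis using select_mem(2)[OF short_b[OF a step.prems]] by simp
  qed
  ultimately show ?thesis unfolding two.b_first[OF a] by (rule first_le)
 qed
qed

text \<open>The second step takes precisely the strings just shortened, so at these nodes the two
  steps together shorten strings of even length by two.\<close>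

definition tight :: "nat => bool" where
 "tight a \<longleftrightarrow> l' a = l a - 1 & b' a = b a - 1 & (\<forall>i. l a = enat i \<or> b a = enat i --> even i)"

lemma tight_even:
 assumes t: "!!a. 1 <= a ==> a < n ==> tight a" and a: "1 <= a" "a < n"
 obtains C where "R a = C + strs p a (l a) + strs p a (b a)" "R2 a = C + shorts p2 a (l a - 1) + shorts p2 a (b a - 1)"
proof -
 obtain C where C: "R a = C + strs p a (l a) + strs p a (b a)" "R1 a = C + shorts p1 a (l a) + shorts p1 a (b a)" by (rule one.R1_decomp[OF a])
 obtain D where D: "R1 a = D + strs p1 a (l' a) + strs p1 a (b' a)" "R2 a = D + shorts p2 a (l' a) + shorts p2 a (b' a)" by (rule two.R1_decomp[OF a])
 have "shorts p1 a x = strs p1 a (x - 1)" if "!!i. x = enat i ==> 2 <= i" for x using that by (cases x) (force simp: one_enat_def)+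
 hence "shorts p1 a (l a) = strs p1 a (l' a)" "shorts p1 a (b a) = strs p1 a (b' a)" using t[OF a] l_two[of a] b_two[of a] a by (auto simp: tight_def)
 hence "D = C" using C(2) D(1) by simp
 thus ?thesis using that C(1) D(2) t[OF a] by (simp add: tight_def)
qed

lemma enat_minus_1_le: "x - 1 <= enat j \<longleftrightarrow> x <= enat (Suc j)" by (cases x) (auto simp: one_enat_def)

context
 assumes ev: "!!a z. 1 <= a ==> a < n ==> z \<in># R a ==> even_str z"
  and pe: "!!a i. 1 <= a ==> a < n ==> even i ==> even (p a i)"
begin

lemma l_even: "a < n ==> l a = enat i ==> even i"
 using one.l_0 k_odd one.l_sing[of a i] ev[of a "(i, p a i)"] by (cases "a = 0") (auto simp: even_str_def)

lemma b_even: "1 <= a ==> a < n ==> b a = enat i ==> even i" using one.b_mem[of a i] ev[of a "(i, p a i)"] by (auto simp: even_str_def)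

text \<open>An earlier hit would be an old string of even length and even rigging. But between the
  consecutive selections of the first step the vacancy number has dropped by one from an even value,
  so such a string cannot be singular.\<close>

lemma l'_eq: "a < n ==> l' a = l a - 1"
proof (induction a)
 case 0 show ?case using one.l_0 two.l_0 by (simp add: one_enat_def)
next
 case (Suc a)
 hence a: "1 <= Suc a" "Suc a < n" "Suc a <= n" by auto
 have IH: "l' a = l a - 1" using Suc by simp
 have "first (sing p1 R1 (Suc a)) (l' a) = l (Suc a) - 1"
 proof (rule first_eqI)
  show "l' a <= l (Suc a) - 1" using one.l_mono[of a "Suc a"] a unfolding IH by (cases "l a"; cases "l (Suc a)") (auto simp: one_enat_def)
  show "sing p1 R1 (Suc a) i" if "l (Suc a) - 1 = enat i" for i
  proof (cases "l (Suc a)")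
   case (enat j) thus ?thesis using short_l[OF a(1,3) enat] \<open>l (Suc a) - 1 = enat i\<close> by (simp add: sing_def one_enat_def)
  qed (use that in simp)
  fix j assume j: "l' a <= enat j" and s: "sing p1 R1 (Suc a) j"
  show "l (Suc a) - 1 <= enat j"
  proof (rule ccontr)
   assume "~ l (Suc a) - 1 <= enat j"
   hence lt: "enat (Suc j) < l (Suc a)" by (simp add: enat_minus_1_le)
   have lts: "enat j < l (Suc a)" using lt by (meson enat_ord_simps(2) lessI order_less_trans)
   have bl: "enat (Suc j) < b c" if "c <= n" for c using lt one.l_le_b[of "Suc a" c] that a by auto
   have bls: "enat j < b c" if "c <= n" for c using bl[OF that] by (meson enat_ord_simps(2) lessI order_less_trans)
   have lu: "enat j < l (Suc (Suc a))" using lts one.l_mono[of "Suc a" "Suc (Suc a)"] a by auto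
   from s consider (old) "(j, p1 (Suc a) j) \<in># R (Suc a)" | "l (Suc a) = enat (Suc j)" | "b (Suc a) = enat (Suc j)"
    unfolding sing_def by (rule one.R1_cases[OF a(1,2)])
   thus False
   proof cases
    case old
    hence e: "even j" "even (p1 (Suc a) j)" using ev[OF a(1,2)] by (auto simp: even_str_def)
    have "l a <= enat (Suc j)" using j unfolding IH enat_minus_1_le .
    then obtain i where i: "l a = enat i" "i <= Suc j" by (cases "l a") auto
    have "even i" using l_even[OF _ i(1)] a by simp
    hence "i <= j" using i(2) e(1) by (metis even_Suc le_SucE)
    hence "p1 (Suc a) j = p (Suc a) j - 1" using one.p1_eq[OF a(1,2), of j] lts lu i(1) bls[of a] bls[of "Suc a"] bls[of "Suc (Suc a)"] a by simp
    thus False using e pe[OF a(1,2)] by simp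
   qed (use lt bl[of "Suc a"] a in auto)
  qed
 qed
 thus ?case using two.l_first[OF a(1,3)] by simp
qed

text \<open>The parity argument of \<open>l'_eq\<close> on the way back: when both unbarred
  selections so far lie below, and the next node contributes twice or not at all, the vacancy number
  of an even length has become odd.\<close>

lemma b'_eq: "1 <= a ==> a < n ==> b' a = b a - 1"
proof -
 have "1 <= a ==> (if a = n then True else b' a = b a - 1)" if "a <= n" for a using that
 proof (induction a rule: inc_induct)
  case (step a)
  hence a: "1 <= a" "a < n" by auto
  have IH: "Suc a < n ==> b' (Suc a) = b (Suc a) - 1" using step by auto
  have le: "b' (Suc a) <= enat (i - 1)" if i: "b a = enat i" for i
  proof -
   obtain j where j: "b (Suc a) = enat j" "j <= i" using one.b_ge[OF a] i by (cases "b (Suc a)") auto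
   thus ?thesis using b'_le[of "Suc a" j] a by (auto intro: order_trans)
  qed
  have "first (%i. (if l' a = enat i then 2 else 1) <= count (R1 a) (i, p1 a i)) (b' (a + 1)) = b a - 1"
  proof (rule first_eqI)
   show "b' (a + 1) <= b a - 1" using le by (cases "b a") (auto simp: one_enat_def)
  next
   fix i assume i: "b a - 1 = enat i"
   then obtain m where m: "b a = enat m" "i = m - 1" by (cases "b a") (auto simp: one_enat_def)
   have "l a = enat m" if "l' a = enat i" using that l'_eq[OF a(2)] m l_two[of a] b_two[of a m] a by (cases "l a") (fastforce simp: one_enat_def)+
   thus "(if l' a = enat i then 2 else 1) <= count (R1 a) (i, p1 a i)" using short_b[OF a m(1)] select_mem(2)[OF short_b[OF a m(1)]] m by auto
  next
   fix j assume j: "b' (a + 1) <= enat j" and s: "(if l' a = enat j then 2 else 1) <= count (R1 a) (j, p1 a j)"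
   show "b a - 1 <= enat j"
   proof (rule ccontr)
    assume "~ b a - 1 <= enat j"
    hence lt: "enat (Suc j) < b a" by (simp add: enat_minus_1_le)
    hence lts: "enat j < b a" by (meson enat_ord_simps(2) lessI order_less_trans)
    have bm: "enat j < b (a - 1)" using lts one.b_antimono[of "a - 1" a] a by auto
    have la: "l' a <= enat j" using two.l_le_b[of a "a + 1"] j a by auto
    have m: "(j, p1 a j) \<in># R1 a" by (rule select_mem(1)[OF s])
    from m consider (old) "(j, p1 a j) \<in># R a" | (un) "l a = enat (Suc j)" | "b a = enat (Suc j)" by (rule one.R1_cases[OF a])
    thus False
    proof cases
     case old
     hence e: "even j" "even (p1 a j)" using ev[OF a] by (auto simp: even_str_def)
     have even_le: "x <= enat j" if h: "x - 1 <= enat j" "!!i. x = enat i ==> even i" for x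
     proof -
      obtain i where i: "x = enat i" "i <= Suc j" using h(1) unfolding enat_minus_1_le by (cases x) auto
      hence "i <= j" using h(2)[OF i(1)] e(1) by (metis even_Suc le_SucE)
      thus ?thesis using i by simp
     qed
     have "l a <= enat j" by (rule even_le) (use la l'_eq[OF a(2)] l_even[OF a(2)] in auto)
     hence l2: "l (a - 1) <= enat j" using one.l_mono[of "a - 1" a] a by auto
     have "chi (l (a + 1)) j = chi (b (a + 1)) j"
     proof (cases "a + 1 = n")
      case False
      hence "Suc a < n" using a by simp
      hence "b (a + 1) <= enat j" using even_le[of "b (a + 1)"] j IH b_even[of "a + 1"] by auto
      moreover from this have "l (a + 1) <= enat j" using one.l_le_b[of "a + 1" "a + 1"] a by auto
      ultimately show ?thesis by simp
     qed (simp add: one.b_n)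
     hence "odd (p1 a j - p a j)" using one.p1_eq[OF a, of j] bm l2 by simp
     thus False using e pe[OF a] by simp
    next
     \<comment> \<open>The shortened string has odd length, so it occurs only once among the even
       old strings, and \<open>l'\<close> has taken it already.\<close>
     case un
     hence l': "l' a = enat j" using l'_eq[OF a(2)] by (simp add: one_enat_def)
     have "odd j" using l_even[OF a(2) un] by simp
     obtain C where C: "R a = C + strs p a (l a) + strs p a (b a)" "R1 a = C + shorts p1 a (l a) + shorts p1 a (b a)" by (rule one.R1_decomp[OF a])
     have "(j, p1 a j) \<notin># C" using ev[OF a, of "(j, p1 a j)"] \<open>odd j\<close> C(1) by (auto simp: even_str_def)
     moreover have "(j, p1 a j) \<notin># shorts p1 a (b a)" using lt by (auto dest!: one.shorts_mem)
     moreover have "count (shorts p1 a (l a)) (j, p1 a j) <= 1" using un by (simp add: shorts_def)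
     ultimately show False using s l' C(2) by (simp add: not_in_iff)
    qed (use lt in auto)
   qed
  qed
  thus ?case using two.b_first[OF a] by simp
 qed simp
 thus "1 <= a ==> a < n ==> b' a = b a - 1" by force
qed

lemma forward_tight: "1 <= a ==> a < n ==> tight a" using l'_eq[of a] b'_eq[of a] l_even[of a] b_even[of a] by (auto simp: tight_def)

end

text \<open>The converse direction: evenness is known only after the two steps. \<open>fin\<close>
  says that both steps succeed at the same nodes; it will come from comparing the letters.\<close>

context
 assumes ev2: "!!a z. 1 <= a ==> a < n ==> z \<in># R2 a ==> even_str z"
  and pe2: "!!a i. 1 <= a ==> a < n ==> even i ==> even (p2 a i)"
  and fin: "!!a. 1 <= a ==> a < n ==> (l a = \<infinity> \<longleftrightarrow> l' a = \<infinity>) & (b a = \<infinity> \<longleftrightarrow> b' a = \<infinity>)"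
begin

text \<open>A string shortened in the second step is left in \<open>R2\<close> with length i - 1,
  which is even; if i = 1, nothing is left and i is odd anyway.\<close>

lemma created_odd:
 assumes a: "1 <= a" "a < n" and i: "l' a = enat i \<or> b' a = enat i"
 shows "odd i"
proof (cases "1 < i")
 case True
 hence "(i - 1, p2 a (i - 1)) \<in># R2 a" using i two.R1_eq[OF a] by auto
 thus ?thesis using ev2[OF a] True by (fastforce simp: even_str_def)
next
 case False
 have "enat k <= enat i" using i two.k_le[of a] order_trans[OF two.k_le[of a] two.l_le_b[of a a]] a by auto
 thus ?thesis using False two.k by (cases "i = 1") auto
qed

text \<open>A singular string that the second step does not use survives into \<open>R2\<close>, so
  its length and rigging are even.\<close>

lemma remaining:
 assumes a: "1 <= a" "a < n" and l: "l' a ~= enat j" and m: "(if b' a = enat j then 2 else 1) <= count (R1 a) (j, p1 a j)"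
 shows "even j" "even (p1 a j)"
proof -
 obtain D where D: "R1 a = D + strs p1 a (l' a) + strs p1 a (b' a)" "R2 a = D + shorts p2 a (l' a) + shorts p2 a (b' a)" by (rule two.R1_decomp[OF a])
 have "count (strs p1 a (l' a)) (j, p1 a j) = 0" using l by (cases "l' a") auto
 moreover have "count (strs p1 a (b' a)) (j, p1 a j) = of_bool (b' a = enat j)" by (cases "b' a") auto
 ultimately have "0 < count D (j, p1 a j)" using m D(1) by (auto split: if_splits)
 hence "(j, p1 a j) \<in># R2 a" by (simp add: D(2))
 thus "even j" "even (p1 a j)" using ev2[OF a] by (auto simp: even_str_def)
qed

text \<open>Runs against the direction of selection, from node 0 upwards. If \<open>b'\<close>
  stopped early, the string of length i - 1 would survive, so i - 1 and its vacancy number would be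
  even before and after the step. This forces \<open>b'\<close> at the previous node to equal i - 1,
  against \<open>created_odd\<close>.\<close>

lemma b'_tight: "a < n ==> b' a = b a - 1"
proof (induction a)
 case 0 show ?case using one.b_0 two.b_0 by simp
next
 case (Suc a)
 hence a: "1 <= Suc a" "Suc a < n" by auto
 have IH: "b' a = b a - 1" using Suc by simp
 show ?case
 proof (cases "b (Suc a)")
  case infinity thus ?thesis using fin[OF a] by simp
 next
  case (enat i)
  have i2: "2 <= i" using b_two[OF _ enat] a by simp
  have le: "b' (Suc a) <= enat (i - 1)" using b'_le[OF _ enat] a by simp
  have "b' (Suc a) = enat (i - 1)"
  proof (rule ccontr)
   assume ne: "b' (Suc a) ~= enat (i - 1)"
   hence lt: "b' (Suc a) < enat (i - 1)" using le by simp
   have le': "l' c <= enat (i - 1)" if "c <= n" for c using two.l_le_b[of c "Suc a"] le that a by auto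
   have lu: "b' (Suc (Suc a)) <= enat (i - 1)" using two.b_ge[OF a] le by auto
   have "l' (Suc a) ~= enat (i - 1)" using two.l_le_b[of "Suc a" "Suc a"] lt a by auto
   moreover have "(if b' (Suc a) = enat (i - 1) then 2 else 1) <= count (R1 (Suc a)) (i - 1, p1 (Suc a) (i - 1))"
    using select_mem(2)[OF short_b[OF a enat]] ne by simp
   ultimately have e: "even (i - 1)" "even (p1 (Suc a) (i - 1))" by (rule remaining[OF a])+
   have "p2 (Suc a) (i - 1) = p1 (Suc a) (i - 1) + 1 - chi (b' a) (i - 1)"
    using two.p1_eq[OF a, of "i - 1"] le lu le'[of a] le'[of "Suc a"] le'[of "Suc (Suc a)"] a by simp
   hence "chi (b' a) (i - 1) = 1" using pe2[OF a e(1)] e(2) by (auto simp: chi_def)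
   hence "b' a <= enat (i - 1)" by (auto simp: chi_def)
   hence "b a <= enat i" using i2 unfolding IH enat_minus_1_le by simp
   moreover have "enat i <= b a" using one.b_antimono[of a "Suc a"] a enat by simp
   ultimately have "b' a = enat (i - 1)" using IH by (simp add: one_enat_def)
   thus False using created_odd[of a "i - 1"] e(1) a two.b_0 by (cases "a = 0") auto
  qed
  thus ?thesis using enat by (simp add: one_enat_def)
 qed
qed

text \<open>The same contradiction for the unbarred selections, now from n downwards and with
  \<open>b'_tight\<close> available at all nodes.\<close>

lemma l'_tight: "1 <= a ==> a < n ==> l' a = l a - 1"
proof -
 have "1 <= a ==> (if a = n then True else l' a = l a - 1)" if "a <= n" for a using that
 proof (induction a rule: inc_induct)
  case (step a)
  hence a: "1 <= a" "a < n" by auto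
  have IH: "Suc a < n ==> l' (Suc a) = l (Suc a) - 1" using step by auto
  show ?case
  proof (cases "l a")
   case infinity thus ?thesis using fin[OF a] by simp
  next
   case (enat i)
   have i2: "2 <= i" using l_two[OF _ enat] a by simp
   have le: "l' a <= enat (i - 1)" using l'_le[OF _ enat] a by simp
   have "l' a = enat (i - 1)"
   proof (rule ccontr)
    assume ne: "l' a ~= enat (i - 1)"
    have "(if b' a = enat (i - 1) then 2 else 1) <= count (R1 a) (i - 1, p1 a (i - 1))"
    proof (cases "b' a = enat (i - 1)")
     case True
     hence "b a = enat i" using b'_tight[OF a(2)] i2 by (cases "b a") (auto simp: one_enat_def)
     thus ?thesis using short_b[OF a] enat True by simp
    next
     case False
     thus ?thesis using short_l[of a i] a enat by simp
    qed
    hence e: "even (i - 1)" "even (p1 a (i - 1))" by (rule remaining[OF a ne])+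
    have z: "~ x <= enat (i - 1)" if "x = y - 1" "enat i <= y" "!!j. x = enat j ==> odd j" for x y
    proof
     assume h: "x <= enat (i - 1)"
     hence "y <= enat i" using i2 that(1) enat_minus_1_le[of y "i - 1"] by simp
     hence "y = enat i" using that(2) by (rule antisym)
     thus False using that(1) that(3)[of "i - 1"] e(1) by (simp add: one_enat_def)
    qed
    have zb: "chi (b' c) (i - 1) = 0" if "c < n" for c
    proof (cases "c = 0")
     case False
     have "~ b' c <= enat (i - 1)" by (rule z[OF b'_tight]) (use that False one.l_le_b[of a c] a enat created_odd[of c] in auto)
     thus ?thesis by simp
    qed (simp add: two.b_0)
    have "even (chi (l' (a + 1)) (i - 1) + chi (b' (a + 1)) (i - 1))"
    proof (cases "a + 1 = n")
     case False
     hence s: "Suc a < n" using a by simp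
     have "~ l' (Suc a) <= enat (i - 1)" by (rule z[OF IH]) (use s one.l_mono[of a "Suc a"] enat created_odd[of "Suc a"] in auto)
     thus ?thesis using zb[OF s] by simp
    qed (simp add: two.b_n)
    moreover have "l' (a - 1) <= enat (i - 1)" using two.l_mono[of "a - 1" a] le a by auto
    ultimately have "odd (p2 a (i - 1) - p1 a (i - 1))" using two.p1_eq[OF a, of "i - 1"] zb[of "a - 1"] a by simp
    thus False using pe2[OF a e(1)] e(2) by simp
   qed
   thus ?thesis using enat by (simp add: one_enat_def)
  qed
 qed simp
 thus "1 <= a ==> a < n ==> l' a = l a - 1" by force
qed

lemma backward_tight:
 assumes a: "1 <= a" "a < n" shows "tight a"
proof -
 have "even i" if i: "l a = enat i" for i using l'_tight a i created_odd[OF a, of "i - 1"] by (simp add: one_enat_def)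
 moreover have "even i" if i: "b a = enat i" for i using b'_tight i created_odd[OF a, of "i - 1"] a by (simp add: one_enat_def)
 ultimately show ?thesis using l'_tight[OF a] b'_tight[OF a(2)] by (auto simp: tight_def)
qed

end

text \<open>Lengths come first and separately: evenness of the vacancy numbers, assumed for the
  riggings, itself follows from evenness of lengths.\<close>

lemma tight_lengths:
 assumes t: "!!a. 1 <= a ==> a < n ==> tight a" and a: "1 <= a" "a < n"
 shows "(\<forall>z\<in>#R a. even (fst z)) \<longleftrightarrow> (\<forall>z\<in>#R2 a. even (fst z))"
  and "(!!i. even i ==> even (p a i)) ==> (!!i. even i ==> even (p2 a i)) ==>
   (\<forall>z\<in>#R a. even_str z) \<longleftrightarrow> (\<forall>z\<in>#R2 a. even_str z)"
proof -
 obtain C where C: "R a = C + strs p a (l a) + strs p a (b a)" "R2 a = C + shorts p2 a (l a - 1) + shorts p2 a (b a - 1)" by (rule tight_even[OF t a])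
 have x: "even i" if "x : {l a, b a}" "x = enat i" for x i using t[OF a] that by (auto simp: tight_def)
 have 1: "\<forall>z\<in>#strs q a x. even (fst z) & snd z = q a (fst z)" if "x : {l a, b a}" for q x using x[OF that] by (cases x) auto
 have 2: "\<forall>z\<in>#shorts q a (x - 1). even (fst z) & snd z = q a (fst z)" if h: "x : {l a, b a}" for q x
 proof (cases x)
  case (enat i)
  show ?thesis using x h by (simp add: enat one_enat_def shorts_def)
 qed simp
 have s: "\<forall>z\<in>#strs p a (l a). even (fst z)" "\<forall>z\<in>#strs p a (b a). even (fst z)"
  "\<forall>z\<in>#shorts p2 a (l a - 1). even (fst z)" "\<forall>z\<in>#shorts p2 a (b a - 1). even (fst z)"
  using 1[of "l a" p] 1[of "b a" p] 2[of "l a" p2] 2[of "b a" p2] by blast+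
 show "(\<forall>z\<in>#R a. even (fst z)) \<longleftrightarrow> (\<forall>z\<in>#R2 a. even (fst z))"
  unfolding C set_mset_union ball_Un using s by argo
 assume p: "!!i. even i ==> even (p a i)" and p2: "!!i. even i ==> even (p2 a i)"
 have e: "\<forall>z\<in>#strs p a (l a). even_str z" "\<forall>z\<in>#strs p a (b a). even_str z"
  "\<forall>z\<in>#shorts p2 a (l a - 1). even_str z" "\<forall>z\<in>#shorts p2 a (b a - 1). even_str z"
  using 1[of "l a" p] 1[of "b a" p] 2[of "l a" p2] 2[of "b a" p2] p p2 by (simp_all add: even_str_def)
 show "(\<forall>z\<in>#R a. even_str z) \<longleftrightarrow> (\<forall>z\<in>#R2 a. even_str z)" unfolding C set_mset_union ball_Un using e by argo
qed

end

section \<open>The exchange of the spin nodes\<close>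

definition swap :: "nat => (nat => 'a) => nat => 'a" where
 "swap N f a = f (if a = N then N - 1 else if a = N - 1 then N else a)"

lemma swap_simps:
 "swap N f N = f (N - 1)" "4 <= N ==> swap N f (N - 1) = f N" "4 <= N ==> a <= N - 2 ==> swap N f a = f a" by (auto simp: swap_def)

lemma cartan_D_sum:
 assumes "4 <= N" "1 <= a" "a < N"
 shows "(\<Sum>b\<in>nodes (TypeD N). cartan (TypeD N) a b * f b)
  = 2 * f a - (if 1 < a then f (a - 1) else 0) - (if a + 1 < N then f (a + 1) else 0) - (if a = N - 2 then f N else 0)"
proof -
 have "(\<Sum>b\<in>nodes (TypeD N). cartan (TypeD N) a b * f b)
  = (\<Sum>b\<in>{1..N}. (if b = a then 2 * f b else 0) - (if b = a - 1 then f b else 0)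
   - (if b = a + 1 then (if a + 1 < N then f b else 0) else 0) - (if b = N then (if a = N - 2 then f b else 0) else 0))"
  by (rule sum.cong) (use assms in \<open>auto simp: doubleton_eq_iff\<close>)
 thus ?thesis using assms by (auto simp: sum_subtractf)
qed

lemma swap_auto:
 assumes N: "4 <= N"
 shows "diagram_auto (TypeD N) (%a. if a = N then N - 1 else if a = N - 1 then N else a)" (is "diagram_auto _ ?s")
proof -
 have "a : {1..N} \<longleftrightarrow> ?s a : {1..N}" "?s (?s a) = a" for a using N by auto
 hence b: "bij_betw ?s {1..N} {1..N} & (\<forall>a. ?s a : {1..N} --> a : {1..N})" by (intro conjI bij_betw_byWitness[of _ ?s]) blast+
 obtain m where m: "N = m + 4" using N by (metis add.commute le_Suc_ex)
 have n: "N - 2 = m + 2" "N - 1 = m + 3" using m by simp_all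
 have "cartan (TypeD N) (?s a) (?s b) = cartan (TypeD N) a b" if "a : {1..N}" "b : {1..N}" for a b
 proof -
  have "a = m + 4 \<or> a = m + 3 \<or> a < m + 3" "b = m + 4 \<or> b = m + 3 \<or> b < m + 3" using that m by auto
  thus ?thesis unfolding cartan.simps n unfolding m by (elim disjE) (simp_all add: doubleton_eq_iff)
 qed
 thus ?thesis unfolding diagram_auto_def nodes.simps using b by blast
qed

lemma swap_shape: "shape (swap N R) = swap N (shape R)" by (simp add: shape_def swap_def fun_eq_iff)

lemma swap_vacancy:
 assumes "4 <= N" "1 <= a" "a <= N" "L (N - 1) = L N"
 shows "vacancy (TypeD N) L (swap N nu) a i = swap N (%a. vacancy (TypeD N) L nu a i) a"
 using auto_vacancy[OF swap_auto, of N a L nu i] assms unfolding swap_def[abs_def] by simp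

lemma swap_nodes: "4 <= (N::nat) ==> (if a = N then N - 1 else if a = N - 1 then N else a) : {1..N} \<longleftrightarrow> a : {1..N}" by auto

lemma swap_RC_wt:
 assumes "4 <= N" "L (N - 1) = L N" "R : RC_wt (TypeD N) L lam"
 shows "swap N R : RC_wt (TypeD N) L (swap N lam)" using auto_RC_wt[OF swap_auto _ assms(3)] assms(1,2) unfolding swap_def[abs_def] by simp

lemma swap_dominant: "4 <= N ==> lam : dominant (nodes (TypeD N)) ==> swap N lam : dominant (nodes (TypeD N))"
 using auto_dominant[OF swap_auto] unfolding swap_def[abs_def] .

lemma swap_eq_iff: "4 <= N ==> swap N f = f \<longleftrightarrow> f N = f (N - 1)" unfolding fun_eq_iff swap_def by (smt (verit))

lemma swap_num_singular:
 assumes "4 <= N" "1 <= a" "a <= N" "L (N - 1) = L N"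
 shows "num_singular (TypeD N) L (swap N R) a i = swap N (%a. num_singular (TypeD N) L R a i) a"
 unfolding num_singular_def swap_shape swap_vacancy[OF assms] by (simp add: swap_def)

lemma swap_ell_chain:
 assumes N: "4 <= N" and L: "L (N - 1) = L N" and a: "a <= N - 2"
 shows "ell_chain (TypeD N) L (swap N R) a = ell_chain (TypeD N) L R a" using a
proof (induction a)
 case (Suc a)
 have "num_singular (TypeD N) L (swap N R) (Suc a) i = num_singular (TypeD N) L R (Suc a) i" for i
  using swap_num_singular[OF N _ _ L, of "Suc a" R i] Suc.prems swap_simps(3)[OF N Suc.prems] by (metis Suc_le_mono diff_le_self le0 One_nat_def order_trans)
 thus ?case using Suc by simp
qed simp

text \<open>Both spin searches start from the selection at N - 2, so exchanging the nodes just
  exchanges their results.\<close>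

lemma swap_ell:
 assumes N: "4 <= N" and L: "L (N - 1) = L N" and a: "1 <= a" "a <= N"
 shows "ell (TypeD N) L (swap N R) a = swap N (ell (TypeD N) L R) a"
proof -
 have e: "N - 1 = Suc (N - 2)" using N by simp
 have c: "ell_chain (TypeD N) L (swap N R) (N - 2) = ell_chain (TypeD N) L R (N - 2)" using swap_ell_chain[OF N L] by simp
 have s: "num_singular (TypeD N) L (swap N R) N i = num_singular (TypeD N) L R (N - 1) i"
  "num_singular (TypeD N) L (swap N R) (N - 1) i = num_singular (TypeD N) L R N i" for i
  using swap_num_singular[OF N _ _ L, of N R i] swap_num_singular[OF N _ _ L, of "N - 1" R i] N by (auto simp: swap_def)
 have ch: "ell_chain (TypeD N) L Q (N - 1) = Option.bind (ell_chain (TypeD N) L Q (N - 2)) (first_from (%i. num_singular (TypeD N) L Q (N - 1) i \<ge> 1))" for Q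
  unfolding e ell_chain.simps ..
 consider "a = N" | "a = N - 1" | "a <= N - 2" using a by linarith
 thus ?thesis
 proof cases
  case 1 
  have "ell (TypeD N) L (swap N R) N = ell (TypeD N) L R (N - 1)" unfolding ell.simps c s by (simp add: ch[simplified])
  thus ?thesis unfolding 1 swap_simps(1) .
 next
  case 2
  have "ell (TypeD N) L (swap N R) (N - 1) = ell (TypeD N) L R N" unfolding ell.simps ch c s by simp
  thus ?thesis unfolding 2 swap_simps(2)[OF N] .
 next
  case 3
  hence "a ~= N" using N by auto
  thus ?thesis using swap_ell_chain[OF N L 3] unfolding swap_simps(3)[OF N 3] by simp
 qed
qed

lemma swap_ell_bar:
 assumes N: "4 <= N" and L: "L (N - 1) = L N" and j: "j <= N - 2"
 shows "ell_bar N L (swap N R) j = ell_bar N L R j" using j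
proof (induction j)
 case 0
 have "ell (TypeD N) L (swap N R) (N - 1) = ell (TypeD N) L R N" "ell (TypeD N) L (swap N R) N = ell (TypeD N) L R (N - 1)"
  using swap_ell[OF N L, of N R] swap_ell[OF N L, of "N - 1" R] N by (simp_all add: swap_def)
 thus ?case unfolding ell_bar.simps by (simp only:) (auto simp: max.commute split: option.splits)
next
 case (Suc j)
 have a: "1 <= N - 1 - Suc j" "N - 1 - Suc j <= N" "N - 1 - Suc j <= N - 2" using Suc.prems by auto
 have "ell (TypeD N) L (swap N R) (N - 1 - Suc j) = ell (TypeD N) L R (N - 1 - Suc j)" using swap_ell[OF N L a(1,2)] swap_simps(3)[OF N a(3)] by metis
 moreover have "num_singular (TypeD N) L (swap N R) (N - 1 - Suc j) i = num_singular (TypeD N) L R (N - 1 - Suc j) i" for i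
  using swap_num_singular[OF N a(1,2) L] swap_simps(3)[OF N a(3)] by metis
 ultimately show ?case using Suc by simp
qed

lemma swap_selected:
 assumes N: "4 <= N" and L: "L (N - 1) = L N"
 shows "selected (TypeD N) L (swap N R) = swap N (selected (TypeD N) L R)"
proof
 fix a
 show "selected (TypeD N) L (swap N R) a = swap N (selected (TypeD N) L R) a"
 proof (cases "1 <= a & a <= N")
  case True
  thus ?thesis using swap_ell[OF N L, of a R] swap_ell_bar[OF N L, of "N - 1 - a" R] N by (auto simp: swap_def simp del: ell.simps)
 next
  case False thus ?thesis using N by (auto simp: swap_def)
 qed
qed

lemma swap_delta:
 assumes N: "4 <= N" and L: "L (N - 1) = L N" and R: "!!a. a \<notin> {1..N} ==> R a = {#}"
 shows "delta (TypeD N) L (swap N R) = swap N (delta (TypeD N) L R)"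
proof -
 define sw where "sw a = (if a = N then N - 1 else if a = N - 1 then N else a)" for a
 have s: "swap N f a = f (sw a)" for f :: "nat => 'x" and a by (simp add: swap_def sw_def)
 have mem: "sw a : {1..N} \<longleftrightarrow> a : {1..N}" for a using swap_nodes[OF N] unfolding sw_def by blast
 define L' where "L' = L(1 := L 1 - {#1#})"
 have L': "L' (N - 1) = L' N" using N L by (auto simp: L'_def)
 define sel where "sel = selected (TypeD N) L R"
 define nu where "nu = (%a. shape R a - sel a + {# i - 1. i \<in># filter_mset (%i. i > 1) (sel a) #})"
 have nu: "(%a. shape (swap N R) a - swap N sel a + {# i - 1. i \<in># filter_mset (%i. i > 1) (swap N sel a) #}) = swap N nu"
  by (simp add: fun_eq_iff nu_def swap_shape s)
 have vac: "vacancy (TypeD N) L (shape (swap N R)) a i = vacancy (TypeD N) L (shape R) (sw a) i"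
  "vacancy (TypeD N) L' (swap N nu) a i = vacancy (TypeD N) L' nu (sw a) i" if "a : {1..N}" for a i
  using swap_vacancy[OF N _ _ L, of a "shape R" i] swap_vacancy[OF N _ _ L', of a nu i] that unfolding swap_shape s by simp_all
 have off: "sel a = {#}" if "a \<notin> {1..N}" for a using that by (auto simp: sel_def)
 show ?thesis
 proof
  fix a
  show "delta (TypeD N) L (swap N R) a = swap N (delta (TypeD N) L R) a"
  proof (cases "a : {1..N}")
   case True
   show ?thesis
    unfolding delta_def Let_def swap_selected[OF N L] sel_def[symmetric] L'_def[symmetric] nu nu_def[symmetric] vac[OF True] unfolding s ..
  next
   case False
   hence "sw a \<notin> {1..N}" using mem by blast
   thus ?thesis unfolding delta_def swap_selected[OF N L] sel_def[symmetric] s using off by simp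
  qed
 qed
qed

lemma mult_array_D: "admissible (TypeD N) B ==> a ~= 1 ==> mult_array B a = {#}" by (induction B) (auto simp: admissible_def mult_array_def)

lemma hw_path_admissible: "hw_path Y B p ==> admissible Y B" by (simp add: hw_path_def)

lemma Phi_step_D:
 assumes Phi: "rc_bijection Y Phi" and wf: "wf_ytype Y" and hw: "hw_path Y ((1, Suc k) # B) ((c # cs) # p)"
 shows "Phi (fac 1 k @ B) (tabs cs @ p) = delta Y (mult_array ((1, 1) # fac 1 k @ B)) (Phi ((1, Suc k) # B) ((c # cs) # p))"
 using Phi_lh[OF Phi wf hw_path_split[OF hw]] Phi_split[OF Phi wf hw] by simp

text \<open>The coefficient at a of the weight of the letter x in the orthonormal basis.\<close>

definition ee :: "int => nat => int" where
 "ee x a = of_bool (x = int a) - of_bool (x = - int a)"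

lemma ee_inj:
 assumes "!!a. 1 <= a ==> a <= M ==> ee x a = ee y a" "1 <= \<bar>x\<bar>" "\<bar>x\<bar> <= int M"
 shows "x = y"
proof -
 have "1 <= nat \<bar>x\<bar>" "nat \<bar>x\<bar> <= M" "int (nat \<bar>x\<bar>) = \<bar>x\<bar>" using assms(2,3) by auto
 hence "ee x (nat \<bar>x\<bar>) = ee y (nat \<bar>x\<bar>)" "int (nat \<bar>x\<bar>) = \<bar>x\<bar>" using assms(1) by auto
 thus ?thesis using assms(2) by (auto simp: ee_def of_bool_def split: if_splits)
qed

lemma letter_wt_D:
 assumes "4 <= N" "1 <= a" "a <= N"
 shows "word_wt (TypeD N) [[x]] a = (if a < N then ee x a - ee x (a + 1) else ee x (N - 1) + ee x N)"
 using assms by (auto simp: word_wt_def tabsig_def D_letter_e_def D_letter_f_def ee_def)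

lemma letter_inj_D:
 assumes N: "4 <= N" and w: "!!a. 1 <= a ==> a <= N ==> word_wt (TypeD N) [[x]] a = word_wt (TypeD N) [[y]] a"
  and x: "1 <= \<bar>x\<bar>" "\<bar>x\<bar> <= int N"
 shows "x = y"
proof (rule ee_inj[OF _ x])
 have s: "ee x a - ee x (a + 1) = ee y a - ee y (a + 1)" if "1 <= a" "a < N" for a using w[of a] letter_wt_D[OF N, of a] that by simp
 have "ee x (N - 1) + ee x N = ee y (N - 1) + ee y N" using w[of N] letter_wt_D[OF N, of N] N by simp
 moreover have "ee x (N - 1) - ee x N = ee y (N - 1) - ee y N" using s[of "N - 1"] N by simp
 ultimately have e: "ee x N = ee y N" by linarith
 fix a assume "1 <= a" "a <= N"
 from this(2,1) show "ee x a = ee y a"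
 proof (induction a rule: inc_induct)
  case (step a) thus ?case using s[of a] by simp
 qed (use e in simp)
qed

lemma symmetric_weight:
 assumes N: "4 <= N" and L: "L (N - 1) = L N" and R: "R : RC_wt (TypeD N) L lam"
  and lam: "lam : dominant (nodes (TypeD N))" and s: "R N = R (N - 1)"
 shows "lam N = lam (N - 1)" by (metis s swap_eq_iff N swap_RC_wt L R RC_wt_unique lam swap_dominant)

lemma letter_D:
 assumes "hw_path (TypeD N) ((1, Suc k) # B) ((c # cs) # p)"
 obtains x where "c = [x]" "1 <= \<bar>x\<bar>" "\<bar>x\<bar> <= int N" using assms by (auto simp: hw_path_def wf_path_def tableaux_def)

text \<open>Invariance passes through \<open>delta\<close>, and invariant weights before and after
  exclude the letters N and - N. Conversely, the exchanged configuration belongs to a path with the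
  same remainder, whose first letter has the exchanged weight and is therefore the same
  letter.\<close>

theorem symmetric_step_D:
 assumes Phi: "rc_bijection (TypeD N) Phi" and N: "4 <= N"
  and hw: "hw_path (TypeD N) ((1, Suc k) # B) ((c # cs) # p)"
 defines "R \<equiv> Phi ((1, Suc k) # B) ((c # cs) # p)" and "R1 \<equiv> Phi (fac 1 k @ B) (tabs cs @ p)"
 shows "R N = R (N - 1) \<longleftrightarrow> R1 N = R1 (N - 1) & c ~= [int N] & c ~= [- int N]"
proof -
 let ?B = "(1, Suc k) # B" and ?B1 = "fac 1 k @ B" and ?Y = "TypeD N"
 let ?L2 = "mult_array ((1, 1) # ?B1)"
 have wf: "wf_ytype ?Y" using N by (simp add: wf_ytype_def)
 note hw1 = hw_path_split_tl[OF hw]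
 obtain x where x: "c = [x]" "1 <= \<bar>x\<bar>" "\<bar>x\<bar> <= int N" by (rule letter_D[OF hw])
 have "N ~= 1" "N - 1 ~= 1" using N by auto
 hence L: "mult_array ?B (N - 1) = mult_array ?B N" "mult_array ?B1 (N - 1) = mult_array ?B1 N" "?L2 (N - 1) = ?L2 N"
  using mult_array_D[OF hw_path_admissible[OF hw]] mult_array_D[OF hw_path_admissible[OF hw1]]
   mult_array_D[OF hw_path_admissible[OF hw_path_split[OF hw]]] by metis+
 let ?lam = "word_wt ?Y (concat ((c # cs) # p))" and ?lam1 = "word_wt ?Y (concat (tabs cs @ p))"
 have RC: "R : RC_wt ?Y (mult_array ?B) ?lam" "R1 : RC_wt ?Y (mult_array ?B1) ?lam1"
  unfolding R_def R1_def using Phi_RC[OF Phi wf hw] Phi_RC[OF Phi wf hw1] .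
 have dom: "?lam : dominant (nodes ?Y)" "?lam1 : dominant (nodes ?Y)" using word_wt_dominant[OF hw] word_wt_dominant[OF hw1] .
 have D: "R1 = delta ?Y ?L2 R" unfolding R_def R1_def by (rule Phi_step_D[OF Phi wf hw])
 have off: "R a = {#}" if "a \<notin> {1..N}" for a using RC(1) that unfolding RC_wt_def nodes.simps by blast
 have diff: "?lam a - ?lam1 a = word_wt ?Y [c] a" for a by (rule word_wt_column_diff)
 have sym: "word_wt ?Y [c] N = word_wt ?Y [c] (N - 1) \<longleftrightarrow> c ~= [int N] & c ~= [- int N]"
 using N by (simp add: x(1) letter_wt_D ee_def)
 show ?thesis
 proof
  assume s: "R N = R (N - 1)"
  hence "swap N R = R" using swap_eq_iff[OF N] by blast
  moreover have "delta ?Y ?L2 (swap N R) = swap N (delta ?Y ?L2 R)" by (rule swap_delta[OF N L(3) off])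
  ultimately have "swap N R1 = R1" unfolding D by simp
  hence s1: "R1 N = R1 (N - 1)" using swap_eq_iff[OF N] by blast
  have "?lam N = ?lam (N - 1)" "?lam1 N = ?lam1 (N - 1)"
   using symmetric_weight[OF N L(1) RC(1) dom(1) s] symmetric_weight[OF N L(2) RC(2) dom(2) s1] .
  thus "R1 N = R1 (N - 1) & c ~= [int N] & c ~= [- int N]" using s1 sym diff by metis
 next
  assume h: "R1 N = R1 (N - 1) & c ~= [int N] & c ~= [- int N]"
  hence wc: "word_wt ?Y [c] N = word_wt ?Y [c] (N - 1)" using sym by blast
  have s1: "swap N R1 = R1" using h swap_eq_iff[OF N] by blast
  obtain q where q: "hw_path ?Y ?B q" "word_wt ?Y (concat q) = swap N ?lam" "Phi ?B q = swap N R"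
   by (rule Phi_surj[OF Phi wf hw_path_admissible[OF hw] swap_dominant[OF N dom(1)] swap_RC_wt[OF N L(1) RC(1)]])
  obtain T r where T: "q = T # r" by (rule hw_path_Cons[OF q(1)])
  have "length T = Suc k" using hw_path_tableaux[OF q(1)[unfolded T]] by (simp add: tableaux_def)
  then obtain c' cs' where c': "T = c' # cs'" "length cs' = k" by (cases T) auto
  note q = q[unfolded T c'(1)]
  have "Phi ?B1 (tabs cs' @ r) = delta ?Y ?L2 (swap N R)" using Phi_step_D[OF Phi wf q(1)] q(3) by simp
  also have "\<dots> = swap N R1" unfolding D by (rule swap_delta[OF N L(3) off])
  finally have "Phi ?B1 (tabs cs' @ r) = Phi ?B1 (tabs cs @ p)" using s1 by (simp add: R1_def)
  hence e: "tabs cs' @ r = tabs cs @ p" by (rule Phi_inj'[OF Phi wf hw_path_split_tl[OF q(1)] hw1])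
  have "length cs = k" using hw_path_tableaux[OF hw] by (simp add: tableaux_def)
  hence e2: "cs' = cs" "r = p" using e c'(2) by (auto simp: tabs_def split: if_splits)
  obtain y where y: "c' = [y]" "1 <= \<bar>y\<bar>" "\<bar>y\<bar> <= int N" by (rule letter_D[OF q(1)])
  have "word_wt ?Y [c'] a = word_wt ?Y [c] a" for a
  proof -
   have "word_wt ?Y [c'] a = swap N ?lam a - ?lam1 a" using word_wt_column_diff[of ?Y c' cs' r a] unfolding q(2) unfolding e2 by simp
   also have "?lam1 a = swap N ?lam1 a" using symmetric_weight[OF N L(2) RC(2) dom(2)] h swap_eq_iff[OF N, of ?lam1] by metis
   also have "swap N ?lam a - swap N ?lam1 a = swap N (word_wt ?Y [c]) a" using diff by (simp add: swap_def)
   also have "\<dots> = word_wt ?Y [c] a" using wc swap_eq_iff[OF N, of "word_wt ?Y [c]"] by metis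
   finally show ?thesis .
  qed
  hence "y = x" using letter_inj_D[OF N _ y(2,3), of x] x(1) y(1) by blast
  hence "swap N R = R" using q(3) e2 x(1) y(1) by (simp add: R_def)
  thus "R N = R (N - 1)" using swap_eq_iff[OF N] by blast
 qed
qed

section \<open>The type D algorithm as a step of the folded diagram\<close>

definition pD :: "nat => arr => rigged => vacancies" where
 "pD N L R a i = (if 1 <= a & a <= N then vacancy (TypeD N) L (shape R) a i else 0)"

lemma RC_wt_validD: "R : RC_wt (TypeD N) L lam ==> valid N (pD N L R) R" unfolding valid_def by (auto simp: RC_wt_def pD_def)

fun dbar :: "nat => vacancies => rigged => (nat => enat) => nat => enat" where
 "dbar n p R l 0 = l n"
| "dbar n p R l (Suc j) = first (%i. (if l (n - Suc j) = enat i then 2 else 1) <= count (R (n - Suc j)) (i, p (n - Suc j) i)) (dbar n p R l j)"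

lemma dbar_ge: "l n <= dbar n p R l j"
proof (induction j)
 case (Suc j) thus ?case using first_ge by (auto intro: order_trans)
qed simp

lemma dsel_up:
 assumes "2 <= n" "1 <= k"
 shows "dsel n k p R (up k p R) (%a. if a = 0 then \<infinity> else dbar n p R (up k p R) (n - a))"
proof
 fix a
 { assume "1 <= a" "a <= n"
  thus "up k p R a = first (sing p R a) (up k p R (a - 1))" by (cases a) auto }
 { assume a: "1 <= a" "a < n"
  hence "n - a = Suc (n - (a + 1))" "n - Suc (n - (a + 1)) = a" by auto
  thus "(if a = 0 then \<infinity> else dbar n p R (up k p R) (n - a)) =
   first (%i. (if up k p R a = enat i then 2 else 1) <= count (R a) (i, p a i))
    (if a + 1 = 0 then \<infinity> else dbar n p R (up k p R) (n - (a + 1)))" using a by simp }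
qed (use assms in auto)

lemma first_cong:
 assumes "!!i. x <= enat i ==> P i \<longleftrightarrow> Q i"
 shows "first P x = first Q x"
proof -
 have "{enat i | i. x <= enat i & P i} = {enat i | i. x <= enat i & Q i}" using assms by blast
 thus ?thesis by (simp add: first_def)
qed

definition ems :: "enat => nat multiset" where
 "ems x = (case x of \<infinity> => {#} | enat i => {#i#})"

lemma ems_simps [simp]: "ems \<infinity> = {#}" "ems (enat i) = {#i#}" by (simp_all add: ems_def)

lemma opt_mset_ems: "opt_mset z = ems (enat_of z)" by (cases z) (simp_all add: opt_mset_def)

lemma short_parts:
 assumes "S \<subseteq># M" "!!j. j \<in># S ==> 1 <= j"
 shows "msum (M - S + {#i - 1. i \<in># filter_mset (%i. i > 1) S#}) i = msum M i - (\<Sum>j\<in>#S. of_bool (j <= i))"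
  and "ssum (M - S + {#i - 1. i \<in># filter_mset (%i. i > 1) S#}) = ssum M - int (size S)"
proof -
 obtain C where C: "M = C + S" using assms(1) by (metis subset_mset.diff_add)
 have pos: "\<forall>j\<in>#S. 1 <= j" using assms(2) by blast
 have 1: "msum {#i - 1. i \<in># filter_mset (%i. i > 1) S#} i = msum S i - (\<Sum>j\<in>#S. of_bool (j <= i))"
  using pos by (induction S) (auto simp: min_def)
 have 2: "ssum {#i - 1. i \<in># filter_mset (%i. i > 1) S#} = ssum S - int (size S)" using pos by (induction S) (auto simp: of_nat_diff)
 show "msum (M - S + {#i - 1. i \<in># filter_mset (%i. i > 1) S#}) i = msum M i - (\<Sum>j\<in>#S. of_bool (j <= i))"
  "ssum (M - S + {#i - 1. i \<in># filter_mset (%i. i > 1) S#}) = ssum M - int (size S)" unfolding C using 1 2 by simp_all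
qed

lemma ems_sum: "(\<Sum>j\<in>#ems x. of_bool (j <= i)) = chi x i" "size (ems x) = of_bool (x ~= \<infinity>)" by (cases x; simp add: chi_def)+

text \<open>Equal values at the spin nodes fold the fork into a string of N - 1 nodes whose last
  value counts twice for its neighbour.\<close>

lemma fold_sum_D:
 fixes f :: "nat => int"
 assumes N: "4 <= N" and s: "f N = f (N - 1)"
 shows "1 <= a ==> a < N - 1 ==> (\<Sum>b\<in>nodes (TypeD N). cartan (TypeD N) a b * f b)
   = 2 * f a - (if 1 < a then f (a - 1) else 0) - (if a + 1 < N - 1 then f (a + 1) else 2 * f (N - 1))"
  and "(\<Sum>b\<in>nodes (TypeD N). cartan (TypeD N) (N - 1) b * f b) = 2 * f (N - 1) - f (N - 2)"
proof -
 obtain m where m: "N = m + 4" using N by (metis add.commute le_Suc_ex)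
 have e: "N - 1 = m + 3" "N - 2 = m + 2" using m by simp_all
 { assume a: "1 <= a" "a < N - 1"
  hence a': "1 <= a" "a < N" by auto
  consider "a = m + 2" | "a < m + 2" using a m by linarith
  thus "(\<Sum>b\<in>nodes (TypeD N). cartan (TypeD N) a b * f b)
   = 2 * f a - (if 1 < a then f (a - 1) else 0) - (if a + 1 < N - 1 then f (a + 1) else 2 * f (N - 1))"
   using s unfolding cartan_D_sum[OF N a'] unfolding e unfolding m using a(1) by cases (simp_all add: eval_nat_numeral) }
 have a': "1 <= N - 1" "N - 1 < N" using N by auto
 show "(\<Sum>b\<in>nodes (TypeD N). cartan (TypeD N) (N - 1) b * f b) = 2 * f (N - 1) - f (N - 2)"
  unfolding cartan_D_sum[OF N a'] unfolding e m by simp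
qed

lemma fold_vacancy:
 assumes N: "4 <= N" and s: "nu N = nu (N - 1)" and a: "1 <= a" "a < N - 1"
 shows "vacancy (TypeD N) L nu a i = msum (L a) i - 2 * msum (nu a) i + (if 1 < a then msum (nu (a - 1)) i else 0)
  + (if a + 1 < N - 1 then msum (nu (a + 1)) i else 2 * msum (nu (N - 1)) i)"
 using fold_sum_D(1)[OF N _ a, of "%b. msum (nu b) i"] s unfolding vacancy_def msum_def[symmetric] by simp

lemma fold_weight:
 assumes N: "4 <= N" and s: "shape R N = shape R (N - 1)" and R: "R : RC_wt (TypeD N) L lam"
 shows "1 <= a ==> a < N - 1 ==> lam a = ssum (L a) - 2 * ssum (shape R a) + (if 1 < a then ssum (shape R (a - 1)) else 0)
  + (if a + 1 < N - 1 then ssum (shape R (a + 1)) else 2 * ssum (shape R (N - 1)))"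
  and "lam (N - 1) = ssum (L (N - 1)) - 2 * ssum (shape R (N - 1)) + ssum (shape R (N - 2))"
proof -
 have w: "(\<Sum>b\<in>nodes (TypeD N). cartan (TypeD N) a b * ssum (shape R b)) = ssum (L a) - lam a" if "a : nodes (TypeD N)" for a
  using R that unfolding RC_wt_def ssum_def by blast
 { assume a: "1 <= a" "a < N - 1"
  hence "a : nodes (TypeD N)" by simp
  thus "lam a = ssum (L a) - 2 * ssum (shape R a) + (if 1 < a then ssum (shape R (a - 1)) else 0)
  + (if a + 1 < N - 1 then ssum (shape R (a + 1)) else 2 * ssum (shape R (N - 1)))"
   using w[of a] fold_sum_D(1)[OF N _ a, of "%b. ssum (shape R b)"] s by simp }
 have "N - 1 : nodes (TypeD N)" using N by auto
 thus "lam (N - 1) = ssum (L (N - 1)) - 2 * ssum (shape R (N - 1)) + ssum (shape R (N - 2))"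
  using w[of "N - 1"] fold_sum_D(2)[OF N, of "%b. ssum (shape R b)"] s by simp
qed

text \<open>The number of boxes removed at the nodes of the folded diagram determines the letter.\<close>

definition boxes :: "nat => (nat => enat) => (nat => enat) => nat => int" where
 "boxes n l b a = (if a = 0 then 1 else if a < n then of_bool (l a ~= \<infinity>) + of_bool (b a ~= \<infinity>) else 2 * of_bool (l a ~= \<infinity>))"

text \<open>Plain arithmetic over variables, to be matched against long vacancy and weight
  terms.\<close>

lemma second_difference:
 fixes P :: int
 assumes "P1 = L1 - 2 * r1 + x1 + y1" "P = L - 2 * r + x + y" "L1 = L - c" "r1 = r - u" "x1 = x - v + c" "y1 = y - w"
 shows "P1 = P + 2 * u - (v + w)" using assms by simp

lemma second_difference':
 fixes r :: int
 assumes "u = r - r1" "x - x1 + c = v" "y - y1 = w" "L1 = L - c"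
 shows "(L - 2 * r + x + y) - (L1 - 2 * r1 + x1 + y1) = v - 2 * u + w" using assms by simp

text \<open>As in type A, splitting off a letter turns the search from 1 for \<open>p2\<close> into
  the search from k + 1 for \<open>p\<close>. By symmetry the two spin selections coincide, so their
  maximum is \<open>l n\<close>. The weights give the second differences of \<open>boxes\<close>,
  from which the letter is recovered.\<close>

lemma dstep_Phi:
 assumes Phi: "rc_bijection (TypeD N) Phi" and N: "4 <= N"
  and hw: "hw_path (TypeD N) ((1, Suc k) # B) ((c # cs) # p0)"
 defines "R \<equiv> Phi ((1, Suc k) # B) ((c # cs) # p0)" and "R1 \<equiv> Phi (fac 1 k @ B) (tabs cs @ p0)"
 assumes sym: "R N = R (N - 1)"
 obtains l b where "dstep (N - 1) (Suc k) (pD N (mult_array ((1, Suc k) # B)) R) R l b (pD N (mult_array (fac 1 k @ B)) R1) R1"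
  "!!a. 1 <= a ==> a <= N - 1 ==> boxes (N - 1) l b (a - 1) - boxes (N - 1) l b a = ee (hd c) a"
proof -
 let ?n = "N - 1" and ?Y = "TypeD N" and ?B = "(1, Suc k) # B" and ?B1 = "fac 1 k @ B"
 let ?L = "mult_array ?B" and ?L1 = "mult_array ?B1"
 define L2 where "L2 = mult_array ((1, 1) # ?B1)"
 have wf: "wf_ytype ?Y" using N by (simp add: wf_ytype_def)
 note hw1 = hw_path_split_tl[OF hw] and hw2 = hw_path_split[OF hw]
 have RC: "R : RC_wt ?Y ?L (word_wt ?Y (concat ((c # cs) # p0)))" "R1 : RC_wt ?Y ?L1 (word_wt ?Y (concat (tabs cs @ p0)))"
  unfolding R_def R1_def using Phi_RC[OF Phi wf hw] Phi_RC[OF Phi wf hw1] .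
 have D: "R1 = delta ?Y L2 R" unfolding R_def R1_def L2_def by (rule Phi_step_D[OF Phi wf hw])
 have st: "R1 N = R1 ?n" "c ~= [int N]" "c ~= [- int N]" using symmetric_step_D[OF Phi N hw] sym unfolding R_def R1_def by blast+
 have shs: "shape R N = shape R ?n" "shape R1 N = shape R1 ?n" using sym st(1) by (simp_all add: shape_def)
 define p p2 where "p = pD N ?L R" and "p2 = pD N L2 R"
 have v: "valid N p R" unfolding p_def by (rule RC_wt_validD[OF RC(1)])
 have n: "2 <= ?n" "?n <= N" using N by auto
 have pp: "p2 a i = p a i + of_bool (a = 1 & 1 <= i & i <= k)" if "1 <= a" "a <= N" for a i
  using that unfolding p_def p2_def pD_def vacancy_def msum_def[symmetric] L2_def msum_mult_array msum_fac by auto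
 define l where "l = up (Suc k) p R"
 define b where "b = (%a. if a = 0 then \<infinity> else dbar ?n p R l (?n - a))"
 have sel: "dsel ?n (Suc k) p R l b" unfolding l_def b_def by (rule dsel_up) (use N in auto)
 interpret dsel ?n "Suc k" p R l b by (rule sel)
 have kl: "Suc k <= i" if "l a = enat i" for a i
 proof -
  have "enat (Suc k) <= l a" unfolding l_def by (rule up_ge)
  thus ?thesis using that by simp
 qed
 have same: "p2 a i = p a i" if "Suc k <= i" for a i using pp that by (simp add: p_def p2_def pD_def)
 have num: "num_singular ?Y L2 R a i = count (R a) (i, p2 a i)" if "1 <= a" "a <= N" for a i using that by (simp add: num_singular_def p2_def pD_def)
 have ch: "enat_of (ell_chain ?Y L2 R a) = up 1 p2 R a" if "a <= N" for a using that
 proof (induction a)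
  case (Suc a)
  have "1 <= num_singular ?Y L2 R (Suc a) i \<longleftrightarrow> sing p2 R (Suc a) i" for i using num[of "Suc a" i] Suc.prems by (simp add: sing_def)
  thus ?case using Suc unfolding ell_chain.simps enat_of_bind by simp
 qed (simp add: one_enat_def)
 have "up 1 p2 R a = l a" if "1 <= a" for a unfolding l_def by (rule split_up(1)[OF v _ pp that]) (use N in auto)
 hence ch: "enat_of (ell_chain ?Y L2 R a) = l a" if "1 <= a" "a <= N" for a using ch that by simp
 have spin: "ell ?Y L2 R N = ell_chain ?Y L2 R ?n"
 proof -
  have e: "?n = Suc (N - 2)" using N by simp
  have "swap N R = R" using sym swap_eq_iff[OF N] by blast
  moreover have "L2 ?n = L2 N" using mult_array_D[OF hw_path_admissible[OF hw2], of N] mult_array_D[OF hw_path_admissible[OF hw2], of ?n] N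
   unfolding L2_def by auto
  ultimately have "num_singular ?Y L2 R N i = num_singular ?Y L2 R ?n i" for i
   using swap_num_singular[OF N _ _, of N L2 R i] N by (simp add: swap_simps(1))
  thus ?thesis unfolding e ell_chain.simps by simp
 qed
 have el: "enat_of (ell ?Y L2 R a) = l a" if "1 <= a" "a <= ?n" for a using that ch by auto
 have elN: "enat_of (ell ?Y L2 R N) = l ?n" unfolding spin using ch[of ?n] N by simp
 have br: "enat_of (ell_bar N L2 R j) = dbar ?n p R l j" if "j <= N - 2" for j using that
 proof (induction j)
  case 0
  have e: "ell ?Y L2 R ?n = ell ?Y L2 R N" unfolding spin using N by auto
  show ?case unfolding ell_bar.simps dbar.simps e using elN by (cases "ell ?Y L2 R N") simp_all
 next
  case (Suc j)
  have a: "1 <= ?n - Suc j" "?n - Suc j <= ?n" "?n - Suc j <= N" using Suc.prems by auto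
  have IH: "enat_of (ell_bar N L2 R j) = dbar ?n p R l j" using Suc by simp
  have e: "ell ?Y L2 R (?n - Suc j) = Some i \<longleftrightarrow> l (?n - Suc j) = enat i" for i
   using el[OF a(1,2)] by (cases "ell ?Y L2 R (?n - Suc j)") auto
  have "first (%i. (if ell ?Y L2 R (?n - Suc j) = Some i then 2 else 1) <= num_singular ?Y L2 R (?n - Suc j) i) (dbar ?n p R l j)
   = first (%i. (if l (?n - Suc j) = enat i then 2 else 1) <= count (R (?n - Suc j)) (i, p (?n - Suc j) i)) (dbar ?n p R l j)"
  proof (rule first_cong)
   fix i assume i: "dbar ?n p R l j <= enat i"
   have "enat (Suc k) <= l ?n" unfolding l_def by (rule up_ge)
   hence "enat (Suc k) <= enat i" using dbar_ge[of l ?n p R j] i by (meson order_trans)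
   thus "((if ell ?Y L2 R (?n - Suc j) = Some i then 2 else 1) <= num_singular ?Y L2 R (?n - Suc j) i)
    \<longleftrightarrow> ((if l (?n - Suc j) = enat i then 2 else 1) <= count (R (?n - Suc j)) (i, p (?n - Suc j) i))"
    unfolding num[OF a(1,3)] e by (simp add: same)
  qed
  thus ?case unfolding ell_bar.simps dbar.simps Let_def enat_of_bind IH .
 qed
 define sl where "sl = selected ?Y L2 R"
 have sl: "sl a = ems (l a) + ems (b a)" if "1 <= a" "a < ?n" for a
  using that el[of a] br[of "?n - a"] unfolding sl_def b_def by (auto simp: opt_mset_ems)
 have sln: "sl ?n = ems (l ?n)" "sl N = ems (l ?n)" using el[of ?n] elN N unfolding sl_def by (auto simp: opt_mset_ems)
 have kb: "Suc k <= i" if "b a = enat i" for a i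
 proof -
  have "enat (Suc k) <= l ?n" unfolding l_def by (rule up_ge)
  hence "enat (Suc k) <= b a" using dbar_ge[of l ?n p R "?n - a"] by (auto simp: b_def)
  thus ?thesis using that by simp
 qed
 define nu where "nu = (%a. shape R a - sl a + {# i - 1. i \<in># filter_mset (%i. i > 1) (sl a) #})"
 have L1: "L2(1 := L2 1 - {#1#}) = ?L1" by (auto simp: L2_def mult_array_Cons)
 have R1: "R1 a = R a - {# (i, vacancy ?Y L2 (shape R) a i). i \<in># sl a #}
       + {# (i - 1, vacancy ?Y ?L1 nu a (i - 1)). i \<in># filter_mset (%i. i > 1) (sl a) #}" for a
  unfolding D delta_def Let_def L1 sl_def[symmetric] nu_def[symmetric] ..
 have st1: "{# (i, vacancy ?Y L2 (shape R) a i). i \<in># ems x #} = strs p a x"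
  if "1 <= a" "a <= N" "!!i. x = enat i ==> Suc k <= i" for a x using that same[of _ a] by (cases x) (auto simp: p2_def pD_def)
 have S: "{# (i, vacancy ?Y L2 (shape R) a i). i \<in># sl a #} \<subseteq># R a" if "1 <= a" "a <= ?n" for a
 proof (cases "a = ?n")
  case True
  have "strs p ?n (l ?n) \<subseteq># R ?n" using l_sing[of ?n] N by (cases "l ?n") auto
  moreover have "{# (i, vacancy ?Y L2 (shape R) ?n i). i \<in># ems (l ?n) #} = strs p ?n (l ?n)" by (rule st1) (use N kl in auto)
  ultimately show ?thesis unfolding True sln by simp
 next
  case False
  hence a: "1 <= a" "a < ?n" "a <= N" using that by auto
  show ?thesis using strs_subset[OF a(1,2)] st1[of a "l a"] st1[of a "b a"] kl kb a by (simp add: sl)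
 qed
 have shR1: "shape R1 a = nu a" if "1 <= a" "a <= ?n" for a unfolding shape_def R1 nu_def image_mset_union image_mset_Diff[OF S[OF that]]
  by (simp add: multiset.map_comp comp_def)
 have slsub: "sl a \<subseteq># shape R a" if "1 <= a" "a <= ?n" for a
  using image_mset_subseteq_mono[OF S[OF that], of fst] by (simp add: shape_def multiset.map_comp comp_def)
 have slpos: "1 <= j" if "1 <= a" "a <= ?n" "j \<in># sl a" for a j
 using mset_subset_eqD[OF slsub[OF that(1,2)] that(3)] v by (auto simp: shape_def valid_def)
 have nuN: "nu N = nu ?n" unfolding nu_def sln shs ..
 have shR1': "shape R1 a = nu a" if "1 <= a" "a <= N" for a
 proof (cases "a = N")
  case True thus ?thesis using shR1[of ?n] shs nuN N by simp
 next
  case False thus ?thesis using shR1[of a] that by simp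
 qed
 have vac1: "vacancy ?Y ?L1 nu a i = pD N ?L1 R1 a i" if "1 <= a" "a <= N" for a i using that by (simp add: shR1' pD_def vacancy_def)
 have st2: "{# (i - 1, vacancy ?Y ?L1 nu a (i - 1)). i \<in># filter_mset (%i. i > 1) (ems x) #} = shorts (pD N ?L1 R1) a x"
  if "1 <= a" "a <= N" for a x using vac1[OF that] by (cases x) (auto simp: shorts_def)
 have ms: "msum (shape R1 a) i = msum (shape R a) i - (if a < ?n then chi (l a) i + chi (b a) i else chi (l a) i)"
  and ss: "ssum (shape R1 a) = ssum (shape R a) - (if a < ?n then of_bool (l a ~= \<infinity>) + of_bool (b a ~= \<infinity>) else of_bool (l a ~= \<infinity>))"
  if a: "1 <= a" "a <= ?n" for a i
 proof -
  note sp = short_parts[OF slsub[OF a] slpos[OF a]]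
  have s: "sl a = (if a < ?n then ems (l a) + ems (b a) else ems (l a))" using sl[of a] sln a by (cases "a < ?n") auto
  show "msum (shape R1 a) i = msum (shape R a) i - (if a < ?n then chi (l a) i + chi (b a) i else chi (l a) i)"
  using sp(1) by (simp add: shR1[OF a] nu_def s ems_sum)
  show "ssum (shape R1 a) = ssum (shape R a) - (if a < ?n then of_bool (l a ~= \<infinity>) + of_bool (b a ~= \<infinity>) else of_bool (l a ~= \<infinity>))"
  using sp(2) by (simp add: shR1[OF a] nu_def s ems_sum)
 qed
 have "dstep ?n (Suc k) p R l b (pD N ?L1 R1) R1"
 proof
  fix a assume a: "1 <= a" "a < ?n"
  hence a': "a <= N" by simp
  show "R1 a = R a - strs p a (l a) - strs p a (b a) + shorts (pD N ?L1 R1) a (l a) + shorts (pD N ?L1 R1) a (b a)"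
  proof -
   have "{# (i, vacancy ?Y L2 (shape R) a i). i \<in># ems (l a) #} = strs p a (l a)"
    "{# (i, vacancy ?Y L2 (shape R) a i). i \<in># ems (b a) #} = strs p a (b a)" by (rule st1; use a a' kl kb in auto)+
   thus ?thesis unfolding R1 sl[OF a] filter_union_mset image_mset_union st2[OF a(1) a'] by (simp add: add.assoc)
  qed
  fix i
  have "1 <= a" "a <= N" using a by auto
  hence "pD N ?L1 R1 a i = vacancy ?Y ?L1 (shape R1) a i" "p a i = vacancy ?Y ?L (shape R) a i" by (simp_all add: p_def pD_def)
  moreover have "msum (?L1 a) i = msum (?L a) i - (if a = 1 then chi (l 0) i else 0)" by (auto simp: msum_mult_array msum_fac l_0 chi_def)
  moreover have "msum (shape R1 a) i = msum (shape R a) i - (chi (l a) i + chi (b a) i)" using ms[of a i] a by simp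
  moreover have "(if 1 < a then msum (shape R1 (a - 1)) i else 0) = (if 1 < a then msum (shape R (a - 1)) i else 0)
    - (chi (l (a - 1)) i + chi (b (a - 1)) i) + (if a = 1 then chi (l 0) i else 0)" using a ms(1) by (simp add: b_0)
  moreover have "(if a + 1 < ?n then msum (shape R1 (a + 1)) i else 2 * msum (shape R1 ?n) i)
   = (if a + 1 < ?n then msum (shape R (a + 1)) i else 2 * msum (shape R ?n) i) - (chi (l (a + 1)) i + chi (b (a + 1)) i)"
  proof (cases "a + 1 < ?n")
   case True thus ?thesis using ms(1)[of "a + 1" i] by simp
  next
   case False
   hence "a + 1 = ?n" using a by simp
   moreover have "msum (shape R1 ?n) i = msum (shape R ?n) i - chi (l ?n) i" using ms(1)[of ?n i] n by simp
   ultimately show ?thesis using b_n by simp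
  qed
  ultimately show "pD N ?L1 R1 a i = p a i + 2 * (chi (l a) i + chi (b a) i)
   - (chi (l (a - 1)) i + chi (b (a - 1)) i + chi (l (a + 1)) i + chi (b (a + 1)) i)"
   unfolding fold_vacancy[where nu="shape R1", OF N shs(2) a] fold_vacancy[where nu="shape R", OF N shs(1) a] using second_difference by (simp only:)
 next
  show "R1 ?n = R ?n - strs p ?n (l ?n) + shorts (pD N ?L1 R1) ?n (l ?n)"
  proof -
   have n1: "1 <= ?n" "?n <= N" using N by auto
   have "{# (i, vacancy ?Y L2 (shape R) ?n i). i \<in># ems (l ?n) #} = strs p ?n (l ?n)" by (rule st1) (use n1 kl in auto)
   thus ?thesis unfolding R1 sln st2[OF n1] by simp
  qed
 qed
 moreover have "boxes ?n l b (a - 1) - boxes ?n l b a = ee (hd c) a" if a: "1 <= a" "a <= ?n" for a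
 proof -
  obtain x where x: "c = [x]" by (rule letter_D[OF hw])
  have diff: "word_wt ?Y [[x]] a = word_wt ?Y (concat ((c # cs) # p0)) a - word_wt ?Y (concat (tabs cs @ p0)) a" for a
   using word_wt_column_diff[of ?Y c cs p0 a] x by simp
  have L: "ssum (?L1 a) = ssum (?L a) - of_bool (a = 1)" for a by (auto simp: ssum_mult_array ssum_fac)
  define g where "g = boxes ?n l b"
  have g: "g 0 = 1" "!!a. 1 <= a ==> a < ?n ==> g a = ssum (shape R a) - ssum (shape R1 a)"
   "g ?n = 2 * (ssum (shape R ?n) - ssum (shape R1 ?n))" using ss N by (auto simp: g_def boxes_def)
  have top: "g (?n - 1) - g ?n = ee x ?n"
  proof -
   have e: "?n - 1 = N - 2" "?n + 1 = N" "1 <= N - 2" "N - 2 < ?n" using N by auto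
   have "word_wt ?Y [[x]] ?n = g (?n - 1) - g ?n"
    unfolding diff fold_weight(2)[OF N shs(1) RC(1)] fold_weight(2)[OF N shs(2) RC(2)] e g(3) g(2)[OF e(3,4)] using L[of ?n] N by simp
   moreover have "word_wt ?Y [[x]] ?n = ee x ?n - ee x N" using letter_wt_D[OF N, of ?n x] e by simp
   moreover have "ee x N = 0" using st x by (simp add: ee_def)
   ultimately show ?thesis by simp
  qed
  have mid: "word_wt ?Y [[x]] a = g (a - 1) - 2 * g a + g (a + 1)" if a: "1 <= a" "a < ?n" for a
  proof -
   have "g a = ssum (shape R a) - ssum (shape R1 a)" using g(2)[of a] a by simp
   moreover have "(if 1 < a then ssum (shape R (a - 1)) else 0) - (if 1 < a then ssum (shape R1 (a - 1)) else 0) + of_bool (a = 1) = g (a - 1)"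
   proof (cases "a = 1")
    case True thus ?thesis by (simp add: g(1))
   next
    case False
    hence "1 <= a - 1" "a - 1 < ?n" "1 < a" using a by auto
    thus ?thesis using g(2)[of "a - 1"] by simp
   qed
   moreover have "(if a + 1 < ?n then ssum (shape R (a + 1)) else 2 * ssum (shape R ?n))
    - (if a + 1 < ?n then ssum (shape R1 (a + 1)) else 2 * ssum (shape R1 ?n)) = g (a + 1)"
   proof (cases "a + 1 < ?n")
    case True thus ?thesis using g(2)[of "a + 1"] by simp
   next
    case False
    hence "a + 1 = ?n" using a by simp
    thus ?thesis using g(3) by simp
   qed
   ultimately show ?thesis
    unfolding diff fold_weight(1)[OF N shs(1) RC(1) a] fold_weight(1)[OF N shs(2) RC(2) a] using L[of a] by (rule second_difference')
  qed
  \<comment> \<open>The weight equations fix the differences along the diagram; starting from node n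
    they are summed downwards.\<close>
  have "1 <= a ==> g (a - 1) - g a = ee x a" using a(2)
  proof (induction a rule: inc_induct)
   case base show ?case by (rule top)
  next
   case (step a)
   hence "1 <= a" "a <= N" "a < N" by auto
   hence "word_wt ?Y [[x]] a = ee x a - ee x (a + 1)" using letter_wt_D[OF N, of a x] by simp
   thus ?case using step mid[of a] by simp
  qed
  thus ?thesis using a x by (simp add: g_def)
 qed
 ultimately show ?thesis using that unfolding p_def by blast
qed

subsection \<open>Two steps in type B\<close>

lemma even_msum: "\<forall>j\<in>#M. even j ==> even i ==> even (msum M i)" by (induction M) (auto simp: min_def)

text \<open>For even i the minimum of i and an even length is even. The spin partition, on which no
  parity is imposed, enters twice.\<close>

lemma even_vacancy:
 assumes N: "4 <= N" and B: "\<forall>(r, s)\<in>set B. even s" and s: "R N = R (N - 1)"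
  and R: "!!a. 1 <= a ==> a < N - 1 ==> \<forall>z\<in>#R a. even (fst z)" and a: "1 <= a" "a < N - 1" and i: "even i"
 shows "even (pD N (mult_array B) R a i)"
proof -
 have sh: "shape R N = shape R (N - 1)" using s by (simp add: shape_def)
 have e: "even (msum (shape R c) i)" if "1 <= c" "c < N - 1" for c by (rule even_msum) (use R[OF that] i in \<open>auto simp: shape_def\<close>)
 have "even (msum (mult_array B a) i)" by (rule even_msum) (use B i in \<open>auto simp: mult_array_def\<close>)
 moreover have "even (if 1 < a then msum (shape R (a - 1)) i else 0)" using e[of "a - 1"] a by auto
 moreover have "even (if a + 1 < N - 1 then msum (shape R (a + 1)) i else 2 * msum (shape R (N - 1)) i)" using e[of "a + 1"] by auto
 ultimately show ?thesis unfolding pD_def fold_vacancy[where nu = "shape R", OF N sh a] by simp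
qed

definition Bclass :: "nat => rigged => bool" where
 "Bclass N R \<longleftrightarrow> R N = R (N - 1) & (\<forall>a. 1 <= a & a < N - 1 --> (\<forall>z\<in>#R a. even_str z))"

text \<open>Besides doubled letters the pair N - 1, - (N - 1) is allowed: it is the image of the
  letter 0 of type B.\<close>

definition Bpair :: "nat => column => column => bool" where
 "Bpair N c c' \<longleftrightarrow> c = c' & c ~= [int N] & c ~= [- int N] \<or> c = [int (N - 1)] & c' = [- int (N - 1)]"

text \<open>Tight steps take equally many boxes at each node below N - 1, so the two letters have
  the same coordinates there. At N - 1 the second step may find a string where the first found none,
  and this gives the exceptional pair. Conversely, such letters force both steps to succeed at the
  same nodes, and the backward argument applies.\<close>

theorem Bclass_pair:
 assumes Phi: "rc_bijection (TypeD N) Phi" and N: "4 <= N" and j: "even j" and B: "\<forall>(r, s)\<in>set B. even s"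
  and hw: "hw_path (TypeD N) ((1, Suc (Suc j)) # B) ((c # c' # cs) # p0)"
 defines "R \<equiv> Phi ((1, Suc (Suc j)) # B) ((c # c' # cs) # p0)" and "R2 \<equiv> Phi (fac 1 j @ B) (tabs cs @ p0)"
 shows "Bclass N R \<longleftrightarrow> Bpair N c c' & Bclass N R2"
proof -
 let ?n = "N - 1"
 have f1: "fac 1 (Suc j) @ B = (1, Suc j) # B" "tabs (c' # cs) @ p0 = (c' # cs) # p0" by (simp_all add: fac_def tabs_def)
 define R1 where "R1 = Phi ((1, Suc j) # B) ((c' # cs) # p0)"
 have hw1: "hw_path (TypeD N) ((1, Suc j) # B) ((c' # cs) # p0)" using hw_path_split_tl[OF hw] unfolding f1 .
 note s1 = symmetric_step_D[OF Phi N hw, unfolded f1, folded R_def R1_def]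
 note s2 = symmetric_step_D[OF Phi N hw1, folded R1_def R2_def]
 obtain x where x: "c = [x]" "1 <= \<bar>x\<bar>" "\<bar>x\<bar> <= int N" by (rule letter_D[OF hw])
 obtain y where y: "c' = [y]" "1 <= \<bar>y\<bar>" "\<bar>y\<bar> <= int N" by (rule letter_D[OF hw1])
 show ?thesis
 proof (cases "R N = R ?n")
  case False
  moreover have "c ~= [int N] & c ~= [- int N] & c' ~= [int N] & c' ~= [- int N]" if "Bpair N c c'" using that N by (auto simp: Bpair_def)
  ultimately have "~ (Bpair N c c' & Bclass N R2)" using s1 s2 unfolding Bclass_def by blast
  thus ?thesis using False by (auto simp: Bclass_def)
 next
  case True
  hence sym: "R1 N = R1 ?n" "R2 N = R2 ?n" and nc: "c ~= [int N]" "c ~= [- int N]" "c' ~= [int N]" "c' ~= [- int N]" using s1 s2 by blast+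
  have xy: "\<bar>x\<bar> <= int ?n" "\<bar>y\<bar> <= int ?n" using x y nc by auto
  obtain l b where one: "dstep ?n (Suc (Suc j)) (pD N (mult_array ((1, Suc (Suc j)) # B)) R) R l b (pD N (mult_array ((1, Suc j) # B)) R1) R1"
   and g: "!!a. 1 <= a ==> a <= ?n ==> boxes ?n l b (a - 1) - boxes ?n l b a = ee x a"
   using dstep_Phi[OF Phi N hw, unfolded f1, folded R_def R1_def, OF True] x(1) by auto
  obtain l' b' where two: "dstep ?n (Suc j) (pD N (mult_array ((1, Suc j) # B)) R1) R1 l' b' (pD N (mult_array (fac 1 j @ B)) R2) R2"
   and g': "!!a. 1 <= a ==> a <= ?n ==> boxes ?n l' b' (a - 1) - boxes ?n l' b' a = ee y a"
   using dstep_Phi[OF Phi N hw1, folded R1_def R2_def, OF sym(1)] y(1) by auto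
  define p p2 where "p = pD N (mult_array ((1, Suc (Suc j)) # B)) R" and "p2 = pD N (mult_array (fac 1 j @ B)) R2"
  define p1 where "p1 = pD N (mult_array ((1, Suc j) # B)) R1"
  interpret two_steps ?n "Suc j" p R l b p1 R1 l' b' p2 R2 unfolding two_steps_def two_steps_axioms_def p_def p1_def p2_def using one two j by simp
  have pe: "even (p a i)" if "!!a. 1 <= a ==> a < ?n ==> \<forall>z\<in>#R a. even (fst z)" "1 <= a" "a < ?n" "even i" for a i
   unfolding p_def by (rule even_vacancy[OF N _ True]) (use B j that in auto)
  have pe2: "even (p2 a i)" if "!!a. 1 <= a ==> a < ?n ==> \<forall>z\<in>#R2 a. even (fst z)" "1 <= a" "a < ?n" "even i" for a i
   unfolding p2_def by (rule even_vacancy[OF N _ sym(2)]) (use B j that in \<open>auto simp: fac_def\<close>)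
  show ?thesis
  proof
   assume c: "Bclass N R"
   hence ev: "even_str z" if "1 <= a" "a < ?n" "z \<in># R a" for a z using that by (auto simp: Bclass_def)
   have len: "\<forall>z\<in>#R a. even (fst z)" if "1 <= a" "a < ?n" for a using ev[OF that] by (simp add: even_str_def)
   have t: "tight a" if "1 <= a" "a < ?n" for a by (rule forward_tight[OF ev pe[OF len] that])
   have len2: "\<forall>z\<in>#R2 a. even (fst z)" if "1 <= a" "a < ?n" for a using tight_lengths(1)[OF t that] len[OF that] by blast
   have "\<forall>z\<in>#R2 a. even_str z" if "1 <= a" "a < ?n" for a
    using tight_lengths(2)[OF t that pe[OF len that] pe2[OF len2 that]] ev[OF that] by blast
   hence "Bclass N R2" using sym unfolding Bclass_def by blast
   moreover have "Bpair N c c'"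
   proof -
    have bx: "boxes ?n l' b' a = boxes ?n l b a" if "a < ?n" for a
     using t[of a] that by (cases "l a"; cases "b a") (auto simp: boxes_def tight_def one_enat_def)
    have e: "ee x a = ee y a" if "1 <= a" "a < ?n" for a using g[of a] g'[of a] bx[of a] bx[of "a - 1"] that by simp
    have n1: "1 <= ?n" using N by simp
    have en: "boxes ?n l b (?n - 1) - 2 * of_bool (l ?n ~= \<infinity>) = ee x ?n"
     "boxes ?n l b (?n - 1) - 2 * of_bool (l' ?n ~= \<infinity>) = ee y ?n"
    proof -
     have z: "boxes ?n l b ?n = 2 * of_bool (l ?n ~= \<infinity>)" "boxes ?n l' b' ?n = 2 * of_bool (l' ?n ~= \<infinity>)"
      using N by (simp_all add: boxes_def)
     have "?n - 1 < ?n" using N by simp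
     thus "boxes ?n l b (?n - 1) - 2 * of_bool (l ?n ~= \<infinity>) = ee x ?n"
      "boxes ?n l b (?n - 1) - 2 * of_bool (l' ?n ~= \<infinity>) = ee y ?n"
      using g[OF n1 order_refl] g'[OF n1 order_refl] bx[of "?n - 1"] unfolding z by simp_all
    qed
    show ?thesis
    proof (cases "l ?n = \<infinity> \<longleftrightarrow> l' ?n = \<infinity>")
     case True
     hence "ee x ?n = ee y ?n" using en by simp
     hence "x = y" using ee_inj[OF _ x(2) xy(1), of y] e by (metis le_neq_implies_less)
     thus ?thesis using x(1) y(1) nc by (simp add: Bpair_def)
    next
     case False
     hence "l ?n = \<infinity>" "l' ?n ~= \<infinity>" using l'_le[of ?n] by (cases "l ?n", fastforce, simp)+
     hence "ee x ?n = ee y ?n + 2" using en by simp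
     hence "x = int ?n" "y = - int ?n" by (auto simp: ee_def of_bool_def split: if_splits)
     thus ?thesis using x(1) y(1) by (simp add: Bpair_def)
    qed
   qed
   ultimately show "Bpair N c c' & Bclass N R2" by blast
  next
   assume h: "Bpair N c c' & Bclass N R2"
   hence ev2: "even_str z" if "1 <= a" "a < ?n" "z \<in># R2 a" for a z using that by (auto simp: Bclass_def)
   have len2: "\<forall>z\<in>#R2 a. even (fst z)" if "1 <= a" "a < ?n" for a using ev2[OF that] by (simp add: even_str_def)
   have e: "ee x a = ee y a" if "1 <= a" "a < ?n" for a using h x(1) y(1) that by (auto simp: Bpair_def ee_def)
   have bx: "boxes ?n l b a = boxes ?n l' b' a" if "a < ?n" for a using that
   proof (induction a)
    case (Suc a)
    thus ?case using g[of "Suc a"] g'[of "Suc a"] e[of "Suc a"] by simp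
   qed (simp add: boxes_def)
   have fin: "(l a = \<infinity> \<longleftrightarrow> l' a = \<infinity>) & (b a = \<infinity> \<longleftrightarrow> b' a = \<infinity>)" if a: "1 <= a" "a < ?n" for a
   proof -
    \<comment> \<open>As \<open>b\<close> never succeeds without \<open>l\<close>, the number of
      boxes tells which searches succeed.\<close>
    have "l a = \<infinity> ==> b a = \<infinity>" "l' a = \<infinity> ==> b' a = \<infinity>" using one.l_le_b[of a a] two.l_le_b[of a a] a by auto
    thus ?thesis using bx[OF a(2)] a by (auto simp: boxes_def of_bool_def split: if_splits)
   qed
   have t: "tight a" if "1 <= a" "a < ?n" for a by (rule backward_tight[OF ev2 pe2[OF len2] fin that])
   have len: "\<forall>z\<in>#R a. even (fst z)" if "1 <= a" "a < ?n" for a using tight_lengths(1)[OF t that] len2[OF that] by blast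
   have "\<forall>z\<in>#R a. even_str z" if "1 <= a" "a < ?n" for a
    using tight_lengths(2)[OF t that pe[OF len that] pe2[OF len2 that]] ev2[OF that] by blast
   thus "Bclass N R" using True unfolding Bclass_def by blast
  qed
 qed
qed

section \<open>Virtual configurations along whole paths of type D\<close>

definition vclassD :: "xtype => nat => rigged => bool" where
 "vclassD X n R \<longleftrightarrow> (if X = XB then Bclass (n + 1) R else R (n + 1) = R n)"

definition width :: "xtype => nat => nat" where
 "width X s = (if X = XB then 2 * s else s)"

lemma hat_factors_list_Cons_D:
 "X : {XB, XAodd} ==> hat_factors_list X n (s # ss) = (1, width X s) # hat_factors_list X n ss"
 by (auto simp: hat_factors_list_def hat_factors_def width_def)

lemma hat_factors_list_D:
 assumes X: "X : {XB, XAodd}"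
 shows "\<forall>s\<in>set ss. 1 <= s ==> admissible (TypeD N) (hat_factors_list X n ss)"
  and "X = XB ==> \<forall>(r, s)\<in>set (hat_factors_list X n ss). even s"
proof -
 show "\<forall>s\<in>set ss. 1 <= s ==> admissible (TypeD N) (hat_factors_list X n ss)"
  by (induction ss) (auto simp: admissible_def hat_factors_list_Cons_D[OF X] width_def)
 assume XB: "X = XB"
 show "\<forall>(r, s)\<in>set (hat_factors_list X n ss). even s"
 proof (induction ss)
  case (Cons s ss)
  thus ?case unfolding hat_factors_list_Cons_D[OF X] by (simp add: width_def XB)
 qed simp
qed

lemma gamma_D: "X : {XB, XAodd} ==> gamma X n i = (if i < n & X = XB then 2 else 1)" by auto

lemma RC_virtual_D:
 assumes V: "valid_rank X n" and X: "X : {XB, XAodd}" and ss: "\<forall>s\<in>set ss. 1 <= s"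
 shows "RC_virtual X n ss = {R : RC_hat X n ss. vclassD X n R}"
proof -
 let ?N = "n + 1" and ?L = "mult_array (hat_factors_list X n ss)"
 have n: "3 <= n" using V X by auto
 have Y: "Y_of X n = TypeD ?N" using X by (simp add: Y_of_def)
 have N: "4 <= ?N" "?N - 1 = n" using n by simp_all
 have adm: "admissible (TypeD ?N) (hat_factors_list X n ss)" by (rule hat_factors_list_D(1)[OF X ss])
 have L: "?L (?N - 1) = ?L ?N" using mult_array_D[OF adm, of n] mult_array_D[OF adm, of ?N] n by simp
 note g = gamma_D[OF X]
 have io: "set (iota X n a) = (if a < n then {a} else {n, ?N})" for a using X by (auto simp: iota_def)
 have vc: "virtual_rc X n R \<longleftrightarrow> vclassD X n R" for R
 proof -
  have sc: "str_cond X n a b z \<longleftrightarrow> (X = XB & a < n --> even_str z)" for a b z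
   using X by (cases z) (auto simp: str_cond_def even_str_def g)
  have "(\<forall>a\<in>{1..n}. \<forall>b\<in>set (iota X n a). R b = R a) \<longleftrightarrow> R ?N = R n" using n unfolding io by auto
  moreover have "(\<forall>a\<in>{1..n}. \<forall>b\<in>set (iota X n a). \<forall>z\<in>#R b. str_cond X n a b z) \<longleftrightarrow>
    (X = XB --> (\<forall>a. 1 <= a & a < n --> (\<forall>z\<in>#R a. even_str z)))" unfolding io sc by auto
  ultimately show ?thesis unfolding virtual_rc_def vclassD_def Bclass_def by (auto simp: ball_conj_distrib)
 qed
 have "RC_virtual X n ss = {R : RC_hat X n ss. virtual_rc X n R}"
 proof (rule RC_virtual_iff[OF V])
  fix R mu a b assume R: "R : RC_wt (Y_of X n) ?L mu" and mu: "mu : dominant (nodes (Y_of X n))"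
   and v: "virtual_rc X n R" and ab: "a : {1..n}" "b : set (iota X n a)"
  note R = R[unfolded Y] and mu = mu[unfolded Y]
  have sym: "R ?N = R (?N - 1)" and ev: "X = XB ==> 1 <= a ==> a < n ==> z \<in># R a ==> even_str z" for a z
   using v unfolding vc vclassD_def Bclass_def by (auto split: if_splits)
  have "even (mu a)" if XB: "X = XB" and a: "a < n"
  proof -
   have es: "even (ssum M)" if "\<forall>j\<in>#M. even j" for M using that by (induction M) auto
   have e: "even (ssum (shape R c))" if "1 <= c" "c < n" for c by (rule es) (use ev[OF XB that] in \<open>auto simp: shape_def even_str_def\<close>)
   have "even (ssum (?L a))" using hat_factors_list_D(2)[OF X XB, of n ss] by (intro es) (auto simp: mult_array_def)
   moreover have "even (if 1 < a then ssum (shape R (a - 1)) else 0)" using e[of "a - 1"] a by auto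
   moreover have "even (if a + 1 < n then ssum (shape R (a + 1)) else 2 * ssum (shape R n))" using e[of "a + 1"] by auto
   moreover have "shape R ?N = shape R (?N - 1)" using sym by (simp add: shape_def)
   ultimately show ?thesis using fold_weight(1)[OF N(1) _ R, of a] a ab unfolding N(2) by simp
  qed
  moreover have "mu ?N = mu n" using symmetric_weight[OF N(1) L R mu sym] by simp
  ultimately show "mu b = mu a & int (gamma X n a) dvd mu a" using ab unfolding g io by (auto split: if_splits)
 qed
 thus ?thesis using vc by simp
qed

fun bpairs :: "nat => tableau => bool" where
 "bpairs N [] \<longleftrightarrow> True"
| "bpairs N [c] \<longleftrightarrow> False"
| "bpairs N (c # c' # T) \<longleftrightarrow> Bpair N c c' & bpairs N T"

definition vfacD :: "xtype => nat => tableau => bool" where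
 "vfacD X n T \<longleftrightarrow> (if X = XB then bpairs (n + 1) T else \<forall>c\<in>set T. c ~= [int (n + 1)] & c ~= [- int (n + 1)])"

lemma fac_Cons: "fac r (Suc k) @ B = (r, Suc k) # B" "tabs (c # cs) @ p = (c # cs) # p" by (simp_all add: fac_def tabs_def)

lemma symmetric_row_D:
 assumes Phi: "rc_bijection (TypeD N) Phi" and N: "4 <= N"
 shows "hw_path (TypeD N) (fac 1 k @ B) (tabs T @ p) ==> length T = k ==>
  Phi (fac 1 k @ B) (tabs T @ p) N = Phi (fac 1 k @ B) (tabs T @ p) (N - 1) \<longleftrightarrow>
  (\<forall>c\<in>set T. c ~= [int N] & c ~= [- int N]) & Phi B p N = Phi B p (N - 1)"
proof (induction k arbitrary: T)
 case 0 thus ?case by (simp add: fac_def tabs_def)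
next
 case (Suc k)
 then obtain c cs where T: "T = c # cs" "length cs = k" by (cases T) auto
 have hw: "hw_path (TypeD N) ((1, Suc k) # B) ((c # cs) # p)" using Suc.prems(1) unfolding T fac_Cons .
 have IH: "Phi (fac 1 k @ B) (tabs cs @ p) N = Phi (fac 1 k @ B) (tabs cs @ p) (N - 1) \<longleftrightarrow>
  (\<forall>c\<in>set cs. c ~= [int N] & c ~= [- int N]) & Phi B p N = Phi B p (N - 1)" by (rule Suc.IH[OF hw_path_split_tl[OF hw] T(2)])
 show ?case unfolding T fac_Cons symmetric_step_D[OF Phi N hw] IH by auto
qed

lemma Bclass_row:
 assumes Phi: "rc_bijection (TypeD N) Phi" and N: "4 <= N" and B: "\<forall>(r, s)\<in>set B. even s"
 shows "hw_path (TypeD N) (fac 1 (2 * j) @ B) (tabs T @ p) ==> length T = 2 * j ==>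
  Bclass N (Phi (fac 1 (2 * j) @ B) (tabs T @ p)) \<longleftrightarrow> bpairs N T & Bclass N (Phi B p)"
proof (induction j arbitrary: T)
 case 0 thus ?case by (simp add: fac_def tabs_def)
next
 case (Suc j)
 then obtain c c' cs where T: "T = c # c' # cs" "length cs = 2 * j" by (cases T; cases "tl T") auto
 have e: "2 * Suc j = Suc (Suc (2 * j))" by simp
 have hw: "hw_path (TypeD N) ((1, Suc (Suc (2 * j))) # B) ((c # c' # cs) # p)" using Suc.prems(1) unfolding T e fac_Cons .
 have hw1: "hw_path (TypeD N) ((1, Suc (2 * j)) # B) ((c' # cs) # p)" using hw_path_split_tl[OF hw] unfolding fac_Cons .
 have IH: "Bclass N (Phi (fac 1 (2 * j) @ B) (tabs cs @ p)) \<longleftrightarrow> bpairs N cs & Bclass N (Phi B p)"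
  by (rule Suc.IH[OF hw_path_split_tl[OF hw1] T(2)])
 have "even (2 * j)" by simp
 show ?case unfolding T e fac_Cons Bclass_pair[OF Phi N \<open>even (2 * j)\<close> B hw] IH by auto
qed

lemma vclassD_path:
 assumes Phi: "rc_bijection (TypeD (n + 1)) Phi" and X: "X : {XB, XAodd}" and n: "3 <= n"
 shows "\<forall>s\<in>set ss. 1 <= s ==> hw_path (TypeD (n + 1)) (hat_factors_list X n ss) p ==>
  vclassD X n (Phi (hat_factors_list X n ss) p) \<longleftrightarrow> list_all (vfacD X n) p"
proof (induction ss arbitrary: p)
 case Nil
 hence "p = []" "Phi [] [] = (%a. {#})" using Phi by (simp_all add: hw_path_def wf_path_def rc_bijection_def)
 thus ?case by (simp add: vclassD_def Bclass_def)
next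
 case (Cons s ss)
 let ?N = "n + 1" and ?B = "hat_factors_list X n ss"
 have N: "4 <= ?N" "?N - 1 = n" using n by simp_all
 note hC = hat_factors_list_Cons_D[OF X, of n s ss]
 obtain T q where q: "p = T # q" by (rule hw_path_Cons[OF Cons.prems(2)[unfolded hC]])
 note hw = Cons.prems(2)[unfolded hC q]
 have IH: "vclassD X n (Phi ?B q) \<longleftrightarrow> list_all (vfacD X n) q" using Cons.IH[OF _ hw_path_tl[OF hw]] Cons.prems(1) by simp
 have len: "length T = width X s" using hw_path_tableaux[OF hw] by (simp add: tableaux_def)
 have "1 <= width X s" using Cons.prems(1) by (auto simp: width_def)
 hence f: "(1, width X s) # ?B = fac 1 (width X s) @ ?B" "T # q = tabs T @ q" using len by (auto simp: fac_def tabs_def)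
 have hw': "hw_path (TypeD ?N) (fac 1 (width X s) @ ?B) (tabs T @ q)" using hw unfolding f .
 have "vclassD X n (Phi (fac 1 (width X s) @ ?B) (tabs T @ q)) \<longleftrightarrow> vfacD X n T & vclassD X n (Phi ?B q)"
 using symmetric_row_D[OF Phi N(1) hw' len] Phi N(1) hw' len Bclass_row hat_factors_list_D(2) by (auto simp: width_def vclassD_def vfacD_def split: if_splits)
 thus ?case unfolding hC q IH f[symmetric] by simp
qed

subsection \<open>Rows of type D\<close>

definition lcount :: "tableau => int => nat" where
 "lcount T a = length (filter (%c. c = [a]) T)"

lemma lcount_Cons: "lcount ([x] # T) a = of_bool (x = a) + lcount T a" by (simp add: lcount_def)

lemma D_row_sorted:
 assumes "T : tableaux (TypeD N) r s"
 shows "sorted_wrt (col_le (TypeD N)) T"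
proof -
 have "transp (col_le (TypeD N))" by (rule transpI) auto
 from successively_conv_sorted_wrt[OF this] show ?thesis using assms by (simp add: tableaux_def)
qed

lemma D_row_letters:
 assumes "T : tableaux (TypeD N) r s" "c : set T"
 obtains x where "c = [x]" "1 <= \<bar>x\<bar>" "\<bar>x\<bar> <= int N" using assms by (auto simp: tableaux_def)

lemma sorted_wrt_restrict:
 assumes "sorted_wrt P T" "!!c d. c : set T ==> d : set T ==> P c d ==> Q c d"
 shows "sorted_wrt Q T" by (rule sorted_wrt_mono_rel[OF _ assms(1)]) (rule assms(2))

text \<open>Unbarred letters precede barred ones. Nothing cancels within either half; between the
  halves i + 1 cancels against its barred counterpart.\<close>

lemma row_signature_D:
 assumes T: "T : tableaux (TypeD N) 1 s" and i: "1 <= i" "i < N"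
 shows "tabsig (TypeD N) i T = (lcount T (int i) + (lcount T (- int (i + 1)) - lcount T (int (i + 1))),
   lcount T (- int i) + (lcount T (int (i + 1)) - lcount T (- int (i + 1))))"
proof -
 note so = D_row_sorted[OF T]
 define U V where "U = takeWhile (%c. 0 < hd c) T" and "V = dropWhile (%c. 0 < hd c) T"
 have UV: "T = U @ V" by (simp add: U_def V_def)
 have U: "0 < hd c" if "c : set U" for c using that set_takeWhileD unfolding U_def by fastforce
 have V: "hd c < 0" if c: "c : set V" for c
 proof (cases V)
  case (Cons d V')
  have d: "~ 0 < hd d" using Cons hd_dropWhile[of "%c. 0 < hd c" T] unfolding V_def by force
  have "d : set T" "c : set T" using Cons c UV by auto
  obtain x where x: "d = [x]" "1 <= \<bar>x\<bar>" "\<bar>x\<bar> <= int N" by (rule D_row_letters[OF T \<open>d : set T\<close>])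
  obtain y where y: "c = [y]" "1 <= \<bar>y\<bar>" "\<bar>y\<bar> <= int N" by (rule D_row_letters[OF T \<open>c : set T\<close>])
  have "c = d \<or> col_le (TypeD N) d c" using so c unfolding UV Cons by (auto simp: sorted_wrt_append)
  thus ?thesis using x y d by (auto simp: D_rank_def split: if_splits)
 qed (use c in simp)
 have m: "c : set T" if "c : set U \<or> c : set V" for c using that UV by auto
 have su: "sorted_wrt (col_le (TypeD N)) U" "sorted_wrt (col_le (TypeD N)) V" using so unfolding UV by (simp_all add: sorted_wrt_append)
 have "bicsum (colsig (TypeD N) i) U = (length (filter (%c. c = [int i]) U), length (filter (%c. c = [int (i + 1)]) U))"
 proof (rule bicsum_counts)
  fix c assume c: "c : set U"
  obtain x where "c = [x]" by (rule D_row_letters[OF T m]) (use c in auto)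
  thus "colsig (TypeD N) i c = (of_bool (c = [int i]), of_bool (c = [int (i + 1)]))" "~ (c = [int i] & c = [int (i + 1)])"
   using U[OF c] i by (auto simp: D_letter_e_def D_letter_f_def)
 next
  show "sorted_wrt (%c d. c = [int (i + 1)] --> d ~= [int i]) U"
   by (rule sorted_wrt_restrict[OF su(1)]) (use i in \<open>auto simp: D_rank_def\<close>)
 qed
 moreover have "bicsum (colsig (TypeD N) i) V = (length (filter (%c. c = [- int (i + 1)]) V), length (filter (%c. c = [- int i]) V))"
 proof (rule bicsum_counts)
  fix c assume c: "c : set V"
  obtain x where "c = [x]" by (rule D_row_letters[OF T m]) (use c in auto)
  thus "colsig (TypeD N) i c = (of_bool (c = [- int (i + 1)]), of_bool (c = [- int i]))" "~ (c = [- int (i + 1)] & c = [- int i])"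
   using V[OF c] i by (auto simp: D_letter_e_def D_letter_f_def)
 next
  show "sorted_wrt (%c d. c = [- int i] --> d ~= [- int (i + 1)]) V"
   by (rule sorted_wrt_restrict[OF su(2)]) (use i in \<open>auto simp: D_rank_def\<close>)
 qed
 moreover have "lcount T a = (if 0 < a then length (filter (%c. c = [a]) U) else length (filter (%c. c = [a]) V))" for a
 proof -
  have "0 < a ==> filter (%c. c = [a]) V = []" "~ 0 < a ==> filter (%c. c = [a]) U = []" using U V by (fastforce simp: filter_empty_conv)+
  thus ?thesis by (auto simp: lcount_def UV)
 qed
 ultimately show ?thesis using i unfolding tabsig_def by (subst UV) (simp add: bicsum_append)
qed

lemma row_signature_spin:
 assumes T: "T : tableaux (TypeD N) 1 s" and N: "4 <= N"
 shows "tabsig (TypeD N) N T = (lcount T (int (N - 1)) + lcount T (int N), lcount T (- int N) + lcount T (- int (N - 1)))"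
proof -
 have "bicsum (colsig (TypeD N) N) T = (length (filter (%c. c = [int (N - 1)] \<or> c = [int N]) T),
   length (filter (%c. c = [- int N] \<or> c = [- int (N - 1)]) T))"
 proof (rule bicsum_counts)
  fix c assume c: "c : set T"
  obtain x where "c = [x]" by (rule D_row_letters[OF T c])
  thus "colsig (TypeD N) N c = (of_bool (c = [int (N - 1)] \<or> c = [int N]), of_bool (c = [- int N] \<or> c = [- int (N - 1)]))"
   "~ ((c = [int (N - 1)] \<or> c = [int N]) & (c = [- int N] \<or> c = [- int (N - 1)]))" using N by (auto simp: D_letter_e_def D_letter_f_def)
 next
  show "sorted_wrt (%c d. c = [- int N] \<or> c = [- int (N - 1)] --> ~ (d = [int (N - 1)] \<or> d = [int N])) T"
   by (rule sorted_wrt_restrict[OF D_row_sorted[OF T]]) (use N in \<open>auto simp: D_rank_def of_nat_diff\<close>)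
 qed
 moreover have "length (filter (%c. c = [a] \<or> c = [b]) T) = lcount T a + lcount T b" if "a ~= b" for a b
  using that unfolding lcount_def by (induction T) auto
 ultimately show ?thesis using N by (simp add: tabsig_def)
qed

lemma lcount_total:
 assumes T: "T : tableaux (TypeD N) 1 s"
 shows "(\<Sum>i=1..N. int (lcount T (int i)) + int (lcount T (- int i))) = int s"
proof -
 have "(\<Sum>a\<in>{- int N..int N}. length (filter (%c. c = [a]) T)) = length T"
 proof (rule sum_length_filter)
  fix c assume c: "c : set T"
  obtain x where "c = [x]" "1 <= \<bar>x\<bar>" "\<bar>x\<bar> <= int N" by (rule D_row_letters[OF T c])
  thus "\<exists>!a. a : {- int N..int N} & c = [a]" by auto
 qed simp
 hence "(\<Sum>a=- int N..int N. int (lcount T a)) = int s" using T unfolding of_nat_sum[symmetric] lcount_def by (simp add: tableaux_def)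
 moreover have "lcount T 0 = 0"
 proof -
  have "c ~= [0]" if c: "c : set T" for c
  proof -
   obtain x where "c = [x]" "1 <= \<bar>x\<bar>" by (rule D_row_letters[OF T c])
   thus ?thesis by auto
  qed
  thus ?thesis by (simp add: lcount_def)
 qed
 ultimately show ?thesis unfolding sum_symmetric_interval by simp
qed

text \<open>For \<open>XB\<close> multiplicities are doubled and each letter 0 becomes one n and one
  - n.\<close>

definition vcoordsD :: "xtype => nat => coords => (int => nat) => bool" where
 "vcoordsD X n x y \<longleftrightarrow> y (int (n + 1)) = 0 & y (- int (n + 1)) = 0 &
  (\<forall>i\<in>{1..n}. int (y (int i)) = (if X = XB then 2 else 1) * x (int i) + of_bool (i = n) * x 0 &
   int (y (- int i)) = (if X = XB then 2 else 1) * x (- int i) + of_bool (i = n) * x 0)"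

text \<open>The nodes n and n + 1 must have equal string lengths, which leaves no room for the
  letters n + 1 and - (n + 1). The other multiplicities follow by descending induction from
  n.\<close>

lemma psi_vcoordsD:
 assumes V: "valid_rank X n" and X: "X : {XB, XAodd}" and emb: "virtual_embedding X n s psi" and x: "x : KRX_elems X n s"
 obtains T where "psi x = [T]" "T : tableaux (TypeD (n + 1)) 1 (width X s)" "vcoordsD X n x (lcount T)"
proof -
 let ?N = "n + 1"
 have n: "3 <= n" using V X by auto
 have N: "4 <= ?N" using n by simp
 have Y: "Y_of X n = TypeD ?N" using X by (simp add: Y_of_def)
 have h: "hat_factors X n s = [(1, width X s)]" using X by (auto simp: hat_factors_def width_def)
 have "wf_path (TypeD ?N) [(1, width X s)] (psi x)" using psi_signature(1)[OF V emb x] by (simp only: Y h)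
 then obtain T where T: "psi x = [T]" "T : tableaux (TypeD ?N) 1 (width X s)" unfolding wf_path_def list_all2_Cons1 by auto
 define y where "y = lcount T"
 have nn: "!!c. 0 <= x c" using x by (simp add: KRX_elems_def)
 have x0: "X = XAodd ==> x 0 = 0" using x by (auto simp: KRX_elems_def)
 have sg: "tabsig (TypeD ?N) j T = (gamma X n i * fst (xsig X n i x), gamma X n i * snd (xsig X n i x))"
  if "i : {1..n}" "j : set (iota X n i)" for i j using psi_signature(2)[OF V emb x that] by (simp only: Y T(1)) simp
 have m: "n : {1..n}" "n : set (iota X n n)" "?N : set (iota X n n)" using X n by (auto simp: iota_def)
 have 1: "(y (int n) + (y (- int ?N) - y (int ?N)), y (- int n) + (y (int ?N) - y (- int ?N))) = (fst (xsig X n n x), snd (xsig X n n x))"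
  using sg[OF m(1,2)] row_signature_D[OF T(2), of n] n gamma_D[OF X, of n n] by (simp add: y_def)
 have 2: "(y (int n) + y (int ?N), y (- int ?N) + y (- int n)) = (fst (xsig X n n x), snd (xsig X n n x))"
  using sg[OF m(1,3)] row_signature_spin[OF T(2) N] gamma_D[OF X, of n n] by (simp add: y_def)
 have z: "y (int ?N) = 0" "y (- int ?N) = 0" using 1 2 by (cases "xsig X n n x"; auto)+
 define w :: int where "w = (if X = XB then 2 else 1)"
 have yn: "int (y (int n)) = w * x (int n) + x 0" "int (y (- int n)) = w * x (- int n) + x 0" using 1 z X nn x0 by (auto simp: xsig_def w_def)
 have top: "int (y (int i)) = w * x (int i) + of_bool (i = n) * x 0 & int (y (- int i)) = w * x (- int i) + of_bool (i = n) * x 0"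
  if "1 <= i" "i <= n" for i using that(2,1)
 proof (induction i rule: inc_induct)
  case base thus ?case using yn by simp
 next
  case (step i)
  hence i: "i : {1..n}" "i : set (iota X n i)" "i < ?N" "1 <= i" "i < n" by (auto simp: iota_def)
  have IH: "int (y (int (Suc i))) - int (y (- int (Suc i))) = w * (x (int (Suc i)) - x (- int (Suc i)))" using step by (simp add: algebra_simps)
  have sgi: "y (int i) + (y (- int (Suc i)) - y (int (Suc i))) = gamma X n i * fst (xsig X n i x)"
   "y (- int i) + (y (int (Suc i)) - y (- int (Suc i))) = gamma X n i * snd (xsig X n i x)"
   using sg[OF i(1,2)] row_signature_D[OF T(2) i(4,3)] by (simp_all add: y_def)
  have g: "int (gamma X n i) = w" using gamma_D[OF X, of n i] i by (simp add: w_def)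
  have xs: "int (fst (xsig X n i x)) = x (int i) + max 0 (x (- int (Suc i)) - x (int (Suc i)))"
   "int (snd (xsig X n i x)) = x (- int i) + max 0 (x (int (Suc i)) - x (- int (Suc i)))" using i nn by (auto simp: xsig_def add.commute)
  have tr: "int (a - b) = max 0 (int a - int b)" for a b :: nat by auto
  have w: "w * max 0 a = max 0 (w * a)" for a by (auto simp: w_def)
  have e1: "int (y (int i)) + max 0 (int (y (- int (Suc i))) - int (y (int (Suc i)))) = w * x (int i) + max 0 (w * (x (- int (Suc i)) - x (int (Suc i))))"
   using arg_cong[OF sgi(1), of int] unfolding of_nat_add of_nat_mult tr g xs distrib_left w .
  have e2: "int (y (- int i)) + max 0 (int (y (int (Suc i))) - int (y (- int (Suc i)))) = w * x (- int i) + max 0 (w * (x (int (Suc i)) - x (- int (Suc i))))"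
   using arg_cong[OF sgi(2), of int] unfolding of_nat_add of_nat_mult tr g xs distrib_left w .
  have "w * (x (- int (Suc i)) - x (int (Suc i))) = int (y (- int (Suc i))) - int (y (int (Suc i)))"
   "w * (x (int (Suc i)) - x (- int (Suc i))) = int (y (int (Suc i))) - int (y (- int (Suc i)))" using IH by (simp_all add: algebra_simps)
  thus ?case using e1 e2 i by simp
 qed
 have "vcoordsD X n x y" unfolding vcoordsD_def w_def[symmetric] using z top by simp
 thus ?thesis using that T unfolding y_def by blast
qed

text \<open>The rank does not separate N from - N; away from these two letters it is an injective
  sorting key.\<close>

lemma D_row_eq:
 assumes T: "T : tableaux (TypeD N) 1 s" "T' : tableaux (TypeD N) 1 s"
  and c: "!!a. lcount T a = lcount T' a" and z: "lcount T (int N) = 0" "lcount T (- int N) = 0"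
 shows "T = T'"
proof -
 define A where "A = {[a] | a. 1 <= \<bar>a\<bar> & \<bar>a\<bar> < int N}"
 have sub: "set U \<subseteq> A" if U: "U : tableaux (TypeD N) 1 s" "lcount U (int N) = 0" "lcount U (- int N) = 0" for U
 proof
  fix d assume d: "d : set U"
  obtain x where x: "d = [x]" "1 <= \<bar>x\<bar>" "\<bar>x\<bar> <= int N" by (rule D_row_letters[OF U(1) d])
  have "x ~= int N" "x ~= - int N" using U(2,3) d x(1) by (auto simp: lcount_def filter_empty_conv)
  thus "d : A" using x by (auto simp: A_def)
 qed
 have so: "sorted (map (%c. D_rank N (hd c)) U)" if "U : tableaux (TypeD N) 1 s" for U
  unfolding sorted_map by (rule sorted_wrt_restrict[OF D_row_sorted[OF that]]) auto
 have le: "length (filter Q U) = (\<Sum>a\<in>{a. [a] : A & Q [a]}. lcount U a)" if "set U \<subseteq> A" for Q U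
 proof -
  have fin: "finite {a. [a] : A & Q [a]}" by (rule finite_subset[of _ "{- int N..int N}"]) (auto simp: A_def)
  have "(\<Sum>a\<in>{a. [a] : A & Q [a]}. length (filter (%c. c = [a]) (filter Q U))) = length (filter Q U)"
   by (rule sum_length_filter) (use that fin in \<open>auto simp: A_def\<close>)
  moreover have "length (filter (%c. c = [a]) (filter Q U)) = lcount U a" if "Q [a]" for a
   unfolding lcount_def filter_filter using that by (metis (mono_tags, lifting) filter_cong)
  ultimately show ?thesis by simp
 qed
 have "inj_on (%c. D_rank N (hd c)) A" by (auto simp: inj_on_def A_def D_rank_def)
 moreover have s: "set T \<subseteq> A" "set T' \<subseteq> A" using sub[OF T(1) z] sub[OF T(2)] z c by simp_all
 ultimately show ?thesis using lists_eq_of_keys[OF so[OF T(1)] so[OF T(2)] _ s] le[OF s(1)] le[OF s(2)] c by simp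
qed

text \<open>If the first two letters are distinct, sortedness makes the first occur once, so by the
  parities it is n or - n and its negative occurs as well. The order then forces the pair n, - n,
  because n + 1 and - (n + 1), the only letters in between, are absent.\<close>

lemma bpairs_iff:
 assumes n: "1 <= n"
 shows "sorted_wrt (col_le (TypeD (n + 1))) T ==> \<forall>c\<in>set T. \<exists>x. c = [x] & 1 <= \<bar>x\<bar> & \<bar>x\<bar> <= int (n + 1) ==>
  bpairs (n + 1) T \<longleftrightarrow> lcount T (int (n + 1)) = 0 & lcount T (- int (n + 1)) = 0 &
   (\<forall>a. \<bar>a\<bar> ~= int n --> even (lcount T a)) & (even (lcount T (int n)) \<longleftrightarrow> even (lcount T (- int n)))"
proof (induction "n + 1" T rule: bpairs.induct)
 case 1 thus ?case by (simp add: lcount_def)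
next
 case (2 c)
 then obtain x where x: "c = [x]" "1 <= \<bar>x\<bar>" by auto
 have "odd (lcount [c] x)" "!!a. a ~= x ==> lcount [c] a = 0" by (simp_all add: lcount_def x)
 moreover have "\<bar>x\<bar> = int n ==> (x = int n & - int n ~= x) \<or> (x = - int n & int n ~= x)" using n by auto
 ultimately show ?case by (metis bpairs.simps(2) even_zero)
next
 case (3 c c' T)
 let ?N = "n + 1"
 obtain x where x: "c = [x]" "1 <= \<bar>x\<bar>" "\<bar>x\<bar> <= int ?N" using 3(3) by auto
 obtain x' where x': "c' = [x']" "1 <= \<bar>x'\<bar>" "\<bar>x'\<bar> <= int ?N" using 3(3) by auto
 have so: "sorted_wrt (col_le (TypeD ?N)) T" using 3(2) by simp
 have let_T: "\<forall>c\<in>set T. \<exists>x. c = [x] & 1 <= \<bar>x\<bar> & \<bar>x\<bar> <= int ?N" using 3(3) by simp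
 note IH = 3(1)[OF so let_T]
 have cnt: "lcount (c # c' # T) a = of_bool (x = a) + (of_bool (x' = a) + lcount T a)" for a by (simp add: x x' lcount_Cons)
 have nm: "lcount T a = 0 \<longleftrightarrow> [a] \<notin> set T" for a by (auto simp: lcount_def filter_empty_conv)
 show ?case
 proof (cases "Bpair ?N c c'")
  case True
  then consider (eq) "x = x'" "x ~= int ?N" "x ~= - int ?N" | (opp) "x = int n" "x' = - int n" by (auto simp: Bpair_def x(1) x'(1))
  thus ?thesis
  proof cases
   case eq thus ?thesis using True IH unfolding cnt by auto
  next
   case opp thus ?thesis using True IH unfolding cnt by auto
  qed
 next
  case False
  have "~ (lcount (c # c' # T) (int ?N) = 0 & lcount (c # c' # T) (- int ?N) = 0 &
   (\<forall>a. \<bar>a\<bar> ~= int n --> even (lcount (c # c' # T) a)) &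
   (even (lcount (c # c' # T) (int n)) \<longleftrightarrow> even (lcount (c # c' # T) (- int n))))"
  proof
   assume h: "lcount (c # c' # T) (int ?N) = 0 & lcount (c # c' # T) (- int ?N) = 0 &
    (\<forall>a. \<bar>a\<bar> ~= int n --> even (lcount (c # c' # T) a)) &
    (even (lcount (c # c' # T) (int n)) \<longleftrightarrow> even (lcount (c # c' # T) (- int n)))"
   hence xN: "x ~= int ?N" "x ~= - int ?N" "x' ~= int ?N" "x' ~= - int ?N" unfolding cnt by auto
   hence ne: "x ~= x'" using False x(1) x'(1) by (auto simp: Bpair_def)
   have r: "D_rank ?N x < D_rank ?N x'" using 3(2) ne x(1) x'(1) by auto
   have r': "x' = a \<or> D_rank ?N x' < D_rank ?N a" if "[a] : set T" for a using 3(2) that x'(1) by auto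
   have "[x] \<notin> set T" using r r' by fastforce
   hence ox: "lcount (c # c' # T) x = 1" using nm[of x] ne unfolding cnt by simp
   hence ax: "\<bar>x\<bar> = int n" using h by (metis odd_one)
   have "[- x] : set T \<or> x' = - x"
   proof (rule ccontr)
    assume "~ ([- x] : set T \<or> x' = - x)"
    hence "lcount (c # c' # T) (- x) = 0" using nm[of "- x"] x(2) unfolding cnt by simp
    moreover have "x = int n \<or> x = - int n" using ax by auto
    ultimately show False using h ox by (elim disjE; hypsubst) (simp del: of_nat_Suc)+
   qed
   hence le: "D_rank ?N x' <= D_rank ?N (- x)" using r' by force
   have "x = int n" using le r ax by (auto simp: D_rank_def split: if_splits)
   hence "x' = - int n" using le r x'(2,3) xN(3,4) by (auto simp: D_rank_def split: if_splits)
   thus False using False \<open>x = int n\<close> x(1) x'(1) by (simp add: Bpair_def)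
  qed
  thus ?thesis using False by simp
 qed
qed

lemma vfacD_counts:
 assumes n: "1 <= n" and X: "X : {XB, XAodd}" and T: "T : tableaux (TypeD (n + 1)) 1 s"
 shows "vfacD X n T \<longleftrightarrow> lcount T (int (n + 1)) = 0 & lcount T (- int (n + 1)) = 0 &
   (X = XB --> (\<forall>a. \<bar>a\<bar> ~= int n --> even (lcount T a)) & (even (lcount T (int n)) \<longleftrightarrow> even (lcount T (- int n))))"
proof (cases "X = XB")
 case True
 have "\<forall>c\<in>set T. \<exists>x. c = [x] & 1 <= \<bar>x\<bar> & \<bar>x\<bar> <= int (n + 1)" using D_row_letters[OF T] by metis
 thus ?thesis using bpairs_iff[OF n D_row_sorted[OF T]] True by (simp add: vfacD_def)
next
 case False thus ?thesis by (auto simp: vfacD_def lcount_def filter_empty_conv)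
qed

lemma vfacD_of_vcoordsD:
 assumes n: "1 <= n" and X: "X : {XB, XAodd}" and T: "T : tableaux (TypeD (n + 1)) 1 s"
  and v: "vcoordsD X n x (lcount T)"
 shows "vfacD X n T" unfolding vfacD_counts[OF n X T]
proof (intro conjI impI allI)
 show "lcount T (int (n + 1)) = 0" "lcount T (- int (n + 1)) = 0" using v by (simp_all add: vcoordsD_def)
 assume XB: "X = XB"
 have e: "int (lcount T (int i)) = 2 * x (int i) + of_bool (i = n) * x 0 &
   int (lcount T (- int i)) = 2 * x (- int i) + of_bool (i = n) * x 0" if "i : {1..n}" for i using v that XB unfolding vcoordsD_def by simp
 have "even (int (lcount T (int n))) \<longleftrightarrow> even (int (lcount T (- int n)))" using e[of n] n by simp
 thus "even (lcount T (int n)) \<longleftrightarrow> even (lcount T (- int n))" by simp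
 fix a :: int assume a: "\<bar>a\<bar> ~= int n"
 show "even (lcount T a)"
 proof (cases "lcount T a = 0")
  case False
  hence "[a] : set T" by (auto simp: lcount_def filter_empty_conv)
  then obtain y where "[a] = [y]" "1 <= \<bar>y\<bar>" "\<bar>y\<bar> <= int (n + 1)" by (rule D_row_letters[OF T])
  hence ab: "1 <= \<bar>a\<bar>" "\<bar>a\<bar> <= int (n + 1)" by auto
  have "a ~= int (n + 1)" "a ~= - int (n + 1)" using v False by (auto simp: vcoordsD_def)
  hence i: "nat \<bar>a\<bar> : {1..n}" "nat \<bar>a\<bar> ~= n" "a = int (nat \<bar>a\<bar>) \<or> a = - int (nat \<bar>a\<bar>)" using ab a by auto
  then obtain j where j: "j : {1..n}" "j ~= n" "a = int j \<or> a = - int j" by blast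
  hence "int (lcount T a) = 2 * x a" using e[OF j(1)] by auto
  thus ?thesis by (metis dvd_triv_left even_of_nat)
 qed simp
qed

lemma vcoordsD_of_vfacD:
 assumes n: "1 <= n" and X: "X : {XB, XAodd}" and T: "T : tableaux (TypeD (n + 1)) 1 (width X s)" and v: "vfacD X n T"
 obtains x where "x : KRX_elems X n s" "vcoordsD X n x (lcount T)"
proof -
 define y where "y = lcount T"
 define w :: nat where "w = (if X = XB then 2 else 1)"
 note v = v[unfolded vfacD_counts[OF n X T], folded y_def]
 \<comment> \<open>The multiplicities of n and - n have the same remainder modulo w; it becomes
   \<open>x 0\<close>, and is zero when w = 1.\<close>
 define x :: coords where "x a = (if a = 0 then int (y (int n) mod w) else if int n < \<bar>a\<bar> then 0 else int (y a div w))" for a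
 have xp: "x (int i) = int (y (int i) div w)" "x (- int i) = int (y (- int i) div w)" if "1 <= i" "i <= n" for i using that by (simp_all add: x_def)
 have md: "y (int i) mod w = of_bool (i = n) * (y (int n) mod w) & y (- int i) mod w = of_bool (i = n) * (y (int n) mod w)"
  if "1 <= i" "i <= n" for i using v by (auto simp: w_def mod_2_eq_odd)
 have dm: "int (y a) = int w * int (y a div w) + int (y a mod w)" for a by (metis mult_div_mod_eq of_nat_add of_nat_mult)
 have co: "int (y (int i)) = int w * x (int i) + of_bool (i = n) * x 0 & int (y (- int i)) = int w * x (- int i) + of_bool (i = n) * x 0"
  if i: "1 <= i" "i <= n" for i unfolding xp[OF i] dm[of "int i"] dm[of "- int i"] using md[OF i] by (simp add: x_def)
 have "vcoordsD X n x y" unfolding vcoordsD_def using v co by (simp add: w_def)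
 moreover have "x : KRX_elems X n s"
 proof -
  have "int w * (\<Sum>a=- int n..int n. x a) = int (width X s)"
  proof -
   have "int (width X s) = (\<Sum>i=1..n + 1. int (y (int i)) + int (y (- int i)))" using lcount_total[OF T] by (simp add: y_def)
   also have "\<dots> = (\<Sum>i=1..n. int (y (int i)) + int (y (- int i)))" using v by simp
   also have "\<dots> = (\<Sum>i=1..n. int w * (x (int i) + x (- int i)) + of_bool (i = n) * (2 * x 0))"
    by (rule sum.cong) (use co in \<open>auto simp: algebra_simps\<close>)
   also have "\<dots> = int w * (\<Sum>i=1..n. x (int i) + x (- int i)) + 2 * x 0" using n by (simp add: sum.distrib flip: sum_distrib_left)
   also have "2 * x 0 = int w * x 0" by (simp add: w_def x_def)
   finally show ?thesis unfolding sum_symmetric_interval by (simp add: algebra_simps)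
  qed
  hence t: "(\<Sum>a=- int n..int n. x a) = int s" by (simp add: w_def width_def split: if_splits)
  have "0 <= x a" for a by (simp add: x_def)
  moreover have "\<forall>a. int n < \<bar>a\<bar> --> x a = 0" by (auto simp: x_def)
  moreover have "if X : {XB, XAdag, XD} then x 0 <= 1 else x 0 = 0" by (auto simp: x_def w_def)
  ultimately show ?thesis using t unfolding KRX_elems_def by auto
 qed
 ultimately show ?thesis using that unfolding y_def by blast
qed

lemma vcoordsD_unique:
 assumes X: "X : {XB, XAodd}" and T: "T : tableaux (TypeD (n + 1)) 1 s" "U : tableaux (TypeD (n + 1)) 1 s"
  and v: "vcoordsD X n x (lcount T)" "vcoordsD X n x (lcount U)"
 shows "T = U"
proof (rule D_row_eq[OF T])
 fix a :: int
 have z: "lcount S a = 0" if "S : tableaux (TypeD (n + 1)) 1 s" "~ (1 <= \<bar>a\<bar> & \<bar>a\<bar> <= int (n + 1))" for S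
 proof -
  have "c ~= [a]" if c: "c : set S" for c
  proof -
   obtain y where "c = [y]" "1 <= \<bar>y\<bar>" "\<bar>y\<bar> <= int (n + 1)" by (rule D_row_letters[OF \<open>S : tableaux (TypeD (n + 1)) 1 s\<close> c])
   thus ?thesis using \<open>~ (1 <= \<bar>a\<bar> & \<bar>a\<bar> <= int (n + 1))\<close> by auto
  qed
  thus ?thesis by (simp add: lcount_def)
 qed
 consider "~ (1 <= \<bar>a\<bar> & \<bar>a\<bar> <= int (n + 1))" | "a = int (n + 1)" | "a = - int (n + 1)"
  | i where "i : {1..n}" "a = int i" | i where "i : {1..n}" "a = - int i"
 proof -
  have "~ (1 <= \<bar>a\<bar> & \<bar>a\<bar> <= int (n + 1)) \<or> a = int (n + 1) \<or> a = - int (n + 1)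
   \<or> (nat \<bar>a\<bar> : {1..n} & (a = int (nat \<bar>a\<bar>) \<or> a = - int (nat \<bar>a\<bar>)))" by auto
  thus ?thesis using that by blast
 qed
 thus "lcount T a = lcount U a"
 proof cases
  case 1 thus ?thesis using z T by simp
 next
  case 2 thus ?thesis using v by (simp add: vcoordsD_def)
 next
  case 3 thus ?thesis using v by (simp add: vcoordsD_def)
 next
  case 4
  hence "int (lcount T a) = int (lcount U a)" using v unfolding vcoordsD_def by metis
  thus ?thesis by simp
 next
  case 5
  hence "int (lcount T a) = int (lcount U a)" using v unfolding vcoordsD_def by metis
  thus ?thesis by simp
 qed
qed (use v in \<open>simp_all add: vcoordsD_def\<close>)

lemma factor_image_D:
 assumes V: "valid_rank X n" and X: "X : {XB, XAodd}" and emb: "virtual_embedding X n s psi"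
  and T: "T : tableaux (TypeD (n + 1)) 1 (width X s)"
 shows "(\<exists>x\<in>KRX_elems X n s. psi x = [T]) \<longleftrightarrow> vfacD X n T"
proof
 have n: "1 <= n" by (rule valid_rank_pos[OF V])
 { assume "\<exists>x\<in>KRX_elems X n s. psi x = [T]"
  then obtain x where x: "x : KRX_elems X n s" "psi x = [T]" by blast
  obtain U where "psi x = [U]" "vcoordsD X n x (lcount U)" by (rule psi_vcoordsD[OF V X emb x(1)])
  thus "vfacD X n T" using vfacD_of_vcoordsD[OF n X T] x(2) by simp }
 { assume "vfacD X n T"
  then obtain x where x: "x : KRX_elems X n s" "vcoordsD X n x (lcount T)" by (rule vcoordsD_of_vfacD[OF n X T])
  obtain U where U: "psi x = [U]" "U : tableaux (TypeD (n + 1)) 1 (width X s)" "vcoordsD X n x (lcount U)" by (rule psi_vcoordsD[OF V X emb x(1)])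
  have "U = T" by (rule vcoordsD_unique[OF X U(2) T U(3) x(2)])
  thus "\<exists>x\<in>KRX_elems X n s. psi x = [T]" using U(1) x(1) by blast }
qed

lemma Psi_path_Cons: "Psi_path psi (s # ss) (x # b) = psi s x @ Psi_path psi ss b" by (simp add: Psi_path_def)

lemma path_image_D:
 assumes V: "valid_rank X n" and X: "X : {XB, XAodd}"
 shows "\<forall>s\<in>set ss. virtual_embedding X n s (psi s) ==> wf_path (TypeD (n + 1)) (hat_factors_list X n ss) p ==>
  (\<exists>b. coords_list X n ss b & p = Psi_path psi ss b) \<longleftrightarrow> list_all (vfacD X n) p"
proof (induction ss arbitrary: p)
 case Nil thus ?case by (simp add: wf_path_def coords_list_def Psi_path_def)
next
 case (Cons s ss)
 let ?N = "n + 1"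
 obtain T q where p: "p = T # q" and T: "T : tableaux (TypeD ?N) 1 (width X s)"
  and q: "wf_path (TypeD ?N) (hat_factors_list X n ss) q"
  using Cons.prems(2) unfolding hat_factors_list_Cons_D[OF X] wf_path_def list_all2_Cons1 by auto
 have emb: "virtual_embedding X n s (psi s)" using Cons.prems(1) by simp
 have IH: "(\<exists>b. coords_list X n ss b & q = Psi_path psi ss b) \<longleftrightarrow> list_all (vfacD X n) q"
  using Cons.IH[OF _ q] Cons.prems(1) by simp
 have c: "coords_list X n (s # ss) b \<longleftrightarrow> (\<exists>x b'. b = x # b' & x : KRX_elems X n s & coords_list X n ss b')" for b
  by (auto simp: coords_list_def list_all2_Cons1)
 have eq: "p = psi s x @ Psi_path psi ss b \<longleftrightarrow> psi s x = [T] & q = Psi_path psi ss b" if x: "x : KRX_elems X n s" for x b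
 proof -
  obtain U where "psi s x = [U]" by (rule psi_vcoordsD[OF V X emb x])
  thus ?thesis using p by auto
 qed
 have "(\<exists>b. coords_list X n (s # ss) b & p = Psi_path psi (s # ss) b) \<longleftrightarrow>
  (\<exists>x b. x : KRX_elems X n s & coords_list X n ss b & p = psi s x @ Psi_path psi ss b)" unfolding c by (metis Psi_path_Cons)
 also have "\<dots> \<longleftrightarrow> (\<exists>x\<in>KRX_elems X n s. psi s x = [T]) & (\<exists>b. coords_list X n ss b & q = Psi_path psi ss b)"
  using eq by blast
 also have "\<dots> \<longleftrightarrow> list_all (vfacD X n) p" unfolding factor_image_D[OF V X emb T] IH p by simp
 finally show ?case .
qed

section \<open>Restriction of the bijection\<close>

text \<open>The common end of both types: \<open>P\<close> describes the image of the embedding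
  among paths, \<open>C\<close> the virtual configurations, and \<open>PC\<close> says that the
  bijection matches them.\<close>

lemma virtual_bijection_of:
 assumes V: "valid_rank X n" and emb: "\<forall>s\<in>set ss. virtual_embedding X n s (psi s)" and Phi: "rc_bijection (Y_of X n) Phi"
  and adm: "admissible (Y_of X n) (hat_factors_list X n ss)"
  and path: "!!p. wf_path (Y_of X n) (hat_factors_list X n ss) p ==>
   (\<exists>b. coords_list X n ss b & p = Psi_path psi ss b) \<longleftrightarrow> P p"
  and RC: "RC_virtual X n ss = {R : RC_hat X n ss. C R}"
  and PC: "!!p. hw_path (Y_of X n) (hat_factors_list X n ss) p ==> C (Phi (hat_factors_list X n ss) p) \<longleftrightarrow> P p"
 shows "P_virtual X n psi ss \<subseteq> P_hat X n ss & RC_virtual X n ss \<subseteq> RC_hat X n ss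
    & bij_betw (Phi (hat_factors_list X n ss)) (P_virtual X n psi ss) (RC_virtual X n ss)"
proof -
 let ?Y = "Y_of X n" and ?B = "hat_factors_list X n ss"
 have wf: "wf_ytype ?Y" by (rule valid_rank_wf[OF V])
 have hat: "P_hat X n ss = {p. hw_path ?Y ?B p}" using adm unfolding P_hat_def hw_vectors_path[OF wf] hw_path_def by blast
 have Pv: "P_virtual X n psi ss = {p. hw_path ?Y ?B p & P p}" using path unfolding P_virtual_image[OF V emb] hat hw_path_def by blast
 have "Phi ?B ` {p. hw_path ?Y ?B p & P p} = {R : RC_hat X n ss. C R}"
 proof (intro subset_antisym subsetI)
  fix R assume "R : Phi ?B ` {p. hw_path ?Y ?B p & P p}"
  then obtain p where p: "hw_path ?Y ?B p" "P p" "R = Phi ?B p" by blast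
  hence "R : RC_hat X n ss" using Phi_RC[OF Phi wf p(1)] word_wt_dominant[OF p(1)] by (auto simp: RC_hat_def RC_def)
  thus "R : {R : RC_hat X n ss. C R}" using PC[OF p(1)] p by simp
 next
  fix R assume R: "R : {R : RC_hat X n ss. C R}"
  then obtain lam where "lam : dominant (nodes ?Y)" "R : RC_wt ?Y (mult_array ?B) lam" by (auto simp: RC_hat_def RC_def)
  from Phi_surj[OF Phi wf adm this] obtain p where p: "hw_path ?Y ?B p" "Phi ?B p = R" by metis
  thus "R : Phi ?B ` {p. hw_path ?Y ?B p & P p}" using PC[OF p(1)] R by auto
 qed
 moreover have "inj_on (Phi ?B) {p. hw_path ?Y ?B p & P p}" using Phi_inj'[OF Phi wf] by (auto intro: inj_onI)
 ultimately show ?thesis unfolding bij_betw_def Pv RC hat by blast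
qed

theorem theorem10p1:
  fixes X :: xtype and n :: nat and ss :: "nat list"
    and psi :: "nat \<Rightarrow> coords \<Rightarrow> path"
    and Phi :: "factors \<Rightarrow> path \<Rightarrow> rigged"
  assumes "valid_rank X n"
    and "\<forall>s\<in>set ss. 1 \<le> s"
    and "\<forall>s\<in>set ss. virtual_embedding X n s (psi s)"
    and "rc_bijection (Y_of X n) Phi"
  shows "P_virtual X n psi ss \<subseteq> P_hat X n ss
       \<and> RC_virtual X n ss \<subseteq> RC_hat X n ss
       \<and> bij_betw (Phi (hat_factors_list X n ss)) (P_virtual X n psi ss) (RC_virtual X n ss)"
proof (cases "X : {XB, XAodd}")
 case True
 hence Y: "Y_of X n = TypeD (n + 1)" and n: "3 <= n" using assms(1) by (auto simp: Y_of_def)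
 note Phi = assms(4)[unfolded Y]
 show ?thesis
 proof (rule virtual_bijection_of[OF assms(1,3,4)])
  show "admissible (Y_of X n) (hat_factors_list X n ss)" unfolding Y by (rule hat_factors_list_D(1)[OF True assms(2)])
  show "RC_virtual X n ss = {R : RC_hat X n ss. vclassD X n R}" by (rule RC_virtual_D[OF assms(1) True assms(2)])
 qed (use path_image_D[OF assms(1) True assms(3)] vclassD_path[OF Phi True n assms(2)] Y in auto)
next
 case False
 hence Y: "Y_of X n = TypeA (2 * n - 1)" by (simp add: Y_of_def)
 have n: "1 <= n" by (rule valid_rank_pos[OF assms(1)])
 note Phi = assms(4)[unfolded Y]
 show ?thesis
 proof (rule virtual_bijection_of[OF assms(1,3,4)])
  show "admissible (Y_of X n) (hat_factors_list X n ss)" unfolding Y using assms(2) n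
   by (induction ss) (auto simp: admissible_def hat_factors_list_Cons_A[OF False])
  show "RC_virtual X n ss = {R : RC_hat X n ss. vclass X n R}" by (rule RC_virtual_A[OF assms(1) False])
 qed (use path_image_A[OF assms(1) False assms(3)] vclass_path[OF Phi False n assms(2)] Y in auto)
qed

end
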